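(* Let $n\ge 3$ be an integer and let $\alpha$ be a real number with $n-2\le \alpha<n$. Then there exist origin-symmetric convex bodies $K,L\subset\mathbb{R}^n$ such that $$(-\Delta)^{\alpha/2}\mathrm{vol}_{n-1}(L|\theta^\perp)\le (-\Delta)^{\alpha/2}\mathrm{vol}_{n-1}(K|\theta^\perp)\qquad \text{for all } \theta\in S^{n-1},$$ but $$\mathrm{vol}_n(L)<\mathrm{vol}_n(K).$$
   Context: A convex body in $\mathbb{R}^n$ is a compact convex set with non-empty interior. $|x|_2$ is the Euclidean norm, $(\cdot,\cdot)$ the standard inner product, and $K|\theta^\perp$ is the orthogonal projection of $K$ onto the hyperplane $\theta^\perp$ orthogonal to $\theta\in S^{n-1}$. Fourier transform: for test functions, $\hat\phi(\xi)=\int_{\mathbb{R}^n}\phi(x)e^{-i(x,\xi)}dx$; for a distribution $f$, $\langle\hat f,\phi\rangle=\langle f,\hat\phi\rangle$ for all Schwartz functions $\phi$. Also write $f^\wedge=\hat f$. Fractional Laplacian: for a distribution $g$ on $\mathbb{R}^n$, $$(-\Delta)^{\alpha/2}g=\frac1{(2\pi)^n}\left(|x|_2^\alpha\,\hat g(x)\right)^\wedge .$$ The projection function $\theta\mapsto \mathrm{vol}_{n-1}(K|\theta^\perp)$ is extended from $S^{n-1}$ to $\mathbb{R}^n$ as a homogeneous function of degree $1$, and $(-\Delta)^{\alpha/2}\mathrm{vol}_{n-1}(K|\theta^\perp)$ denotes the value at $\theta\in S^{n-1}$ of $(-\Delta)^{\alpha/2}$ applied to this extension. In concrete terms: $K$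 has a curvature function $f_K$ if its surface area measure $S_{n-1}(K,\cdot)$ is absolutely continuous with respect to Lebesgue measure on $S^{n-1}$ with density $f_K\in L^1(S^{n-1})$; $f_K$ is also extended to $\mathbb{R}^n\setminus\{0\}$ as a homogeneous function of degree $-n-1$. For such $K$, $$(-\Delta)^{\alpha/2}\mathrm{vol}_{n-1}(K|\theta^\perp)=-\frac1\pi\left(|x|_2^\alpha f_K(x)\right)^\wedge(\theta),$$ where: - if $\alpha>1$, the function $|x|_2^\alpha f_K(x)$ (homogeneous of degree $\alpha-n-1>-n$) is locally integrable and is regarded as a distribution in the usual way; - if $\alpha=1$ (which can occur only for $n=3$), the function $|x|_2f_K(x)$ is homogeneous of degree $-3$ on $\mathbb{R}^3$, and its Fourier transform at $\xi\in S^2$ is $\int_{S^2}f_K(\theta)\left(\Gamma'(1)-\ln|(\theta,\xi)|\right)d\theta$, where $\Gamma'$ is the derivative of the Gamma function. (This corresponds to the regularization $\phi\mapsto\int_{|x|_2<1}|x|_2f_K(x)(\phi(x)-\phi(0))dx+\int_{|x|_2>1}|x|_2f_K(x)\phi(x)dx$.) The pointwise inequality is understood for bodies $K,L$ having curvature functions for which these Fourier transforms coincide on $\mathbb{R}^n\setminus\{0\}$ with continuous functions (this is the case, for example, for bodies with infinitely smooth radial function and positive Gauss curvature); that $K$ and $L$ are of this kind is part of the assertion. *)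

theory Defs
  imports "HOL-Analysis.Analysis"
begin

subsection \<open>Convex bodies, projections, homogeneous extensions\<close>

definition convex_body :: "'a::euclidean_space set \<Rightarrow> bool" where
  "convex_body K \<longleftrightarrow> compact K \<and> convex K \<and> interior K \<noteq> {}"

definition origin_symmetric :: "'a::euclidean_space set \<Rightarrow> bool" where
  "origin_symmetric K \<longleftrightarrow> uminus ` K = K"

text \<open>Meant for unit vectors \<open>\<theta>\<close>: the orthogonal projection \<open>K|\<theta>\<^sup>\<bottom>\<close>.\<close>

definition hyperplane_projection :: "'a::euclidean_space \<Rightarrow> 'a set \<Rightarrow> 'a set" where
  "hyperplane_projection \<theta> K = (\<lambda>x. x - (x \<bullet> \<theta>) *\<^sub>R \<theta>) ` K"

text \<open>The \<open>(n-1)\<close>-dimensional volume of a subset of the hyperplane \<open>\<theta>\<^sup>\<bottom>\<close> is expressed as the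
  \<open>n\<close>-dimensional volume of the right cylinder of height 1 over it.\<close>

definition projection_volume :: "'a::euclidean_space set \<Rightarrow> 'a \<Rightarrow> real" where
  "projection_volume K \<theta> =
     measure lebesgue {y + t *\<^sub>R \<theta> | y t. y \<in> hyperplane_projection \<theta> K \<and> 0 \<le> t \<and> t \<le> 1}"

text \<open>Only the values of \<open>f\<close> on the unit sphere matter; the value at the origin is 0.\<close>

definition homogeneous_extension :: "real \<Rightarrow> ('a::euclidean_space \<Rightarrow> real) \<Rightarrow> 'a \<Rightarrow> real" where
  "homogeneous_extension d f x = norm x powr d * f (sgn x)"


subsection \<open>Surface area measure and curvature function\<close>

text \<open>Lebesgue measure on the unit sphere, \<open>\<sigma>(E) = n vol {r u | 0 < r < 1, u \<in> E}\<close>, as a Borel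
  measure on the ambient space that is concentrated on the sphere.\<close>

definition sphere_measure :: "'a::euclidean_space measure" where
  "sphere_measure =
     scale_measure (of_nat DIM('a)) (distr (restrict_space lborel (ball 0 1)) borel sgn)"

definition local_parallel_set :: "'a::euclidean_space set \<Rightarrow> real \<Rightarrow> 'a set \<Rightarrow> 'a set" where
  "local_parallel_set K \<epsilon> E =
     {x. 0 < infdist x K \<and> infdist x K \<le> \<epsilon> \<and> sgn (x - closest_point K x) \<in> E}"

text \<open>The surface area measure \<open>S\<^sub>n\<^sub>-\<^sub>1(K, \<cdot>)\<close> is the coefficient of \<open>\<epsilon>\<close> in the local Steiner formula
  \<open>vol (local_parallel_set K \<epsilon> E) = (1/n) (\<Sum>m<n. \<epsilon>\<^bsup>n-m\<^esup> (n choose m) S\<^sub>m(K, E))\<close>, that is,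
  \<open>S\<^sub>n\<^sub>-\<^sub>1(K, E)\<close> is the limit of \<open>vol (local_parallel_set K \<epsilon> E) / \<epsilon>\<close> as \<open>\<epsilon>\<close> tends to \<open>0\<close>.\<close>

definition is_surface_area_measure ::
    "'a::euclidean_space set \<Rightarrow> 'a measure \<Rightarrow> bool" where
  "is_surface_area_measure K \<mu> \<longleftrightarrow>
     sets \<mu> = sets borel \<and> emeasure \<mu> UNIV < \<infinity> \<and> emeasure \<mu> (- sphere 0 1) = 0 \<and>
     (\<forall>E \<in> sets borel. E \<subseteq> sphere 0 1 \<longrightarrow>
        ((\<lambda>\<epsilon>. measure lebesgue (local_parallel_set K \<epsilon> E) / \<epsilon>) \<longlongrightarrow> measure \<mu> E) (at_right 0))"

definition is_curvature_function ::
    "'a::euclidean_space set \<Rightarrow> ('a \<Rightarrow> real) \<Rightarrow> bool" where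
  "is_curvature_function K f \<longleftrightarrow>
     integrable sphere_measure f \<and> (AE \<theta> in sphere_measure. 0 \<le> f \<theta>) \<and>
     is_surface_area_measure K (density sphere_measure (\<lambda>\<theta>. ennreal (f \<theta>)))"


subsection \<open>Test functions, distributions, Fourier transform\<close>

primrec continuously_differentiable ::
    "nat \<Rightarrow> ('a::euclidean_space \<Rightarrow> complex) \<Rightarrow> bool" where
  "continuously_differentiable 0 \<phi> \<longleftrightarrow> continuous_on UNIV \<phi>"
| "continuously_differentiable (Suc k) \<phi> \<longleftrightarrow>
     (\<forall>x. \<phi> differentiable at x) \<and>
     (\<forall>v\<in>Basis. continuously_differentiable k (\<lambda>x. frechet_derivative \<phi> (at x) v))"

definition test_function_off_origin :: "('a::euclidean_space \<Rightarrow> complex) \<Rightarrow> bool" where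
  "test_function_off_origin \<phi> \<longleftrightarrow>
     (\<forall>k. continuously_differentiable k \<phi>) \<and>
     compact (closure {x. \<phi> x \<noteq> 0}) \<and> 0 \<notin> closure {x. \<phi> x \<noteq> 0}"

definition fourier :: "('a::euclidean_space \<Rightarrow> complex) \<Rightarrow> 'a \<Rightarrow> complex" where
  "fourier \<phi> \<xi> = (LINT x|lborel. \<phi> x * exp (- (\<i> * of_real (x \<bullet> \<xi>))))"

text \<open>Distributions are represented by their action on test functions.\<close>

type_synonym 'a dist = "('a \<Rightarrow> complex) \<Rightarrow> complex"

definition fourier_dist :: "'a::euclidean_space dist \<Rightarrow> 'a dist" where
  "fourier_dist T \<phi> = T (fourier \<phi>)"

definition fun_dist :: "('a::euclidean_space \<Rightarrow> real) \<Rightarrow> 'a dist" where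
  "fun_dist u \<phi> = (LINT x|lborel. of_real (u x) * \<phi> x)"

definition regularized_dist :: "('a::euclidean_space \<Rightarrow> real) \<Rightarrow> 'a dist" where
  "regularized_dist u \<phi> =
     (LINT x:{x. norm x < 1}|lborel. of_real (u x) * (\<phi> x - \<phi> 0)) +
     (LINT x:{x. norm x > 1}|lborel. of_real (u x) * \<phi> x)"

text \<open>The distribution \<open>|x|\<^sup>\<alpha> G(x)\<close> for \<open>G\<close> homogeneous of degree \<open>-n-1\<close> and \<open>\<alpha> \<ge> 1\<close>. The product is
  locally integrable for \<open>\<alpha> > 1\<close>; for \<open>\<alpha> = 1\<close> it has degree \<open>-n\<close> and must be regularized. With this
  regularization, for even \<open>G\<close> and \<open>\<alpha> = 1\<close>, the value of the Fourier transform at a unit vector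
  \<open>\<xi>\<close> is the integral of \<open>G(\<theta>) (\<Gamma>'(1) - ln |(\<theta>,\<xi>)|)\<close> over the unit sphere.\<close>

definition norm_powr_dist :: "real \<Rightarrow> ('a::euclidean_space \<Rightarrow> real) \<Rightarrow> 'a dist" where
  "norm_powr_dist \<alpha> G =
     (if 1 < \<alpha> then fun_dist (\<lambda>x. norm x powr \<alpha> * G x)
      else regularized_dist (\<lambda>x. norm x powr \<alpha> * G x))"

definition coincides_off_origin :: "'a::euclidean_space dist \<Rightarrow> ('a \<Rightarrow> real) \<Rightarrow> bool" where
  "coincides_off_origin T g \<longleftrightarrow>
     (\<forall>\<phi>. test_function_off_origin \<phi> \<longrightarrow> T \<phi> = fun_dist g \<phi>)"


subsection \<open>Fractional Laplacian of the projection function\<close>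

text \<open>\<open>g\<close> is the continuous function off the origin which represents
  \<open>(-\<Delta>)\<^bsup>\<alpha>/2\<^esup> u = (2\<pi>)\<^bsup>-n\<^esup> (|x|\<^sup>\<alpha> u\<^sup>\<and>)\<^sup>\<and>\<close>. Meant for \<open>u\<close> homogeneous of degree 1 and \<open>\<alpha> \<ge> 1\<close>: then
  \<open>u\<^sup>\<and>\<close> is homogeneous of degree \<open>-n-1\<close>, and \<open>|x|\<^sup>\<alpha> u\<^sup>\<and>\<close> is formed from the function \<open>G\<close> (unique up to
  null sets) with which \<open>u\<^sup>\<and>\<close> coincides off the origin.\<close>

definition has_frac_laplacian ::
    "real \<Rightarrow> ('a::euclidean_space \<Rightarrow> real) \<Rightarrow> ('a \<Rightarrow> real) \<Rightarrow> bool" where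
  "has_frac_laplacian \<alpha> u g \<longleftrightarrow>
     continuous_on (- {0}) g \<and>
     (\<exists>G. (\<forall>C. compact C \<and> 0 \<notin> C \<longrightarrow> set_integrable lborel C G) \<and>
          coincides_off_origin (fourier_dist (fun_dist u)) G \<and>
          coincides_off_origin
            (\<lambda>\<phi>. fourier_dist (norm_powr_dist \<alpha> G) \<phi> / of_real ((2 * pi) ^ DIM('a))) g)"

text \<open>\<open>g\<close> is the continuous function \<open>(-\<Delta>)\<^bsup>\<alpha>/2\<^esup> vol\<^sub>n\<^sub>-\<^sub>1(K|\<theta>\<^sup>\<bottom>)\<close> for a body \<open>K\<close> with a curvature
  function \<open>f\<close>: both by definition, from the degree 1 extension of the projection function, and in the
  form \<open>- (1/\<pi>) (|x|\<^sup>\<alpha> f(x))\<^sup>\<and>\<close>, from the degree \<open>-n-1\<close> extension of \<open>f\<close>.\<close>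

definition projection_frac_laplacian ::
    "real \<Rightarrow> 'a::euclidean_space set \<Rightarrow> ('a \<Rightarrow> real) \<Rightarrow> bool" where
  "projection_frac_laplacian \<alpha> K g \<longleftrightarrow>
     has_frac_laplacian \<alpha> (homogeneous_extension 1 (projection_volume K)) g \<and>
     (\<exists>f. is_curvature_function K f \<and>
          coincides_off_origin
            (\<lambda>\<phi>. - fourier_dist
                     (norm_powr_dist \<alpha> (homogeneous_extension (- real DIM('a) - 1) f)) \<phi> / of_real pi) g)"

end

theory Submission
  imports Defs "HOL-Probability.Probability"
begin

text \<open>Let \<open>L\<close> be the ellipsoid with semi-axes \<open>N, 1, \<dots>, 1\<close> and \<open>K\<close> the ball of twice its volume. Up to
  constants, \<open>f\<^sub>L(x) = N\<^sup>2 (N\<^sup>2 x\<^sub>1\<^sup>2 + |y|\<^sup>2)\<^bsup>-(n+1)/2\<^esup>\<close>, where \<open>y\<close> is the part of \<open>x\<close> orthogonal to the long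
  axis. The function \<open>|x|\<^sup>\<alpha> f\<^sub>L(x)\<close> is a mixture with positive weights of the kernels
  \<open>|y|\<^sup>-\<^sup>1 exp (- s x\<^sub>1\<^sup>2 / |y|\<^sup>2 - t |y|\<^sup>2)\<close>: expand one factor in a binomial series with positive
  coefficients and write powers as gamma integrals. The Fourier transform of such a kernel is an explicit
  positive function, which gives \<open>(|x|\<^sup>\<alpha> f\<^sub>L)\<^sup>\<and> \<ge> c N - C N\<^bsup>1-(n-\<alpha>)/2\<^esup>\<close> on the unit sphere with \<open>c > 0\<close>. For \<open>\<alpha> = 1\<close>
  the regularization subtracts a constant, and \<open>c > 0\<close> amounts to \<open>ln 2\<close> being larger than Euler's
  constant. For the ball the same transform is \<open>O(N\<^bsup>1-1/n\<^esup>)\<close>, so it is smaller for large \<open>N\<close>.\<close>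

section \<open>Determinants and volumes over an arbitrary finite index type\<close>

text \<open>The factor -1/\<pi> reverses the order, so the transform of L has to exceed that of K at
  every point of the sphere. The reason is concentration: as N grows, f_L has mass of order N and
  gathers at the directions orthogonal to the long axis. To leading order |x|^\<alpha> f_L is N
  times |y|^(\<alpha>-n) on that hyperplane, and the transform of |y|^(\<alpha>-n) in n-1 variables
  is positive for \<alpha> > 1. For n = 3 and \<alpha> = 1 it is a constant minus a logarithm,
  smallest on the unit sphere where the part of \<xi> orthogonal to the axis has length 1; this is
  the source of the comparison of ln 2 with Euler's constant. A limit of distributions would give
  neither a continuous transform nor an inequality at each point, poles included, for one finite N.
  The mixture reduces both to an explicit positive kernel and to moments of the mixing measure. The
  weight 1/|y| and the ratio x_1/|y| in the kernel serve to make the Gaussian integral over x_1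
  cancel the weight and leave a Gaussian in y. For the ball, radius r only multiplies the transform
  by r^(n-1).\<close>

lemma det_rank_one_update:
  fixes a b :: "real^'n"
  shows "det (matrix (\<lambda>x. x + (b \<bullet> x) *\<^sub>R a)) = 1 + a \<bullet> b"
proof -
  obtain k :: 'n where True by simp
  \<comment> \<open>Conjugation by an orthogonal map turns b into a multiple of a coordinate axis
    and leaves the determinant unchanged.\<close>
  have "norm (axis k (norm b) :: real^'n) = norm b"
    by (simp add: norm_eq_sqrt_inner inner_axis_axis)
  then obtain Q where Q: "orthogonal_transformation Q" "Q (axis k (norm b)) = b"
    using orthogonal_transformation_exists by blast
  define R where "R = inv Q"
  have oR: "orthogonal_transformation R"
    unfolding R_def by (rule orthogonal_transformation_inv[OF Q(1)])
  have bij: "bij Q" by (rule orthogonal_transformation_bij[OF Q(1)])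
  have RQ: "R (Q x) = x" "Q (R x) = x" for x
    using bij by (auto simp: R_def bij_is_inj bij_is_surj surj_f_inv_f)
  have lin: "linear Q" "linear R"
    using Q oR by (auto simp: orthogonal_transformation_linear)
  define T where "T = (\<lambda>x. x + (b \<bullet> x) *\<^sub>R a)"
  define T' where "T' = (\<lambda>x. x + (axis k (norm b) \<bullet> x) *\<^sub>R R a)"
  have linT: "linear T" "linear T'"
    by (auto simp: T_def T'_def linear_iff inner_simps algebra_simps)
  have T': "T' = R \<circ> T \<circ> Q"
  proof
    fix x
    have "b \<bullet> Q x = axis k (norm b) \<bullet> x"
      using Q(1) unfolding orthogonal_transformation_def by (metis Q(2))
    then show "T' x = (R \<circ> T \<circ> Q) x"
      using lin(2) by (simp add: T_def T'_def linear_add linear_scale RQ)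
  qed
  have "matrix R ** matrix Q = matrix (R \<circ> Q)"
    by (simp add: matrix_compose lin)
  also have "R \<circ> Q = id" using RQ by auto
  finally have "det (matrix R ** matrix Q) = 1" by (simp add: matrix_id_mat_1[symmetric] id_def[symmetric] del: matrix_id_mat_1)
  then have d: "det (matrix R) * det (matrix Q) = 1" by (simp add: det_mul)
  have "det (matrix T') = det (matrix R) * det (matrix T) * det (matrix Q)"
    unfolding T' by (simp add: matrix_compose lin linT linear_compose det_mul)
  then have "det (matrix T) = det (matrix T')" using d by (simp add: algebra_simps)
  \<comment> \<open>Only column k of the identity is changed, and \<open>cramer_lemma\<close> for
    the identity matrix returns the k-th entry of the new column.\<close>
  also have "matrix T' = (\<chi> i j. if j = k then (mat 1 *v (axis k 1 + norm b *\<^sub>R R a)) $ i else mat 1 $ i $ j)"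
  proof -
    have "axis i 1 $ k = (if i = k then 1 else (0::real))" for i by (simp add: axis_def)
    then show ?thesis
      by (auto simp: vec_eq_iff matrix_def T'_def inner_axis_axis) (auto simp: mat_def axis_def)
  qed
  also have "det \<dots> = (axis k 1 + norm b *\<^sub>R R a) $ k * det (mat 1 :: real^'n^'n)"
    by (rule cramer_lemma)
  also have "\<dots> = 1 + R a \<bullet> axis k (norm b)"
    by (simp add: inner_axis)
  also have "R a \<bullet> axis k (norm b) = R a \<bullet> R b"
    using RQ Q(2) by metis
  also have "\<dots> = a \<bullet> b"
    using oR by (simp add: orthogonal_transformation_def)
  finally show ?thesis by (simp add: T_def)
qed

text \<open>The change of variables theorems of the library require a well-ordered index type. The copy
  below supplies one for an arbitrary finite index type.\<close>

typedef 'a indexed = "UNIV :: 'a set" morphisms of_indexed to_indexed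
  by simp

instance indexed :: (finite) finite
proof
  have "(UNIV :: 'a indexed set) = range to_indexed"
    by (metis UNIV_eq_I of_indexed_inverse rangeI)
  moreover have "finite (range (to_indexed :: 'a \<Rightarrow> _))"
    by (rule finite_imageI) (rule finite)
  ultimately show "finite (UNIV :: 'a indexed set)" by (simp only:)
qed

instantiation indexed :: (finite) wellorder
begin

definition indexed_rank :: "'a indexed \<Rightarrow> nat" where
  "indexed_rank = (SOME f. inj f)"

definition less_eq_indexed :: "'a indexed \<Rightarrow> 'a indexed \<Rightarrow> bool" where
  "x \<le> y \<longleftrightarrow> indexed_rank x \<le> indexed_rank y"

definition less_indexed :: "'a indexed \<Rightarrow> 'a indexed \<Rightarrow> bool" where
  "x < y \<longleftrightarrow> indexed_rank x < indexed_rank y"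

lemma inj_indexed_rank: "inj (indexed_rank :: 'a indexed \<Rightarrow> nat)"
proof -
  have "\<exists>f :: 'a indexed \<Rightarrow> nat. inj f"
    using finite_imp_inj_to_nat_seg[of "UNIV :: 'a indexed set"] by auto
  then show ?thesis unfolding indexed_rank_def by (rule someI_ex)
qed

instance
proof
  fix P :: "'a indexed \<Rightarrow> bool" and a
  assume step: "\<And>x. (\<And>y. y < x \<Longrightarrow> P y) \<Longrightarrow> P x"
  show "P a"
  proof (induction a rule: measure_induct_rule[of indexed_rank])
    case (less x)
    show ?case by (rule step, rule less) (simp add: less_indexed_def)
  qed
qed (use inj_indexed_rank in \<open>auto simp: less_eq_indexed_def less_indexed_def inj_def\<close>)

end

section \<open>Transport of Lebesgue measure and determinants along the relabelling\<close>

definition relabel :: "real^'n \<Rightarrow> real^'n indexed" where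
  "relabel x = (\<chi> i. x $ of_indexed i)"

definition unlabel :: "real^'n indexed \<Rightarrow> real^'n" where
  "unlabel x = (\<chi> i. x $ to_indexed i)"

lemma relabel_unlabel [simp]: "relabel (unlabel x) = x" "unlabel (relabel y) = y"
  by (simp_all add: relabel_def unlabel_def vec_eq_iff of_indexed_inverse to_indexed_inverse)

lemma linear_relabel: "linear relabel" "linear unlabel"
  by (auto simp: linear_iff relabel_def unlabel_def vec_eq_iff)

lemma inner_unlabel: "unlabel x \<bullet> y = x \<bullet> relabel y"
  unfolding inner_vec_def relabel_def unlabel_def
  by (rule sum.reindex_bij_witness[of _ of_indexed to_indexed])
     (auto simp: of_indexed_inverse to_indexed_inverse)

lemma CARD_indexed [simp]: "CARD('n indexed) = CARD('n)"
  using type_definition.card[OF type_definition_indexed] by simp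

lemma measurable_relabel [measurable]:
  "(relabel :: real^'n \<Rightarrow> _) \<in> borel_measurable borel" "(unlabel :: _ \<Rightarrow> real^'n) \<in> borel_measurable borel"
  using linear_relabel by (auto intro!: borel_measurable_continuous_onI linear_continuous_on linear_conv_bounded_linear[THEN iffD1])

text \<open>Permuting coordinates maps boxes to boxes with the same side lengths, and the values on
  boxes determine Lebesgue measure.\<close>

lemma distr_lborel_relabel: "distr lborel borel relabel = (lborel :: (real^('n::finite) indexed) measure)"
proof (rule lborel_eqI[symmetric])
  fix l u :: "real^'n indexed"
  assume lu: "\<And>b. b \<in> Basis \<Longrightarrow> l \<bullet> b \<le> u \<bullet> b"
  have le: "l $ i \<le> u $ i" for i
    using lu[of "axis i 1"] by (simp add: inner_axis)
  have "relabel -` box l u = box (unlabel l) (unlabel u)"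
  proof -
    have all: "(\<forall>i. P (to_indexed i)) \<longleftrightarrow> (\<forall>j. P j)" for P :: "'n indexed \<Rightarrow> bool"
      by (metis of_indexed_inverse)
    show ?thesis
      by (auto simp: mem_box_cart relabel_def unlabel_def all[symmetric] to_indexed_inverse)
  qed
  then have "emeasure (distr lborel borel relabel) (box l u) = emeasure lborel (box (unlabel l) (unlabel u))"
    by (simp add: emeasure_distr)
  also have "\<dots> = ennreal (\<Prod>b\<in>Basis. (unlabel u - unlabel l) \<bullet> b)"
    by (subst emeasure_lborel_box) (auto simp: Basis_vec_def inner_axis unlabel_def le)
  also have "(\<Prod>b\<in>Basis. (unlabel u - unlabel l) \<bullet> b) = (\<Prod>i\<in>UNIV. (unlabel u - unlabel l) $ i)"
    by (rule prod.reindex_bij_witness[of _ "\<lambda>i. axis i 1" "\<lambda>b. THE i. b = axis i 1"])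
       (auto simp: Basis_vec_def inner_axis axis_eq_axis)
  also have "\<dots> = (\<Prod>i\<in>UNIV. (u - l) $ i)"
    by (rule prod.reindex_bij_witness[of _ of_indexed to_indexed])
       (auto simp: of_indexed_inverse to_indexed_inverse unlabel_def)
  also have "\<dots> = (\<Prod>b\<in>Basis. (u - l) \<bullet> b)"
    by (rule prod.reindex_bij_witness[of _ "\<lambda>b. THE i. b = axis i 1" "\<lambda>i. axis i 1"])
       (auto simp: Basis_vec_def inner_axis axis_eq_axis)
  finally show "emeasure (distr lborel borel relabel) (box l u) = ennreal (\<Prod>b\<in>Basis. (u - l) \<bullet> b)" .
qed simp

text \<open>The value is the ordinary determinant, since relabelling permutes coordinates. It is
  taken after the relabelling so that it is literally the Jacobian determinant in the change of
  variables over the ordered index type.\<close>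

definition ldet :: "(real^'n \<Rightarrow> real^'n) \<Rightarrow> real" where
  "ldet f = det (matrix (relabel \<circ> f \<circ> unlabel))"

lemma ldet_compose:
  assumes "linear f" "linear g"
  shows "ldet (\<lambda>x. f (g x)) = ldet f * ldet g"
proof -
  have "relabel \<circ> (\<lambda>x. f (g x)) \<circ> unlabel = (relabel \<circ> f \<circ> unlabel) \<circ> (relabel \<circ> g \<circ> unlabel)"
    by (auto simp: fun_eq_iff)
  then show ?thesis
    unfolding ldet_def by (simp only: matrix_compose linear_compose linear_relabel assms det_mul)
qed

lemma ldet_rank_one_update: "ldet (\<lambda>x. x + (b \<bullet> x) *\<^sub>R a) = 1 + a \<bullet> b"
proof -
  have "relabel \<circ> (\<lambda>x. x + (b \<bullet> x) *\<^sub>R a) \<circ> unlabel = (\<lambda>x. x + (relabel b \<bullet> x) *\<^sub>R relabel a)"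
    by (auto simp: fun_eq_iff linear_add[OF linear_relabel(1)] linear_scale[OF linear_relabel(1)]
        inner_unlabel inner_commute[of b] inner_commute[of "relabel b"])
  then show ?thesis
    by (simp add: ldet_def det_rank_one_update inner_unlabel[symmetric])
qed

lemma ldet_scaleR: "ldet (\<lambda>x :: real^'n. c *\<^sub>R x) = c ^ CARD('n)"
proof -
  have "relabel \<circ> (\<lambda>x. c *\<^sub>R x) \<circ> unlabel = (\<lambda>x. c *\<^sub>R x)"
    by (auto simp: fun_eq_iff linear_scale[OF linear_relabel(1)])
  then have "ldet (\<lambda>x :: real^'n. c *\<^sub>R x) = det (matrix ((*\<^sub>R) c) :: real^'n indexed^'n indexed)"
    unfolding ldet_def by (rule arg_cong)
  then show ?thesis by simp
qed

text \<open>The map is conjugated by \<open>relabel\<close>, the library theorem is applied to the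
  conjugate, and the measure of the image as well as the integral of the Jacobian are pulled back
  along \<open>distr_lborel_relabel\<close>.\<close>

lemma measure_differentiable_image_ldet:
  fixes f :: "real^'n \<Rightarrow> real^'n"
  assumes S [measurable]: "S \<in> sets borel" and fS: "f ` S \<in> sets borel"
    and der: "\<And>x. x \<in> S \<Longrightarrow> (f has_derivative f' x) (at x within S)"
    and inj: "inj_on f S"
    and int: "set_integrable lborel S (\<lambda>x. \<bar>ldet (f' x)\<bar>)"
  shows "measure lborel (f ` S) = (LINT x:S|lborel. \<bar>ldet (f' x)\<bar>)"
proof -
  define g where "g = relabel \<circ> f \<circ> unlabel"
  define g' where "g' = (\<lambda>x. relabel \<circ> f' (unlabel x) \<circ> unlabel)"
  have im: "relabel ` A = unlabel -` A" for A :: "(real^'n) set"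
    by (auto simp: image_iff) (metis relabel_unlabel(1))
  have gim: "g ` (relabel ` S) = relabel ` (f ` S)"
    by (auto simp: g_def image_comp)
  have bl: "bounded_linear relabel" "bounded_linear unlabel"
    using linear_relabel by (auto simp: linear_conv_bounded_linear)
  have derg: "(g has_derivative g' x) (at x within relabel ` S)" if x: "x \<in> relabel ` S" for x
  proof -
    have xS: "unlabel x \<in> S" using x by auto
    have 1: "(f has_derivative f' (unlabel x)) (at (unlabel x) within unlabel ` (relabel ` S))"
      using der[OF xS] by (simp add: image_comp o_def)
    have "((\<lambda>y. f (unlabel y)) has_derivative (\<lambda>h. f' (unlabel x) (unlabel h))) (at x within relabel ` S)"
      by (rule has_derivative_in_compose[OF bounded_linear_imp_has_derivative[OF bl(2)] 1])
    from bounded_linear.has_derivative[OF bl(1) this]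
    show ?thesis by (simp add: g_def g'_def o_def)
  qed
  have meas1: "relabel ` S \<in> sets borel" unfolding im
    using measurable_sets[OF measurable_relabel(2) S] by simp
  have injg: "inj_on g (relabel ` S)"
    using inj by (auto simp: inj_on_def g_def) (metis relabel_unlabel(2))
  have int': "set_integrable lborel (relabel ` S) (\<lambda>x. \<bar>det (matrix (g' x))\<bar>)"
    and eq: "(LINT x:relabel ` S|lborel. \<bar>det (matrix (g' x))\<bar>) = (LINT x:S|lborel. \<bar>ldet (f' x)\<bar>)"
  proof -
    define h where "h = (\<lambda>x. indicator S x *\<^sub>R \<bar>ldet (f' x)\<bar>)"
    have h: "integrable lborel h" using int by (simp add: set_integrable_def h_def)
    have h': "(\<lambda>y. indicator (relabel ` S) y *\<^sub>R \<bar>det (matrix (g' y))\<bar>) = (\<lambda>y. h (unlabel y))"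
      by (auto simp: h_def im indicator_def ldet_def g'_def fun_eq_iff)
    have hm: "h \<in> borel_measurable borel" using h by (auto dest: borel_measurable_integrable)
    have hm': "(\<lambda>y. h (unlabel y)) \<in> borel_measurable borel"
      using measurable_compose[OF measurable_relabel(2) hm] .
    have 1: "integrable (distr lborel borel relabel) (\<lambda>y. h (unlabel y)) \<longleftrightarrow> integrable lborel h"
      by (subst integrable_distr_eq) (use hm' in auto)
    have 2: "integral\<^sup>L (distr lborel borel relabel) (\<lambda>y. h (unlabel y)) = integral\<^sup>L lborel h"
      by (subst integral_distr) (use hm' in auto)
    show "set_integrable lborel (relabel ` S) (\<lambda>x. \<bar>det (matrix (g' x))\<bar>)"
      unfolding set_integrable_def h' using 1 h by (simp add: distr_lborel_relabel)
    show "(LINT x:relabel ` S|lborel. \<bar>det (matrix (g' x))\<bar>) = (LINT x:S|lborel. \<bar>ldet (f' x)\<bar>)"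
      unfolding set_lebesgue_integral_def h' using 2 by (simp add: distr_lborel_relabel h_def)
  qed
  have hk: "(\<lambda>x. \<bar>det (matrix (g' x))\<bar>) integrable_on (relabel ` S)"
    using set_borel_integral_eq_integral(1)[OF int'] .
  have "measure lebesgue (g ` relabel ` S) = integral (relabel ` S) (\<lambda>x. \<bar>det (matrix (g' x))\<bar>)"
    by (rule measure_differentiable_image_eq) (use meas1 derg injg hk in auto)
  also have "\<dots> = (LINT x:S|lborel. \<bar>ldet (f' x)\<bar>)"
    using set_borel_integral_eq_integral(2)[OF int'] eq by simp
  finally have 3: "measure lebesgue (relabel ` f ` S) = (LINT x:S|lborel. \<bar>ldet (f' x)\<bar>)"
    by (simp add: gim)
  have "relabel ` f ` S \<in> sets borel" unfolding im
    using measurable_sets[OF measurable_relabel(2) fS] by simp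
  then have "measure lebesgue (relabel ` f ` S) = measure (distr lborel borel relabel) (relabel ` f ` S)"
    by (simp add: measure_completion distr_lborel_relabel)
  also have "\<dots> = measure lborel (relabel -` (relabel ` f ` S))"
    by (subst measure_distr) (use \<open>relabel ` f ` S \<in> sets borel\<close> in auto)
  also have "relabel -` (relabel ` f ` S) = f ` S"
    by (auto simp: image_iff) (metis relabel_unlabel(2))
  finally show ?thesis using 3 by simp
qed

lemma compact_linear_imageI:
  fixes f :: "'a::euclidean_space \<Rightarrow> 'b::euclidean_space"
  assumes "linear f" "compact S"
  shows "compact (f ` S)"
  using assms by (auto intro!: compact_continuous_image linear_continuous_on simp: linear_conv_bounded_linear)

lemma measure_linear_image_ldet:
  fixes f :: "real^'n \<Rightarrow> real^'n"
  assumes "linear f" "inj f" "compact S"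
  shows "measure lborel (f ` S) = \<bar>ldet f\<bar> * measure lborel S"
proof -
  have "measure lborel (f ` S) = (LINT x:S|lborel. \<bar>ldet f\<bar>)"
  proof (rule measure_differentiable_image_ldet)
    show "f ` S \<in> sets borel"
      using compact_linear_imageI[OF assms(1,3)] by (simp add: compact_imp_closed)
    show "S \<in> sets borel" using assms(3) by (simp add: compact_imp_closed)
    show "(f has_derivative f) (at x within S)" for x
      using assms(1) by (simp add: linear_imp_has_derivative)
    show "inj_on f S" using assms(2) by (rule inj_on_subset) simp
    show "set_integrable lborel S (\<lambda>x. \<bar>ldet f\<bar>)"
      unfolding set_integrable_def by (rule borel_integrable_compact[OF assms(3)]) auto
  qed
  then show ?thesis
    using assms(3) by (simp add: set_lebesgue_integral_def compact_imp_closed mult.commute)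
qed

section \<open>Projections and parallel sets of ellipsoids\<close>

text \<open>For a unit vector \<open>e\<close> this is the cylinder of height 1 over the unit ball
  of the hyperplane orthogonal to \<open>e\<close>. Its measure is therefore the (n-1)-dimensional
  volume of that ball, in the same encoding that \<open>projection_volume\<close> uses.\<close>

definition unit_cylinder :: "'a::euclidean_space \<Rightarrow> 'a set" where
  "unit_cylinder e = {x. norm (x - (x \<bullet> e) *\<^sub>R e) \<le> 1 \<and> 0 \<le> x \<bullet> e \<and> x \<bullet> e \<le> 1}"

lemma compact_unit_cylinder:
  assumes "norm e = 1"
  shows "compact (unit_cylinder e)"
proof -
  have "norm x \<le> 2" if "x \<in> unit_cylinder e" for x
  proof -
    have "norm x \<le> norm (x - (x \<bullet> e) *\<^sub>R e) + norm ((x \<bullet> e) *\<^sub>R e)"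
      using norm_triangle_ineq[of "x - (x \<bullet> e) *\<^sub>R e" "(x \<bullet> e) *\<^sub>R e"] by simp
    then show ?thesis using that assms by (simp add: unit_cylinder_def)
  qed
  then have "bounded (unit_cylinder e)" by (auto intro: boundedI)
  moreover have "closed (unit_cylinder e)"
    unfolding unit_cylinder_def by (intro closed_Collect_conj closed_Collect_le continuous_intros)
  ultimately show ?thesis by (simp add: compact_eq_bounded_closed)
qed

lemma measure_unit_cylinder_eq:
  fixes e e' :: "real^'n"
  assumes "norm e = 1" "norm e' = 1"
  shows "measure lborel (unit_cylinder e) = measure lborel (unit_cylinder e')"
proof -
  obtain f where f: "orthogonal_transformation f" "f e = e'"
    using orthogonal_transformation_exists[of e e'] assms by auto
  have lin: "linear f" and inj: "inj f" and surj: "surj f"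
    using f orthogonal_transformation_inj orthogonal_transformation_surj
    by (auto simp: orthogonal_transformation_linear)
  have inner: "f x \<bullet> f y = x \<bullet> y" for x y
    using f by (simp add: orthogonal_transformation_def)
  have norm: "norm (f x) = norm x" for x by (simp add: norm_eq_sqrt_inner inner)
  have cb: "f ` cball 0 1 = cball 0 1"
  proof
    show "cball 0 1 \<subseteq> f ` cball 0 1"
    proof
      fix y :: "real^'n" assume "y \<in> cball 0 1"
      moreover obtain x where "y = f x" using surj by auto
      ultimately show "y \<in> f ` cball 0 1" by (auto simp: norm)
    qed
  qed (auto simp: norm)
  \<comment> \<open>The modulus of the determinant of an orthogonal map is read off from the unit
    ball, which it preserves and which has positive volume.\<close>
  have "measure lborel (cball 0 1 :: (real^'n) set) = \<bar>ldet f\<bar> * measure lborel (cball 0 1 :: (real^'n) set)"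
    using measure_linear_image_ldet[OF lin inj compact_cball[of 0 1]] cb by simp
  moreover have "measure lborel (cball 0 1 :: (real^'n) set) > 0"
    using content_cball_pos[of 1 "0::real^'n"] by simp
  ultimately have det: "\<bar>ldet f\<bar> = 1" by simp
  have "f ` unit_cylinder e = unit_cylinder e'"
  proof -
    have *: "f x \<bullet> e' = x \<bullet> e" for x
      using f(2) inner[of x e] by simp
    have "f (x - (x \<bullet> e) *\<^sub>R e) = f x - (x \<bullet> e) *\<^sub>R e'" for x
      using f(2) by (simp add: linear_diff[OF lin] linear_scale[OF lin])
    then have **: "norm (f x - (x \<bullet> e) *\<^sub>R e') = norm (x - (x \<bullet> e) *\<^sub>R e)" for x
      by (metis norm)
    show ?thesis
    proof
      show "unit_cylinder e' \<subseteq> f ` unit_cylinder e"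
      proof
        fix y assume y: "y \<in> unit_cylinder e'"
        obtain x where "y = f x" using surj by auto
        with y show "y \<in> f ` unit_cylinder e" by (auto simp: unit_cylinder_def * **)
      qed
    qed (auto simp: unit_cylinder_def * **)
  qed
  then show ?thesis
    using measure_linear_image_ldet[OF lin inj compact_unit_cylinder[OF assms(1)]] det by simp
qed

text \<open>The cylinder over the projection of the ellipsoid is the image of the unit cylinder in
  direction \<open>w = A\<^sup>-\<^sup>1 \<theta>\<close> under the map \<open>A\<close> composed with a shear along \<open>w\<close>.\<close>

lemma projection_volume_ellipsoid:
  fixes A :: "real^'n \<Rightarrow> real^'n" and e :: "real^'n"
  assumes lin: "linear A" and sym: "\<And>x y. A x \<bullet> y = x \<bullet> A y" and inj: "inj A"
    and w: "A w = \<theta>" and \<theta>: "norm \<theta> = 1" and e: "norm e = 1"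
  shows "projection_volume (A ` cball 0 1) \<theta> = \<bar>ldet A\<bar> * norm w * measure lborel (unit_cylinder e)"
proof -
  have w0: "w \<noteq> 0" using w \<theta> linear_0[OF lin] by auto
  have \<theta>2: "\<theta> \<bullet> \<theta> = 1" using \<theta> by (simp add: norm_eq_1)
  define u where "u = w /\<^sub>R norm w"
  have u: "norm u = 1" "w = norm w *\<^sub>R u" "u \<bullet> u = 1" using w0 by (auto simp: u_def power2_norm_eq_inner[symmetric] power2_eq_square)
  have Au: "A u = \<theta> /\<^sub>R norm w" by (simp add: u_def linear_scale[OF lin] w)
  \<comment> \<open>\<open>R\<close> changes x only by a multiple of w, and A w = \<theta>, so A (R
    x) and A x have the same projection. The coefficient is chosen such that A (R x) \<bullet>
    \<theta> = u \<bullet> x: the height over the hyperplane becomes the height of x along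
    u.\<close>
  define R where "R = (\<lambda>x. x + ((u - A \<theta>) \<bullet> x) *\<^sub>R w)"
  have linR: "linear R" by (auto simp: R_def linear_iff inner_simps algebra_simps)
  have uw: "u \<bullet> w = norm w" using u by (metis inner_scaleR_right mult.right_neutral)
  have Aw: "A \<theta> \<bullet> w = 1" by (simp add: sym w \<theta>2)
  have ldetR: "ldet R = norm w"
    unfolding R_def ldet_rank_one_update using uw Aw by (simp add: inner_diff_right inner_commute[of w])
  have AR: "A (R x) = A x + (u \<bullet> x - A x \<bullet> \<theta>) *\<^sub>R \<theta>" for x
    using sym[of x \<theta>] by (simp add: R_def linear_add[OF lin] linear_scale[OF lin] w inner_diff_left inner_commute[of x])
  have injR: "inj R"
  proof (rule linear_injective_0[OF linR, THEN iffD2], intro allI impI)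
    fix x assume "R x = 0"
    then have "A (R x) = 0" using linear_0[OF lin] by simp
    then have "A (R x) \<bullet> \<theta> = 0" by simp
    then have ux: "u \<bullet> x = 0" by (simp add: AR inner_add_left \<theta>2)
    have "x = - ((u - A \<theta>) \<bullet> x) *\<^sub>R w" using \<open>R x = 0\<close> by (simp add: R_def eq_neg_iff_add_eq_0)
    moreover from this have "u \<bullet> x = - ((u - A \<theta>) \<bullet> x) * norm w" by (metis inner_scaleR_right uw)
    ultimately show "x = 0" using ux w0 by auto
  qed
  let ?C = "{y + t *\<^sub>R \<theta> | y t. y \<in> hyperplane_projection \<theta> (A ` cball 0 1) \<and> 0 \<le> t \<and> t \<le> 1}"
  have C: "?C = A ` R ` unit_cylinder u"
  proof
    show "A ` R ` unit_cylinder u \<subseteq> ?C"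
    proof
      fix z assume "z \<in> A ` R ` unit_cylinder u"
      then obtain x where x: "x \<in> unit_cylinder u" "z = A (R x)" by auto
      define b where "b = x - (x \<bullet> u) *\<^sub>R u"
      have Ab: "A b = A x - ((x \<bullet> u) / norm w) *\<^sub>R \<theta>"
        by (simp add: b_def linear_diff[OF lin] linear_scale[OF lin] Au divide_inverse)
      have "z = (A b - (A b \<bullet> \<theta>) *\<^sub>R \<theta>) + (x \<bullet> u) *\<^sub>R \<theta>"
        unfolding x(2) AR Ab by (simp add: inner_diff_left \<theta>2 algebra_simps inner_commute)
      moreover have "b \<in> cball 0 1" "0 \<le> x \<bullet> u" "x \<bullet> u \<le> 1"
        using x(1) by (auto simp: unit_cylinder_def b_def)
      ultimately show "z \<in> ?C" unfolding hyperplane_projection_def by blast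
    qed
    show "?C \<subseteq> A ` R ` unit_cylinder u"
    proof
      fix z assume "z \<in> ?C"
      then obtain t b where b: "norm b \<le> 1" "z = (A b - (A b \<bullet> \<theta>) *\<^sub>R \<theta>) + t *\<^sub>R \<theta>" and t: "0 \<le> t" "t \<le> 1"
        unfolding hyperplane_projection_def by (auto simp: dist_norm) (metis (no_types))
      \<comment> \<open>Since A u is a multiple of \<theta>, dropping the u-component of b does not
        change the projection of A b. What remains is orthogonal to u and still of length at most 1,
        so it can serve as a base point of the cylinder.\<close>
      define b' where "b' = b - (b \<bullet> u) *\<^sub>R u"
      define x where "x = b' + t *\<^sub>R u"
      have b'u: "b' \<bullet> u = 0" by (simp add: b'_def inner_diff_left u)
      have xu: "x \<bullet> u = t" by (simp add: x_def inner_add_left b'u u)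
      have "(norm b)\<^sup>2 = (norm b')\<^sup>2 + (b \<bullet> u)\<^sup>2"
        unfolding power2_norm_eq_inner b'_def
        by (simp add: inner_simps u inner_commute power2_eq_square algebra_simps)
      then have "(norm b')\<^sup>2 \<le> (norm b)\<^sup>2" by simp
      then have "norm b' \<le> 1" using b(1) by (meson norm_ge_zero order_trans power2_le_imp_le)
      then have "x \<in> unit_cylinder u" using t xu by (simp add: unit_cylinder_def) (simp add: x_def)
      moreover have "z = A (R x)"
      proof -
        have Ab': "A b' = A b - ((b \<bullet> u) / norm w) *\<^sub>R \<theta>"
          by (simp add: b'_def linear_diff[OF lin] linear_scale[OF lin] Au divide_inverse)
        have Ax: "A x = A b' + (t / norm w) *\<^sub>R \<theta>"
          by (simp add: x_def linear_add[OF lin] linear_scale[OF lin] Au divide_inverse)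
        show ?thesis
          unfolding AR Ax Ab' b(2) using xu
          by (simp add: inner_add_left inner_diff_left \<theta>2 algebra_simps inner_commute[of u])
      qed
      ultimately show "z \<in> A ` R ` unit_cylinder u" by blast
    qed
  qed
  have comp: "compact (R ` unit_cylinder u)"
    by (rule compact_linear_imageI[OF linR compact_unit_cylinder[OF u(1)]])
  have "projection_volume (A ` cball 0 1) \<theta> = measure lborel (A ` R ` unit_cylinder u)"
    unfolding projection_volume_def C
    using compact_linear_imageI[OF lin comp] by (simp add: measure_completion compact_imp_closed)
  also have "\<dots> = \<bar>ldet A\<bar> * (\<bar>ldet R\<bar> * measure lborel (unit_cylinder u))"
    by (simp add: measure_linear_image_ldet lin inj comp linR injR compact_unit_cylinder u)
  finally show ?thesis
    using measure_unit_cylinder_eq[OF u(1) e] ldetR by simp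
qed

text \<open>For z = A b symmetry gives z \<bullet> \<theta> = b \<bullet> A \<theta>, so the bound
  is Cauchy-Schwarz and the uniqueness of the maximiser is its equality case. Thus
  \<open>norm (A \<theta>)\<close> is the support function, and p is the boundary point with outer
  normal \<theta>.\<close>

lemma ellipsoid_support:
  fixes A :: "'a::euclidean_space \<Rightarrow> 'a"
  assumes lin: "linear A" and sym: "\<And>x y. A x \<bullet> y = x \<bullet> A y"
    and nz: "A \<theta> \<noteq> 0"
  defines "p \<equiv> A (A \<theta>) /\<^sub>R norm (A \<theta>)"
  shows "p \<in> A ` cball 0 1" "p \<bullet> \<theta> = norm (A \<theta>)"
    "z \<in> A ` cball 0 1 \<Longrightarrow> z \<bullet> \<theta> \<le> norm (A \<theta>)"
    "z \<in> A ` cball 0 1 \<Longrightarrow> z \<bullet> \<theta> = norm (A \<theta>) \<Longrightarrow> z = p"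
proof -
  have p: "p = A (A \<theta> /\<^sub>R norm (A \<theta>))" by (simp add: p_def linear_scale[OF lin])
  show "p \<in> A ` cball 0 1" unfolding p using nz by (intro imageI) simp
  show pt: "p \<bullet> \<theta> = norm (A \<theta>)"
    using nz by (simp add: p_def sym power2_norm_eq_inner[symmetric] power2_eq_square)
  assume "z \<in> A ` cball 0 1"
  then obtain b where b: "z = A b" "norm b \<le> 1" by auto
  have "z \<bullet> \<theta> = b \<bullet> A \<theta>" using b sym by simp
  also have "\<dots> \<le> norm b * norm (A \<theta>)" by (rule norm_cauchy_schwarz)
  also have "\<dots> \<le> norm (A \<theta>)" using b(2) by (simp add: mult_left_le_one_le)
  finally show "z \<bullet> \<theta> \<le> norm (A \<theta>)" .
  assume eq: "z \<bullet> \<theta> = norm (A \<theta>)"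
  define v where "v = A \<theta> /\<^sub>R norm (A \<theta>)"
  have v: "v \<bullet> v = 1" using nz by (simp add: v_def power2_norm_eq_inner[symmetric] power2_eq_square)
  have "b \<bullet> v = 1" using eq nz b(1) by (simp add: v_def sym)
  moreover have "b \<bullet> b \<le> 1" using b(2) by (simp add: norm_le_square)
  ultimately have "(b - v) \<bullet> (b - v) \<le> 0" using v by (simp add: inner_simps inner_commute)
  then have "(norm (b - v))\<^sup>2 \<le> 0" by (simp add: power2_norm_eq_inner)
  then have "b = v" by simp
  then show "z = p" using b(1) p v_def by simp
qed

text \<open>For y = (1 + s) \<theta> with |\<theta>| = 1 the value is p + s \<theta>, where p is the
  boundary point with outer normal \<theta>. These are normal coordinates of the exterior: the
  direction of y is the normal, and |y| - 1 is the distance from the body.\<close>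

definition ellipsoid_shell :: "('a::euclidean_space \<Rightarrow> 'a) \<Rightarrow> 'a \<Rightarrow> 'a" where
  "ellipsoid_shell A y = A (A y) /\<^sub>R norm (A y) + y - sgn y"

lemma ellipsoid_shell_eq:
  assumes "linear A" "y \<noteq> 0"
  shows "ellipsoid_shell A y = A (A (sgn y)) /\<^sub>R norm (A (sgn y)) + (norm y - 1) *\<^sub>R sgn y"
  using assms by (simp add: ellipsoid_shell_def sgn_div_norm linear_scale algebra_simps)

lemma convex_compact_ellipsoid:
  fixes A :: "'a::euclidean_space \<Rightarrow> 'a"
  assumes "linear A"
  shows "convex (A ` cball 0 1)" "compact (A ` cball 0 1)" "closed (A ` cball 0 1)" "A ` cball 0 1 \<noteq> {}"
  using assms by (auto simp: convex_linear_image compact_linear_imageI compact_imp_closed)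

lemma infdist_eq_dist_closest_point:
  assumes "closed S" "S \<noteq> {}"
  shows "infdist x S = dist x (closest_point S x)"
  using assms by (simp add: infdist_eq_setdist setdist_closest_point)

text \<open>The body lies below its supporting hyperplane at p with normal \<theta> = y/|y|. Hence
  every point of it is at distance at least |y| - 1 from p + (|y| - 1) \<theta>, and p attains
  this.\<close>

lemma closest_point_ellipsoid_shell:
  fixes A :: "'a::euclidean_space \<Rightarrow> 'a"
  assumes lin: "linear A" and sym: "\<And>x y. A x \<bullet> y = x \<bullet> A y" and inj: "inj A" and y: "1 < norm y"
  shows "closest_point (A ` cball 0 1) (ellipsoid_shell A y) = A (A (sgn y)) /\<^sub>R norm (A (sgn y))"
    and "infdist (ellipsoid_shell A y) (A ` cball 0 1) = norm y - 1"
    and "sgn (ellipsoid_shell A y - closest_point (A ` cball 0 1) (ellipsoid_shell A y)) = sgn y"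
proof -
  let ?L = "A ` cball 0 1"
  define \<theta> where "\<theta> = sgn y"
  define p where "p = A (A \<theta>) /\<^sub>R norm (A \<theta>)"
  have y0: "y \<noteq> 0" using y by auto
  have \<theta>: "norm \<theta> = 1" "\<theta> \<bullet> \<theta> = 1" using y0 by (auto simp: \<theta>_def norm_sgn norm_eq_1[symmetric])
  have nz: "A \<theta> \<noteq> 0" using \<theta> inj lin by (metis linear_injective_0 norm_zero zero_neq_one)
  have x: "ellipsoid_shell A y = p + (norm y - 1) *\<^sub>R \<theta>"
    using ellipsoid_shell_eq[OF lin y0] by (simp add: \<theta>_def p_def)
  note supp = ellipsoid_support[OF lin sym nz, folded p_def]
  have "p = closest_point ?L (ellipsoid_shell A y)"
  proof (rule closest_point_unique)
    show "\<forall>z\<in>?L. dist (ellipsoid_shell A y) p \<le> dist (ellipsoid_shell A y) z"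
    proof
      fix z assume "z \<in> ?L"
      have "norm y - 1 \<le> (ellipsoid_shell A y - z) \<bullet> \<theta>"
        using supp(2) supp(3)[OF \<open>z \<in> ?L\<close>] by (simp add: x inner_simps \<theta>)
      also have "\<dots> \<le> norm (ellipsoid_shell A y - z)"
        using norm_cauchy_schwarz[of "ellipsoid_shell A y - z" \<theta>] \<theta> by simp
      finally show "dist (ellipsoid_shell A y) p \<le> dist (ellipsoid_shell A y) z"
        using y \<theta> by (simp add: dist_norm x)
    qed
  qed (rule convex_compact_ellipsoid[OF lin] supp(1))+
  then have cp: "closest_point ?L (ellipsoid_shell A y) = p" by simp
  show "closest_point ?L (ellipsoid_shell A y) = A (A (sgn y)) /\<^sub>R norm (A (sgn y))"
    using cp by (simp add: p_def \<theta>_def)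
  show "infdist (ellipsoid_shell A y) ?L = norm y - 1"
  proof -
    have "infdist (ellipsoid_shell A y) ?L = dist (ellipsoid_shell A y) p"
      using infdist_eq_dist_closest_point[OF convex_compact_ellipsoid(3,4)[OF lin], of "ellipsoid_shell A y"]
      unfolding cp .
    also have "\<dots> = norm y - 1" using y \<theta> by (simp add: dist_norm x)
    finally show ?thesis .
  qed
  show "sgn (ellipsoid_shell A y - closest_point ?L (ellipsoid_shell A y)) = sgn y"
  proof -
    have "sgn (ellipsoid_shell A y - p) = \<theta>"
      using y \<theta> by (simp add: x sgn_div_norm)
    then show ?thesis by (simp only: cp \<theta>_def)
  qed
qed

lemma local_parallel_set_ellipsoid:
  fixes A :: "'a::euclidean_space \<Rightarrow> 'a"
  assumes lin: "linear A" and sym: "\<And>x y. A x \<bullet> y = x \<bullet> A y" and inj: "inj A"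
  shows "local_parallel_set (A ` cball 0 1) \<epsilon> E =
    ellipsoid_shell A ` {y. 1 < norm y \<and> norm y \<le> 1 + \<epsilon> \<and> sgn y \<in> E}"
proof
  let ?L = "A ` cball 0 1"
  show "ellipsoid_shell A ` {y. 1 < norm y \<and> norm y \<le> 1 + \<epsilon> \<and> sgn y \<in> E} \<subseteq> local_parallel_set ?L \<epsilon> E"
    using closest_point_ellipsoid_shell[OF lin sym inj] by (auto simp: local_parallel_set_def)
  show "local_parallel_set ?L \<epsilon> E \<subseteq> ellipsoid_shell A ` {y. 1 < norm y \<and> norm y \<le> 1 + \<epsilon> \<and> sgn y \<in> E}"
  proof
    fix x assume "x \<in> local_parallel_set ?L \<epsilon> E"
    then have x: "0 < infdist x ?L" "infdist x ?L \<le> \<epsilon>" "sgn (x - closest_point ?L x) \<in> E"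
      by (auto simp: local_parallel_set_def)
    define c where "c = closest_point ?L x"
    define s where "s = infdist x ?L"
    define \<theta> where "\<theta> = sgn (x - c)"
    have s: "s = norm (x - c)"
      using infdist_eq_dist_closest_point[of ?L x] convex_compact_ellipsoid[OF lin]
      by (simp add: s_def c_def dist_norm)
    have s0: "0 < s" using x by (simp add: s_def)
    have \<theta>: "norm \<theta> = 1" "x = c + s *\<^sub>R \<theta>" using s s0 by (auto simp: \<theta>_def norm_sgn sgn_div_norm)
    have nz: "A \<theta> \<noteq> 0" using \<theta> inj lin by (metis linear_injective_0 norm_zero zero_neq_one)
    have c: "c \<in> ?L" unfolding c_def using convex_compact_ellipsoid[OF lin] by (intro closest_point_in_set) auto
    note supp = ellipsoid_support[OF lin sym nz]
    \<comment> \<open>The variational inequality of the nearest point, tested with the support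
      point, shows that c maximises the inner product with \<theta>. Uniqueness of the maximiser
      then identifies c.\<close>
    have "c \<bullet> \<theta> \<ge> norm (A \<theta>)"
    proof -
      have "(x - c) \<bullet> (A (A \<theta>) /\<^sub>R norm (A \<theta>) - c) \<le> 0"
        unfolding c_def using convex_compact_ellipsoid[OF lin] supp(1) by (intro closest_point_dot) auto
      then have "s * (\<theta> \<bullet> (A (A \<theta>) /\<^sub>R norm (A \<theta>) - c)) \<le> 0" using \<theta>(2) by simp
      then have "\<theta> \<bullet> (A (A \<theta>) /\<^sub>R norm (A \<theta>) - c) \<le> 0" using s0 by (simp add: mult_le_0_iff)
      then show ?thesis using supp(2) unfolding inner_diff_right by (simp add: inner_commute)
    qed
    then have ceq: "c = A (A \<theta>) /\<^sub>R norm (A \<theta>)" using supp(3,4)[OF c] by (simp add: order_antisym)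
    define y where "y = (1 + s) *\<^sub>R \<theta>"
    have ny: "norm y = 1 + s" "sgn y = \<theta>" "y \<noteq> 0"
      using s0 \<theta>(1) by (auto simp: y_def sgn_scaleR) (simp add: sgn_div_norm)
    have "x = ellipsoid_shell A y"
      using ellipsoid_shell_eq[OF lin ny(3)] ceq \<theta>(2) by (simp add: ny)
    moreover have "1 < norm y" "norm y \<le> 1 + \<epsilon>" "sgn y \<in> E"
      using ny s0 x(2,3) by (simp_all add: s_def) (simp add: \<theta>_def c_def)
    ultimately show "x \<in> ellipsoid_shell A ` {y. 1 < norm y \<and> norm y \<le> 1 + \<epsilon> \<and> sgn y \<in> E}" by blast
  qed
qed

lemma norm_sgn_scaleR: "norm y *\<^sub>R sgn y = (y :: 'a::real_normed_vector)"
  by (cases "y = 0") (simp_all add: sgn_div_norm)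

lemma inj_on_ellipsoid_shell:
  fixes A :: "'a::euclidean_space \<Rightarrow> 'a"
  assumes "linear A" "\<And>x y. A x \<bullet> y = x \<bullet> A y" "inj A"
  shows "inj_on (ellipsoid_shell A) {y. 1 < norm y}"
proof (rule inj_onI)
  fix y z assume yz: "y \<in> {y. 1 < norm y}" "z \<in> {y. 1 < norm y}" and eq: "ellipsoid_shell A y = ellipsoid_shell A z"
  have "norm y = norm z" "sgn y = sgn z"
    using closest_point_ellipsoid_shell(2,3)[OF assms, of y] closest_point_ellipsoid_shell(2,3)[OF assms, of z]
      yz eq by auto
  then show "y = z"
    by (metis (no_types) norm_sgn_scaleR)
qed

section \<open>The curvature function of an ellipsoid\<close>

definition shell_derivative :: "('a::euclidean_space \<Rightarrow> 'a) \<Rightarrow> 'a \<Rightarrow> 'a \<Rightarrow> 'a" where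
  "shell_derivative A y v =
     A (A v) /\<^sub>R norm (A y) - ((A y \<bullet> A v) / norm (A y) ^ 3) *\<^sub>R A (A y)
     + v - (v /\<^sub>R norm y - ((y \<bullet> v) / norm y ^ 3) *\<^sub>R y)"

lemma has_derivative_inverse_norm:
  fixes B :: "'a::euclidean_space \<Rightarrow> 'a"
  assumes "linear B" "B y \<noteq> 0"
  shows "((\<lambda>y. inverse (norm (B y))) has_derivative (\<lambda>v. - ((B y \<bullet> B v) / norm (B y) ^ 3))) (at y)"
proof -
  have "((\<lambda>y. norm (B y)) has_derivative (\<lambda>v. B v \<bullet> sgn (B y))) (at y)"
    using has_derivative_compose[OF linear_imp_has_derivative[OF assms(1)] has_derivative_norm[OF assms(2)]] .
  then have "((\<lambda>y. inverse (norm (B y))) has_derivative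
      (\<lambda>v. - (inverse (norm (B y)) * (B v \<bullet> sgn (B y)) * inverse (norm (B y))))) (at y)"
    by (rule Deriv.has_derivative_inverse[rotated]) (use assms in auto)
  then show ?thesis
    by (rule has_derivative_eq_rhs)
       (auto simp: fun_eq_iff sgn_div_norm power3_eq_cube inner_commute divide_inverse)
qed

lemma has_derivative_ellipsoid_shell:
  fixes A :: "'a::euclidean_space \<Rightarrow> 'a"
  assumes lin: "linear A" and inj: "inj A" and y: "y \<noteq> 0"
  shows "(ellipsoid_shell A has_derivative shell_derivative A y) (at y)"
proof -
  have nz: "A y \<noteq> 0" using y inj lin by (metis linear_injective_0)
  have linAA: "linear (\<lambda>x. A (A x))" using linear_compose[OF lin lin] by (simp add: o_def)
  have "((\<lambda>y. inverse (norm (A y)) *\<^sub>R A (A y) + y - inverse (norm y) *\<^sub>R y) has_derivative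
      (\<lambda>v. (inverse (norm (A y)) *\<^sub>R A (A v) + (- ((A y \<bullet> A v) / norm (A y) ^ 3)) *\<^sub>R A (A y)) + v
         - (inverse (norm y) *\<^sub>R v + (- ((y \<bullet> v) / norm y ^ 3)) *\<^sub>R y))) (at y)"
    using has_derivative_inverse_norm[OF linear_id, of y] y
    by (intro has_derivative_diff has_derivative_add has_derivative_scaleR
        has_derivative_inverse_norm[OF lin nz] linear_imp_has_derivative[OF linAA] has_derivative_ident) auto
  then show ?thesis
    by (simp add: ellipsoid_shell_def[abs_def] shell_derivative_def[abs_def] sgn_div_norm)
qed

lemma continuous_on_ldet:
  assumes "\<And>v. continuous_on S (\<lambda>y. D y v)"
  shows "continuous_on S (\<lambda>y. ldet (D y))"
proof -
  have "continuous_on S (\<lambda>y. relabel (D y v))" for v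
    using assms linear_relabel
    by (auto intro!: continuous_on_compose2[OF linear_continuous_on[of relabel UNIV]]
        simp: linear_conv_bounded_linear)
  then show ?thesis
    unfolding ldet_def det_def matrix_def by (auto intro!: continuous_intros)
qed

lemma continuous_on_shell_derivative:
  assumes lin: "linear A" and inj: "inj A"
  shows "continuous_on (- {0}) (\<lambda>y. shell_derivative A y v)"
proof -
  have nz: "A y \<noteq> 0" if "y \<noteq> 0" for y using that inj lin by (metis linear_injective_0)
  have [continuous_intros]: "continuous_on S A" for S
    using lin by (simp add: linear_continuous_on linear_conv_bounded_linear)
  have [continuous_intros]: "continuous_on S (\<lambda>y. A (A y))" for S
    using linear_compose[OF lin lin] by (simp add: linear_continuous_on linear_conv_bounded_linear o_def)
  show ?thesis unfolding shell_derivative_def by (intro continuous_intros) (auto simp: nz)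
qed

text \<open>On the unit sphere the last terms of the derivative reduce to the radial part (\<theta>
  \<bullet> v) \<theta>. With q = |A \<theta>|, u = A \<theta> / q and A z = \<theta> the derivative
  becomes A (I - u u^T + q z z^T) (1/q) A, because \<theta> \<bullet> v = z \<bullet> A v. The
  middle factor is a product of two mutually transposed rank one updates of the identity, each of
  determinant q^(-1/2).\<close>

lemma ldet_shell_derivative:
  fixes A :: "real^'n \<Rightarrow> real^'n"
  assumes lin: "linear A" and sym: "\<And>x y. A x \<bullet> y = x \<bullet> A y" and inj: "inj A"
    and \<theta>: "norm \<theta> = 1"
  shows "ldet (shell_derivative A \<theta>) = (ldet A)\<^sup>2 / norm (A \<theta>) ^ (CARD('n) + 1)"
proof -
  define q where "q = norm (A \<theta>)"
  have "\<theta> \<noteq> 0" using \<theta> by auto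
  then have q0: "q > 0" using inj lin unfolding q_def by (metis linear_injective_0 zero_less_norm_iff)
  obtain z where z: "A z = \<theta>"
    using linear_injective_imp_surjective[OF lin inj] by (metis surjD)
  define u where "u = A \<theta> /\<^sub>R q"
  have u: "u \<bullet> u = 1" using q0 by (simp add: u_def q_def power2_norm_eq_inner[symmetric] power2_eq_square)
  have Au: "A \<theta> = q *\<^sub>R u" using q0 by (simp add: u_def)
  have uz: "u \<bullet> z = 1 / q"
    using \<theta> by (simp add: u_def sym z norm_eq_1 divide_inverse)
  \<comment> \<open>With c^2 = q the product of I + (c z - u) u^T and its transpose is I - u u^T + q
    z z^T: the mixed terms cancel because |u| = 1.\<close>
  define c where "c = sqrt q"
  have c: "c * c = q" "c > 0" using q0 by (auto simp: c_def)
  define R1 where "R1 = (\<lambda>x. x + (u \<bullet> x) *\<^sub>R (c *\<^sub>R z - u))"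
  define R2 where "R2 = (\<lambda>x. x + ((c *\<^sub>R z - u) \<bullet> x) *\<^sub>R u)"
  have linR: "linear R1" "linear R2"
    by (auto simp: R1_def R2_def linear_iff inner_simps algebra_simps)
  have "1 + (c *\<^sub>R z - u) \<bullet> u = c / q"
    using uz u by (simp add: inner_diff_left inner_commute[of z])
  then have d: "ldet R1 = c / q" "ldet R2 = c / q"
    unfolding R1_def R2_def ldet_rank_one_update by (simp_all add: inner_commute[of u])
  have R12: "R1 (R2 v) = v - (u \<bullet> v) *\<^sub>R u + (q * (z \<bullet> v)) *\<^sub>R z" for v
  proof -
    have "u \<bullet> R2 v = c * (z \<bullet> v)"
      by (simp add: R2_def inner_add_right inner_diff_left u)
    then have "R1 (R2 v) = R2 v + (c * (z \<bullet> v)) *\<^sub>R (c *\<^sub>R z - u)"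
      by (simp add: R1_def)
    also have "\<dots> = v - (u \<bullet> v) *\<^sub>R u + ((c * c) * (z \<bullet> v)) *\<^sub>R z"
      by (simp add: R2_def inner_diff_left algebra_simps)
    finally show ?thesis by (simp add: c)
  qed
  have "shell_derivative A \<theta> v = A (R1 (R2 (inverse q *\<^sub>R A v)))" for v
  proof -
    have "z \<bullet> A v = \<theta> \<bullet> v" using sym[of z v] z by simp
    then have "A (R1 (R2 (inverse q *\<^sub>R A v))) =
        inverse q *\<^sub>R A (A v) - (inverse q * (u \<bullet> A v)) *\<^sub>R A u + (\<theta> \<bullet> v) *\<^sub>R \<theta>"
      using q0 unfolding R12
      by (simp add: linear_add[OF lin] linear_diff[OF lin] linear_scale[OF lin] z)
    moreover have "(inverse q * (u \<bullet> A v)) *\<^sub>R A u = ((A \<theta> \<bullet> A v) / q ^ 3) *\<^sub>R A (A \<theta>)"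
      by (simp add: u_def linear_scale[OF lin] power3_eq_cube divide_inverse)
    ultimately show ?thesis
      using \<theta> by (simp add: shell_derivative_def q_def algebra_simps)
  qed
  then have "ldet (shell_derivative A \<theta>) = ldet (\<lambda>v. A (R1 (R2 (inverse q *\<^sub>R A v))))"
    by presburger
  also have "\<dots> = ldet A * (ldet R1 * (ldet R2 * (ldet (\<lambda>v::real^'n. inverse q *\<^sub>R v) * ldet A)))"
  proof -
    have l: "linear (\<lambda>v::real^'n. inverse q *\<^sub>R v)" "linear (\<lambda>v. inverse q *\<^sub>R A v)"
      "linear (\<lambda>v. R2 (inverse q *\<^sub>R A v))" "linear (\<lambda>v. R1 (R2 (inverse q *\<^sub>R A v)))"
      using lin linR by (auto simp: linear_iff algebra_simps)
    have "ldet (\<lambda>v. inverse q *\<^sub>R A v) = ldet (\<lambda>v::real^'n. inverse q *\<^sub>R v) * ldet A"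
      by (rule ldet_compose[OF l(1) lin])
    moreover have "ldet (\<lambda>v. R2 (inverse q *\<^sub>R A v)) = ldet R2 * ldet (\<lambda>v. inverse q *\<^sub>R A v)"
      by (rule ldet_compose[OF linR(2) l(2)])
    moreover have "ldet (\<lambda>v. R1 (R2 (inverse q *\<^sub>R A v))) = ldet R1 * ldet (\<lambda>v. R2 (inverse q *\<^sub>R A v))"
      by (rule ldet_compose[OF linR(1) l(3)])
    moreover have "ldet (\<lambda>v. A (R1 (R2 (inverse q *\<^sub>R A v)))) = ldet A * ldet (\<lambda>v. R1 (R2 (inverse q *\<^sub>R A v)))"
      by (rule ldet_compose[OF lin l(4)])
    ultimately show ?thesis by simp
  qed
  also have "\<dots> = (ldet A)\<^sup>2 * (c * c) / q\<^sup>2 * inverse q ^ CARD('n)"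
    by (simp add: d ldet_scaleR power2_eq_square)
  also have "\<dots> = (ldet A)\<^sup>2 / q ^ (CARD('n) + 1)"
    unfolding c(1) using q0 by (simp add: power2_eq_square field_simps)
  finally show ?thesis by (simp add: q_def)
qed

section \<open>Integration over shells and the surface area measure\<close>

lemma lborel_integral_scaleR:
  fixes f :: "'a::euclidean_space \<Rightarrow> 'b::{banach,second_countable_topology}"
  assumes "c > 0" "f \<in> borel_measurable borel"
  shows "integral\<^sup>L lborel f = (c ^ DIM('a)) *\<^sub>R (\<integral>x. f (c *\<^sub>R x) \<partial>lborel)"
proof -
  have "integral\<^sup>L lborel f = integral\<^sup>L (density (distr lborel borel (\<lambda>x. 0 + c *\<^sub>R x)) (\<lambda>_. ennreal (\<bar>c\<bar> ^ DIM('a)))) f"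
    using lborel_affine[of c "0::'a"] assms(1) by simp
  also have "\<dots> = (c ^ DIM('a)) *\<^sub>R (\<integral>x. f (c *\<^sub>R x) \<partial>lborel)"
    using assms by (subst integral_density) (auto simp: integral_distr)
  finally show ?thesis .
qed

lemma measurable_sgn [measurable]: "(sgn :: 'a::euclidean_space \<Rightarrow> 'a) \<in> borel_measurable borel"
  unfolding sgn_div_norm[abs_def] by measurable

lemma integral_cball_radial:
  fixes h :: "'a::euclidean_space \<Rightarrow> real"
  assumes [measurable]: "h \<in> borel_measurable borel" and "\<rho> > 0"
  shows "(LINT y:cball 0 \<rho>|lborel. h (sgn y)) = \<rho> ^ DIM('a) * (LINT y:cball 0 1|lborel. h (sgn y))"
proof -
  have h: "(\<lambda>x. h (sgn x)) \<in> borel_measurable borel"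
    by (rule measurable_compose[OF measurable_sgn assms(1)])
  have "(LINT y:cball 0 \<rho>|lborel. h (sgn y)) =
      \<rho> ^ DIM('a) *\<^sub>R (\<integral>x. indicator (cball 0 \<rho>) (\<rho> *\<^sub>R x) *\<^sub>R h (sgn (\<rho> *\<^sub>R x)) \<partial>lborel)"
    unfolding set_lebesgue_integral_def by (rule lborel_integral_scaleR[OF assms(2)]) (auto intro!: borel_measurable_times borel_measurable_indicator h)
  also have "(\<lambda>x. indicator (cball 0 \<rho>) (\<rho> *\<^sub>R x) *\<^sub>R h (sgn (\<rho> *\<^sub>R x))) =
      (\<lambda>x::'a. indicator (cball 0 1) x *\<^sub>R h (sgn x))"
    using assms(2) by (auto simp: fun_eq_iff indicator_def sgn_scaleR)
  finally show ?thesis by (simp add: set_lebesgue_integral_def)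
qed

lemma sets_sphere_measure [simp, measurable_cong]: "sets (sphere_measure :: 'a::euclidean_space measure) = sets borel"
  by (simp add: sphere_measure_def)

lemma nn_integral_sphere_measure:
  fixes g :: "'a::euclidean_space \<Rightarrow> ennreal"
  assumes [measurable]: "g \<in> borel_measurable borel"
  shows "(\<integral>\<^sup>+x. g x \<partial>sphere_measure) = of_nat DIM('a) * (\<integral>\<^sup>+y. g (sgn y) * indicator (ball 0 1) y \<partial>lborel)"
proof -
  have [measurable]: "sgn \<in> measurable (restrict_space lborel (ball 0 1)) (borel :: 'a measure)"
    by (rule measurable_restrict_space1) simp
  show ?thesis
    unfolding sphere_measure_def
    by (subst nn_integral_scale_measure)
       (auto simp: nn_integral_distr nn_integral_restrict_space)
qed

lemma AE_lborel_norm_neq: "AE y in lborel. norm (y :: 'a::euclidean_space) \<noteq> r"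
proof -
  have "sphere (0::'a) r \<in> null_sets lborel"
    using negligible_sphere[of "0::'a" r] by (simp add: negligible_iff_null_sets null_sets_completion_iff)
  then have "AE y in lborel. y \<notin> sphere (0::'a) r" by (rule AE_not_in)
  then show ?thesis by eventually_elim simp
qed

lemma tendsto_power_diff_quotient:
  "((\<lambda>\<epsilon>::real. ((1 + \<epsilon>) ^ n - 1) / \<epsilon>) \<longlongrightarrow> real n) (at_right 0)"
proof -
  have "((\<lambda>x::real. (1 + x) ^ n) has_field_derivative real n) (at 0)"
    by (auto intro!: derivative_eq_intros)
  then have "((\<lambda>\<epsilon>::real. ((1 + \<epsilon>) ^ n - 1) / \<epsilon>) \<longlongrightarrow> real n) (at 0)"
    by (simp add: has_field_derivative_iff)
  then show ?thesis by (rule filterlim_mono) (auto simp: at_within_le_at)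
qed

text \<open>In normal coordinates the local parallel set is the image of the shell 1 < |y| \<le> 1 +
  \<epsilon> over the directions in E, so its volume is the integral of the Jacobian J there. On the
  unit sphere J equals f, by \<open>ldet_shell_derivative\<close>; on a thin shell J is uniformly
  close to f (y/|y|), and this radially constant function can be integrated exactly. Dividing by
  \<epsilon> yields the limit.\<close>

lemma curvature_function_ellipsoid:
  fixes A :: "real^'n \<Rightarrow> real^'n"
  assumes lin: "linear A" and sym: "\<And>x y. A x \<bullet> y = x \<bullet> A y" and inj: "inj A"
  shows "is_curvature_function (A ` cball 0 1) (\<lambda>x. (ldet A)\<^sup>2 / norm (A x) ^ (CARD('n) + 1))"
proof -
  let ?L = "A ` cball 0 1"
  define f where "f = (\<lambda>x. (ldet A)\<^sup>2 / norm (A x) ^ (CARD('n) + 1))"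
  define J where "J = (\<lambda>y. \<bar>ldet (shell_derivative A y)\<bar>)"
  let ?n = "CARD('n)"
  have nz: "A y \<noteq> 0" if "y \<noteq> 0" for y using that inj lin by (metis linear_injective_0)
  have A0: "A 0 = 0" using lin by (rule linear_0)
  have contA: "continuous_on S A" for S
    using lin by (simp add: linear_continuous_on linear_conv_bounded_linear)
  have [measurable]: "A \<in> borel_measurable borel"
    by (rule borel_measurable_continuous_onI[OF contA])
  have [measurable]: "f \<in> borel_measurable borel" unfolding f_def by measurable
  have f0: "f x \<ge> 0" for x by (simp add: f_def)
  have contJ: "continuous_on (- {0}) J"
    unfolding J_def by (intro continuous_intros continuous_on_ldet continuous_on_shell_derivative lin inj)
  have Jf: "J \<theta> = f \<theta>" if "norm \<theta> = 1" for \<theta>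
    using ldet_shell_derivative[OF lin sym inj that] by (simp add: J_def f_def)
  have "compact (J ` sphere 0 1)"
    by (intro compact_continuous_image continuous_on_subset[OF contJ]) auto
  then obtain C where C: "\<And>x. x \<in> sphere 0 1 \<Longrightarrow> \<bar>J x\<bar> \<le> C"
    using compact_imp_bounded[of "J ` sphere 0 1"] unfolding bounded_iff real_norm_def by blast
  have fC: "f (sgn y) \<le> max C 0" for y
  proof (cases "y = 0")
    case False
    then show ?thesis using C[of "sgn y"] Jf[of "sgn y"] by (simp add: norm_sgn)
  qed (simp add: f_def A0)
  have fin: "(\<integral>\<^sup>+y. ennreal (f (sgn y)) * indicator (ball 0 1) y \<partial>lborel) < \<infinity>"
  proof -
    have "(\<integral>\<^sup>+y. ennreal (f (sgn y)) * indicator (ball 0 1) y \<partial>lborel) \<le>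
        (\<integral>\<^sup>+y. ennreal (max C 0) * indicator (ball (0::real^'n) 1) y \<partial>lborel)"
      by (intro nn_integral_mono mult_right_mono ennreal_leI fC) auto
    also have "\<dots> = ennreal (max C 0) * emeasure lborel (ball (0::real^'n) 1)"
      by (rule nn_integral_cmult_indicator) simp
    also have "\<dots> < \<infinity>"
      using emeasure_lborel_ball_finite[of "0::real^'n" 1] by (auto simp: ennreal_mult_less_top)
    finally show ?thesis .
  qed
  have total: "(\<integral>\<^sup>+x. ennreal (f x) \<partial>sphere_measure) < \<infinity>"
    using fin by (subst nn_integral_sphere_measure) (auto simp: ennreal_mult_less_top of_nat_less_top)
  have int: "integrable sphere_measure f"
    using total f0 by (auto simp: integrable_iff_bounded)
  have emE: "emeasure (density sphere_measure (\<lambda>x. ennreal (f x))) E =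
      of_nat ?n * (\<integral>\<^sup>+y. ennreal (f (sgn y) * indicator E (sgn y)) * indicator (ball 0 1) y \<partial>lborel)"
    if [measurable]: "E \<in> sets borel" for E
    by (subst emeasure_density)
       (auto simp: nn_integral_sphere_measure ennreal_mult' ennreal_indicator f0)
  have fI: "set_integrable lborel S (\<lambda>y. f (sgn y) * indicator E (sgn y))"
    if "E \<in> sets borel" "S \<in> sets borel" "bounded S" for E S
  proof -
    note [measurable] = that(1,2)
    have "set_integrable lborel S (\<lambda>y. max C 0)"
      using that(2,3) emeasure_bounded_finite[OF that(3)] by (simp add: set_integrable_def)
    then show ?thesis
      unfolding set_integrable_def
      by (rule Bochner_Integration.integrable_bound)
         (auto simp: indicator_def f0 intro: order_trans[OF fC])
  qed
  have lim: "((\<lambda>\<epsilon>. measure lebesgue (local_parallel_set ?L \<epsilon> E) / \<epsilon>) \<longlongrightarrow>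
      measure (density sphere_measure (\<lambda>x. ennreal (f x))) E) (at_right 0)"
    if E[measurable]: "E \<in> sets borel" and Es: "E \<subseteq> sphere 0 1" for E
  proof -
    define h where "h = (\<lambda>\<theta>. f \<theta> * indicator E \<theta>)"
    have [measurable]: "h \<in> borel_measurable borel" unfolding h_def by measurable
    define I where "I = (LINT y:cball 0 1|lborel. h (sgn y))"
    define S where "S = (\<lambda>\<epsilon>. {y. 1 < norm y \<and> norm y \<le> 1 + \<epsilon> \<and> sgn y \<in> E})"
    have [measurable]: "S \<epsilon> \<in> sets borel" for \<epsilon> unfolding S_def by measurable
    have bS: "bounded (S \<epsilon>)" for \<epsilon> by (auto simp: S_def intro!: boundedI[of _ "1 + \<epsilon>"])
    \<comment> \<open>The dimension factor comes from the normalisation of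
      \<open>sphere_measure\<close>; it will match the derivative n of (1 + \<epsilon>)^n at
      0.\<close>
    have mE: "measure (density sphere_measure (\<lambda>x. ennreal (f x))) E = real ?n * I"
    proof -
      have "(\<integral>\<^sup>+y. ennreal (f (sgn y) * indicator E (sgn y)) * indicator (ball 0 1) y \<partial>lborel)
          = (\<integral>\<^sup>+y. ennreal (indicator (cball 0 1) y *\<^sub>R h (sgn y)) \<partial>lborel)"
        using AE_lborel_norm_neq[of 1]
        by (intro nn_integral_cong_AE) (auto simp: h_def indicator_def f0)
      also have "\<dots> = ennreal I"
        unfolding I_def set_lebesgue_integral_def
        using fI[OF E, of "cball 0 1"]
        by (intro nn_integral_eq_integral) (auto simp: h_def set_integrable_def f0)
      finally show ?thesis
        unfolding measure_def emE[OF E]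
        by (simp add: I_def h_def set_lebesgue_integral_def f0 integral_nonneg_AE enn2real_mult)
    qed
    have meas: "measure lebesgue (local_parallel_set ?L \<epsilon> E) = (LINT y:S \<epsilon>|lborel. J y)"
      if "0 < \<epsilon>" for \<epsilon>
    proof -
      have eq: "local_parallel_set ?L \<epsilon> E = ellipsoid_shell A ` S \<epsilon>"
        unfolding S_def by (rule local_parallel_set_ellipsoid[OF lin sym inj])
      have [measurable]: "closest_point ?L \<in> borel_measurable borel"
        using convex_compact_ellipsoid[OF lin]
        by (intro borel_measurable_continuous_onI continuous_on_closest_point) auto
      have [measurable]: "(\<lambda>x. infdist x ?L) \<in> borel_measurable borel"
        by (intro borel_measurable_continuous_onI continuous_intros)
      have b: "local_parallel_set ?L \<epsilon> E \<in> sets borel"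
        unfolding local_parallel_set_def by measurable
      have "measure lborel (ellipsoid_shell A ` S \<epsilon>) = (LINT y:S \<epsilon>|lborel. \<bar>ldet (shell_derivative A y)\<bar>)"
      proof (rule measure_differentiable_image_ldet)
        show "ellipsoid_shell A ` S \<epsilon> \<in> sets borel" using b eq by simp
        show "inj_on (ellipsoid_shell A) (S \<epsilon>)"
          by (rule inj_on_subset[OF inj_on_ellipsoid_shell[OF lin sym inj]]) (auto simp: S_def)
        show "(ellipsoid_shell A has_derivative shell_derivative A x) (at x within S \<epsilon>)" if "x \<in> S \<epsilon>" for x
        proof -
          have "x \<noteq> 0" using that by (auto simp: S_def)
          from has_derivative_ellipsoid_shell[OF lin inj this] show ?thesis by (rule has_derivative_at_withinI)
        qed
        have "continuous_on (cball 0 (1+\<epsilon>) - ball 0 1) J"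
          by (rule continuous_on_subset[OF contJ]) auto
        then have "set_integrable lborel (cball 0 (1+\<epsilon>) - ball 0 1) J"
          unfolding set_integrable_def by (intro borel_integrable_compact) (auto simp: compact_diff)
        then show "set_integrable lborel (S \<epsilon>) (\<lambda>x. \<bar>ldet (shell_derivative A x)\<bar>)"
          unfolding J_def by (rule set_integrable_subset) (auto simp: S_def)
      qed simp
      then show ?thesis using b eq by (simp add: J_def measure_completion)
    qed
    have shell: "(LINT y:S \<epsilon>|lborel. f (sgn y)) = ((1 + \<epsilon>) ^ ?n - 1) * I" if "0 < \<epsilon>" for \<epsilon>
    proof -
      have 1: "set_integrable lborel (cball 0 (1+\<epsilon>)) (\<lambda>y. h (sgn y))" "set_integrable lborel (cball 0 1) (\<lambda>y. h (sgn y))"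
        unfolding h_def by (rule fI; simp)+
      have "(LINT y:S \<epsilon>|lborel. f (sgn y)) = (LINT y:cball 0 (1+\<epsilon>)|lborel. h (sgn y)) - (LINT y:cball 0 1|lborel. h (sgn y))"
        unfolding set_lebesgue_integral_def
        apply (subst Bochner_Integration.integral_diff[symmetric])
        subgoal using 1 by (simp add: set_integrable_def)
        subgoal using 1 by (simp add: set_integrable_def)
        by (rule Bochner_Integration.integral_cong) (use that in \<open>auto simp: S_def h_def indicator_def\<close>)
      also have "\<dots> = ((1 + \<epsilon>) ^ ?n - 1) * I"
        using that by (subst integral_cball_radial) (auto simp: I_def algebra_simps)
      finally show ?thesis .
    qed
    have fin_cball: "cball (0::real^'n) r \<in> fmeasurable lborel" for r
      using emeasure_lborel_cball_finite[of "0::real^'n" r] by (intro fmeasurableI) auto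
    have vol: "measure lborel (S \<epsilon>) \<le> ((1 + \<epsilon>) ^ ?n - 1) * measure lborel (cball (0::real^'n) 1)" if "0 < \<epsilon>" for \<epsilon>
    proof -
      have "S \<epsilon> \<subseteq> cball 0 (1+\<epsilon>) - cball 0 1" by (auto simp: S_def)
      then have "measure lborel (S \<epsilon>) \<le> measure lborel (cball (0::real^'n) (1+\<epsilon>) - cball 0 1)"
        by (intro measure_mono_fmeasurable) (auto intro!: fmeasurable.Diff fin_cball)
      also have "\<dots> = measure lborel (cball (0::real^'n) (1+\<epsilon>)) - measure lborel (cball (0::real^'n) 1)"
        using that by (intro measure_Diff) (use emeasure_lborel_cball_finite[of "0::real^'n" "1+\<epsilon>"] in auto)
      also have "\<dots> = ((1 + \<epsilon>) ^ ?n - 1) * measure lborel (cball (0::real^'n) 1)"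
        using that by (simp add: content_cball_conv_ball content_ball_conv_unit_ball[of "1+\<epsilon>"] algebra_simps)
      finally show ?thesis .
    qed
    have "((\<lambda>\<epsilon>. measure lebesgue (local_parallel_set ?L \<epsilon> E) / \<epsilon> - ((1 + \<epsilon>) ^ ?n - 1) / \<epsilon> * I) \<longlongrightarrow> 0) (at_right 0)"
    proof (rule tendstoI)
      fix r :: real assume r: "r > 0"
      define \<omega> where "\<omega> = measure lborel (cball (0::real^'n) 1)"
      have \<omega>: "\<omega> \<ge> 0" by (simp add: \<omega>_def)
      \<comment> \<open>The shell has volume ((1 + \<epsilon>)^n - 1) \<omega>, which is below (n +
        1) \<omega> \<epsilon> for small \<epsilon>. A pointwise error \<delta> of the Jacobian thus
        costs less than \<delta> (n + 1) (\<omega> + 1) = r after division by \<epsilon>.\<close>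
      define \<delta> where "\<delta> = r / ((real ?n + 1) * (\<omega> + 1))"
      have \<delta>: "\<delta> > 0" using r \<omega> by (simp add: \<delta>_def)
      have "uniformly_continuous_on (cball 0 2 - ball 0 1) J"
        by (intro compact_uniformly_continuous continuous_on_subset[OF contJ]) (auto simp: compact_diff)
      then obtain d where d: "d > 0"
        "\<And>x y. x \<in> cball 0 2 - ball 0 1 \<Longrightarrow> y \<in> cball 0 2 - ball 0 1 \<Longrightarrow> dist y x < d \<Longrightarrow> dist (J y) (J x) < \<delta>"
        unfolding uniformly_continuous_on_def using \<delta> by metis
      have "eventually (\<lambda>\<epsilon>::real. 0 < \<epsilon>) (at_right 0)" by (simp add: eventually_at_right_less)
      moreover have "eventually (\<lambda>\<epsilon>::real. \<epsilon> < min 1 d) (at_right 0)"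
        using d(1) by (intro eventually_at_rightI[of 0 "min 1 d"]) auto
      moreover have "eventually (\<lambda>\<epsilon>::real. ((1 + \<epsilon>) ^ ?n - 1) / \<epsilon> < real ?n + 1) (at_right 0)"
        by (rule order_tendstoD(2)[OF tendsto_power_diff_quotient]) simp
      ultimately show "\<forall>\<^sub>F \<epsilon> in at_right 0. dist (measure lebesgue (local_parallel_set ?L \<epsilon> E) / \<epsilon> - ((1 + \<epsilon>) ^ ?n - 1) / \<epsilon> * I) 0 < r"
      proof eventually_elim
        fix \<epsilon> :: real assume \<epsilon>: "0 < \<epsilon>" "\<epsilon> < min 1 d" "((1 + \<epsilon>) ^ ?n - 1) / \<epsilon> < real ?n + 1"
        have dJ: "\<bar>J y - f (sgn y)\<bar> \<le> \<delta>" if "y \<in> S \<epsilon>" for y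
        proof -
          have y: "1 < norm y" "norm y \<le> 1 + \<epsilon>" "y \<noteq> 0" using that by (auto simp: S_def)
          have "y - sgn y = (norm y - 1) *\<^sub>R sgn y"
            by (simp add: norm_sgn_scaleR scaleR_diff_left)
          then have "dist y (sgn y) = norm y - 1"
            using y by (simp add: dist_norm norm_sgn)
          then have "dist (J y) (J (sgn y)) < \<delta>"
            using y \<epsilon> by (intro d(2)) (auto simp: norm_sgn)
          then show ?thesis using Jf[of "sgn y"] y by (simp add: norm_sgn dist_real_def)
        qed
        have iJ: "set_integrable lborel (S \<epsilon>) J"
        proof -
          have "set_integrable lborel (cball 0 (1+\<epsilon>) - ball 0 1) J"
            unfolding set_integrable_def
            by (intro borel_integrable_compact continuous_on_subset[OF contJ]) (auto simp: compact_diff)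
          then show ?thesis by (rule set_integrable_subset) (auto simp: S_def)
        qed
        have if': "set_integrable lborel (S \<epsilon>) (\<lambda>y. f (sgn y))"
          using fI[of UNIV "S \<epsilon>"] bS by simp
        have ic: "set_integrable lborel (S \<epsilon>) (\<lambda>y. \<delta>)"
          using emeasure_bounded_finite[OF bS, of \<epsilon>] by (simp add: set_integrable_def)
        have "\<bar>(LINT y:S \<epsilon>|lborel. J y) - (LINT y:S \<epsilon>|lborel. f (sgn y))\<bar> = \<bar>LINT y:S \<epsilon>|lborel. J y - f (sgn y)\<bar>"
          by (simp add: set_integral_diff iJ if')
        also have "\<dots> \<le> (LINT y:S \<epsilon>|lborel. \<bar>J y - f (sgn y)\<bar>)"
          unfolding set_lebesgue_integral_def
          by (rule order_trans[OF integral_abs_bound]) (simp add: abs_mult)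
        also have "\<dots> \<le> (LINT y:S \<epsilon>|lborel. \<delta>)"
          using dJ by (intro set_integral_mono ic) (auto intro!: set_integrable_abs set_integral_diff iJ if')
        also have "\<dots> = \<delta> * measure lborel (S \<epsilon>)" by (simp add: set_lebesgue_integral_def)
        also have "\<dots> \<le> \<delta> * (((1 + \<epsilon>) ^ ?n - 1) * \<omega>)"
          using vol[OF \<epsilon>(1)] \<delta> by (simp add: \<omega>_def)
        finally have "\<bar>measure lebesgue (local_parallel_set ?L \<epsilon> E) - ((1 + \<epsilon>) ^ ?n - 1) * I\<bar> \<le> \<delta> * (((1 + \<epsilon>) ^ ?n - 1) * \<omega>)"
          by (simp add: meas shell \<epsilon>)
        then have "\<bar>measure lebesgue (local_parallel_set ?L \<epsilon> E) - ((1 + \<epsilon>) ^ ?n - 1) * I\<bar> / \<epsilon> \<le> \<delta> * (((1 + \<epsilon>) ^ ?n - 1) * \<omega>) / \<epsilon>"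
          using \<epsilon>(1) by (simp add: divide_right_mono)
        also have "\<dots> = (\<delta> * \<omega>) * (((1 + \<epsilon>) ^ ?n - 1) / \<epsilon>)" by simp
        also have "\<dots> \<le> (\<delta> * \<omega>) * (real ?n + 1)"
          using \<epsilon>(3) \<delta> \<omega> by (intro mult_left_mono) auto
        also have "\<dots> < \<delta> * (\<omega> + 1) * (real ?n + 1)" using \<delta> by (simp add: algebra_simps add_pos_nonneg)
        also have "\<dots> = r" using \<omega> by (simp add: \<delta>_def field_simps add_nonneg_eq_0_iff)
        finally show "dist (measure lebesgue (local_parallel_set ?L \<epsilon> E) / \<epsilon> - ((1 + \<epsilon>) ^ ?n - 1) / \<epsilon> * I) 0 < r"
          using \<epsilon>(1) by (simp add: dist_real_def diff_divide_distrib[symmetric] abs_divide)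
      qed
    qed
    from tendsto_add[OF this tendsto_mult_right[OF tendsto_power_diff_quotient[of ?n], of I]]
    show ?thesis unfolding mE by simp
  qed
  have "emeasure (density sphere_measure (\<lambda>x. ennreal (f x))) (- sphere 0 1) = 0"
  proof -
    \<comment> \<open>Here \<open>sgn 0 = 0\<close> lies off the sphere, but f vanishes at 0, since
      a quotient with denominator 0 is 0.\<close>
    have z: "f (sgn y) * indicator (- sphere 0 1) (sgn y) = 0" for y
      by (cases "y = 0") (auto simp: f_def A0 norm_sgn)
    show ?thesis by (subst emE) (simp_all only: z ennreal_0 mult_zero_left nn_integral_0_iff, auto)
  qed
  then have "is_surface_area_measure ?L (density sphere_measure (\<lambda>x. ennreal (f x)))"
    using total lim unfolding is_surface_area_measure_def by (simp add: emeasure_density)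
  then show ?thesis
    using int f0 unfolding is_curvature_function_def f_def by auto
qed

section \<open>Gaussian integrals in axial coordinates\<close>

text \<open>Scaling by sqrt (2 c) turns the integral into the characteristic function of the
  standard normal distribution, evaluated at -\<xi> / sqrt (2 c).\<close>

lemma gauss_fourier_real:
  assumes c: "c > (0::real)"
  shows "has_bochner_integral lborel (\<lambda>x. complex_of_real (exp (- (c * x\<^sup>2))) * exp (- (\<i> * of_real (x * \<xi>))))
     (of_real (sqrt (pi / c) * exp (- (\<xi>\<^sup>2 / (4 * c)))))"
proof -
  define k where "k = sqrt (2 * c)"
  have k: "k > 0" "k\<^sup>2 = 2 * c" using c by (auto simp: k_def)
  define t where "t = - \<xi> / k"
  let ?f = "\<lambda>x. std_normal_density x *\<^sub>R iexp (t * x)"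
  have int: "integrable lborel ?f"
  proof (rule Bochner_Integration.integrable_bound)
    show "integrable lborel std_normal_density" by (rule integrable_normal_density) simp
  qed (auto simp: norm_mult)
  have "complex_of_real (exp (- (t\<^sup>2) / 2)) = char std_normal_distribution t"
    by (simp add: char_std_normal_distribution)
  also have "\<dots> = integral\<^sup>L lborel ?f"
    unfolding char_def by (subst integral_density) (auto simp: normal_density_nonneg)
  finally have "has_bochner_integral lborel ?f (complex_of_real (exp (- (t\<^sup>2) / 2)))"
    using int by (simp add: has_bochner_integral_iff)
  then have "has_bochner_integral lborel (\<lambda>x. ?f (0 + k * x)) (complex_of_real (exp (- (t\<^sup>2) / 2)) /\<^sub>R \<bar>k\<bar>)"
    using k by (subst (asm) lborel_has_bochner_integral_real_affine_iff[of k _ _ 0]) auto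
  then have "has_bochner_integral lborel (\<lambda>x. complex_of_real (sqrt (2 * pi)) * ?f (0 + k * x))
      (complex_of_real (sqrt (2 * pi)) * (complex_of_real (exp (- (t\<^sup>2) / 2)) /\<^sub>R \<bar>k\<bar>))"
    by (rule has_bochner_integral_mult_right)
  moreover have "complex_of_real (sqrt (2 * pi)) * ?f (0 + k * x) =
      complex_of_real (exp (- (c * x\<^sup>2))) * exp (- (\<i> * of_real (x * \<xi>)))" for x
    using k by (simp add: std_normal_density_def t_def power_mult_distrib scaleR_conv_of_real mult_ac)
  moreover have "complex_of_real (sqrt (2 * pi)) * (complex_of_real (exp (- (t\<^sup>2) / 2)) /\<^sub>R \<bar>k\<bar>) =
      of_real (sqrt (pi / c) * exp (- (\<xi>\<^sup>2 / (4 * c))))"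
  proof -
    have "sqrt (2 * pi) / k = sqrt (pi / c)" using c by (simp add: k_def real_sqrt_divide[symmetric])
    moreover have "t\<^sup>2 / 2 = \<xi>\<^sup>2 / (4 * c)" using k by (simp add: t_def power_divide)
    moreover have "complex_of_real (sqrt (2 * pi)) * (complex_of_real (exp (- (t\<^sup>2) / 2)) /\<^sub>R \<bar>k\<bar>) =
        of_real (sqrt (2 * pi) / k * exp (- (t\<^sup>2 / 2)))"
    proof -
      have a: "\<bar>k\<bar> = k" "- (t\<^sup>2) / 2 = - (t\<^sup>2 / 2)" using k(1) by auto
      show ?thesis unfolding a scaleR_conv_of_real divide_inverse of_real_mult of_real_inverse
        by (simp only: mult_ac mult_minus_right)
    qed
    ultimately show ?thesis by (simp only:)
  qed
  ultimately show ?thesis by (simp only:)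
qed

lemma has_bochner_integral_lborel_prod:
  fixes f :: "'a::euclidean_space \<Rightarrow> real \<Rightarrow> complex"
  assumes f: "\<And>b. b \<in> Basis \<Longrightarrow> has_bochner_integral lborel (f b) (I b)"
  shows "has_bochner_integral lborel (\<lambda>x::'a. \<Prod>b\<in>Basis. f b (x \<bullet> b)) (\<Prod>b\<in>Basis. I b)"
proof -
  interpret product_sigma_finite "\<lambda>_::'a. lborel :: real measure" by standard
  have int: "\<And>b. b \<in> Basis \<Longrightarrow> integrable lborel (f b)" and val: "\<And>b. b \<in> Basis \<Longrightarrow> integral\<^sup>L lborel (f b) = I b"
    using f by (auto simp: has_bochner_integral_iff)
  have [measurable]: "f b \<in> borel_measurable borel" if "b \<in> Basis" for b
    using int[OF that] by (auto dest: borel_measurable_integrable)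
  have [measurable]: "(\<lambda>x::'a. \<Prod>b\<in>Basis. f b (x \<bullet> b)) \<in> borel_measurable borel" by measurable
  have eq: "(\<Prod>b\<in>Basis. f b ((\<Sum>b\<in>Basis. y b *\<^sub>R b) \<bullet> b)) = (\<Prod>b\<in>Basis. f b (y b))" for y :: "'a \<Rightarrow> real"
    by (intro prod.cong) (auto simp: inner_sum_left_Basis)
  have 1: "integrable (\<Pi>\<^sub>M b\<in>Basis. lborel) (\<lambda>y. \<Prod>b\<in>Basis. f b (y b))"
    by (rule product_integrable_prod) (auto intro: int)
  have 2: "(\<integral>y. (\<Prod>b\<in>Basis. f b (y b)) \<partial>(\<Pi>\<^sub>M b\<in>Basis. lborel)) = (\<Prod>b\<in>Basis. I b)"
    by (subst product_integral_prod) (auto intro: int simp: val)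
  show ?thesis
    unfolding has_bochner_integral_iff lborel_eq[where 'a='a]
    by (simp add: integrable_distr_eq integral_distr eq 1 2)
qed

text \<open>The squared length |y|^2 of the component of x orthogonal to the axis \<open>e\<close>,
  for a unit vector \<open>e\<close>. Writing it as a quadratic form keeps all integrals on the full
  space, without a splitting into axis and hyperplane.\<close>

definition perp2 :: "'a::euclidean_space \<Rightarrow> 'a \<Rightarrow> real" where
  "perp2 e x = (norm x)\<^sup>2 - (x \<bullet> e)\<^sup>2"

lemma measurable_perp2 [measurable]: "perp2 e \<in> borel_measurable borel"
  unfolding perp2_def[abs_def] by measurable

lemma perp2_eq:
  assumes "e \<in> Basis"
  shows "perp2 e x = (\<Sum>b\<in>Basis - {e}. (x \<bullet> b)\<^sup>2)"
  unfolding perp2_def power2_norm_eq_inner euclidean_inner[of x x]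
  using assms by (subst sum.remove[of _ e]) (auto simp: power2_eq_square)

lemma perp2_nonneg: "e \<in> Basis \<Longrightarrow> 0 \<le> perp2 e x"
  by (simp add: perp2_eq sum_nonneg)

lemma perp2_add_axis:
  assumes "e \<in> Basis"
  shows "perp2 e (x + r *\<^sub>R e) = perp2 e x"
  using assms unfolding perp2_eq[OF assms]
  by (intro sum.cong) (auto simp: inner_add_left inner_not_same_Basis)

lemma gauss_fourier:
  fixes e :: "'a::euclidean_space"
  assumes e: "e \<in> Basis" and c: "c > 0" and d: "d > 0"
  shows "has_bochner_integral lborel
     (\<lambda>x. complex_of_real (exp (- (c * (x \<bullet> e)\<^sup>2 + d * perp2 e x))) * exp (- (\<i> * of_real (x \<bullet> \<xi>))))
     (of_real (sqrt (pi / c) * sqrt (pi / d) ^ (DIM('a) - 1) *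
        exp (- ((\<xi> \<bullet> e)\<^sup>2 / (4 * c) + perp2 e \<xi> / (4 * d)))))"
proof -
  define w where "w = (\<lambda>b. if b = e then c else d)"
  have w: "w b > 0" for b using c d by (simp add: w_def)
  have "has_bochner_integral lborel
     (\<lambda>x::'a. \<Prod>b\<in>Basis. complex_of_real (exp (- (w b * (x \<bullet> b)\<^sup>2))) * exp (- (\<i> * of_real ((x \<bullet> b) * (\<xi> \<bullet> b)))))
     (\<Prod>b\<in>Basis. of_real (sqrt (pi / w b) * exp (- ((\<xi> \<bullet> b)\<^sup>2 / (4 * w b)))))"
    by (rule has_bochner_integral_lborel_prod) (rule gauss_fourier_real[OF w])
  moreover have "(\<Prod>b\<in>Basis. complex_of_real (exp (- (w b * (x \<bullet> b)\<^sup>2))) * exp (- (\<i> * of_real ((x \<bullet> b) * (\<xi> \<bullet> b))))) =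
      complex_of_real (exp (- (c * (x \<bullet> e)\<^sup>2 + d * perp2 e x))) * exp (- (\<i> * of_real (x \<bullet> \<xi>)))" for x
  proof -
    have "(\<Sum>b\<in>Basis. w b * (x \<bullet> b)\<^sup>2) = c * (x \<bullet> e)\<^sup>2 + d * perp2 e x"
      using e by (subst sum.remove[of _ e]) (auto simp: w_def perp2_eq sum_distrib_left)
    then have 1: "(\<Prod>b\<in>Basis. complex_of_real (exp (- (w b * (x \<bullet> b)\<^sup>2)))) = complex_of_real (exp (- (c * (x \<bullet> e)\<^sup>2 + d * perp2 e x)))"
      by (simp only: of_real_prod[symmetric] exp_sum[OF finite_Basis, symmetric] sum_negf)
    have 2: "(\<Prod>b\<in>Basis. exp (- (\<i> * of_real ((x \<bullet> b) * (\<xi> \<bullet> b))))) = exp (- (\<i> * of_real (x \<bullet> \<xi>)))"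
      unfolding exp_sum[OF finite_Basis, symmetric] euclidean_inner[of x \<xi>]
      by (simp add: sum_negf sum_distrib_left)
    show ?thesis by (simp only: prod.distrib 1 2)
  qed
  moreover have "(\<Prod>b\<in>Basis. sqrt (pi / w b) * exp (- ((\<xi> \<bullet> b)\<^sup>2 / (4 * w b)))) =
      sqrt (pi / c) * sqrt (pi / d) ^ (DIM('a) - 1) * exp (- ((\<xi> \<bullet> e)\<^sup>2 / (4 * c) + perp2 e \<xi> / (4 * d)))"
  proof -
    have "(\<Sum>b\<in>Basis. (\<xi> \<bullet> b)\<^sup>2 / (4 * w b)) = (\<xi> \<bullet> e)\<^sup>2 / (4 * c) + perp2 e \<xi> / (4 * d)"
      using e by (subst sum.remove[of _ e]) (auto simp: w_def perp2_eq sum_divide_distrib)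
    then have 1: "(\<Prod>b\<in>Basis. exp (- ((\<xi> \<bullet> b)\<^sup>2 / (4 * w b)))) = exp (- ((\<xi> \<bullet> e)\<^sup>2 / (4 * c) + perp2 e \<xi> / (4 * d)))"
      by (simp only: exp_sum[OF finite_Basis, symmetric] sum_negf)
    have 2: "(\<Prod>b\<in>Basis. sqrt (pi / w b)) = sqrt (pi / c) * sqrt (pi / d) ^ (DIM('a) - 1)"
      using e by (subst prod.remove[of _ e]) (auto simp: w_def card_Diff_singleton)
    show ?thesis by (simp only: prod.distrib 1 2)
  qed
  ultimately show ?thesis by (simp only: of_real_prod[symmetric])
qed

lemma AE_perp2_pos:
  fixes e :: "'a::euclidean_space"
  assumes e: "e \<in> Basis" and dim: "DIM('a) \<ge> 2"
  shows "AE x in lborel. perp2 e x > 0"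
proof -
  have "Basis - {e} \<noteq> {}"
  proof
    assume "Basis - {e} = {}"
    then have "Basis = {e}" using e by auto
    then have "DIM('a) = card {e}" by (rule arg_cong)
    then show False using dim by simp
  qed
  then obtain b :: 'a where b: "b \<in> Basis" "b \<noteq> e" by auto
  have "{x::'a. x \<bullet> b = 0} \<in> null_sets lborel"
    using negligible_standard_hyperplane[OF b(1), of 0]
    by (simp add: negligible_iff_null_sets null_sets_completion_iff)
  then have "AE x in lborel. x \<notin> {x::'a. x \<bullet> b = 0}" by (rule AE_not_in)
  then show ?thesis
  proof eventually_elim
    case (elim x)
    then have "0 < (x \<bullet> b)\<^sup>2" by simp
    also have "\<dots> \<le> perp2 e x"
      unfolding perp2_eq[OF e] using b by (intro member_le_sum) auto
    finally show ?case .
  qed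
qed

text \<open>Integration over one coordinate without splitting the space: the coordinate that has been
  integrated out is replaced by a dummy variable with a Gaussian weight of total mass 1.\<close>

lemma nn_integral_axis:
  fixes e :: "'a::euclidean_space" and f :: "'a \<Rightarrow> ennreal"
  assumes [measurable]: "f \<in> borel_measurable borel" and e: "e \<in> Basis"
  shows "(\<integral>\<^sup>+x. f x \<partial>lborel) =
    (\<integral>\<^sup>+x. ennreal (exp (- (x \<bullet> e)\<^sup>2) / sqrt pi) * (\<integral>\<^sup>+r. f (x + (r - x \<bullet> e) *\<^sub>R e) \<partial>lborel) \<partial>lborel)"
proof -
  define g where "g = (\<lambda>u::real. exp (- u\<^sup>2) / sqrt pi)"
  have [measurable]: "g \<in> borel_measurable borel" unfolding g_def by measurable
  have ee: "e \<bullet> e = 1" using e by simp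
  have g1: "(\<integral>\<^sup>+r. ennreal (g (a - r)) \<partial>lborel) = 1" for a
  proof -
    have "has_bochner_integral lborel (\<lambda>x. complex_of_real (exp (- x\<^sup>2))) (of_real (sqrt pi))"
      using gauss_fourier_real[of 1 0] by simp
    from has_bochner_integral_Re[OF this]
    have "has_bochner_integral lborel (\<lambda>x. exp (- x\<^sup>2)) (sqrt pi)" by simp
    from has_bochner_integral_divide_zero[OF this, of "sqrt pi"]
    have "has_bochner_integral lborel g 1" by (simp add: g_def)
    then have "(\<integral>\<^sup>+r. ennreal (g r) \<partial>lborel) = 1"
      by (subst nn_integral_eq_integral) (auto simp: has_bochner_integral_iff g_def)
    then show ?thesis
      by (subst (asm) nn_integral_real_affine[of _ "-1" a]) auto
  qed
  have "(\<integral>\<^sup>+x. ennreal (g (x \<bullet> e)) * (\<integral>\<^sup>+r. f (x + (r - x \<bullet> e) *\<^sub>R e) \<partial>lborel) \<partial>lborel)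
      = (\<integral>\<^sup>+x. (\<integral>\<^sup>+r. ennreal (g (x \<bullet> e)) * f (x + r *\<^sub>R e) \<partial>lborel) \<partial>lborel)"
  proof (rule nn_integral_cong)
    fix x :: 'a
    have "(\<integral>\<^sup>+r. f (x + (r - x \<bullet> e) *\<^sub>R e) \<partial>lborel) = (\<integral>\<^sup>+r. f (x + r *\<^sub>R e) \<partial>lborel)"
      by (subst nn_integral_real_affine[of _ 1 "x \<bullet> e"]) auto
    then show "ennreal (g (x \<bullet> e)) * (\<integral>\<^sup>+r. f (x + (r - x \<bullet> e) *\<^sub>R e) \<partial>lborel) =
        (\<integral>\<^sup>+r. ennreal (g (x \<bullet> e)) * f (x + r *\<^sub>R e) \<partial>lborel)"
      by (simp add: nn_integral_cmult)
  qed
  also have "\<dots> = (\<integral>\<^sup>+r. (\<integral>\<^sup>+x. ennreal (g (x \<bullet> e)) * f (x + r *\<^sub>R e) \<partial>lborel) \<partial>lborel)"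
    by (rule lborel_pair.Fubini') simp
  \<comment> \<open>Translation by r e moves the shift from f to the weight, where integrating over
    r gives the factor 1.\<close>
  also have "\<dots> = (\<integral>\<^sup>+r. (\<integral>\<^sup>+x. ennreal (g (x \<bullet> e - r)) * f x \<partial>lborel) \<partial>lborel)"
  proof (rule nn_integral_cong)
    fix r :: real
    have "(\<integral>\<^sup>+x. ennreal (g (x \<bullet> e - r)) * f x \<partial>lborel) =
        (\<integral>\<^sup>+x. ennreal (g (x \<bullet> e - r)) * f x \<partial>distr lborel borel ((+) (r *\<^sub>R e)))"
      by (simp add: lborel_distr_plus)
    also have "\<dots> = (\<integral>\<^sup>+x. ennreal (g (x \<bullet> e)) * f (x + r *\<^sub>R e) \<partial>lborel)"
      by (subst nn_integral_distr) (auto simp: inner_add_left ee add.commute)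
    finally show "(\<integral>\<^sup>+x. ennreal (g (x \<bullet> e)) * f (x + r *\<^sub>R e) \<partial>lborel) = (\<integral>\<^sup>+x. ennreal (g (x \<bullet> e - r)) * f x \<partial>lborel)" ..
  qed
  also have "\<dots> = (\<integral>\<^sup>+x. (\<integral>\<^sup>+r. ennreal (g (x \<bullet> e - r)) * f x \<partial>lborel) \<partial>lborel)"
    by (rule lborel_pair.Fubini'[symmetric]) simp
  also have "\<dots> = (\<integral>\<^sup>+x. f x \<partial>lborel)"
    by (intro nn_integral_cong) (simp add: nn_integral_multc g1)
  finally show ?thesis by (simp add: g_def)
qed

text \<open>The formula for nonnegative functions, applied to indicators, says that Lebesgue measure
  is the image of a weighted product measure under (x, r) \<mapsto> x + (r - x \<bullet> e) e.
  Integrability of f then passes to the product, where Fubini applies.\<close>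

lemma integral_axis:
  fixes e :: "'a::euclidean_space" and f :: "'a \<Rightarrow> complex"
  assumes f: "integrable lborel f" and e: "e \<in> Basis"
  shows "(\<integral>x. f x \<partial>lborel) =
    (\<integral>x. complex_of_real (exp (- (x \<bullet> e)\<^sup>2) / sqrt pi) * (\<integral>r. f (x + (r - x \<bullet> e) *\<^sub>R e) \<partial>lborel) \<partial>lborel)"
proof -
  define G where "G = (\<lambda>(x::'a,r::real). ennreal (exp (- (x \<bullet> e)\<^sup>2) / sqrt pi))"
  have [measurable]: "G \<in> borel_measurable (lborel \<Otimes>\<^sub>M lborel)" unfolding G_def by measurable
  have [measurable]: "f \<in> borel_measurable borel" using f by (auto dest: borel_measurable_integrable)
  define T where "T = (\<lambda>(x::'a,r::real). x + (r - x \<bullet> e) *\<^sub>R e)"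
  have [measurable]: "T \<in> lborel \<Otimes>\<^sub>M lborel \<rightarrow>\<^sub>M borel" unfolding T_def by measurable
  have lb: "lborel = distr (density (lborel \<Otimes>\<^sub>M lborel) G) borel T"
  proof (rule measure_eqI)
    fix A :: "'a set" assume "A \<in> sets lborel"
    then have [measurable]: "A \<in> sets borel" by simp
    have "emeasure lborel A = (\<integral>\<^sup>+x. indicator A x \<partial>lborel)" by simp
    also have "\<dots> = (\<integral>\<^sup>+x. (\<integral>\<^sup>+r. G (x, r) * indicator A (T (x, r)) \<partial>lborel) \<partial>lborel)"
      by (subst nn_integral_axis[OF _ e]) (auto simp: G_def T_def nn_integral_cmult)
    also have "\<dots> = (\<integral>\<^sup>+p. G p * indicator A (T p) \<partial>(lborel \<Otimes>\<^sub>M lborel))"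
      by (subst lborel.nn_integral_fst[symmetric]) auto
    also have "\<dots> = (\<integral>\<^sup>+p. G p * indicator (T -` A \<inter> space (lborel \<Otimes>\<^sub>M lborel)) p \<partial>(lborel \<Otimes>\<^sub>M lborel))"
      by (intro nn_integral_cong) (auto simp: indicator_def)
    also have "\<dots> = emeasure (distr (density (lborel \<Otimes>\<^sub>M lborel) G) borel T) A"
    proof -
      have "T -` A \<inter> space (lborel \<Otimes>\<^sub>M lborel) \<in> sets (lborel \<Otimes>\<^sub>M lborel)"
        by (rule measurable_sets[of T _ borel]) auto
      then show ?thesis by (simp add: emeasure_distr emeasure_density)
    qed
    finally show "emeasure lborel A = emeasure (distr (density (lborel \<Otimes>\<^sub>M lborel) G) borel T) A" .
  qed simp
  let ?h = "\<lambda>p. (exp (- (fst p \<bullet> e)\<^sup>2) / sqrt pi) *\<^sub>R f (T p)"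
  have G': "G = (\<lambda>p. ennreal (exp (- (fst p \<bullet> e)\<^sup>2) / sqrt pi))" by (auto simp: G_def)
  have "integrable (distr (density (lborel \<Otimes>\<^sub>M lborel) G) borel T) f" using f lb by simp
  then have "integrable (density (lborel \<Otimes>\<^sub>M lborel) G) (\<lambda>p. f (T p))"
    by (subst (asm) integrable_distr_eq) auto
  then have int: "integrable (lborel \<Otimes>\<^sub>M lborel) ?h"
    unfolding G' by (subst (asm) integrable_density) auto
  have "integral\<^sup>L lborel f = integral\<^sup>L (distr (density (lborel \<Otimes>\<^sub>M lborel) G) borel T) f" using lb by simp
  also have "\<dots> = (\<integral>p. f (T p) \<partial>density (lborel \<Otimes>\<^sub>M lborel) G)" by (subst integral_distr) auto
  also have "\<dots> = integral\<^sup>L (lborel \<Otimes>\<^sub>M lborel) ?h" unfolding G' by (subst integral_density) auto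
  also have "\<dots> = (\<integral>x. (\<integral>r. ?h (x, r) \<partial>lborel) \<partial>lborel)"
    by (rule lborel_pair.integral_fst'[symmetric]) (rule int)
  finally show ?thesis by (simp add: T_def scaleR_conv_of_real)
qed

section \<open>The axial kernel and its Fourier transform\<close>

definition axial_kernel :: "'a::euclidean_space \<Rightarrow> real \<Rightarrow> real \<Rightarrow> 'a \<Rightarrow> real" where
  "axial_kernel e s t x = exp (- (s * (x \<bullet> e)\<^sup>2 / perp2 e x + t * perp2 e x)) / sqrt (perp2 e x)"

text \<open>Let z = \<xi> \<bullet> e. The integral over the axial variable is a Gaussian integral
  with rate s / |y|^2: it contributes sqrt (\<pi> / s) |y|, which cancels the weight 1/|y|, and
  raises the rate in y from t to t + z^2 / (4 s). The remaining factors are the Gaussian transform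
  in n - 1 variables with this rate.\<close>

definition axial_kernel_fourier :: "'a::euclidean_space \<Rightarrow> real \<Rightarrow> real \<Rightarrow> 'a \<Rightarrow> real" where
  "axial_kernel_fourier e s t \<xi> = sqrt (pi / s) * sqrt (pi / (t + (\<xi> \<bullet> e)\<^sup>2 / (4 * s))) ^ (DIM('a) - 1) *
     exp (- (perp2 e \<xi> / (4 * (t + (\<xi> \<bullet> e)\<^sup>2 / (4 * s)))))"

lemma measurable_axial_kernel [measurable]: "axial_kernel e s t \<in> borel_measurable borel"
  unfolding axial_kernel_def[abs_def] by measurable

lemma axial_kernel_nonneg: "e \<in> Basis \<Longrightarrow> 0 \<le> axial_kernel e s t x"
  by (simp add: axial_kernel_def perp2_nonneg)

lemma axial_kernel_line:
  assumes e: "e \<in> Basis"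
  shows "axial_kernel e s t (x + (r - x \<bullet> e) *\<^sub>R e) =
    exp (- ((s / perp2 e x) * r\<^sup>2)) * (exp (- (t * perp2 e x)) / sqrt (perp2 e x))"
proof -
  have "e \<bullet> e = 1" using e by simp
  then have "(x + (r - x \<bullet> e) *\<^sub>R e) \<bullet> e = r" unfolding inner_add_left inner_scaleR_left by simp
  then show ?thesis
    unfolding axial_kernel_def perp2_add_axis[OF e] by (simp add: exp_add[symmetric])
qed

lemma nn_integral_axial_kernel_line:
  fixes e :: "'a::euclidean_space"
  assumes e: "e \<in> Basis" and s: "s > 0" and P: "perp2 e x > 0"
  shows "(\<integral>\<^sup>+r. ennreal (axial_kernel e s t (x + (r - x \<bullet> e) *\<^sub>R e)) \<partial>lborel) =
    ennreal (sqrt (pi / s) * exp (- (t * perp2 e x)))"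
proof -
  have ee: "e \<bullet> e = 1" using e by simp
  define P where "P = perp2 e x"
  have P0: "P > 0" using P by (simp add: P_def)
  have "has_bochner_integral lborel (\<lambda>x. complex_of_real (exp (- ((s / P) * x\<^sup>2)))) (of_real (sqrt (pi / (s / P))))"
    using gauss_fourier_real[of "s / P" 0] s P0 by simp
  from has_bochner_integral_Re[OF this]
  have "has_bochner_integral lborel (\<lambda>x. exp (- ((s / P) * x\<^sup>2))) (sqrt (pi / (s / P)))" by simp
  from has_bochner_integral_mult_left[OF this, of "exp (- (t * P)) / sqrt P"]
  have "has_bochner_integral lborel (\<lambda>r. exp (- ((s / P) * r\<^sup>2)) * (exp (- (t * P)) / sqrt P)) (sqrt (pi / (s / P)) * (exp (- (t * P)) / sqrt P))"
    by simp
  moreover have "exp (- ((s / P) * r\<^sup>2)) * (exp (- (t * P)) / sqrt P) = axial_kernel e s t (x + (r - x \<bullet> e) *\<^sub>R e)" for r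
    unfolding P_def axial_kernel_line[OF e] ..
  moreover have "sqrt (pi / (s / P)) * (exp (- (t * P)) / sqrt P) = sqrt (pi / s) * exp (- (t * P))"
    using s P0 by (simp add: real_sqrt_divide real_sqrt_mult)
  ultimately have "has_bochner_integral lborel (\<lambda>r. axial_kernel e s t (x + (r - x \<bullet> e) *\<^sub>R e)) (sqrt (pi / s) * exp (- (t * P)))"
    by (simp only:)
  then show ?thesis
    unfolding P_def[symmetric]
    by (subst nn_integral_eq_integral) (simp_all add: has_bochner_integral_iff axial_kernel_nonneg e)
qed

lemma has_bochner_integral_axial_kernel:
  fixes e :: "'a::euclidean_space"
  assumes e: "e \<in> Basis" and dim: "DIM('a) \<ge> 2" and s: "s > 0" and t: "t > 0"
  shows "has_bochner_integral lborel (\<lambda>x. complex_of_real (axial_kernel e s t x) * exp (- (\<i> * of_real (x \<bullet> \<xi>))))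
    (of_real (axial_kernel_fourier e s t \<xi>))"
proof -
  have ee: "e \<bullet> e = 1" using e by simp
  have AEpos: "AE x in lborel. perp2 e x > 0" by (rule AE_perp2_pos[OF e dim])
  have gauss_int: "integrable lborel (\<lambda>x. exp (- (1 * (x \<bullet> e)\<^sup>2 + d * perp2 e x)))" if "d > 0" for d
    using gauss_fourier[OF e, of 1 d 0] that by (auto simp: has_bochner_integral_iff dest!: integrable_Re)
  have "(\<integral>\<^sup>+x. ennreal (axial_kernel e s t x) \<partial>lborel) =
      (\<integral>\<^sup>+x. ennreal (exp (- (x \<bullet> e)\<^sup>2) / sqrt pi) * ennreal (sqrt (pi / s) * exp (- (t * perp2 e x))) \<partial>lborel)"
    using AEpos
    by (subst nn_integral_axis[OF _ e], simp, intro nn_integral_cong_AE)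
       (auto simp: nn_integral_axial_kernel_line[OF e s])
  also have "\<dots> = (\<integral>\<^sup>+x. ennreal ((sqrt (pi / s) / sqrt pi) * exp (- (1 * (x \<bullet> e)\<^sup>2 + t * perp2 e x))) \<partial>lborel)"
    using s by (intro nn_integral_cong) (simp add: ennreal_mult[symmetric] exp_add exp_diff exp_minus field_simps)
  also have "\<dots> < \<infinity>"
    using integrable_mult_right[OF gauss_int[OF t], of "sqrt (pi / s) / sqrt pi"] s
    by (subst nn_integral_eq_integral) auto
  finally have intU: "integrable lborel (axial_kernel e s t)"
    by (auto simp: integrable_iff_bounded axial_kernel_nonneg e)
  define f where "f = (\<lambda>x. complex_of_real (axial_kernel e s t x) * exp (- (\<i> * of_real (x \<bullet> \<xi>))))"
  have intf: "integrable lborel f"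
    by (rule Bochner_Integration.integrable_bound[OF intU]) (auto simp: f_def norm_mult)
  define z where "z = \<xi> \<bullet> e"
  define \<kappa> where "\<kappa> = t + z\<^sup>2 / (4 * s)"
  have \<kappa>: "\<kappa> > 0" using t s by (simp add: \<kappa>_def add_pos_nonneg)
  \<comment> \<open>After the axial integration the phase must not involve the dummy coordinate that
    replaces it, so only the component of \<xi> orthogonal to the axis is left in it.\<close>
  define \<eta> where "\<eta> = \<xi> - z *\<^sub>R e"
  have \<eta>e: "\<eta> \<bullet> e = 0" by (simp add: \<eta>_def z_def inner_diff_left ee)
  have \<eta>p: "perp2 e \<eta> = perp2 e \<xi>" using perp2_add_axis[OF e, of \<xi> "- z"] by (simp add: \<eta>_def)
  have inner: "(\<integral>r. f (x + (r - x \<bullet> e) *\<^sub>R e) \<partial>lborel) =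
      of_real (sqrt (pi / s) * exp (- (\<kappa> * perp2 e x))) * exp (- (\<i> * of_real (x \<bullet> \<eta>)))"
    if "perp2 e x > 0" for x
  proof -
    define P where "P = perp2 e x"
    have P0: "P > 0" using that by (simp add: P_def)
    have f_eq: "f (x + (r - x \<bullet> e) *\<^sub>R e) = (complex_of_real (exp (- ((s / P) * r\<^sup>2))) * exp (- (\<i> * of_real (r * z)))) *
        (of_real (exp (- (t * P)) / sqrt P) * exp (- (\<i> * of_real (x \<bullet> \<eta>))))" for r
    proof -
      have "(x + (r - x \<bullet> e) *\<^sub>R e) \<bullet> \<xi> = r * z + x \<bullet> \<eta>"
        by (simp add: \<eta>_def z_def inner_simps inner_commute algebra_simps)
      then have "exp (- (\<i> * of_real ((x + (r - x \<bullet> e) *\<^sub>R e) \<bullet> \<xi>))) = exp (- (\<i> * of_real (r * z))) * exp (- (\<i> * of_real (x \<bullet> \<eta>)))"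
        by (simp add: exp_add[symmetric] algebra_simps)
      moreover have "axial_kernel e s t (x + (r - x \<bullet> e) *\<^sub>R e) = exp (- ((s / P) * r\<^sup>2)) * (exp (- (t * P)) / sqrt P)"
        unfolding P_def axial_kernel_line[OF e] ..
      ultimately show ?thesis unfolding f_def by simp
    qed
    have "(\<integral>r. f (x + (r - x \<bullet> e) *\<^sub>R e) \<partial>lborel) =
       of_real (sqrt (pi / (s / P)) * exp (- (z\<^sup>2 / (4 * (s / P))))) * (of_real (exp (- (t * P)) / sqrt P) * exp (- (\<i> * of_real (x \<bullet> \<eta>))))"
      unfolding f_eq using gauss_fourier_real[of "s / P" z] s P0 by (simp add: has_bochner_integral_iff)
    also have "\<dots> = of_real ((sqrt (pi / (s / P)) * exp (- (z\<^sup>2 / (4 * (s / P))))) * (exp (- (t * P)) / sqrt P)) * exp (- (\<i> * of_real (x \<bullet> \<eta>)))"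
      by (simp only: of_real_mult mult.assoc)
    also have "(sqrt (pi / (s / P)) * exp (- (z\<^sup>2 / (4 * (s / P))))) * (exp (- (t * P)) / sqrt P) = sqrt (pi / s) * exp (- (\<kappa> * P))"
    proof -
      have "exp (- (z\<^sup>2 / (4 * (s / P)))) * exp (- (t * P)) = exp (- (\<kappa> * P))"
        by (simp add: exp_add[symmetric] \<kappa>_def algebra_simps)
      moreover have "sqrt (pi / (s / P)) / sqrt P = sqrt (pi / s)"
        using s P0 by (simp add: real_sqrt_divide real_sqrt_mult)
      ultimately show ?thesis by (metis (no_types, opaque_lifting) mult.assoc mult.commute times_divide_eq_right)
    qed
    finally show ?thesis by (simp add: P_def)
  qed
  have "integral\<^sup>L lborel f = (\<integral>x. complex_of_real (exp (- (x \<bullet> e)\<^sup>2) / sqrt pi) * (\<integral>r. f (x + (r - x \<bullet> e) *\<^sub>R e) \<partial>lborel) \<partial>lborel)"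
    by (rule integral_axis[OF intf e])
  also have "\<dots> = (\<integral>x. of_real (sqrt (pi / s) / sqrt pi) * (complex_of_real (exp (- (1 * (x \<bullet> e)\<^sup>2 + \<kappa> * perp2 e x))) * exp (- (\<i> * of_real (x \<bullet> \<eta>)))) \<partial>lborel)"
  proof (rule integral_cong_AE)
    have [measurable]: "f \<in> borel_measurable borel" unfolding f_def by measurable
    show "(\<lambda>x. complex_of_real (exp (- (x \<bullet> e)\<^sup>2) / sqrt pi) * (\<integral>r. f (x + (r - x \<bullet> e) *\<^sub>R e) \<partial>lborel)) \<in> borel_measurable lborel"
      by measurable
    show "AE x in lborel. complex_of_real (exp (- (x \<bullet> e)\<^sup>2) / sqrt pi) * (\<integral>r. f (x + (r - x \<bullet> e) *\<^sub>R e) \<partial>lborel) =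
        of_real (sqrt (pi / s) / sqrt pi) * (complex_of_real (exp (- (1 * (x \<bullet> e)\<^sup>2 + \<kappa> * perp2 e x))) * exp (- (\<i> * of_real (x \<bullet> \<eta>))))"
      using AEpos
    proof eventually_elim
      case (elim x)
      have "exp (- (1 * (x \<bullet> e)\<^sup>2 + \<kappa> * perp2 e x)) = exp (- (x \<bullet> e)\<^sup>2) * exp (- (\<kappa> * perp2 e x))"
        by (simp add: exp_add[symmetric])
      then show ?case unfolding inner[OF elim] by (simp add: mult_ac)
    qed
  qed measurable
  also have "\<dots> = of_real (sqrt (pi / s) / sqrt pi) * of_real (sqrt (pi / 1) * sqrt (pi / \<kappa>) ^ (DIM('a) - 1) *
        exp (- ((\<eta> \<bullet> e)\<^sup>2 / (4 * 1) + perp2 e \<eta> / (4 * \<kappa>))))"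
    using gauss_fourier[OF e _ \<kappa>, of 1 \<eta>] by (simp add: has_bochner_integral_iff)
  also have "\<dots> = of_real (axial_kernel_fourier e s t \<xi>)"
    unfolding axial_kernel_fourier_def \<eta>e \<eta>p z_def[symmetric] \<kappa>_def[symmetric]
    by (simp add: mult.assoc)
  finally show ?thesis using intf by (simp add: has_bochner_integral_iff f_def)
qed

section \<open>Fourier transforms of test functions\<close>

text \<open>Compact support is recorded as vanishing outside a ball, a form that partial derivatives
  inherit at once and that the integrals along lines use directly.\<close>

definition smooth_compact :: "('a::euclidean_space \<Rightarrow> complex) \<Rightarrow> bool" where
  "smooth_compact \<psi> \<longleftrightarrow> (\<forall>k. continuously_differentiable k \<psi>) \<and> (\<exists>R>0. \<forall>x. norm x > R \<longrightarrow> \<psi> x = 0)"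

lemma smooth_compactD:
  assumes "smooth_compact \<psi>"
  shows "continuous_on UNIV \<psi>" "\<psi> differentiable at x"
proof -
  have "continuously_differentiable 0 \<psi>" "continuously_differentiable (Suc 0) \<psi>"
    using assms by (auto simp: smooth_compact_def simp del: continuously_differentiable.simps)
  then show "continuous_on UNIV \<psi>" "\<psi> differentiable at x" by simp_all
qed

lemma smooth_compact_integrable:
  assumes "smooth_compact \<psi>"
  shows "integrable lborel \<psi>"
proof -
  obtain R where R: "\<And>x. norm x > R \<Longrightarrow> \<psi> x = 0" using assms by (auto simp: smooth_compact_def)
  have "integrable lborel (\<lambda>x. indicator (cball 0 R) x *\<^sub>R \<psi> x)"
    using smooth_compactD(1)[OF assms] by (intro borel_integrable_compact) (auto intro: continuous_on_subset)
  also have "(\<lambda>x. indicator (cball 0 R) x *\<^sub>R \<psi> x) = \<psi>"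
    using R by (force simp: indicator_def fun_eq_iff)
  finally show ?thesis .
qed

lemma smooth_compact_partial:
  assumes "smooth_compact \<psi>" "b \<in> Basis"
  shows "smooth_compact (\<lambda>x. frechet_derivative \<psi> (at x) b)"
proof -
  have cd: "continuously_differentiable (Suc k) \<psi>" for k using assms(1) unfolding smooth_compact_def by blast
  obtain R where R: "R > 0" "\<And>x. norm x > R \<Longrightarrow> \<psi> x = 0" using assms by (auto simp: smooth_compact_def)
  have "frechet_derivative \<psi> (at x) b = 0" if "norm x > R" for x
  proof -
    have "open {y::'a. norm y > R}" by (intro open_Collect_less continuous_intros)
    then have "((\<psi>) has_derivative (\<lambda>_. 0)) (at x)"
      using that R by (intro has_derivative_transform_within_open[of "\<lambda>_. 0" "\<lambda>_. 0" x UNIV "{y. norm y > R}" \<psi>]) auto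
    then have "frechet_derivative \<psi> (at x) = (\<lambda>_. 0)" by (metis frechet_derivative_at)
    then show ?thesis by simp
  qed
  then show ?thesis
    unfolding smooth_compact_def using cd assms(2) R(1) by (auto intro!: exI[of _ R])
qed

text \<open>On each line parallel to b the integral of the derivative is a difference of two values
  of h outside the ball, hence 0. \<open>integral_axis\<close> reduces the full integral to such
  lines.\<close>

lemma integral_partial_zero:
  fixes h :: "'a::euclidean_space \<Rightarrow> complex"
  assumes b: "b \<in> Basis"
    and h: "\<And>x. (h has_derivative h' x) (at x)" and cont: "continuous_on UNIV (\<lambda>x. h' x b)"
    and int: "integrable lborel (\<lambda>x. h' x b)"
    and R: "\<And>x. norm x > R \<Longrightarrow> h x = 0" "\<And>x. norm x > R \<Longrightarrow> h' x b = 0"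
  shows "(\<integral>x. h' x b \<partial>lborel) = 0"
proof -
  have bb: "b \<bullet> b = 1" using b by simp
  have "(\<integral>r. h' (x + (r - x \<bullet> b) *\<^sub>R b) b \<partial>lborel) = 0" for x
  proof -
    define p where "p = (\<lambda>r. x + (r - x \<bullet> b) *\<^sub>R b)"
    define M where "M = \<bar>R\<bar> + 1"
    have big: "norm (p r) > R" if "\<bar>r\<bar> \<ge> M" for r
    proof -
      have "p r \<bullet> b = r" unfolding p_def inner_add_left inner_scaleR_left bb by simp
      then have "\<bar>r\<bar> \<le> norm (p r)" using Basis_le_norm[OF b, of "p r"] by simp
      then show ?thesis using that by (simp add: M_def)
    qed
    have der: "((\<lambda>r. h (p r)) has_vector_derivative h' (p r) b) (at r within {-M..M})" for r
    proof -
      have "(p has_derivative (\<lambda>r. r *\<^sub>R b)) (at r within {-M..M})"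
        unfolding p_def by (auto intro!: derivative_eq_intros)
      from has_derivative_compose[OF this h]
      have "((\<lambda>r. h (p r)) has_derivative (\<lambda>t. h' (p r) (t *\<^sub>R b))) (at r within {-M..M})" .
      then show ?thesis
        unfolding has_vector_derivative_def
        using linear_scale[OF has_derivative_linear[OF h]] by simp
    qed
    have contp: "continuous_on S (\<lambda>r. h' (p r) b)" for S
      by (rule continuous_on_compose2[OF cont]) (auto simp: p_def intro!: continuous_intros)
    have "(\<integral>r. h' (p r) b \<partial>lborel) = (\<integral>r. indicator {-M..M} r *\<^sub>R h' (p r) b \<partial>lborel)"
    proof (intro Bochner_Integration.integral_cong refl)
      fix r :: real
      show "h' (p r) b = indicator {-M..M} r *\<^sub>R h' (p r) b"
        using R(2)[OF big[of r]] by (auto simp: indicator_def)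
    qed
    also have "\<dots> = h (p M) - h (p (- M))"
      by (rule integral_FTC_atLeastAtMost) (rule der contp | simp add: M_def)+
    also have "\<dots> = 0" using R(1)[OF big[of M]] R(1)[OF big[of "-M"]] by (simp add: M_def)
    finally show ?thesis by (simp add: p_def)
  qed
  then show ?thesis by (subst integral_axis[OF int b]) simp
qed

lemma integrable_times_exp_minus_i:
  fixes \<psi> :: "'a::euclidean_space \<Rightarrow> complex"
  assumes "integrable lborel \<psi>"
  shows "integrable lborel (\<lambda>x. \<psi> x * exp (- (\<i> * of_real (x \<bullet> \<xi>))))"
proof (rule Bochner_Integration.integrable_bound[OF assms])
  have [measurable]: "\<psi> \<in> borel_measurable borel" using assms by (auto dest: borel_measurable_integrable)
  show "(\<lambda>x. \<psi> x * exp (- (\<i> * of_real (x \<bullet> \<xi>)))) \<in> borel_measurable lborel" by measurable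
qed (simp add: norm_mult)

text \<open>Integration by parts: the derivative of \<psi> times the exponential has integral 0, and
  the product rule separates the two terms.\<close>

lemma fourier_partial:
  fixes \<psi> :: "'a::euclidean_space \<Rightarrow> complex"
  assumes \<psi>: "smooth_compact \<psi>" and b: "b \<in> Basis"
  shows "fourier (\<lambda>x. frechet_derivative \<psi> (at x) b) \<xi> = \<i> * of_real (\<xi> \<bullet> b) * fourier \<psi> \<xi>"
proof -
  define E where "E = (\<lambda>x. exp (- (\<i> * complex_of_real (x \<bullet> \<xi>))))"
  define h where "h = (\<lambda>x. \<psi> x * E x)"
  define h' where "h' = (\<lambda>x v. frechet_derivative \<psi> (at x) v * E x - \<psi> x * (\<i> * of_real (v \<bullet> \<xi>) * E x))"
  have \<psi>': "smooth_compact (\<lambda>x. frechet_derivative \<psi> (at x) b)" by (rule smooth_compact_partial[OF \<psi> b])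
  have der\<psi>: "(\<psi> has_derivative frechet_derivative \<psi> (at x)) (at x)" for x
    using smooth_compactD(2)[OF \<psi>, of x] by (simp add: frechet_derivative_works)
  have derE: "(E has_derivative (\<lambda>v. - (\<i> * of_real (v \<bullet> \<xi>)) * E x)) (at x)" for x
  proof -
    have "((\<lambda>x. - (\<i> * complex_of_real (x \<bullet> \<xi>))) has_derivative (\<lambda>v. - (\<i> * of_real (v \<bullet> \<xi>)))) (at x)"
      by (intro linear_imp_has_derivative) (auto simp: linear_iff inner_simps algebra_simps scaleR_conv_of_real)
    from has_derivative_compose[OF this DERIV_exp[unfolded has_field_derivative_def]]
    show ?thesis
      unfolding E_def by (rule has_derivative_eq_rhs) (simp add: fun_eq_iff mult.commute)
  qed
  have h: "(h has_derivative h' x) (at x)" for x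
    using has_derivative_mult[OF der\<psi> derE] unfolding h_def
    by (rule has_derivative_eq_rhs) (auto simp: h'_def fun_eq_iff)
  obtain R1 R2 where R1: "\<And>x. norm x > R1 \<Longrightarrow> \<psi> x = 0" and R2: "\<And>x. norm x > R2 \<Longrightarrow> frechet_derivative \<psi> (at x) b = 0"
    using \<psi> \<psi>' by (auto simp: smooth_compact_def)
  have i1: "integrable lborel (\<lambda>x. frechet_derivative \<psi> (at x) b * E x)"
    unfolding E_def by (intro integrable_times_exp_minus_i smooth_compact_integrable \<psi>')
  have i2: "integrable lborel (\<lambda>x. \<psi> x * E x)"
    unfolding E_def by (intro integrable_times_exp_minus_i smooth_compact_integrable \<psi>)
  have h'b: "h' x b = frechet_derivative \<psi> (at x) b * E x - \<i> * of_real (\<xi> \<bullet> b) * (\<psi> x * E x)" for x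
    by (simp add: h'_def inner_commute mult_ac)
  have int: "integrable lborel (\<lambda>x. h' x b)"
    unfolding h'b by (intro Bochner_Integration.integrable_diff i1 integrable_mult_right i2)
  have "(\<integral>x. h' x b \<partial>lborel) = 0"
  proof (rule integral_partial_zero[OF b h _ int, of "max R1 R2"])
    show "continuous_on UNIV (\<lambda>x. h' x b)"
      unfolding h'_def E_def
      by (intro continuous_intros smooth_compactD(1)[OF \<psi>] smooth_compactD(1)[OF \<psi>'])
  qed (auto simp: h_def h'_def R1 R2)
  then have "(\<integral>x. frechet_derivative \<psi> (at x) b * E x \<partial>lborel) - \<i> * of_real (\<xi> \<bullet> b) * (\<integral>x. \<psi> x * E x \<partial>lborel) = 0"
    unfolding h'b using i1 i2 by (subst (asm) Bochner_Integration.integral_diff) auto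
  then show ?thesis by (simp add: fourier_def E_def)
qed

lemma norm_fourier_le:
  fixes \<psi> :: "'a::euclidean_space \<Rightarrow> complex"
  shows "norm (fourier \<psi> \<xi>) \<le> (\<integral>x. norm (\<psi> x) \<partial>lborel)"
  unfolding fourier_def by (rule order_trans[OF integral_norm_bound]) (simp add: norm_mult)

text \<open>Each partial derivative trades for one factor \<xi> \<bullet> b, and the transform of
  the k-fold derivative is bounded by its L^1 norm.\<close>

lemma fourier_coordinate_decay:
  fixes \<psi> :: "'a::euclidean_space \<Rightarrow> complex"
  assumes b: "b \<in> Basis"
  shows "smooth_compact \<psi> \<Longrightarrow> \<exists>C. \<forall>\<xi>. \<bar>\<xi> \<bullet> b\<bar> ^ k * norm (fourier \<psi> \<xi>) \<le> C"
proof (induction k arbitrary: \<psi>)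
  case 0
  show ?case using norm_fourier_le[of \<psi>] by auto
next
  case (Suc k)
  from Suc.IH[OF smooth_compact_partial[OF Suc.prems b]] obtain C where
    C: "\<And>\<xi>. \<bar>\<xi> \<bullet> b\<bar> ^ k * norm (fourier (\<lambda>x. frechet_derivative \<psi> (at x) b) \<xi>) \<le> C" by auto
  show ?case
  proof (intro exI allI)
    fix \<xi>
    show "\<bar>\<xi> \<bullet> b\<bar> ^ Suc k * norm (fourier \<psi> \<xi>) \<le> C"
      using C[of \<xi>] unfolding fourier_partial[OF Suc.prems b] by (simp add: norm_mult mult_ac)
  qed
qed

lemma norm_power_le_sum_coordinates:
  fixes \<xi> :: "'a::euclidean_space"
  shows "norm \<xi> ^ k \<le> real DIM('a) ^ k * (\<Sum>b\<in>Basis. \<bar>\<xi> \<bullet> b\<bar> ^ k)"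
proof -
  define m where "m = Max ((\<lambda>b. \<bar>\<xi> \<bullet> b\<bar>) ` Basis)"
  have "m \<in> (\<lambda>b. \<bar>\<xi> \<bullet> b\<bar>) ` Basis" unfolding m_def by (rule Max_in) auto
  then obtain b where b: "b \<in> Basis" "m = \<bar>\<xi> \<bullet> b\<bar>" by auto
  have le: "\<bar>\<xi> \<bullet> c\<bar> \<le> m" if "c \<in> Basis" for c unfolding m_def using that by (intro Max_ge) auto
  have "norm \<xi> \<le> (\<Sum>b\<in>Basis. \<bar>\<xi> \<bullet> b\<bar>)" by (rule norm_le_l1)
  also have "\<dots> \<le> real DIM('a) * m" using sum_bounded_above[of Basis "\<lambda>b. \<bar>\<xi> \<bullet> b\<bar>" m] le by simp
  finally have "norm \<xi> ^ k \<le> (real DIM('a) * m) ^ k" by (intro power_mono) auto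
  also have "\<dots> = real DIM('a) ^ k * \<bar>\<xi> \<bullet> b\<bar> ^ k" using b by (simp add: power_mult_distrib)
  also have "\<dots> \<le> real DIM('a) ^ k * (\<Sum>b\<in>Basis. \<bar>\<xi> \<bullet> b\<bar> ^ k)"
    using b by (intro mult_left_mono member_le_sum) auto
  finally show ?thesis .
qed

text \<open>The bound is stated with powers of 1 + |\<xi>|^2 because these are smooth at 0 and have
  a gamma integral representation, which makes their integrability over the whole space
  accessible.\<close>

lemma fourier_decay:
  fixes \<psi> :: "'a::euclidean_space \<Rightarrow> complex"
  assumes \<psi>: "smooth_compact \<psi>"
  shows "\<exists>C\<ge>0. \<forall>\<xi>. norm (fourier \<psi> \<xi>) \<le> C / (1 + (norm \<xi>)\<^sup>2) ^ m"
proof -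
  have "\<forall>b\<in>Basis. \<exists>C. \<forall>\<xi>. \<bar>\<xi> \<bullet> b\<bar> ^ (2*m) * norm (fourier \<psi> \<xi>) \<le> C"
    using fourier_coordinate_decay[OF _ \<psi>] by auto
  then obtain C where C: "\<And>b \<xi>. b \<in> Basis \<Longrightarrow> \<bar>\<xi> \<bullet> b\<bar> ^ (2*m) * norm (fourier \<psi> \<xi>) \<le> C b" by metis
  define C0 where "C0 = (\<integral>x. norm (\<psi> x) \<partial>lborel)"
  define D where "D = 2 ^ m * (C0 + real DIM('a) ^ (2*m) * (\<Sum>b\<in>Basis. C b))"
  have bound: "(1 + (norm \<xi>)\<^sup>2) ^ m * norm (fourier \<psi> \<xi>) \<le> D" for \<xi>
  proof -
    have "(1 + (norm \<xi>)\<^sup>2) ^ m \<le> (2 * max 1 ((norm \<xi>)\<^sup>2)) ^ m" by (intro power_mono) auto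
    also have "\<dots> = 2 ^ m * (max 1 ((norm \<xi>)\<^sup>2)) ^ m" by (simp add: power_mult_distrib)
    also have "\<dots> \<le> 2 ^ m * (1 + norm \<xi> ^ (2*m))"
      by (intro mult_left_mono) (auto simp: max_def power_mult)
    finally have "(1 + (norm \<xi>)\<^sup>2) ^ m * norm (fourier \<psi> \<xi>) \<le> 2 ^ m * (1 + norm \<xi> ^ (2*m)) * norm (fourier \<psi> \<xi>)"
      by (rule mult_right_mono) simp
    also have "\<dots> = 2 ^ m * (norm (fourier \<psi> \<xi>) + norm \<xi> ^ (2*m) * norm (fourier \<psi> \<xi>))"
      by (simp add: algebra_simps)
    also have "\<dots> \<le> D"
      unfolding D_def
    proof (intro mult_left_mono add_mono)
      show "norm (fourier \<psi> \<xi>) \<le> C0" unfolding C0_def by (rule norm_fourier_le)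
      have "norm \<xi> ^ (2*m) * norm (fourier \<psi> \<xi>) \<le>
          real DIM('a) ^ (2*m) * (\<Sum>b\<in>Basis. \<bar>\<xi> \<bullet> b\<bar> ^ (2*m)) * norm (fourier \<psi> \<xi>)"
        by (intro mult_right_mono norm_power_le_sum_coordinates) auto
      also have "\<dots> = real DIM('a) ^ (2*m) * (\<Sum>b\<in>Basis. \<bar>\<xi> \<bullet> b\<bar> ^ (2*m) * norm (fourier \<psi> \<xi>))"
        by (simp add: sum_distrib_right)
      also have "\<dots> \<le> real DIM('a) ^ (2*m) * (\<Sum>b\<in>Basis. C b)"
        by (intro mult_left_mono sum_mono C) auto
      finally show "norm \<xi> ^ (2*m) * norm (fourier \<psi> \<xi>) \<le> real DIM('a) ^ (2*m) * (\<Sum>b\<in>Basis. C b)" .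
    qed auto
    finally show ?thesis .
  qed
  have "0 \<le> D" by (rule order_trans[OF _ bound[of 0]]) auto
  moreover have "norm (fourier \<psi> \<xi>) \<le> D / (1 + (norm \<xi>)\<^sup>2) ^ m" for \<xi>
    using bound[of \<xi>] by (simp add: pos_le_divide_eq add_pos_nonneg mult.commute)
  ultimately show ?thesis by auto
qed

section \<open>Pairings of functions with transforms of test functions\<close>

lemma measurable_fourier [measurable]:
  fixes \<phi> :: "'a::euclidean_space \<Rightarrow> complex"
  assumes [measurable]: "\<phi> \<in> borel_measurable borel"
  shows "fourier \<phi> \<in> borel_measurable borel"
proof -
  have "(\<lambda>\<xi>. \<integral>x. \<phi> x * exp (- (\<i> * of_real (x \<bullet> \<xi>))) \<partial>lborel) \<in> borel_measurable borel"
    by (rule lborel.borel_measurable_lebesgue_integral) measurable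
  then show ?thesis by (simp add: fourier_def[abs_def])
qed

text \<open>Only for \<alpha> = 1 is this gain of one factor |\<xi>| at the origin called upon:
  there it makes the product with a function of order |x|^(-3) in dimension 3 integrable near
  0.\<close>

lemma fourier_lipschitz_at_0:
  fixes \<phi> :: "'a::euclidean_space \<Rightarrow> complex"
  assumes \<phi>: "integrable lborel \<phi>" and R: "\<And>x. norm x > R \<Longrightarrow> \<phi> x = 0"
  shows "norm (fourier \<phi> \<xi> - fourier \<phi> 0) \<le> (R * (\<integral>x. norm (\<phi> x) \<partial>lborel)) * norm \<xi>"
proof -
  have "fourier \<phi> \<xi> - fourier \<phi> 0 = (\<integral>x. \<phi> x * exp (- (\<i> * of_real (x \<bullet> \<xi>))) - \<phi> x \<partial>lborel)"
    unfolding fourier_def using \<phi> integrable_times_exp_minus_i[OF \<phi>, of \<xi>]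
    by (subst Bochner_Integration.integral_diff) auto
  also have "norm \<dots> \<le> (\<integral>x. norm (\<phi> x * exp (- (\<i> * of_real (x \<bullet> \<xi>))) - \<phi> x) \<partial>lborel)"
    by (rule integral_norm_bound)
  also have "\<dots> \<le> (\<integral>x. (R * norm \<xi>) * norm (\<phi> x) \<partial>lborel)"
  proof (rule integral_mono)
    show "integrable lborel (\<lambda>x. norm (\<phi> x * exp (- (\<i> * of_real (x \<bullet> \<xi>))) - \<phi> x))"
      using \<phi> integrable_times_exp_minus_i[OF \<phi>, of \<xi>] by simp
    show "integrable lborel (\<lambda>x. (R * norm \<xi>) * norm (\<phi> x))" using \<phi> by simp
    fix x :: 'a
    show "norm (\<phi> x * exp (- (\<i> * of_real (x \<bullet> \<xi>))) - \<phi> x) \<le> (R * norm \<xi>) * norm (\<phi> x)"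
    proof (cases "norm x > R")
      case False
      have "norm (\<phi> x * exp (- (\<i> * of_real (x \<bullet> \<xi>))) - \<phi> x) = norm (\<phi> x) * norm (iexp (- (x \<bullet> \<xi>)) - 1)"
        by (simp flip: norm_mult add: algebra_simps)
      also have "\<dots> \<le> norm (\<phi> x) * (R * norm \<xi>)"
      proof (rule mult_left_mono)
      have "norm (iexp (- (x \<bullet> \<xi>)) - 1) \<le> \<bar>x \<bullet> \<xi>\<bar>"
        using iexp_approx1[of "- (x \<bullet> \<xi>)" 0] by simp
      also have "\<bar>x \<bullet> \<xi>\<bar> \<le> norm x * norm \<xi>" by (rule Cauchy_Schwarz_ineq2)
      also have "\<dots> \<le> R * norm \<xi>" using False by (intro mult_right_mono) auto
      finally show "norm (iexp (- (x \<bullet> \<xi>)) - 1) \<le> R * norm \<xi>" .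
      qed simp
      finally show ?thesis by (simp add: mult.commute)
    qed (simp add: R)
  qed
  finally show ?thesis by (simp add: mult_ac)
qed

lemma fourier_duality:
  fixes \<phi> :: "'a::euclidean_space \<Rightarrow> complex" and U :: "'a \<Rightarrow> real"
  assumes U: "integrable lborel U" and \<phi>: "integrable lborel \<phi>"
  shows "(\<integral>x. of_real (U x) * fourier \<phi> x \<partial>lborel) = (\<integral>\<xi>. fourier (\<lambda>x. of_real (U x)) \<xi> * \<phi> \<xi> \<partial>lborel)"
proof -
  have [measurable]: "U \<in> borel_measurable borel" "\<phi> \<in> borel_measurable borel"
    using U \<phi> by (auto dest: borel_measurable_integrable)
  let ?k = "\<lambda>x \<xi>. complex_of_real (U x) * (\<phi> \<xi> * exp (- (\<i> * of_real (\<xi> \<bullet> x))))"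
  have int: "integrable (lborel \<Otimes>\<^sub>M lborel) (\<lambda>(x, \<xi>). ?k x \<xi>)"
  proof (rule lborel_pair.Fubini_integrable)
    show "(\<lambda>(x, \<xi>). ?k x \<xi>) \<in> borel_measurable (lborel \<Otimes>\<^sub>M lborel)" by measurable
    show "integrable lborel (\<lambda>x. \<integral>\<xi>. norm (case (x, \<xi>) of (x, \<xi>) \<Rightarrow> ?k x \<xi>) \<partial>lborel)"
      using U by (simp add: norm_mult)
    show "AE x in lborel. integrable lborel (\<lambda>\<xi>. case (x, \<xi>) of (x, \<xi>) \<Rightarrow> ?k x \<xi>)"
      using integrable_times_exp_minus_i[OF \<phi>] by simp
  qed
  have "(\<integral>x. of_real (U x) * fourier \<phi> x \<partial>lborel) = (\<integral>x. (\<integral>\<xi>. ?k x \<xi> \<partial>lborel) \<partial>lborel)"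
    by (simp add: fourier_def)
  also have "\<dots> = (\<integral>\<xi>. (\<integral>x. ?k x \<xi> \<partial>lborel) \<partial>lborel)"
    by (rule lborel_pair.Fubini_integral[symmetric, OF int])
  also have "\<dots> = (\<integral>\<xi>. fourier (\<lambda>x. of_real (U x)) \<xi> * \<phi> \<xi> \<partial>lborel)"
  proof (intro Bochner_Integration.integral_cong refl)
    fix \<xi> :: 'a
    have "(\<integral>x. ?k x \<xi> \<partial>lborel) = (\<integral>x. (complex_of_real (U x) * exp (- (\<i> * of_real (x \<bullet> \<xi>)))) * \<phi> \<xi> \<partial>lborel)"
      by (simp add: mult_ac inner_commute)
    also have "\<dots> = fourier (\<lambda>x. of_real (U x)) \<xi> * \<phi> \<xi>" unfolding fourier_def by simp
    finally show "(\<integral>x. ?k x \<xi> \<partial>lborel) = fourier (\<lambda>x. of_real (U x)) \<xi> * \<phi> \<xi>" .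
  qed
  finally show ?thesis .
qed

text \<open>W is a superposition of functions U \<omega> with known transforms V \<omega>, and
  \<open>ct\<close> is the function by which the value at the origin is subtracted. Fubini is used
  twice: on the side of x, where U is nonnegative and the hypothesis on W supplies integrability,
  and on the side of \<xi>, where only the difference between V \<omega> and the constant from
  \<open>ct\<close> is dominated. V and that constant need not be integrable over \<omega>
  separately, so the two are kept together in the conclusion.\<close>

lemma fourier_mixture:
  fixes P :: "'w measure" and U V :: "'w \<Rightarrow> 'a::euclidean_space \<Rightarrow> real" and W ct :: "'a \<Rightarrow> real"
  assumes P: "sigma_finite_measure P"
    and U [measurable]: "case_prod U \<in> borel_measurable (P \<Otimes>\<^sub>M lborel)" and U0: "\<And>\<omega> x. 0 \<le> U \<omega> x"
    and V [measurable]: "case_prod V \<in> borel_measurable (P \<Otimes>\<^sub>M lborel)"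
    and UV: "AE \<omega> in P. \<forall>\<xi>. has_bochner_integral lborel (\<lambda>x. of_real (U \<omega> x) * exp (- (\<i> * of_real (x \<bullet> \<xi>)))) (complex_of_real (V \<omega> \<xi>))"
    and W [measurable]: "W \<in> borel_measurable borel" and W0: "\<And>x. 0 \<le> W x"
    and WU: "AE x in lborel. (\<integral>\<^sup>+\<omega>. ennreal (U \<omega> x) \<partial>P) = ennreal (W x)"
    and ct [measurable]: "ct \<in> borel_measurable borel" and ct01: "\<And>x. 0 \<le> ct x \<and> ct x \<le> 1"
    and \<phi>: "integrable lborel \<phi>"
    and int: "integrable lborel (\<lambda>x. W x * norm (fourier \<phi> x - of_real (ct x) * fourier \<phi> 0))"
    and G: "integrable P G"
    and dom: "AE \<omega> in P. \<forall>\<xi>. \<phi> \<xi> \<noteq> 0 \<longrightarrow> \<bar>V \<omega> \<xi> - (\<integral>x. U \<omega> x * ct x \<partial>lborel)\<bar> \<le> G \<omega>"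
  shows "(\<integral>x. of_real (W x) * (fourier \<phi> x - of_real (ct x) * fourier \<phi> 0) \<partial>lborel) =
    (\<integral>\<xi>. of_real (\<integral>\<omega>. V \<omega> \<xi> - (\<integral>x. U \<omega> x * ct x \<partial>lborel) \<partial>P) * \<phi> \<xi> \<partial>lborel)"
proof -
  interpret P: sigma_finite_measure P by fact
  interpret PL: pair_sigma_finite P "lborel :: 'a measure" ..
  interpret LP: pair_sigma_finite "lborel :: 'a measure" P ..
  have [measurable]: "\<phi> \<in> borel_measurable borel" using \<phi> by (auto dest: borel_measurable_integrable)
  define \<psi> where "\<psi> = (\<lambda>x. fourier \<phi> x - of_real (ct x) * fourier \<phi> 0)"
  have [measurable]: "\<psi> \<in> borel_measurable borel" unfolding \<psi>_def by measurable
  define u where "u = (\<lambda>\<omega>. \<integral>x. U \<omega> x * ct x \<partial>lborel)"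
  have [measurable]: "u \<in> borel_measurable P" unfolding u_def
    by (rule lborel.borel_measurable_lebesgue_integral) measurable
  have int1: "integrable (P \<Otimes>\<^sub>M lborel) (\<lambda>(\<omega>, x). complex_of_real (U \<omega> x) * \<psi> x)"
    unfolding integrable_iff_bounded
  proof
    show "(\<lambda>(\<omega>, x). complex_of_real (U \<omega> x) * \<psi> x) \<in> borel_measurable (P \<Otimes>\<^sub>M lborel)" by measurable
    have "(\<integral>\<^sup>+p. ennreal (norm (case p of (\<omega>, x) \<Rightarrow> complex_of_real (U \<omega> x) * \<psi> x)) \<partial>(P \<Otimes>\<^sub>M lborel)) =
        (\<integral>\<^sup>+x. (\<integral>\<^sup>+\<omega>. ennreal (U \<omega> x) * ennreal (norm (\<psi> x)) \<partial>P) \<partial>lborel)"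
      by (subst PL.nn_integral_snd[symmetric]) (auto simp: norm_mult U0 ennreal_mult)
    also have "\<dots> = (\<integral>\<^sup>+x. (\<integral>\<^sup>+\<omega>. ennreal (U \<omega> x) \<partial>P) * ennreal (norm (\<psi> x)) \<partial>lborel)"
      by (intro nn_integral_cong nn_integral_multc) measurable
    also have "\<dots> = (\<integral>\<^sup>+x. ennreal (W x * norm (\<psi> x)) \<partial>lborel)"
      using WU by (intro nn_integral_cong_AE) (auto simp: ennreal_mult W0)
    also have "\<dots> < \<infinity>"
      using int by (subst nn_integral_eq_integral) (auto simp: \<psi>_def W0)
    finally show "(\<integral>\<^sup>+p. ennreal (norm (case p of (\<omega>, x) \<Rightarrow> complex_of_real (U \<omega> x) * \<psi> x)) \<partial>(P \<Otimes>\<^sub>M lborel)) < \<infinity>" .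
  qed
  have WU': "AE x in lborel. (\<integral>\<omega>. complex_of_real (U \<omega> x) * \<psi> x \<partial>P) = of_real (W x) * \<psi> x"
    using WU
  proof eventually_elim
    case (elim x)
    have "integral\<^sup>L P (\<lambda>\<omega>. U \<omega> x) = W x"
      by (subst integral_eq_nn_integral) (auto simp: elim U0 W0)
    then show ?case by (simp flip: of_real_mult)
  qed
  have "(\<integral>x. of_real (W x) * \<psi> x \<partial>lborel) = (\<integral>x. (\<integral>\<omega>. complex_of_real (U \<omega> x) * \<psi> x \<partial>P) \<partial>lborel)"
    using WU' by (intro integral_cong_AE) auto
  also have "\<dots> = (\<integral>\<omega>. (\<integral>x. complex_of_real (U \<omega> x) * \<psi> x \<partial>lborel) \<partial>P)"
    by (rule PL.Fubini_integral[OF int1])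
  also have "\<dots> = (\<integral>\<omega>. (\<integral>\<xi>. of_real (V \<omega> \<xi> - u \<omega>) * \<phi> \<xi> \<partial>lborel) \<partial>P)"
  proof (rule integral_cong_AE)
    show "AE \<omega> in P. (\<integral>x. complex_of_real (U \<omega> x) * \<psi> x \<partial>lborel) = (\<integral>\<xi>. of_real (V \<omega> \<xi> - u \<omega>) * \<phi> \<xi> \<partial>lborel)"
      using UV AE_space
    proof eventually_elim
      case (elim \<omega>)
      have [measurable]: "U \<omega> \<in> borel_measurable borel"
        using measurable_Pair2[OF U elim(2)] by simp
      have "integrable lborel (\<lambda>x. complex_of_real (U \<omega> x))"
        using elim(1)[rule_format, of 0] by (simp add: has_bochner_integral_iff)
      from integrable_Re[OF this] have iU: "integrable lborel (U \<omega>)" by simp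
      have fU: "fourier (\<lambda>x. of_real (U \<omega> x)) \<xi> = of_real (V \<omega> \<xi>)" for \<xi>
        using elim(1) by (simp add: fourier_def has_bochner_integral_iff)
      have iUct: "integrable lborel (\<lambda>x. U \<omega> x * ct x)"
        by (rule Bochner_Integration.integrable_bound[OF iU])
           (use ct01 U0 in \<open>auto simp: abs_mult mult_left_le intro!: mult_left_le\<close>)
      have bd: "norm (fourier \<phi> x) \<le> (\<integral>x. norm (\<phi> x) \<partial>lborel)" for x by (rule norm_fourier_le)
      have iUf: "integrable lborel (\<lambda>x. of_real (U \<omega> x) * fourier \<phi> x)"
      proof (rule Bochner_Integration.integrable_bound[OF integrable_mult_left[OF iU, of "\<integral>x. norm (\<phi> x) \<partial>lborel"]])
        have "norm (fourier \<phi> x) \<le> \<bar>\<integral>x. norm (\<phi> x) \<partial>lborel\<bar>" for x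
          by (rule order_trans[OF bd abs_ge_self])
        then show "AE x in lborel. norm (of_real (U \<omega> x) * fourier \<phi> x) \<le> norm (U \<omega> x * (\<integral>x. norm (\<phi> x) \<partial>lborel))"
          by (intro AE_I2) (simp add: norm_mult abs_mult mult_left_mono)
      qed measurable
      have i\<phi>V: "integrable lborel (\<lambda>\<xi>. of_real (V \<omega> \<xi>) * \<phi> \<xi>)"
      proof (rule Bochner_Integration.integrable_bound)
        show "integrable lborel (\<lambda>\<xi>. (\<integral>x. U \<omega> x \<partial>lborel) *\<^sub>R \<phi> \<xi>)" using \<phi> by simp
        have [measurable]: "V \<omega> \<in> borel_measurable borel"
          using measurable_Pair2[OF V elim(2)] by simp
        show "(\<lambda>\<xi>. of_real (V \<omega> \<xi>) * \<phi> \<xi>) \<in> borel_measurable lborel" by measurable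
        have "\<bar>V \<omega> \<xi>\<bar> \<le> (\<integral>x. U \<omega> x \<partial>lborel)" for \<xi>
          using norm_fourier_le[of "\<lambda>x. of_real (U \<omega> x)" \<xi>] by (simp add: fU U0)
        then have "\<bar>V \<omega> \<xi>\<bar> \<le> \<bar>\<integral>x. U \<omega> x \<partial>lborel\<bar>" for \<xi>
          by (rule order_trans[OF _ abs_ge_self])
        then show "AE \<xi> in lborel. norm (of_real (V \<omega> \<xi>) * \<phi> \<xi>) \<le> norm ((\<integral>x. U \<omega> x \<partial>lborel) *\<^sub>R \<phi> \<xi>)"
          by (intro AE_I2) (simp add: norm_mult mult_right_mono)
      qed
      have "(\<integral>x. complex_of_real (U \<omega> x) * \<psi> x \<partial>lborel) =
          (\<integral>x. of_real (U \<omega> x) * fourier \<phi> x - of_real (U \<omega> x * ct x) * fourier \<phi> 0 \<partial>lborel)"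
        by (simp add: \<psi>_def algebra_simps)
      also have "\<dots> = (\<integral>x. of_real (U \<omega> x) * fourier \<phi> x \<partial>lborel) - of_real (u \<omega>) * fourier \<phi> 0"
      proof -
        have i: "integrable lborel (\<lambda>x. complex_of_real (U \<omega> x * ct x))" by (rule integrable_of_real[OF iUct])
        have "(\<integral>x. complex_of_real (U \<omega> x * ct x) \<partial>lborel) = of_real (u \<omega>)"
          unfolding u_def by (rule integral_complex_of_real)
        then show ?thesis
          by (simp only: Bochner_Integration.integral_diff[OF iUf integrable_mult_left[OF i]]
              Bochner_Integration.integral_mult_left[OF i])
      qed
      \<comment> \<open>The transform of \<phi> at 0 is the integral of \<phi>, so the subtraction
        at the origin becomes a constant subtracted from V \<omega>.\<close>
      also have "\<dots> = (\<integral>\<xi>. of_real (V \<omega> \<xi>) * \<phi> \<xi> \<partial>lborel) - of_real (u \<omega>) * (\<integral>\<xi>. \<phi> \<xi> \<partial>lborel)"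
        using fourier_duality[OF iU \<phi>] by (simp add: fU) (simp add: fourier_def)
      also have "\<dots> = (\<integral>\<xi>. of_real (V \<omega> \<xi>) * \<phi> \<xi> - of_real (u \<omega>) * \<phi> \<xi> \<partial>lborel)"
        using i\<phi>V \<phi> by (subst Bochner_Integration.integral_diff) auto
      also have "\<dots> = (\<integral>\<xi>. of_real (V \<omega> \<xi> - u \<omega>) * \<phi> \<xi> \<partial>lborel)"
        by (simp add: algebra_simps)
      finally show ?case .
    qed
  qed measurable
  also have "\<dots> = (\<integral>\<xi>. (\<integral>\<omega>. of_real (V \<omega> \<xi> - u \<omega>) * \<phi> \<xi> \<partial>P) \<partial>lborel)"
  proof (rule PL.Fubini_integral[symmetric])
    have [measurable]: "G \<in> borel_measurable P" using G by auto
    have "(\<integral>\<^sup>+p. ennreal (norm (case p of (\<omega>, \<xi>) \<Rightarrow> complex_of_real (V \<omega> \<xi> - u \<omega>) * \<phi> \<xi>)) \<partial>(P \<Otimes>\<^sub>M lborel)) =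
        (\<integral>\<^sup>+\<omega>. (\<integral>\<^sup>+\<xi>. ennreal (norm (complex_of_real (V \<omega> \<xi> - u \<omega>) * \<phi> \<xi>)) \<partial>lborel) \<partial>P)"
      by (subst lborel.nn_integral_fst[symmetric]) auto
    also have "\<dots> \<le> (\<integral>\<^sup>+\<omega>. (\<integral>\<^sup>+\<xi>. ennreal (norm (G \<omega>)) * ennreal (norm (\<phi> \<xi>)) \<partial>lborel) \<partial>P)"
    proof (rule nn_integral_mono_AE)
      show "AE \<omega> in P. (\<integral>\<^sup>+\<xi>. ennreal (norm (complex_of_real (V \<omega> \<xi> - u \<omega>) * \<phi> \<xi>)) \<partial>lborel) \<le>
          (\<integral>\<^sup>+\<xi>. ennreal (norm (G \<omega>)) * ennreal (norm (\<phi> \<xi>)) \<partial>lborel)"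
        using dom
      proof eventually_elim
        case (elim \<omega>)
        show ?case
        proof (rule nn_integral_mono)
          fix \<xi>
          have "norm (complex_of_real (V \<omega> \<xi> - u \<omega>) * \<phi> \<xi>) = \<bar>V \<omega> \<xi> - u \<omega>\<bar> * norm (\<phi> \<xi>)"
            by (simp only: norm_mult norm_of_real)
          also have "\<dots> \<le> norm (G \<omega>) * norm (\<phi> \<xi>)"
            using elim[rule_format, of \<xi>] unfolding u_def by (cases "\<phi> \<xi> = 0") (auto intro!: mult_right_mono)
          finally show "ennreal (norm (complex_of_real (V \<omega> \<xi> - u \<omega>) * \<phi> \<xi>)) \<le> ennreal (norm (G \<omega>)) * ennreal (norm (\<phi> \<xi>))"
            by (simp add: ennreal_mult[symmetric] ennreal_leI)
        qed
      qed
    qed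
    also have "\<dots> = (\<integral>\<^sup>+\<omega>. ennreal (norm (G \<omega>)) \<partial>P) * (\<integral>\<^sup>+\<xi>. ennreal (norm (\<phi> \<xi>)) \<partial>lborel)"
      by (simp add: nn_integral_cmult nn_integral_multc)
    also have "\<dots> < \<infinity>"
      using G \<phi> by (auto simp: integrable_iff_bounded ennreal_mult_less_top)
    finally show "integrable (P \<Otimes>\<^sub>M lborel) (\<lambda>(\<omega>, \<xi>). complex_of_real (V \<omega> \<xi> - u \<omega>) * \<phi> \<xi>)"
      unfolding integrable_iff_bounded by simp
  qed
  also have "\<dots> = (\<integral>\<xi>. of_real (\<integral>\<omega>. V \<omega> \<xi> - u \<omega> \<partial>P) * \<phi> \<xi> \<partial>lborel)"
    by (simp flip: of_real_diff)
  finally show ?thesis by (simp add: \<psi>_def u_def)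
qed

section \<open>Gamma integrals and radial integrability\<close>

lemma nn_integral_powr_exp:
  assumes a: "a > (0::real)" and l: "l > 0"
  shows "(\<integral>\<^sup>+t. ennreal (indicator {0<..} t * (t powr (a - 1) * exp (- (l * t)))) \<partial>lborel) = ennreal (Gamma a / l powr a)"
proof -
  have "ennreal (Gamma a) = (\<integral>\<^sup>+t. ennreal (indicator {0..} t * t powr (a - 1) / exp t) \<partial>lborel)"
    by (rule Gamma_conv_nn_integral_real[OF a])
  also have "\<dots> = ennreal \<bar>l\<bar> * (\<integral>\<^sup>+t. ennreal (indicator {0..} (0 + l * t) * (0 + l * t) powr (a - 1) / exp (0 + l * t)) \<partial>lborel)"
    using l by (intro nn_integral_real_affine) auto
  also have "(\<integral>\<^sup>+t. ennreal (indicator {0..} (0 + l * t) * (0 + l * t) powr (a - 1) / exp (0 + l * t)) \<partial>lborel) =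
     (\<integral>\<^sup>+t. ennreal (l powr (a - 1)) * ennreal (indicator {0<..} t * (t powr (a - 1) * exp (- (l * t)))) \<partial>lborel)"
  proof (rule nn_integral_cong)
    fix t :: real
    have "indicator {0..} (0 + l * t) * (0 + l * t) powr (a - 1) / exp (0 + l * t) =
        l powr (a - 1) * (indicator {0<..} t * (t powr (a - 1) * exp (- (l * t))))"
    proof (cases "t > 0")
      case True
      then show ?thesis using l by (simp add: powr_mult exp_minus divide_inverse)
    next
      case False
      then show ?thesis using l by (cases "t = 0") (auto simp: indicator_def zero_le_mult_iff)
    qed
    then show "ennreal (indicator {0..} (0 + l * t) * (0 + l * t) powr (a - 1) / exp (0 + l * t)) =
        ennreal (l powr (a - 1)) * ennreal (indicator {0<..} t * (t powr (a - 1) * exp (- (l * t))))"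
      by (simp add: ennreal_mult[symmetric])
  qed
  also have "\<dots> = ennreal (l powr (a - 1)) * (\<integral>\<^sup>+t. ennreal (indicator {0<..} t * (t powr (a - 1) * exp (- (l * t)))) \<partial>lborel)"
    by (rule nn_integral_cmult) measurable
  finally have eq: "ennreal (Gamma a) = ennreal (l powr a) * (\<integral>\<^sup>+t. ennreal (indicator {0<..} t * (t powr (a - 1) * exp (- (l * t)))) \<partial>lborel)"
    using l by (simp add: mult.assoc[symmetric] ennreal_mult[symmetric] powr_diff)
  have "ennreal (1 / l powr a) * ennreal (l powr a) = 1"
    using l by (simp add: ennreal_mult[symmetric])
  then have "(\<integral>\<^sup>+t. ennreal (indicator {0<..} t * (t powr (a - 1) * exp (- (l * t)))) \<partial>lborel) = ennreal (1 / l powr a) * ennreal (Gamma a)"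
    unfolding eq by (simp add: mult.assoc[symmetric])
  also have "\<dots> = ennreal (Gamma a / l powr a)"
    using a by (simp add: ennreal_mult[symmetric] Gamma_real_pos less_imp_le)
  finally show ?thesis .
qed

lemma has_bochner_integral_powr_exp:
  assumes a: "a > (0::real)" and l: "l > 0"
  shows "has_bochner_integral lborel (\<lambda>t. indicator {0<..} t * (t powr (a - 1) * exp (- (l * t)))) (Gamma a / l powr a)"
  using a l by (intro has_bochner_integral_nn_integral nn_integral_powr_exp)
    (auto simp: Gamma_real_pos less_imp_le)

lemma powr_conv_nn_integral:
  assumes "a > (0::real)" "l > 0"
  shows "ennreal (l powr (- a)) = ennreal (1 / Gamma a) * (\<integral>\<^sup>+t. ennreal (indicator {0<..} t * (t powr (a - 1) * exp (- (l * t)))) \<partial>lborel)"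
proof -
  have "1 / Gamma a * (Gamma a / l powr a) = l powr (- a)"
    using Gamma_real_pos[OF assms(1)] by (simp add: powr_minus divide_inverse)
  then show ?thesis
    using Gamma_real_pos[OF assms(1)]
    by (simp only: nn_integral_powr_exp[OF assms] ennreal_mult[symmetric] divide_nonneg_nonneg powr_ge_zero
        zero_le_one less_imp_le)
qed

text \<open>With (1 + t)^(-b) written as a gamma integral, Tonelli reduces the integral to Gamma a *
  Gamma (b - a) / Gamma b. Only finiteness is recorded, as the value enters no later
  estimate.\<close>

lemma nn_integral_beta_prime:
  assumes a: "a > (0::real)" and b: "b > a"
  shows "(\<integral>\<^sup>+t. ennreal (indicator {0<..} t * (t powr (a - 1) * (1 + t) powr (- b))) \<partial>lborel) < \<infinity>"
proof -
  have b0: "b > 0" using a b by simp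
  have "(\<integral>\<^sup>+t. ennreal (indicator {0<..} t * (t powr (a - 1) * (1 + t) powr (- b))) \<partial>lborel)
     = (\<integral>\<^sup>+t. (\<integral>\<^sup>+s. ennreal (1 / Gamma b) * ennreal (indicator {0<..} t * t powr (a - 1)) * ennreal (indicator {0<..} s * (s powr (b - 1) * exp (- ((1 + t) * s)))) \<partial>lborel) \<partial>lborel)"
  proof (rule nn_integral_cong)
    fix t :: real
    show "ennreal (indicator {0<..} t * (t powr (a - 1) * (1 + t) powr (- b))) =
      (\<integral>\<^sup>+s. ennreal (1 / Gamma b) * ennreal (indicator {0<..} t * t powr (a - 1)) * ennreal (indicator {0<..} s * (s powr (b - 1) * exp (- ((1 + t) * s)))) \<partial>lborel)"
    proof (cases "t > 0")
      case True
      then have "ennreal (indicator {0<..} t * (t powr (a - 1) * (1 + t) powr (- b))) = ennreal (t powr (a - 1)) * ennreal ((1 + t) powr (- b))"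
        by (simp add: ennreal_mult)
      also have "ennreal ((1 + t) powr (- b)) = ennreal (1 / Gamma b) * (\<integral>\<^sup>+s. ennreal (indicator {0<..} s * (s powr (b - 1) * exp (- ((1 + t) * s)))) \<partial>lborel)"
        using True by (intro powr_conv_nn_integral b0) simp
      finally show ?thesis using True by (subst nn_integral_cmult) (auto simp: mult_ac)
    qed simp
  qed
  also have "\<dots> = (\<integral>\<^sup>+s. (\<integral>\<^sup>+t. ennreal (1 / Gamma b) * ennreal (indicator {0<..} t * t powr (a - 1)) * ennreal (indicator {0<..} s * (s powr (b - 1) * exp (- ((1 + t) * s)))) \<partial>lborel) \<partial>lborel)"
    by (rule lborel_pair.Fubini'[symmetric]) measurable
  also have "\<dots> = (\<integral>\<^sup>+s. ennreal (Gamma a / Gamma b) * ennreal (indicator {0<..} s * (s powr (b - a - 1) * exp (- (1 * s)))) \<partial>lborel)"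
  proof (rule nn_integral_cong)
    fix s :: real
    show "(\<integral>\<^sup>+t. ennreal (1 / Gamma b) * ennreal (indicator {0<..} t * t powr (a - 1)) * ennreal (indicator {0<..} s * (s powr (b - 1) * exp (- ((1 + t) * s)))) \<partial>lborel)
      = ennreal (Gamma a / Gamma b) * ennreal (indicator {0<..} s * (s powr (b - a - 1) * exp (- (1 * s))))"
    proof (cases "s > 0")
      case True
      have "(\<integral>\<^sup>+t. ennreal (1 / Gamma b) * ennreal (indicator {0<..} t * t powr (a - 1)) * ennreal (indicator {0<..} s * (s powr (b - 1) * exp (- ((1 + t) * s)))) \<partial>lborel)
        = (\<integral>\<^sup>+t. ennreal (1 / Gamma b * (s powr (b - 1) * exp (- s))) * ennreal (indicator {0<..} t * (t powr (a - 1) * exp (- (s * t)))) \<partial>lborel)"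
      proof (rule nn_integral_cong)
        fix t :: real
        have "exp (- ((1 + t) * s)) = exp (- s) * exp (- (s * t))" by (simp add: exp_add[symmetric] algebra_simps)
        then show "ennreal (1 / Gamma b) * ennreal (indicator {0<..} t * t powr (a - 1)) * ennreal (indicator {0<..} s * (s powr (b - 1) * exp (- ((1 + t) * s))))
          = ennreal (1 / Gamma b * (s powr (b - 1) * exp (- s))) * ennreal (indicator {0<..} t * (t powr (a - 1) * exp (- (s * t))))"
          using True Gamma_real_pos[OF b0] by (simp add: ennreal_mult[symmetric] mult_ac)
      qed
      also have "\<dots> = ennreal (1 / Gamma b * (s powr (b - 1) * exp (- s))) * ennreal (Gamma a / s powr a)"
        using a True by (subst nn_integral_cmult) (auto simp: nn_integral_powr_exp)
      also have "\<dots> = ennreal (Gamma a / Gamma b) * ennreal (indicator {0<..} s * (s powr (b - a - 1) * exp (- (1 * s))))"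
      proof -
        have "s powr (b - 1) / s powr a = s powr (b - a - 1)" using True by (simp add: powr_diff[symmetric] algebra_simps)
        then have "1 / Gamma b * (s powr (b - 1) * exp (- s)) * (Gamma a / s powr a) = Gamma a / Gamma b * (s powr (b - a - 1) * exp (- s))"
          by (metis (no_types, opaque_lifting) mult.commute mult.left_commute mult_1 times_divide_times_eq times_divide_eq_right)
        then show ?thesis
          using True Gamma_real_pos[OF b0] Gamma_real_pos[OF a] by (simp add: ennreal_mult[symmetric])
      qed
      finally show ?thesis .
    qed simp
  qed
  also have "\<dots> = ennreal (Gamma a / Gamma b) * ennreal (Gamma (b - a) / 1 powr (b - a))"
    using b by (subst nn_integral_cmult, measurable, subst nn_integral_powr_exp) auto
  also have "\<dots> < \<infinity>" by (simp add: ennreal_mult_less_top)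
  finally show ?thesis .
qed

text \<open>The substitution s \<mapsto> 1/s in the gamma integral. In this form it integrates the
  transforms of Gaussians, where the parameter s appears as exp (- l / s).\<close>

lemma has_bochner_integral_inverse_gamma:
  assumes a: "a > (0::real)" and l: "l > 0"
  shows "has_bochner_integral lborel (\<lambda>s. indicator {0<..} s * (s powr (- a - 1) * exp (- (l / s)))) (Gamma a / l powr a)"
proof -
  let ?f = "\<lambda>t. t powr (a - 1) * exp (- (l * t))"
  have hb: "has_bochner_integral lborel (\<lambda>t. indicator {0<..} t *\<^sub>R ?f t) (Gamma a / l powr a)"
    using has_bochner_integral_powr_exp[OF a l] by simp
  then have si: "set_integrable lborel {0<..} ?f" and sv: "(LINT t:{0<..}|lborel. ?f t) = Gamma a / l powr a"
    by (auto simp: set_integrable_def set_lebesgue_integral_def has_bochner_integral_iff)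
  have im: "inverse ` {0::real<..} = {0<..}"
  proof
    show "{0::real<..} \<subseteq> inverse ` {0<..}"
    proof
      fix x :: real assume "x \<in> {0<..}"
      then have "x = inverse (inverse x)" "inverse x \<in> {0<..}" by auto
      then show "x \<in> inverse ` {0<..}" by blast
    qed
  qed auto
  have "?f absolutely_integrable_on {0<..}"
    using si by (simp add: set_integrable_def integrable_completion)
  moreover have "integral {0<..} ?f = Gamma a / l powr a"
    using set_borel_integral_eq_integral(2)[OF si] sv by simp
  moreover have "(inverse has_field_derivative - (inverse x ^ 2)) (at x within {0<..})" if "x \<in> {0<..}" for x :: real
    using that by (auto intro!: derivative_eq_intros simp: power2_eq_square)
  ultimately have R: "(\<lambda>x. \<bar>- (inverse x ^ 2)\<bar> *\<^sub>R ?f (inverse x)) absolutely_integrable_on {0<..}"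
     "integral {0<..} (\<lambda>x. \<bar>- (inverse x ^ 2)\<bar> *\<^sub>R ?f (inverse x)) = Gamma a / l powr a"
    using has_absolute_integral_change_of_variables_1'[of "{0<..}" inverse "\<lambda>x. - (inverse x ^ 2)" ?f "Gamma a / l powr a"]
    unfolding im by (auto simp: inj_on_def)
  have eq: "\<bar>- (inverse x ^ 2)\<bar> *\<^sub>R ?f (inverse x) = x powr (- a - 1) * exp (- (l / x))" if "x \<in> {0<..}" for x
  proof -
    have x: "x > 0" using that by simp
    have "inverse x ^ 2 = x powr (-2)" using x by (simp add: powr_minus powr_numeral power_inverse)
    moreover have "inverse x powr (a - 1) = x powr (- (a - 1))" using x by (simp only: powr_minus inverse_powr)
    moreover have "x powr (-2) * x powr (- (a - 1)) = x powr (- a - 1)"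
      unfolding powr_add[symmetric] by (rule arg_cong[of _ _ "\<lambda>r. x powr r"]) simp
    ultimately show ?thesis using x by (simp add: divide_inverse mult.assoc[symmetric])
  qed
  have 1: "(\<lambda>x. x powr (- a - 1) * exp (- (l / x))) absolutely_integrable_on {0<..}"
    using R(1) eq by (subst (asm) absolutely_integrable_spike_eq[of "{}"]) auto
  have 2: "integral {0<..} (\<lambda>x. x powr (- a - 1) * exp (- (l / x))) = Gamma a / l powr a"
    using R(2) eq by (metis (no_types, lifting) Henstock_Kurzweil_Integration.integral_cong)
  have si2: "set_integrable lborel {0<..} (\<lambda>x. x powr (- a - 1) * exp (- (l / x)))"
    using 1 unfolding set_integrable_def by (subst (asm) integrable_completion) auto
  show ?thesis
    using si2 set_borel_integral_eq_integral(2)[OF si2] 2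
    by (simp add: has_bochner_integral_iff set_integrable_def set_lebesgue_integral_def)
qed

section \<open>Radial integrability by means of Gaussians instead of polar coordinates\<close>

lemma sqrt_pi_div_power:
  assumes "v > (0::real)"
  shows "sqrt (pi / v) ^ n = sqrt pi ^ n * v powr (- (real n / 2))"
proof -
  have "sqrt v ^ n = v powr (real n / 2)"
    using assms by (simp add: powr_half_sqrt[symmetric] powr_powr powr_realpow[symmetric])
  then show ?thesis unfolding real_sqrt_divide power_divide powr_minus_divide by simp
qed

lemma norm2_eq_perp2: "(norm x)\<^sup>2 = (x \<bullet> e)\<^sup>2 + perp2 e x"
  by (simp add: perp2_def)

lemma nn_integral_gauss:
  assumes s: "s > 0"
  shows "(\<integral>\<^sup>+(x::'a::euclidean_space). ennreal (exp (- (s * (norm x)\<^sup>2))) \<partial>lborel) = ennreal (sqrt (pi / s) ^ DIM('a))"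
proof -
  obtain e :: 'a where e: "e \<in> Basis" using nonempty_Basis by blast
  have "has_bochner_integral lborel (\<lambda>x::'a. complex_of_real (exp (- (s * (norm x)\<^sup>2)))) (of_real (sqrt (pi / s) * sqrt (pi / s) ^ (DIM('a) - 1)))"
  proof -
    have eq: "s * (norm x)\<^sup>2 = s * (x \<bullet> e)\<^sup>2 + s * perp2 e x" for x
      unfolding norm2_eq_perp2[of x e] by (rule distrib_left)
    have "perp2 e 0 = 0" by (simp add: perp2_def)
    then show ?thesis unfolding eq using gauss_fourier[OF e s s, of 0] by simp
  qed
  from has_bochner_integral_Re[OF this]
  have "has_bochner_integral lborel (\<lambda>x::'a. exp (- (s * (norm x)\<^sup>2))) (sqrt (pi / s) ^ DIM('a))"
    by (simp add: power_eq_if)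
  then show ?thesis
    by (subst nn_integral_eq_integral) (auto simp: has_bochner_integral_iff)
qed

text \<open>The power is a gamma integral of exp (- (1 + |x|^2) s). Integrating the Gaussian in x
  costs s^(-n/2), and the remaining gamma integral converges at 0 because n/2 < k.\<close>

lemma integrable_inverse_one_plus_norm:
  assumes k: "DIM('a) < 2 * k"
  shows "integrable lborel (\<lambda>x::'a::euclidean_space. 1 / (1 + (norm x)\<^sup>2) ^ k)"
proof -
  have k0: "real k > 0" using k by simp
  let ?n = "DIM('a)"
  have "(\<integral>\<^sup>+(x::'a). ennreal (1 / (1 + (norm x)\<^sup>2) ^ k) \<partial>lborel) =
     (\<integral>\<^sup>+(x::'a). (\<integral>\<^sup>+s. ennreal (1 / Gamma k) * ennreal (indicator {0<..} s * (s powr (real k - 1) * exp (- ((1 + (norm x)\<^sup>2) * s)))) \<partial>lborel) \<partial>lborel)"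
  proof (rule nn_integral_cong)
    fix x :: 'a
    have p: "1 + (norm x)\<^sup>2 > 0" by (simp add: add_pos_nonneg)
    have "1 / (1 + (norm x)\<^sup>2) ^ k = (1 + (norm x)\<^sup>2) powr (- real k)"
      using p by (simp add: powr_minus powr_realpow divide_inverse)
    then show "ennreal (1 / (1 + (norm x)\<^sup>2) ^ k) = (\<integral>\<^sup>+s. ennreal (1 / Gamma k) * ennreal (indicator {0<..} s * (s powr (real k - 1) * exp (- ((1 + (norm x)\<^sup>2) * s)))) \<partial>lborel)"
      using powr_conv_nn_integral[OF k0 p] by (subst nn_integral_cmult) auto
  qed
  also have "\<dots> = (\<integral>\<^sup>+s. (\<integral>\<^sup>+(x::'a). ennreal (1 / Gamma k) * ennreal (indicator {0<..} s * (s powr (real k - 1) * exp (- ((1 + (norm x)\<^sup>2) * s)))) \<partial>lborel) \<partial>lborel)"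
    by (rule lborel_pair.Fubini'[symmetric]) measurable
  also have "\<dots> = (\<integral>\<^sup>+s. ennreal (1 / Gamma k * sqrt pi ^ ?n) * ennreal (indicator {0<..} s * (s powr ((real k - real ?n / 2) - 1) * exp (- (1 * s)))) \<partial>lborel)"
  proof (rule nn_integral_cong)
    fix s :: real
    show "(\<integral>\<^sup>+(x::'a). ennreal (1 / Gamma k) * ennreal (indicator {0<..} s * (s powr (real k - 1) * exp (- ((1 + (norm x)\<^sup>2) * s)))) \<partial>lborel) =
       ennreal (1 / Gamma k * sqrt pi ^ ?n) * ennreal (indicator {0<..} s * (s powr ((real k - real ?n / 2) - 1) * exp (- (1 * s))))"
    proof (cases "s > 0")
      case True
      have "(\<integral>\<^sup>+(x::'a). ennreal (1 / Gamma k) * ennreal (indicator {0<..} s * (s powr (real k - 1) * exp (- ((1 + (norm x)\<^sup>2) * s)))) \<partial>lborel) =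
         (\<integral>\<^sup>+(x::'a). ennreal (1 / Gamma k * (s powr (real k - 1) * exp (- s))) * ennreal (exp (- (s * (norm x)\<^sup>2))) \<partial>lborel)"
      proof (rule nn_integral_cong)
        fix x :: 'a
        have "exp (- ((1 + (norm x)\<^sup>2) * s)) = exp (- s) * exp (- (s * (norm x)\<^sup>2))" by (simp add: exp_add[symmetric] algebra_simps)
        then show "ennreal (1 / Gamma k) * ennreal (indicator {0<..} s * (s powr (real k - 1) * exp (- ((1 + (norm x)\<^sup>2) * s)))) =
          ennreal (1 / Gamma k * (s powr (real k - 1) * exp (- s))) * ennreal (exp (- (s * (norm x)\<^sup>2)))"
          using True Gamma_real_pos[OF k0] by (simp add: ennreal_mult[symmetric] mult_ac)
      qed
      also have "\<dots> = ennreal (1 / Gamma k * (s powr (real k - 1) * exp (- s))) * ennreal (sqrt (pi / s) ^ ?n)"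
        by (subst nn_integral_cmult) (auto simp: nn_integral_gauss[OF True])
      also have "\<dots> = ennreal (1 / Gamma k * sqrt pi ^ ?n) * ennreal (indicator {0<..} s * (s powr ((real k - real ?n / 2) - 1) * exp (- (1 * s))))"
      proof -
        have "sqrt s ^ ?n = s powr (real ?n / 2)"
          using True by (simp add: powr_half_sqrt[symmetric] powr_powr powr_realpow[symmetric])
        then have "s powr (real k - 1) * sqrt (pi / s) ^ ?n = sqrt pi ^ ?n * s powr ((real k - real ?n / 2) - 1)"
          using True by (simp add: real_sqrt_divide power_divide powr_diff mult_ac)
        then have "(1 / Gamma k * exp (- s)) * (s powr (real k - 1) * sqrt (pi / s) ^ ?n) = (1 / Gamma k * exp (- s)) * (sqrt pi ^ ?n * s powr ((real k - real ?n / 2) - 1))"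
          by (rule arg_cong)
        then have "1 / Gamma k * (s powr (real k - 1) * exp (- s)) * sqrt (pi / s) ^ ?n = 1 / Gamma k * sqrt pi ^ ?n * (s powr ((real k - real ?n / 2) - 1) * exp (- s))"
          by (simp only: mult_ac)
        then show ?thesis using True Gamma_real_pos[OF k0] by (simp add: ennreal_mult[symmetric])
      qed
      finally show ?thesis .
    qed simp
  qed
  also have "\<dots> < \<infinity>"
    using k by (subst nn_integral_cmult, measurable, subst nn_integral_powr_exp) (auto simp: ennreal_mult_less_top)
  finally show ?thesis by (auto simp: integrable_iff_bounded add_nonneg_nonneg)
qed

text \<open>The singular power |x|^(-q) is a gamma integral in t of Gaussians of rate t. Together
  with the given Gaussian this leaves (1 + t)^(-n/2) after integration over x, so q < n is the
  convergence condition of a beta integral.\<close>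

lemma integrable_norm_powr_gauss:
  assumes q: "0 < q" "q < real DIM('a)"
  shows "integrable lborel (\<lambda>x::'a::euclidean_space. norm x powr (- q) * exp (- (norm x)\<^sup>2))"
proof -
  let ?n = "DIM('a)"
  have q2: "q / 2 > 0" using q by simp
  have "(\<integral>\<^sup>+(x::'a). ennreal (norm x powr (- q) * exp (- (norm x)\<^sup>2)) \<partial>lborel) \<le>
     (\<integral>\<^sup>+(x::'a). (\<integral>\<^sup>+t. ennreal (1 / Gamma (q/2)) * ennreal (indicator {0<..} t * (t powr (q/2 - 1) * exp (- ((1 + t) * (norm x)\<^sup>2)))) \<partial>lborel) \<partial>lborel)"
  proof (rule nn_integral_mono)
    fix x :: 'a
    show "ennreal (norm x powr (- q) * exp (- (norm x)\<^sup>2)) \<le> (\<integral>\<^sup>+t. ennreal (1 / Gamma (q/2)) * ennreal (indicator {0<..} t * (t powr (q/2 - 1) * exp (- ((1 + t) * (norm x)\<^sup>2)))) \<partial>lborel)"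
    proof (cases "x = 0")
      case False
      then have p: "(norm x)\<^sup>2 > 0" by simp
      have "norm x powr (- q) = ((norm x)\<^sup>2) powr (- (q / 2))"
        using False by (simp add: powr_powr flip: powr_numeral)
      then have "ennreal (norm x powr (- q) * exp (- (norm x)\<^sup>2)) = ennreal (exp (- (norm x)\<^sup>2)) * ennreal (((norm x)\<^sup>2) powr (- (q / 2)))"
        by (simp add: ennreal_mult[symmetric] mult.commute)
      also have "\<dots> = (\<integral>\<^sup>+t. ennreal (exp (- (norm x)\<^sup>2)) * (ennreal (1 / Gamma (q/2)) * ennreal (indicator {0<..} t * (t powr (q/2 - 1) * exp (- ((norm x)\<^sup>2 * t))))) \<partial>lborel)"
        unfolding powr_conv_nn_integral[OF q2 p] by (simp add: nn_integral_cmult)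
      also have "\<dots> = (\<integral>\<^sup>+t. ennreal (1 / Gamma (q/2)) * ennreal (indicator {0<..} t * (t powr (q/2 - 1) * exp (- ((1 + t) * (norm x)\<^sup>2)))) \<partial>lborel)"
      proof (rule nn_integral_cong)
        fix t :: real
        have "exp (- ((1 + t) * (norm x)\<^sup>2)) = exp (- (norm x)\<^sup>2) * exp (- ((norm x)\<^sup>2 * t))" by (simp add: exp_add[symmetric] algebra_simps)
        then show "ennreal (exp (- (norm x)\<^sup>2)) * (ennreal (1 / Gamma (q/2)) * ennreal (indicator {0<..} t * (t powr (q/2 - 1) * exp (- ((norm x)\<^sup>2 * t)))))
          = ennreal (1 / Gamma (q/2)) * ennreal (indicator {0<..} t * (t powr (q/2 - 1) * exp (- ((1 + t) * (norm x)\<^sup>2))))"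
          using Gamma_real_pos[OF q2] by (simp add: ennreal_mult[symmetric] mult_ac)
      qed
      finally show ?thesis by simp
    qed simp
  qed
  also have "\<dots> = (\<integral>\<^sup>+t. (\<integral>\<^sup>+(x::'a). ennreal (1 / Gamma (q/2)) * ennreal (indicator {0<..} t * (t powr (q/2 - 1) * exp (- ((1 + t) * (norm x)\<^sup>2)))) \<partial>lborel) \<partial>lborel)"
    by (rule lborel_pair.Fubini'[symmetric]) measurable
  also have "\<dots> = (\<integral>\<^sup>+t. ennreal (1 / Gamma (q/2) * sqrt pi ^ ?n) * ennreal (indicator {0<..} t * (t powr (q/2 - 1) * (1 + t) powr (- (real ?n / 2)))) \<partial>lborel)"
  proof (rule nn_integral_cong)
    fix t :: real
    show "(\<integral>\<^sup>+(x::'a). ennreal (1 / Gamma (q/2)) * ennreal (indicator {0<..} t * (t powr (q/2 - 1) * exp (- ((1 + t) * (norm x)\<^sup>2)))) \<partial>lborel) =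
       ennreal (1 / Gamma (q/2) * sqrt pi ^ ?n) * ennreal (indicator {0<..} t * (t powr (q/2 - 1) * (1 + t) powr (- (real ?n / 2))))"
    proof (cases "t > 0")
      case True
      then have t1: "1 + t > 0" by simp
      have "(\<integral>\<^sup>+(x::'a). ennreal (1 / Gamma (q/2)) * ennreal (indicator {0<..} t * (t powr (q/2 - 1) * exp (- ((1 + t) * (norm x)\<^sup>2)))) \<partial>lborel) =
         (\<integral>\<^sup>+(x::'a). ennreal (1 / Gamma (q/2) * t powr (q/2 - 1)) * ennreal (exp (- ((1 + t) * (norm x)\<^sup>2))) \<partial>lborel)"
        using True Gamma_real_pos[OF q2] by (intro nn_integral_cong) (simp add: ennreal_mult[symmetric] mult_ac)
      also have "\<dots> = ennreal (1 / Gamma (q/2) * t powr (q/2 - 1)) * ennreal (sqrt (pi / (1 + t)) ^ ?n)"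
        by (subst nn_integral_cmult) (auto simp: nn_integral_gauss[OF t1])
      also have "\<dots> = ennreal (1 / Gamma (q/2) * sqrt pi ^ ?n) * ennreal (indicator {0<..} t * (t powr (q/2 - 1) * (1 + t) powr (- (real ?n / 2))))"
      proof -
        have "sqrt (pi / (1 + t)) ^ ?n = sqrt pi ^ ?n * (1 + t) powr (- (real ?n / 2))"
          by (rule sqrt_pi_div_power[OF t1])
        then have "1 / Gamma (q/2) * t powr (q/2 - 1) * sqrt (pi / (1 + t)) ^ ?n = 1 / Gamma (q/2) * sqrt pi ^ ?n * (t powr (q/2 - 1) * (1 + t) powr (- (real ?n / 2)))"
          by (simp only: mult_ac)
        then show ?thesis using True t1 Gamma_real_pos[OF q2] by (simp add: ennreal_mult[symmetric])
      qed
      finally show ?thesis .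
    qed simp
  qed
  also have "\<dots> < \<infinity>"
    using nn_integral_beta_prime[OF q2, of "real ?n / 2"] q
    by (subst nn_integral_cmult) (auto simp: ennreal_mult_less_top)
  finally show ?thesis by (auto simp: integrable_iff_bounded)
qed

text \<open>On the unit ball the Gaussian is at least exp (-1), hence the constant
  \<open>exp 1\<close>, and the Gaussian lemma covers the singularity. Outside the ball the power is
  at most 1 and the rational factor decides.\<close>

lemma integrable_norm_powr_decay:
  assumes q: "0 < q" "q < real DIM('a)" and k: "DIM('a) < 2 * k"
  shows "integrable lborel (\<lambda>x::'a::euclidean_space. norm x powr (- q) / (1 + (norm x)\<^sup>2) ^ k)"
proof (rule Bochner_Integration.integrable_bound)
  show "integrable lborel (\<lambda>x::'a. exp 1 * (norm x powr (- q) * exp (- (norm x)\<^sup>2)) + 1 / (1 + (norm x)\<^sup>2) ^ k)"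
    by (intro Bochner_Integration.integrable_add integrable_mult_right integrable_norm_powr_gauss q integrable_inverse_one_plus_norm k)
  have "norm x powr (- q) / (1 + (norm x)\<^sup>2) ^ k \<le> exp 1 * (norm x powr (- q) * exp (- (norm x)\<^sup>2)) + 1 / (1 + (norm x)\<^sup>2) ^ k" for x :: 'a
  proof (cases "norm x \<le> 1")
    case True
    have "norm x powr (- q) / (1 + (norm x)\<^sup>2) ^ k \<le> norm x powr (- q) * 1"
      using divide_left_mono[of 1 "(1 + (norm x)\<^sup>2) ^ k" "norm x powr (- q)"] by (simp add: one_le_power add_pos_nonneg)
    also have "\<dots> \<le> norm x powr (- q) * (exp 1 * exp (- (norm x)\<^sup>2))"
      using True by (intro mult_left_mono) (auto simp: exp_add[symmetric] power_le_one)
    finally have "norm x powr (- q) / (1 + (norm x)\<^sup>2) ^ k \<le> exp 1 * (norm x powr (- q) * exp (- (norm x)\<^sup>2))" by (simp add: mult_ac)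
    then show ?thesis by (rule order_trans) (simp add: add_nonneg_nonneg)
  next
    case False
    then have "norm x powr (- q) \<le> 1" using q powr_mono[of "-q" 0 "norm x"] by (cases "x = 0") auto
    then have "norm x powr (- q) / (1 + (norm x)\<^sup>2) ^ k \<le> 1 / (1 + (norm x)\<^sup>2) ^ k"
      by (intro divide_right_mono) auto
    then show ?thesis by (rule order_trans) simp
  qed
  then show "AE x::'a in lborel. norm (norm x powr (- q) / (1 + (norm x)\<^sup>2) ^ k) \<le>
      norm (exp 1 * (norm x powr (- q) * exp (- (norm x)\<^sup>2)) + 1 / (1 + (norm x)\<^sup>2) ^ k)"
    by (intro AE_I2) (auto simp: add_nonneg_nonneg intro!: order_trans[OF _ abs_ge_self])
qed measurable

section \<open>The Fourier transform of an ellipsoidal norm\<close>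

text \<open>A positive power has no representation as a gamma integral of exponentials; it is a
  superposition of 1 - exp (- s y). One writes this difference as s times the integral of exp (- v
  s) over v from 0 to y and exchanges the order, which leaves Gamma (1/2) v^(-1/2).\<close>

lemma nn_integral_sqrt:
  assumes y: "y \<ge> (0::real)"
  shows "(\<integral>\<^sup>+s. ennreal (indicator {0<..} s * (s powr (- 3/2) * (1 - exp (- (s * y))))) \<partial>lborel) = ennreal (2 * sqrt pi * sqrt y)"
proof -
  have "(\<integral>\<^sup>+s. ennreal (indicator {0<..} s * (s powr (- 3/2) * (1 - exp (- (s * y))))) \<partial>lborel) =
      (\<integral>\<^sup>+s. (\<integral>\<^sup>+v. ennreal (indicator {0<..} s * (s powr (1/2 - 1) * exp (- (v * s)))) * indicator {0..y} v \<partial>lborel) \<partial>lborel)"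
  proof (rule nn_integral_cong)
    fix s :: real
    show "ennreal (indicator {0<..} s * (s powr (- 3/2) * (1 - exp (- (s * y))))) =
      (\<integral>\<^sup>+v. ennreal (indicator {0<..} s * (s powr (1/2 - 1) * exp (- (v * s)))) * indicator {0..y} v \<partial>lborel)"
    proof (cases "s > 0")
      case True
      have p: "s powr (1/2 - 1) / s = s powr (- 3/2)"
        using True powr_diff[of s "1/2 - 1" 1] by simp
      have "(\<integral>\<^sup>+v. ennreal (s powr (1/2 - 1) * exp (- (v * s))) * indicator {0..y} v \<partial>lborel) =
          ennreal (- (s powr (1/2 - 1) / s) * exp (- (y * s)) - (- (s powr (1/2 - 1) / s) * exp (- (0 * s))))"
        using y True by (intro nn_integral_FTC_Icc) (auto intro!: derivative_eq_intros)
      also have "\<dots> = ennreal (s powr (- 3/2) * (1 - exp (- (s * y))))"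
        unfolding p by (simp add: algebra_simps)
      finally show ?thesis using True by simp
    qed simp
  qed
  also have "\<dots> = (\<integral>\<^sup>+v. (\<integral>\<^sup>+s. ennreal (indicator {0<..} s * (s powr (1/2 - 1) * exp (- (v * s)))) * indicator {0..y} v \<partial>lborel) \<partial>lborel)"
    by (rule lborel_pair.Fubini'[symmetric]) measurable
  also have "\<dots> = (\<integral>\<^sup>+v. ennreal (sqrt pi * (indicator {0..y} v * v powr (- 1/2))) \<partial>lborel)"
  proof (rule nn_integral_cong_AE)
    show "AE v in lborel. (\<integral>\<^sup>+s. ennreal (indicator {0<..} s * (s powr (1/2 - 1) * exp (- (v * s)))) * indicator {0..y} v \<partial>lborel) = ennreal (sqrt pi * (indicator {0..y} v * v powr (- 1/2)))"
      using AE_lborel_singleton[of "0::real"]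
    proof eventually_elim
      case (elim v)
      show ?case
      proof (cases "v \<in> {0..y}")
        case True
        then have v: "v > 0" using elim by auto
        have "(\<integral>\<^sup>+s. ennreal (indicator {0<..} s * (s powr (1/2 - 1) * exp (- (v * s)))) \<partial>lborel) = ennreal (Gamma (1/2) / v powr (1/2))"
          by (rule nn_integral_powr_exp) (use v in auto)
        moreover have "Gamma (1/2) / v powr (1/2) = sqrt pi * v powr (- 1/2)"
          using powr_minus_divide[of v "1/2"] by (simp add: Gamma_one_half_real)
        ultimately show ?thesis using True by simp
      qed simp
    qed
  qed
  also have "\<dots> = ennreal (sqrt pi) * (\<integral>\<^sup>+v. ennreal (indicator {0..y} v * v powr (- 1/2)) \<partial>lborel)"
    by (simp add: ennreal_mult nn_integral_cmult)
  also have "(\<integral>\<^sup>+v. ennreal (indicator {0..y} v * v powr (- 1/2)) \<partial>lborel) = ennreal (y powr (1/2) / (1/2))"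
    using nn_integral_has_integral_lebesgue[OF _ has_integral_powr_from_0[of "-1/2" y]] y by simp
  also have "ennreal (sqrt pi) * ennreal (y powr (1/2) / (1/2)) = ennreal (2 * sqrt pi * sqrt y)"
    using y by (simp add: ennreal_mult[symmetric] powr_half_sqrt mult_ac)
  finally show ?thesis .
qed

lemma test_function_off_originD:
  assumes "test_function_off_origin \<phi>"
  shows "smooth_compact \<phi>" "\<exists>\<rho>>0. \<forall>x. \<phi> x \<noteq> 0 \<longrightarrow> \<rho> \<le> norm x"
proof -
  let ?S = "closure {x. \<phi> x \<noteq> 0}"
  have c: "compact ?S" "0 \<notin> ?S" and k: "\<forall>k. continuously_differentiable k \<phi>"
    using assms by (auto simp: test_function_off_origin_def)
  have sub: "x \<in> ?S" if "\<phi> x \<noteq> 0" for x using that by (intro subsetD[OF closure_subset]) simp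
  obtain R where R: "\<And>x. x \<in> ?S \<Longrightarrow> norm x \<le> R" using compact_imp_bounded[OF c(1)] unfolding bounded_iff by blast
  have "\<phi> x = 0" if "norm x > max R 1" for x
  proof (rule ccontr)
    assume "\<phi> x \<noteq> 0"
    then have "norm x \<le> R" by (intro R sub)
    then show False using that by simp
  qed
  then show "smooth_compact \<phi>" using k unfolding smooth_compact_def by (intro conjI exI[of _ "max R 1"]) auto
  have "open (- ?S)" "0 \<in> - ?S" using c by auto
  then obtain \<rho> where "\<rho> > 0" "ball 0 \<rho> \<subseteq> - ?S" using open_contains_ball by metis
  then have "\<rho> \<le> norm x" if "\<phi> x \<noteq> 0" for x using sub[OF that] by (force simp: subset_eq)
  then show "\<exists>\<rho>>0. \<forall>x. \<phi> x \<noteq> 0 \<longrightarrow> \<rho> \<le> norm x" using \<open>\<rho> > 0\<close> by auto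
qed

lemma power_over_fact_le_exp:
  assumes "0 \<le> (x::real)"
  shows "x ^ n / fact n \<le> exp x"
proof -
  have s: "(\<lambda>k. x ^ k /\<^sub>R fact k) sums exp x" by (rule exp_converges)
  have "(\<Sum>k\<in>{n}. x ^ k /\<^sub>R fact k) \<le> (\<Sum>k. x ^ k /\<^sub>R fact k)"
    using s assms by (intro sum_le_suminf) (auto simp: sums_iff)
  then have "x ^ n /\<^sub>R fact n \<le> exp x" using s by (simp add: sums_iff)
  then show ?thesis by (simp add: divide_inverse mult.commute)
qed

text \<open>The norm sqrt D is a superposition of 1 - exp (- s D). The constant 1 is invisible to
  test functions supported away from the origin, and exp (- s D) transforms into a multiple of
  s^(-n/2) exp (- E / (4 s)), where E is the form inverse to D. The remaining integral over s is an
  inverse gamma integral, which produces the power -(n+1)/2 of E and the negative sign.\<close>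

lemma fourier_ellipsoidal_norm:
  fixes e :: "'a::euclidean_space" and \<phi> :: "'a \<Rightarrow> complex"
  assumes e: "e \<in> Basis" and c: "c > 0" and d: "d > 0" and \<phi>: "test_function_off_origin \<phi>"
  defines "D \<equiv> \<lambda>x. c * (x \<bullet> e)\<^sup>2 + d * perp2 e x" and "E \<equiv> \<lambda>\<xi>. (\<xi> \<bullet> e)\<^sup>2 / c + perp2 e \<xi> / d"
    and "a \<equiv> (real DIM('a) + 1) / 2"
  shows "(\<integral>x. of_real (sqrt (D x)) * fourier \<phi> x \<partial>lborel) =
    (\<integral>\<xi>. of_real (- (1 / (2 * sqrt pi) * (sqrt (pi / c) * sqrt (pi / d) ^ (DIM('a) - 1)) * (Gamma a / (E \<xi> / 4) powr a))) * \<phi> \<xi> \<partial>lborel)"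
proof -
  let ?n = "DIM('a)"
  have sc: "smooth_compact \<phi>" by (rule test_function_off_originD[OF \<phi>])
  obtain \<rho> where \<rho>: "\<rho> > 0" "\<And>x. \<phi> x \<noteq> 0 \<Longrightarrow> \<rho> \<le> norm x" using test_function_off_originD(2)[OF \<phi>] by auto
  have i\<phi>: "integrable lborel \<phi>" by (rule smooth_compact_integrable[OF sc])
  have [measurable]: "\<phi> \<in> borel_measurable borel" using i\<phi> by (auto dest: borel_measurable_integrable)
  have [measurable]: "D \<in> borel_measurable borel" "E \<in> borel_measurable borel"
    unfolding D_def E_def by measurable
  have a0: "a > 0" by (simp add: a_def)
  have p0: "0 \<le> perp2 e x" for x by (rule perp2_nonneg[OF e])
  have D0: "0 \<le> D x" for x using c d p0[of x] by (simp add: D_def)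
  have Dle: "D x \<le> max c d * (norm x)\<^sup>2" for x
    unfolding D_def norm2_eq_perp2[of x e] distrib_left using p0[of x] by (intro add_mono mult_right_mono) auto
  have Ege: "(norm \<xi>)\<^sup>2 / max c d \<le> E \<xi>" for \<xi>
    unfolding E_def norm2_eq_perp2[of \<xi> e] add_divide_distrib
    using p0[of \<xi>] c d by (intro add_mono divide_left_mono) auto
  define r where "r = \<rho>\<^sup>2 / max c d"
  have r0: "r > 0" using \<rho> c d by (simp add: r_def)
  have Er: "r \<le> E \<xi>" if "\<phi> \<xi> \<noteq> 0" for \<xi>
  proof -
    have "\<rho>\<^sup>2 / max c d \<le> (norm \<xi>)\<^sup>2 / max c d"
      using \<rho>(2)[OF that] \<rho>(1) c d by (intro divide_right_mono power_mono) auto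
    then show ?thesis using Ege[of \<xi>] by (simp add: r_def)
  qed
  \<comment> \<open>One of the n + 1 powers absorbs the growth of sqrt D, and the remaining n are
    enough for integrability since n < 2 n.\<close>
  obtain C where C: "C \<ge> 0" "\<And>\<xi>. norm (fourier \<phi> \<xi>) \<le> C / (1 + (norm \<xi>)\<^sup>2) ^ (?n + 1)"
    using fourier_decay[OF sc, of "?n + 1"] by auto
  define K where "K = sqrt (pi / c) * sqrt (pi / d) ^ (?n - 1)"
  have K0: "K > 0" using c d by (simp add: K_def)
  define g where "g = (\<lambda>s \<xi>. K * (s powr (- (real ?n / 2)) * exp (- (E \<xi> / (4 * s)))))"
  have [measurable]: "(\<lambda>(s, \<xi>). g s \<xi>) \<in> borel_measurable (lborel \<Otimes>\<^sub>M lborel)" unfolding g_def by measurable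
  have g0: "0 \<le> g s \<xi>" for s \<xi> using K0 by (simp add: g_def)
  have gauss: "(\<integral>x. of_real (exp (- (s * D x))) * fourier \<phi> x \<partial>lborel) = (\<integral>\<xi>. of_real (g s \<xi>) * \<phi> \<xi> \<partial>lborel)"
    and igauss: "integrable lborel (\<lambda>x. of_real (exp (- (s * D x))) * fourier \<phi> x)" if s: "s > 0" for s
  proof -
    have hb: "has_bochner_integral lborel (\<lambda>x. complex_of_real (exp (- (s * D x))) * exp (- (\<i> * of_real (x \<bullet> \<xi>)))) (of_real (g s \<xi>))" for \<xi>
    proof -
      have eq1: "(s * c) * (x \<bullet> e)\<^sup>2 + (s * d) * perp2 e x = s * D x" for x by (simp add: D_def algebra_simps)
      have eq2: "(\<xi> \<bullet> e)\<^sup>2 / (4 * (s * c)) + perp2 e \<xi> / (4 * (s * d)) = E \<xi> / (4 * s)"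
        using s c d by (simp add: E_def field_simps)
      have eq3: "sqrt (pi / (s * c)) * sqrt (pi / (s * d)) ^ (?n - 1) = K * s powr (- (real ?n / 2))"
      proof -
        have split: "sqrt (pi / (s * t)) = sqrt (pi / t) * sqrt (1 / s)" if "t > 0" for t
          unfolding real_sqrt_mult[symmetric] by (simp add: mult.commute)
        have "sqrt (1 / s) = s powr (- (1/2))" using s by (simp add: real_sqrt_divide powr_minus_divide powr_half_sqrt)
        then have "sqrt (1 / s) ^ ?n = s powr (- (real ?n / 2))"
          using s by (simp add: powr_realpow[symmetric] powr_powr)
        moreover have "sqrt (1 / s) ^ ?n = sqrt (1 / s) * sqrt (1 / s) ^ (?n - 1)"
          by (metis DIM_positive power_eq_if less_irrefl)
        ultimately show ?thesis unfolding K_def split[OF c] split[OF d] power_mult_distrib by (simp add: mult_ac)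
      qed
      show ?thesis
        using gauss_fourier[OF e, of "s * c" "s * d" \<xi>] s c d unfolding eq1 eq2 eq3 g_def by (simp add: mult.assoc)
    qed
    have iD: "integrable lborel (\<lambda>x. exp (- (s * D x)))"
      using hb[of 0] by (auto simp: has_bochner_integral_iff dest!: integrable_Re)
    show "(\<integral>x. of_real (exp (- (s * D x))) * fourier \<phi> x \<partial>lborel) = (\<integral>\<xi>. of_real (g s \<xi>) * \<phi> \<xi> \<partial>lborel)"
      using fourier_duality[OF iD i\<phi>] hb by (simp add: fourier_def has_bochner_integral_iff)
    show "integrable lborel (\<lambda>x. of_real (exp (- (s * D x))) * fourier \<phi> x)"
      by (rule Bochner_Integration.integrable_bound[OF integrable_mult_left[OF iD, of "\<integral>x. norm (\<phi> x) \<partial>lborel"]])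
         (auto simp: norm_mult abs_mult intro!: AE_I2 norm_fourier_le)
  qed
  have ifour: "integrable lborel (fourier \<phi>)"
  proof (rule Bochner_Integration.integrable_bound)
    show "integrable lborel (\<lambda>x::'a. C * (1 / (1 + (norm x)\<^sup>2) ^ (?n + 1)))"
      by (intro integrable_mult_right integrable_inverse_one_plus_norm) simp
    show "AE x in lborel. norm (fourier \<phi> x) \<le> norm (C * (1 / (1 + (norm x)\<^sup>2) ^ (?n + 1)))"
      using C(1) by (intro AE_I2 order_trans[OF C(2)]) simp
  qed simp
  \<comment> \<open>This is \<phi> 0 = 0 in disguise. It is obtained without Fourier inversion: the
    integral is the limit, as s tends to 0, of pairings of exp (- s D) with the transform of \<phi>,
    and these are pairings of \<phi> with Gaussians that vanish in the limit on its support, where E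
    \<ge> r.\<close>
  have zero: "(\<integral>x. fourier \<phi> x \<partial>lborel) = 0"
  proof -
    define s where "s = (\<lambda>k::nat. 1 / real (Suc k))"
    have s: "s k > 0" for k by (simp add: s_def)
    have lim1: "(\<lambda>k. \<integral>x. of_real (exp (- (s k * D x))) * fourier \<phi> x \<partial>lborel) \<longlonglongrightarrow> (\<integral>x. fourier \<phi> x \<partial>lborel)"
    proof (rule integral_dominated_convergence)
      show "integrable lborel (\<lambda>x. norm (fourier \<phi> x))" using ifour by simp
      have "s \<longlonglongrightarrow> 0" unfolding s_def by (rule LIMSEQ_Suc[OF lim_1_over_n])
      then show "AE x in lborel. (\<lambda>k. of_real (exp (- (s k * D x))) * fourier \<phi> x) \<longlonglongrightarrow> fourier \<phi> x"
        by (intro AE_I2) (auto intro!: tendsto_eq_intros)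
      show "AE x in lborel. norm (of_real (exp (- (s k * D x))) * fourier \<phi> x) \<le> norm (fourier \<phi> x)" for k
      proof (rule AE_I2)
        fix x
        have "exp (- (s k * D x)) \<le> 1" using s[of k] D0[of x] by simp
        then show "norm (of_real (exp (- (s k * D x))) * fourier \<phi> x) \<le> norm (fourier \<phi> x)"
          by (simp add: norm_mult mult_left_le_one_le)
      qed
    qed measurable
    define B where "B = K * (fact ?n * (4 / r) ^ ?n) * (\<integral>\<xi>. norm (\<phi> \<xi>) \<partial>lborel)"
    have bnd: "norm (\<integral>x. of_real (exp (- (s k * D x))) * fourier \<phi> x \<partial>lborel) \<le> B * s k powr (real ?n / 2)" for k
    proof -
      have gb: "g (s k) \<xi> \<le> K * (fact ?n * (4 / r) ^ ?n) * s k powr (real ?n / 2)" if "\<phi> \<xi> \<noteq> 0" for \<xi>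
      proof -
        define y where "y = E \<xi> / (4 * s k)"
        have yr: "y \<ge> r / (4 * s k)" using Er[OF that] s[of k] by (simp add: y_def divide_right_mono)
        have r4: "r / (4 * s k) > 0" using r0 s[of k] by simp
        \<comment> \<open>The exponential yields s^n, which outweighs the factor s^(-n/2) of the
          transformed Gaussian.\<close>
        have "exp (- y) \<le> fact ?n / (r / (4 * s k)) ^ ?n"
        proof -
          have "(r / (4 * s k)) ^ ?n / fact ?n \<le> exp y"
            using power_over_fact_le_exp[of "r / (4 * s k)" ?n] r4 yr by (meson exp_le_cancel_iff less_imp_le order_trans)
          then have "inverse (exp y) \<le> inverse ((r / (4 * s k)) ^ ?n / fact ?n)"
            using r4 by (intro le_imp_inverse_le) auto
          then show ?thesis by (simp add: exp_minus)
        qed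
        also have "\<dots> = fact ?n * (4 / r) ^ ?n * s k ^ ?n"
          using r0 s[of k] by (simp add: power_divide power_mult_distrib field_simps)
        finally have "g (s k) \<xi> \<le> K * (s k powr (- (real ?n / 2)) * (fact ?n * (4 / r) ^ ?n * s k ^ ?n))"
          unfolding g_def y_def[symmetric] using K0 by (intro mult_left_mono) auto
        also have "\<dots> = K * (fact ?n * (4 / r) ^ ?n) * (s k powr (- (real ?n / 2)) * s k powr real ?n)"
          using s[of k] by (simp add: powr_realpow)
        also have "s k powr (- (real ?n / 2)) * s k powr real ?n = s k powr (real ?n / 2)"
          unfolding powr_add[symmetric] by simp
        finally show ?thesis .
      qed
      have "norm (\<integral>\<xi>. of_real (g (s k) \<xi>) * \<phi> \<xi> \<partial>lborel) \<le> (\<integral>\<xi>. norm (of_real (g (s k) \<xi>) * \<phi> \<xi>) \<partial>lborel)"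
        by (rule integral_norm_bound)
      also have "\<dots> \<le> (\<integral>\<xi>. (K * (fact ?n * (4 / r) ^ ?n) * s k powr (real ?n / 2)) * norm (\<phi> \<xi>) \<partial>lborel)"
      proof (rule integral_mono')
        show "integrable lborel (\<lambda>\<xi>. (K * (fact ?n * (4 / r) ^ ?n) * s k powr (real ?n / 2)) * norm (\<phi> \<xi>))"
          using i\<phi> by simp
        fix \<xi> :: 'a
        show "norm (of_real (g (s k) \<xi>) * \<phi> \<xi>) \<le> (K * (fact ?n * (4 / r) ^ ?n) * s k powr (real ?n / 2)) * norm (\<phi> \<xi>)"
          using gb[of \<xi>] g0[of "s k" \<xi>] by (cases "\<phi> \<xi> = 0") (auto simp: norm_mult intro!: mult_right_mono)
      qed (use K0 r0 in simp)
      finally show ?thesis unfolding gauss[OF s] by (simp add: B_def mult_ac)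
    qed
    have "(\<lambda>k. B * s k powr (real ?n / 2)) \<longlonglongrightarrow> 0"
    proof -
      have "s \<longlonglongrightarrow> 0" unfolding s_def by (rule LIMSEQ_Suc[OF lim_1_over_n])
      then have "(\<lambda>k. s k powr (real ?n / 2)) \<longlonglongrightarrow> 0 powr (real ?n / 2)"
        by (intro tendsto_powr') (auto simp: s_def)
      from tendsto_mult_left[OF this, of B] show ?thesis by simp
    qed
    then have "(\<lambda>k. \<integral>x. of_real (exp (- (s k * D x))) * fourier \<phi> x \<partial>lborel) \<longlonglongrightarrow> 0"
      by (rule Lim_null_comparison[rotated]) (simp add: bnd)
    then show ?thesis using lim1 LIMSEQ_unique by blast
  qed
  define h where "h = (\<lambda>s x. 1 / (2 * sqrt pi) * (indicator {0<..} s * (s powr (- 3/2) * (1 - exp (- (s * D x))))))"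
  have [measurable]: "(\<lambda>(x, s). h s x) \<in> borel_measurable (lborel \<Otimes>\<^sub>M lborel)" unfolding h_def by measurable
  have h0: "0 \<le> h s x" for s x using D0[of x] by (auto simp: h_def indicator_def)
  have hD: "(\<integral>\<^sup>+s. ennreal (h s x) \<partial>lborel) = ennreal (sqrt (D x))" for x
  proof -
    have "(\<integral>\<^sup>+s. ennreal (h s x) \<partial>lborel) = ennreal (1 / (2 * sqrt pi)) * ennreal (2 * sqrt pi * sqrt (D x))"
      unfolding h_def nn_integral_sqrt[OF D0, symmetric]
      by (subst nn_integral_cmult[symmetric], measurable) (intro nn_integral_cong ennreal_mult', simp)
    then show ?thesis by (simp add: ennreal_mult[symmetric] D0)
  qed
  have hD': "(\<integral>s. h s x \<partial>lborel) = sqrt (D x)" for x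
  proof -
    have "(\<lambda>s. h s x) \<in> borel_measurable lborel" unfolding h_def by measurable
    then have "(\<integral>s. h s x \<partial>lborel) = enn2real (\<integral>\<^sup>+s. ennreal (h s x) \<partial>lborel)"
      by (intro integral_eq_nn_integral) (auto simp: h0)
    then show ?thesis by (simp add: hD D0)
  qed
  have int1: "integrable (lborel \<Otimes>\<^sub>M lborel) (\<lambda>(x, s). of_real (h s x) * fourier \<phi> x)"
    unfolding integrable_iff_bounded
  proof
    show "(\<lambda>(x, s). of_real (h s x) * fourier \<phi> x) \<in> borel_measurable (lborel \<Otimes>\<^sub>M lborel)" by measurable
    have "(\<integral>\<^sup>+p. ennreal (norm (case p of (x, s) \<Rightarrow> of_real (h s x) * fourier \<phi> x)) \<partial>(lborel \<Otimes>\<^sub>M lborel)) =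
        (\<integral>\<^sup>+x. (\<integral>\<^sup>+s. ennreal (h s x) * ennreal (norm (fourier \<phi> x)) \<partial>lborel) \<partial>lborel)"
      by (subst lborel.nn_integral_fst[symmetric]) (auto simp: norm_mult ennreal_mult h0)
    also have "\<dots> = (\<integral>\<^sup>+x. ennreal (sqrt (D x) * norm (fourier \<phi> x)) \<partial>lborel)"
    proof (rule nn_integral_cong)
      fix x
      have "(\<integral>\<^sup>+s. ennreal (h s x) * ennreal (norm (fourier \<phi> x)) \<partial>lborel) = (\<integral>\<^sup>+s. ennreal (h s x) \<partial>lborel) * ennreal (norm (fourier \<phi> x))"
        by (rule nn_integral_multc) (simp add: h_def)
      then show "(\<integral>\<^sup>+s. ennreal (h s x) * ennreal (norm (fourier \<phi> x)) \<partial>lborel) = ennreal (sqrt (D x) * norm (fourier \<phi> x))"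
        by (simp add: hD ennreal_mult D0)
    qed
    also have "\<dots> \<le> (\<integral>\<^sup>+(x::'a). ennreal (sqrt (max c d) * C * (1 / (1 + (norm x)\<^sup>2) ^ ?n)) \<partial>lborel)"
    proof (intro nn_integral_mono ennreal_leI)
      fix x :: 'a
      have "sqrt (D x) \<le> sqrt (max c d * (norm x)\<^sup>2)" by (rule real_sqrt_le_mono[OF Dle])
      also have "\<dots> = sqrt (max c d) * norm x" by (simp add: real_sqrt_mult)
      also have "\<dots> \<le> sqrt (max c d) * (1 + (norm x)\<^sup>2)"
      proof (intro mult_left_mono)
        have "0 \<le> (norm x - 1)\<^sup>2" by simp
        then have "2 * norm x \<le> 1 + (norm x)\<^sup>2" by (simp add: power2_diff)
        then show "norm x \<le> 1 + (norm x)\<^sup>2" using norm_ge_zero[of x] by linarith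
      qed (use c in simp)
      finally have "sqrt (D x) * norm (fourier \<phi> x) \<le> (sqrt (max c d) * (1 + (norm x)\<^sup>2)) * (C / (1 + (norm x)\<^sup>2) ^ (?n + 1))"
        using C c D0[of x] by (intro mult_mono) auto
      also have "\<dots> = sqrt (max c d) * C * (1 / (1 + (norm x)\<^sup>2) ^ ?n)"
      proof -
        have "1 + (norm x)\<^sup>2 \<noteq> 0" by (simp add: add_nonneg_eq_0_iff)
        then show ?thesis by simp
      qed
      finally show "sqrt (D x) * norm (fourier \<phi> x) \<le> sqrt (max c d) * C * (1 / (1 + (norm x)\<^sup>2) ^ ?n)" .
    qed
    also have "\<dots> < \<infinity>"
    proof -
      have "integrable lborel (\<lambda>x::'a. sqrt (max c d) * C * (1 / (1 + (norm x)\<^sup>2) ^ ?n))"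
        by (intro integrable_mult_right integrable_inverse_one_plus_norm) simp
      then show ?thesis using C(1) c by (subst nn_integral_eq_integral) (auto simp: add_nonneg_nonneg)
    qed
    finally show "(\<integral>\<^sup>+p. ennreal (norm (case p of (x, s) \<Rightarrow> of_real (h s x) * fourier \<phi> x)) \<partial>(lborel \<Otimes>\<^sub>M lborel)) < \<infinity>" .
  qed
  define k where "k = (\<lambda>s \<xi>. 1 / (2 * sqrt pi) * K * (indicator {0<..} s * (s powr (- a - 1) * exp (- ((E \<xi> / 4) / s)))))"
  have [measurable]: "(\<lambda>(s, \<xi>). k s \<xi>) \<in> borel_measurable (lborel \<Otimes>\<^sub>M lborel)" unfolding k_def by measurable
  have k0: "0 \<le> k s \<xi>" for s \<xi> using K0 by (simp add: k_def)
  \<comment> \<open>The exponent a = (n+1)/2 arises here: s^(-3/2) from the square root and s^(-n/2)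
    from the Gaussian make s^(-a-1).\<close>
  have kg: "k s \<xi> = 1 / (2 * sqrt pi) * (indicator {0<..} s * s powr (- 3/2)) * g s \<xi>" for s \<xi>
  proof -
    have "s powr (- a - 1) = s powr (- 3/2) * s powr (- (real ?n / 2))"
      unfolding powr_add[symmetric] by (rule arg_cong[of _ _ "\<lambda>r. s powr r"]) (simp add: a_def field_simps)
    then show ?thesis by (simp add: k_def g_def mult_ac)
  qed
  have hbk: "has_bochner_integral lborel (\<lambda>s. k s \<xi>) (1 / (2 * sqrt pi) * K * (Gamma a / (E \<xi> / 4) powr a))" if "E \<xi> > 0" for \<xi>
    unfolding k_def using that by (intro has_bochner_integral_mult_right has_bochner_integral_inverse_gamma a0) auto
  have int2: "integrable (lborel \<Otimes>\<^sub>M lborel) (\<lambda>(s, \<xi>). of_real (k s \<xi>) * \<phi> \<xi>)"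
    unfolding integrable_iff_bounded
  proof
    show "(\<lambda>(s, \<xi>). of_real (k s \<xi>) * \<phi> \<xi>) \<in> borel_measurable (lborel \<Otimes>\<^sub>M lborel)" by measurable
    have "(\<integral>\<^sup>+p. ennreal (norm (case p of (s, \<xi>) \<Rightarrow> of_real (k s \<xi>) * \<phi> \<xi>)) \<partial>(lborel \<Otimes>\<^sub>M lborel)) =
        (\<integral>\<^sup>+\<xi>. (\<integral>\<^sup>+s. ennreal (k s \<xi>) * ennreal (norm (\<phi> \<xi>)) \<partial>lborel) \<partial>lborel)"
      by (subst lborel_pair.nn_integral_snd[symmetric]) (auto simp: norm_mult ennreal_mult k0)
    also have "\<dots> \<le> (\<integral>\<^sup>+\<xi>. ennreal (1 / (2 * sqrt pi) * K * (Gamma a / (r / 4) powr a) * norm (\<phi> \<xi>)) \<partial>lborel)"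
    proof (rule nn_integral_mono)
      fix \<xi>
      show "(\<integral>\<^sup>+s. ennreal (k s \<xi>) * ennreal (norm (\<phi> \<xi>)) \<partial>lborel) \<le> ennreal (1 / (2 * sqrt pi) * K * (Gamma a / (r / 4) powr a) * norm (\<phi> \<xi>))"
      proof (cases "\<phi> \<xi> = 0")
        case False
        then have E0: "E \<xi> > 0" and rE: "r \<le> E \<xi>" using Er[of \<xi>] r0 by auto
        have "(\<integral>\<^sup>+s. ennreal (k s \<xi>) * ennreal (norm (\<phi> \<xi>)) \<partial>lborel) = (\<integral>\<^sup>+s. ennreal (k s \<xi>) \<partial>lborel) * ennreal (norm (\<phi> \<xi>))"
          by (rule nn_integral_multc) (simp add: k_def)
        also have "(\<integral>\<^sup>+s. ennreal (k s \<xi>) \<partial>lborel) = ennreal (1 / (2 * sqrt pi) * K * (Gamma a / (E \<xi> / 4) powr a))"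
          using hbk[OF E0] k0 by (subst nn_integral_eq_integral) (auto simp: has_bochner_integral_iff)
        also have "\<dots> * ennreal (norm (\<phi> \<xi>)) = ennreal (1 / (2 * sqrt pi) * K * (Gamma a / (E \<xi> / 4) powr a) * norm (\<phi> \<xi>))"
          by (rule ennreal_mult''[symmetric]) simp
        also have "\<dots> \<le> ennreal (1 / (2 * sqrt pi) * K * (Gamma a / (r / 4) powr a) * norm (\<phi> \<xi>))"
          using r0 rE K0 a0 Gamma_real_pos[OF a0]
          by (intro ennreal_leI mult_right_mono mult_left_mono divide_left_mono powr_mono2) auto
        finally show ?thesis .
      qed simp
    qed
    also have "\<dots> < \<infinity>"
      using i\<phi> K0 Gamma_real_pos[OF a0] by (subst nn_integral_eq_integral) auto
    finally show "(\<integral>\<^sup>+p. ennreal (norm (case p of (s, \<xi>) \<Rightarrow> of_real (k s \<xi>) * \<phi> \<xi>)) \<partial>(lborel \<Otimes>\<^sub>M lborel)) < \<infinity>" .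
  qed
  have "(\<integral>x. of_real (sqrt (D x)) * fourier \<phi> x \<partial>lborel) = (\<integral>x. (\<integral>s. of_real (h s x) * fourier \<phi> x \<partial>lborel) \<partial>lborel)"
    by (simp add: hD')
  also have "\<dots> = (\<integral>s. (\<integral>x. of_real (h s x) * fourier \<phi> x \<partial>lborel) \<partial>lborel)"
    by (rule lborel_pair.Fubini_integral[symmetric, OF int1])
  also have "\<dots> = (\<integral>s. - (\<integral>\<xi>. of_real (k s \<xi>) * \<phi> \<xi> \<partial>lborel) \<partial>lborel)"
  proof (intro Bochner_Integration.integral_cong refl)
    fix s :: real
    show "(\<integral>x. of_real (h s x) * fourier \<phi> x \<partial>lborel) = - (\<integral>\<xi>. of_real (k s \<xi>) * \<phi> \<xi> \<partial>lborel)"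
    proof (cases "s > 0")
      case True
      define q where "q = 1 / (2 * sqrt pi) * s powr (- 3/2)"
      have "(\<integral>x. of_real (h s x) * fourier \<phi> x \<partial>lborel) = (\<integral>x. of_real q * (fourier \<phi> x - of_real (exp (- (s * D x))) * fourier \<phi> x) \<partial>lborel)"
        using True by (intro Bochner_Integration.integral_cong refl) (simp add: h_def q_def right_diff_distrib left_diff_distrib mult_ac diff_divide_distrib)
      also have "\<dots> = of_real q * ((\<integral>x. fourier \<phi> x \<partial>lborel) - (\<integral>x. of_real (exp (- (s * D x))) * fourier \<phi> x \<partial>lborel))"
        using ifour igauss[OF True] by simp
      also have "\<dots> = - (of_real q * (\<integral>\<xi>. of_real (g s \<xi>) * \<phi> \<xi> \<partial>lborel))"
        by (simp add: zero gauss[OF True])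
      also have "of_real q * (\<integral>\<xi>. of_real (g s \<xi>) * \<phi> \<xi> \<partial>lborel) = (\<integral>\<xi>. of_real (k s \<xi>) * \<phi> \<xi> \<partial>lborel)"
        unfolding kg using True by (simp add: q_def mult.assoc flip: integral_mult_right_zero)
      finally show ?thesis .
    qed (simp add: h_def k_def)
  qed
  also have "\<dots> = - (\<integral>s. (\<integral>\<xi>. of_real (k s \<xi>) * \<phi> \<xi> \<partial>lborel) \<partial>lborel)" by simp
  also have "(\<integral>s. (\<integral>\<xi>. of_real (k s \<xi>) * \<phi> \<xi> \<partial>lborel) \<partial>lborel) = (\<integral>\<xi>. (\<integral>s. of_real (k s \<xi>) * \<phi> \<xi> \<partial>lborel) \<partial>lborel)"
    by (rule lborel_pair.Fubini_integral[symmetric, OF int2])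
  also have "- \<dots> = (\<integral>\<xi>. - (\<integral>s. of_real (k s \<xi>) * \<phi> \<xi> \<partial>lborel) \<partial>lborel)" by simp
  also have "\<dots> = (\<integral>\<xi>. of_real (- (1 / (2 * sqrt pi) * K * (Gamma a / (E \<xi> / 4) powr a))) * \<phi> \<xi> \<partial>lborel)"
  proof (intro Bochner_Integration.integral_cong refl)
    fix \<xi>
    show "- (\<integral>s. of_real (k s \<xi>) * \<phi> \<xi> \<partial>lborel) = of_real (- (1 / (2 * sqrt pi) * K * (Gamma a / (E \<xi> / 4) powr a))) * \<phi> \<xi>"
    proof (cases "\<phi> \<xi> = 0")
      case False
      then have "E \<xi> > 0" using Er[of \<xi>] r0 by auto
      then have "(\<integral>s. k s \<xi> \<partial>lborel) = 1 / (2 * sqrt pi) * K * (Gamma a / (E \<xi> / 4) powr a)"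
        using hbk by (simp add: has_bochner_integral_iff)
      then show ?thesis by simp
    qed simp
  qed
  finally show ?thesis by (simp only: K_def)
qed

text \<open>The weight has mass 1 along the axis, so the left side is the (n-1)-dimensional volume
  of a ball of radius sqrt v. The cylinder of height sqrt v over that ball is measured twice: by
  integration along the axis, and by scaling \<open>unit_cylinder\<close>.\<close>

lemma nn_integral_axial_cylinder:
  fixes e :: "'a::euclidean_space"
  assumes e: "e \<in> Basis" and v: "v > 0"
  shows "(\<integral>\<^sup>+x. ennreal (exp (- (x \<bullet> e)\<^sup>2) / sqrt pi) * indicator {..v} (perp2 e x) \<partial>lborel) =
    ennreal (sqrt v ^ (DIM('a) - 1)) * emeasure lborel (unit_cylinder e)"
proof -
  define \<nu> where "\<nu> = (\<integral>\<^sup>+x. ennreal (exp (- (x \<bullet> e)\<^sup>2) / sqrt pi) * indicator {..v} (perp2 e x) \<partial>lborel)"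
  have ee: "e \<bullet> e = 1" using e by simp
  define f where "f = (\<lambda>x. indicator {..v} (perp2 e x) * indicator {0..sqrt v} (x \<bullet> e) :: ennreal)"
  have [measurable]: "f \<in> borel_measurable borel" unfolding f_def by measurable
  have sv: "sqrt v > 0" using v by simp
  have 1: "(\<integral>\<^sup>+x. f x \<partial>lborel) = \<nu> * ennreal (sqrt v)"
  proof -
    have line: "(\<integral>\<^sup>+r. f (x + (r - x \<bullet> e) *\<^sub>R e) \<partial>lborel) = indicator {..v} (perp2 e x) * ennreal (sqrt v)" for x
    proof -
      have "(x + (r - x \<bullet> e) *\<^sub>R e) \<bullet> e = r" for r unfolding inner_add_left inner_scaleR_left ee by simp
      then show ?thesis
        unfolding f_def perp2_add_axis[OF e] using v by (subst nn_integral_cmult) auto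
    qed
    show ?thesis
      unfolding nn_integral_axis[OF \<open>f \<in> borel_measurable borel\<close> e] line \<nu>_def
      by (simp add: mult.assoc[symmetric] nn_integral_multc)
  qed
  have 2: "(\<integral>\<^sup>+x. f x \<partial>lborel) = ennreal (sqrt v ^ DIM('a)) * emeasure lborel (unit_cylinder e)"
  proof -
    have "(\<integral>\<^sup>+x. f x \<partial>lborel) = (\<integral>\<^sup>+x. f x \<partial>density (distr lborel borel (\<lambda>x. 0 + sqrt v *\<^sub>R x)) (\<lambda>_. ennreal (\<bar>sqrt v\<bar> ^ DIM('a))))"
      using lborel_affine[of "sqrt v" "0::'a"] sv by simp
    also have "\<dots> = ennreal (sqrt v ^ DIM('a)) * (\<integral>\<^sup>+x. f (sqrt v *\<^sub>R x) \<partial>lborel)"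
      using v by (simp add: nn_integral_density nn_integral_distr nn_integral_cmult)
    also have "(\<lambda>x. f (sqrt v *\<^sub>R x)) = indicator (unit_cylinder e)"
    proof
      fix x :: 'a
      have p: "perp2 e (sqrt v *\<^sub>R x) = v * perp2 e x"
        using v by (simp add: perp2_def power_mult_distrib algebra_simps)
      have n: "(norm (x - (x \<bullet> e) *\<^sub>R e))\<^sup>2 = perp2 e x"
        unfolding perp2_def power2_norm_eq_inner by (simp add: inner_simps ee power2_eq_square inner_commute)
      have n1: "norm (x - (x \<bullet> e) *\<^sub>R e) \<le> 1 \<longleftrightarrow> perp2 e x \<le> 1"
        unfolding n[symmetric] by (simp add: abs_square_le_1)
      have "f (sqrt v *\<^sub>R x) = indicator {..1} (perp2 e x) * indicator {0..1} (x \<bullet> e)"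
        unfolding f_def p using v sv by (auto simp: indicator_def zero_le_mult_iff)
      then show "f (sqrt v *\<^sub>R x) = indicator (unit_cylinder e) x"
        using n1 by (auto simp: unit_cylinder_def indicator_def)
    qed
    finally show ?thesis
      using compact_unit_cylinder[of e] e by (simp add: compact_imp_closed)
  qed
  have "\<nu> * ennreal (sqrt v) * ennreal (1 / sqrt v) = ennreal (sqrt v ^ DIM('a)) * emeasure lborel (unit_cylinder e) * ennreal (1 / sqrt v)"
    using 1 2 by simp
  moreover have "ennreal (sqrt v) * ennreal (1 / sqrt v) = 1" using sv by (simp add: ennreal_mult[symmetric])
  moreover have "ennreal (sqrt v ^ DIM('a)) * ennreal (1 / sqrt v) = ennreal (sqrt v ^ (DIM('a) - 1))"
  proof -
    obtain m where m: "DIM('a) = Suc m" using DIM_positive[where 'a='a] by (metis Suc_pred)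
    show ?thesis using sv unfolding m by (simp add: ennreal_mult[symmetric])
  qed
  ultimately have "\<nu> = ennreal (sqrt v ^ (DIM('a) - 1)) * emeasure lborel (unit_cylinder e)"
    by (metis (no_types, lifting) mult.assoc mult.commute mult_1_right)
  then show ?thesis by (simp only: \<nu>_def)
qed

text \<open>The Gaussian integral in n - 1 variables is computed twice, once directly and once by
  integrating the volumes of its superlevel balls. The second way gives the gamma function times the
  volume of the unit ball.\<close>

lemma measure_unit_cylinder:
  fixes e :: "'a::euclidean_space"
  assumes e: "e \<in> Basis"
  shows "emeasure lborel (unit_cylinder e) = ennreal (sqrt pi ^ (DIM('a) - 1) / Gamma ((real DIM('a) + 1) / 2))"
proof -
  let ?n = "DIM('a)"
  let ?\<kappa> = "emeasure lborel (unit_cylinder e)"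
  define a where "a = (real ?n + 1) / 2"
  have a0: "a > 0" by (simp add: a_def)
  let ?g = "\<lambda>x. ennreal (exp (- (x \<bullet> e)\<^sup>2) / sqrt pi)"
  have "(\<integral>\<^sup>+x. ?g x * ennreal (exp (- perp2 e x)) \<partial>lborel) = ennreal (sqrt pi ^ (?n - 1))"
  proof -
    have "has_bochner_integral lborel (\<lambda>x. complex_of_real (exp (- (1 * (x \<bullet> e)\<^sup>2 + 1 * perp2 e x)))) (of_real (sqrt pi * sqrt pi ^ (?n - 1)))"
      using gauss_fourier[OF e, of 1 1 0] by (simp add: perp2_def[of e 0])
    from has_bochner_integral_mult_left[OF has_bochner_integral_Re[OF this], of "1 / sqrt pi"]
    have hb: "has_bochner_integral lborel (\<lambda>x. exp (- (1 * (x \<bullet> e)\<^sup>2 + 1 * perp2 e x)) * (1 / sqrt pi)) (sqrt pi ^ (?n - 1))"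
      by simp
    have "(\<integral>\<^sup>+x. ?g x * ennreal (exp (- perp2 e x)) \<partial>lborel) = (\<integral>\<^sup>+x. ennreal (exp (- (1 * (x \<bullet> e)\<^sup>2 + 1 * perp2 e x)) * (1 / sqrt pi)) \<partial>lborel)"
      by (intro nn_integral_cong) (simp add: ennreal_mult[symmetric] exp_diff exp_minus divide_inverse mult_ac)
    also have "\<dots> = ennreal (sqrt pi ^ (?n - 1))"
      using hb by (subst nn_integral_eq_integral) (auto simp: has_bochner_integral_iff)
    finally show ?thesis .
  qed
  moreover have "(\<integral>\<^sup>+x. ?g x * ennreal (exp (- perp2 e x)) \<partial>lborel) = ennreal (Gamma a) * ?\<kappa>"
  proof -
    \<comment> \<open>Layer representation of the Gaussian as a function of P = |y|^2; the level v
      corresponds to the ball of radius sqrt v.\<close>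
    have layer: "ennreal (exp (- P)) = (\<integral>\<^sup>+v. ennreal (indicator {0<..} v * exp (- v)) * indicator {..v} P \<partial>lborel)" if "P \<ge> 0" for P :: real
    proof -
      have "(\<integral>\<^sup>+v. ennreal (exp (- v)) * indicator {P..} v \<partial>lborel) = ennreal (0 - (- exp (- P)))"
      proof (rule nn_integral_FTC_atLeast)
        have "((\<lambda>v::real. - exp (- v)) \<longlongrightarrow> - 0) at_top"
          by (intro tendsto_minus filterlim_compose[OF exp_at_bot filterlim_uminus_at_bot_at_top])
        then show "((\<lambda>v::real. - exp (- v)) \<longlongrightarrow> 0) at_top" by simp
      qed (auto intro!: derivative_eq_intros)
      moreover have "(\<integral>\<^sup>+v. ennreal (indicator {0<..} v * exp (- v)) * indicator {..v} P \<partial>lborel) = (\<integral>\<^sup>+v. ennreal (exp (- v)) * indicator {P..} v \<partial>lborel)"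
        using AE_lborel_singleton[of "0::real"] that
        by (intro nn_integral_cong_AE) (auto simp: indicator_def)
      ultimately show ?thesis by simp
    qed
    have "(\<integral>\<^sup>+x. ?g x * ennreal (exp (- perp2 e x)) \<partial>lborel) =
        (\<integral>\<^sup>+x. (\<integral>\<^sup>+v. ?g x * (ennreal (indicator {0<..} v * exp (- v)) * indicator {0..} (v - perp2 e x)) \<partial>lborel) \<partial>lborel)"
      unfolding layer[OF perp2_nonneg[OF e]]
      by (intro nn_integral_cong) (simp add: nn_integral_cmult indicator_def)
    also have "\<dots> = (\<integral>\<^sup>+v. (\<integral>\<^sup>+x. ?g x * (ennreal (indicator {0<..} v * exp (- v)) * indicator {0..} (v - perp2 e x)) \<partial>lborel) \<partial>lborel)"
      by (rule lborel_pair.Fubini'[symmetric]) measurable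
    also have "\<dots> = (\<integral>\<^sup>+v. ennreal (indicator {0<..} v * (v powr (a - 1) * exp (- (1 * v)))) * ?\<kappa> \<partial>lborel)"
    proof (rule nn_integral_cong)
      fix v :: real
      show "(\<integral>\<^sup>+x. ?g x * (ennreal (indicator {0<..} v * exp (- v)) * indicator {0..} (v - perp2 e x)) \<partial>lborel) = ennreal (indicator {0<..} v * (v powr (a - 1) * exp (- (1 * v)))) * ?\<kappa>"
      proof (cases "v > 0")
        case True
        have "(\<integral>\<^sup>+x. ?g x * (ennreal (indicator {0<..} v * exp (- v)) * indicator {0..} (v - perp2 e x)) \<partial>lborel) =
            (\<integral>\<^sup>+x. ennreal (exp (- v)) * (?g x * indicator {..v} (perp2 e x)) \<partial>lborel)"
          using True by (intro nn_integral_cong) (auto simp: indicator_def mult_ac)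
        also have "\<dots> = ennreal (exp (- v)) * (ennreal (sqrt v ^ (?n - 1)) * ?\<kappa>)"
          by (subst nn_integral_cmult) (auto simp: nn_integral_axial_cylinder[OF e True])
        also have "sqrt v ^ (?n - 1) = v powr (a - 1)"
        proof -
          have "a - 1 = (1/2) * real (?n - 1)" using DIM_positive[where 'a='a] by (simp add: a_def of_nat_diff field_simps)
          then show ?thesis using True by (simp only: powr_powr[symmetric] powr_half_sqrt less_imp_le powr_realpow real_sqrt_gt_zero)
        qed
        finally show ?thesis using True by (simp add: mult.assoc[symmetric] ennreal_mult[symmetric] mult.commute)
      qed simp
    qed
    also have "\<dots> = (\<integral>\<^sup>+v. ennreal (indicator {0<..} v * (v powr (a - 1) * exp (- (1 * v)))) \<partial>lborel) * ?\<kappa>"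
      by (rule nn_integral_multc) measurable
    also have "(\<integral>\<^sup>+v. ennreal (indicator {0<..} v * (v powr (a - 1) * exp (- (1 * v)))) \<partial>lborel) = ennreal (Gamma a)"
      using nn_integral_powr_exp[OF a0, of 1] by simp
    finally show ?thesis .
  qed
  ultimately have "ennreal (Gamma a) * ?\<kappa> = ennreal (sqrt pi ^ (?n - 1))" by simp
  then have "ennreal (1 / Gamma a) * (ennreal (Gamma a) * ?\<kappa>) = ennreal (1 / Gamma a) * ennreal (sqrt pi ^ (?n - 1))" by simp
  moreover have "ennreal (1 / Gamma a) * ennreal (Gamma a) = 1"
    using Gamma_real_pos[OF a0] by (simp add: ennreal_mult[symmetric])
  ultimately have "?\<kappa> = ennreal (1 / Gamma a) * ennreal (sqrt pi ^ (?n - 1))"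
    by (simp add: mult.assoc[symmetric])
  then show ?thesis
    using Gamma_real_pos[OF a0] by (simp add: ennreal_mult[symmetric] a_def)
qed

section \<open>The weight of an ellipsoid as a mixture of kernels\<close>

lemma negative_binomial_series:
  fixes b z :: real
  assumes "\<bar>z\<bar> < 1"
  shows "(\<lambda>j. pochhammer b j / fact j * z ^ j) sums (1 - z) powr (- b)"
proof -
  have "(\<lambda>j. (- b gchoose j) * (- z) ^ j) sums (1 + (- z)) powr (- b)"
    using assms by (intro gen_binomial_real) simp
  moreover have "(- b gchoose j) * (- z) ^ j = pochhammer b j / fact j * z ^ j" for j
  proof -
    have "((-1) ^ j * (-1) ^ j :: real) = 1" by (simp flip: power_mult_distrib)
    then show ?thesis unfolding gbinomial_pochhammer power_minus[of z] by (simp add: mult_ac)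
  qed
  ultimately show ?thesis by simp
qed

lemma power_le_exp:
  assumes "0 < d" "0 \<le> (s::real)"
  shows "(1 + s) ^ k \<le> fact k / d ^ k * exp d * exp (d * s)"
proof -
  have "(d * (1 + s)) ^ k / fact k \<le> exp (d * (1 + s))" using assms by (intro power_over_fact_le_exp) simp
  then have "(1 + s) ^ k \<le> fact k / d ^ k * exp (d * (1 + s))"
    using assms(1) unfolding power_mult_distrib by (simp add: field_simps)
  also have "exp (d * (1 + s)) = exp d * exp (d * s)" by (simp add: exp_add[symmetric] algebra_simps)
  finally show ?thesis by (simp add: mult.assoc)
qed

locale axial_power =
  fixes e :: "'a::euclidean_space" and \<alpha> :: real and n :: nat
  assumes e: "e \<in> Basis" and n_eq: "n = DIM('a)" and dim: "3 \<le> n"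
    and \<alpha>_ge: "real n - 2 \<le> \<alpha>" and \<alpha>_less: "\<alpha> < real n"
begin

text \<open>The exponents are degrees of homogeneity: f_L has degree -2b and |x|^\<alpha> f_L has
  degree \<alpha> - n - 1 = -2a = -(p + 1).\<close>

definition p :: real where "p = real n - \<alpha>"
definition b :: real where "b = (real n + 1) / 2"
definition a :: real where "a = (p + 1) / 2"

lemma p_pos: "0 < p" and b_pos: "0 < b" and a_pos: "0 < a" and b_minus_a: "b - a = \<alpha> / 2"
  and \<alpha>_ge_1: "1 \<le> \<alpha>" and a_gt_half: "1 / 2 < a"
  using \<alpha>_ge \<alpha>_less dim by (auto simp: p_def b_def a_def field_simps)

lemma p_less: "1 < \<alpha> \<Longrightarrow> p < real n - 1"
  by (simp add: p_def)

lemma \<alpha>_eq_1: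
  assumes "\<not> 1 < \<alpha>"
  shows "\<alpha> = 1" "n = 3" "p = 2"
proof -
  show "\<alpha> = 1" using assms \<alpha>_ge_1 by simp
  then have "real n \<le> 3" using \<alpha>_ge by simp
  then show "n = 3" using dim by simp
  then show "p = 2" unfolding p_def using \<open>\<alpha> = 1\<close> by simp
qed

text \<open>With T = x_1^2 / |y|^2, the function |x|^\<alpha> f_L is the profile at T times
  |y|^(-p-1). The dependence on N sits entirely in this function of one variable.\<close>

definition profile :: "real \<Rightarrow> real \<Rightarrow> real" where
  "profile N T = N\<^sup>2 * (1 + T) powr (\<alpha> / 2) * (1 + N\<^sup>2 * T) powr (- b)"

definition mix_term :: "real \<Rightarrow> nat \<Rightarrow> real \<Rightarrow> real" where
  "mix_term N j s = N powr (2 - 2 * b) * (pochhammer b j / fact j * (1 - 1 / N\<^sup>2) ^ j / Gamma (a + j)) *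
     (indicator {0<..} s * (s powr (a + j - 1) * exp (- s)))"

text \<open>With \<open>\<kappa> = 1 - N\<^sup>-\<^sup>2\<close> one has \<open>1 + N\<^sup>2 T = N\<^sup>2 (1 + T) (1 - \<kappa> / (1 + T))\<close>, and the binomial series has
  positive coefficients; hence the profile is the Laplace transform of a sum of gamma densities.\<close>

definition mix :: "real \<Rightarrow> real measure" where
  "mix N = density lborel (\<lambda>s. \<Sum>j. ennreal (mix_term N j s))"

lemma profile_nonneg: "0 \<le> profile N T"
  by (simp add: profile_def)

lemma measurable_mix_term [measurable]: "mix_term N j \<in> borel_measurable borel"
  unfolding mix_term_def[abs_def] by measurable

lemma sets_mix [simp, measurable_cong]: "sets (mix N) = sets borel"
  by (simp add: mix_def)

lemma space_mix [simp]: "space (mix N) = UNIV"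
  by (simp add: mix_def)

lemma nn_integral_mix:
  assumes [measurable]: "f \<in> borel_measurable borel"
  shows "(\<integral>\<^sup>+s. f s \<partial>mix N) = (\<Sum>j. \<integral>\<^sup>+s. ennreal (mix_term N j s) * f s \<partial>lborel)"
  unfolding mix_def
  by (subst nn_integral_density, measurable, subst ennreal_suminf_multc[symmetric], rule nn_integral_suminf) measurable

lemma AE_mix_pos: "AE s in mix N. s > 0"
proof -
  have z: "mix_term N j s = 0" if "\<not> s > 0" for j s using that by (simp add: mix_term_def)
  have "s > 0" if "0 < (\<Sum>j. ennreal (mix_term N j s))" for s
    using that by (rule contrapos_pp) (simp add: z)
  then show ?thesis
    unfolding mix_def by (subst AE_density) auto
qed

text \<open>The j-th gamma density contributes (1 + T)^(-a-j), and the binomial series is summed at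
  z = \<kappa> / (1 + T), where \<kappa> = 1 - 1/N^2. This converges as long as \<kappa> < 1 + T, so
  slightly negative T are included; they provide exponential moments of the mixing measure.\<close>

lemma laplace_mix:
  assumes N: "1 \<le> N" and T: "- (1 / N\<^sup>2) < T"
  shows "(\<integral>\<^sup>+s. ennreal (exp (- (s * T))) \<partial>mix N) = ennreal (profile N T)"
proof -
  define k where "k = 1 - 1 / N\<^sup>2"
  have N2: "1 \<le> N\<^sup>2" "0 < N\<^sup>2" using N by (auto simp: one_le_power zero_less_power)
  have k: "0 \<le> k" "k < 1" using N2 by (auto simp: k_def)
  have T1: "k < 1 + T" using T by (simp add: k_def)
  then have T1: "0 < 1 + T" "k < 1 + T" using k(1) by auto
  define z where "z = k / (1 + T)"
  have z: "0 \<le> z" "z < 1" using T1 k by (auto simp: z_def)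
  define A where "A = N powr (2 - 2 * b) * (1 + T) powr (- a)"
  have tm: "(\<integral>\<^sup>+s. ennreal (mix_term N j s) * ennreal (exp (- (s * T))) \<partial>lborel) = ennreal (A * (pochhammer b j / fact j * z ^ j))" for j
  proof -
    define C where "C = N powr (2 - 2 * b) * (pochhammer b j / fact j * k ^ j / Gamma (a + j))"
    have aj: "a + j > 0" using a_pos by simp
    have C0: "C \<ge> 0" unfolding C_def using k b_pos Gamma_real_pos[OF aj]
      by (intro mult_nonneg_nonneg divide_nonneg_nonneg pochhammer_nonneg zero_le_power) auto
    have "(\<integral>\<^sup>+s. ennreal (mix_term N j s) * ennreal (exp (- (s * T))) \<partial>lborel) =
        (\<integral>\<^sup>+s. ennreal C * ennreal (indicator {0<..} s * (s powr (a + j - 1) * exp (- ((1 + T) * s)))) \<partial>lborel)"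
    proof (rule nn_integral_cong)
      fix s :: real
      have "exp (- ((1 + T) * s)) = exp (- s) * exp (- (s * T))" by (simp add: exp_add[symmetric] algebra_simps)
      then have "mix_term N j s * exp (- (s * T)) = C * (indicator {0<..} s * (s powr (a + j - 1) * exp (- ((1 + T) * s))))"
        by (simp add: mix_term_def C_def k_def mult_ac)
      then show "ennreal (mix_term N j s) * ennreal (exp (- (s * T))) = ennreal C * ennreal (indicator {0<..} s * (s powr (a + j - 1) * exp (- ((1 + T) * s))))"
        using C0 by (simp add: ennreal_mult''[symmetric])
    qed
    also have "\<dots> = ennreal C * ennreal (Gamma (a + j) / (1 + T) powr (a + j))"
      by (subst nn_integral_cmult, measurable, subst nn_integral_powr_exp[OF aj T1(1)]) simp
    also have "\<dots> = ennreal (C * (Gamma (a + j) / (1 + T) powr (a + j)))"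
      using C0 Gamma_real_pos[OF aj] by (simp add: ennreal_mult[symmetric])
    also have "C * (Gamma (a + j) / (1 + T) powr (a + j)) = A * (pochhammer b j / fact j * z ^ j)"
      using Gamma_real_pos[OF aj] T1
      by (simp add: C_def A_def z_def powr_add powr_realpow powr_minus_divide power_divide)
    finally show ?thesis .
  qed
  have "(\<lambda>j. A * (pochhammer b j / fact j * z ^ j)) sums (A * (1 - z) powr (- b))"
    using z by (intro sums_mult negative_binomial_series) simp
  then have "(\<Sum>j. ennreal (A * (pochhammer b j / fact j * z ^ j))) = ennreal (A * (1 - z) powr (- b))"
    using z b_pos by (intro suminf_ennreal_eq) (auto simp: A_def intro!: mult_nonneg_nonneg divide_nonneg_pos pochhammer_nonneg)
  also have "A * (1 - z) powr (- b) = profile N T"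
  proof -
    have "1 + N\<^sup>2 * T = N\<^sup>2 * ((1 + T) * (1 - z))"
      using T1 N2 by (simp add: z_def k_def field_simps)
    then have 1: "(1 + N\<^sup>2 * T) powr (- b) = (N\<^sup>2) powr (- b) * ((1 + T) powr (- b) * (1 - z) powr (- b))"
      using T1 z by (simp add: powr_mult)
    moreover have "N\<^sup>2 * (N\<^sup>2) powr (- b) = N powr (2 - 2 * b)"
    proof -
      have "N\<^sup>2 = N powr 2" using N by (simp add: powr_numeral)
      then show ?thesis by (simp only: powr_powr powr_add[symmetric]) (simp add: algebra_simps)
    qed
    moreover have "(1 + T) powr (\<alpha> / 2) * (1 + T) powr (- b) = (1 + T) powr (- a)"
      unfolding powr_add[symmetric] b_minus_a[symmetric] by simp
    moreover have "profile N T = (N\<^sup>2 * (N\<^sup>2) powr (- b)) * ((1 + T) powr (\<alpha> / 2) * (1 + T) powr (- b)) * (1 - z) powr (- b)"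
      unfolding profile_def 1 by (simp only: mult_ac)
    ultimately show ?thesis by (simp only: A_def)
  qed
  finally show ?thesis by (subst nn_integral_mix) (auto simp: tm)
qed

lemma finite_measure_mix: "1 \<le> N \<Longrightarrow> finite_measure (mix N)"
  using laplace_mix[of N 0] by (intro finite_measureI) (auto simp: profile_def)

text \<open>A negative power of s is a gamma integral of exp (- s T), so moments of the mixing
  measure become integrals of its Laplace transform, which is explicit.\<close>

lemma nn_integral_mix_powr:
  assumes N: "1 \<le> N" and \<gamma>: "0 < \<gamma>" and T0: "- (1 / N\<^sup>2) < T0"
  shows "(\<integral>\<^sup>+s. ennreal (s powr (- \<gamma>) * exp (- (s * T0))) \<partial>mix N) =
    ennreal (1 / Gamma \<gamma>) * (\<integral>\<^sup>+T. ennreal (indicator {0<..} T * (T powr (\<gamma> - 1) * profile N (T0 + T))) \<partial>lborel)"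
proof -
  interpret M: finite_measure "mix N" by (rule finite_measure_mix[OF N])
  interpret PL: pair_sigma_finite "mix N" "lborel :: real measure" ..
  have "(\<integral>\<^sup>+s. ennreal (s powr (- \<gamma>) * exp (- (s * T0))) \<partial>mix N) =
      (\<integral>\<^sup>+s. (\<integral>\<^sup>+T. ennreal (1 / Gamma \<gamma>) * ennreal (indicator {0<..} T * T powr (\<gamma> - 1)) * ennreal (exp (- (s * (T0 + T)))) \<partial>lborel) \<partial>mix N)"
  proof (rule nn_integral_cong_AE)
    show "AE s in mix N. ennreal (s powr (- \<gamma>) * exp (- (s * T0))) =
        (\<integral>\<^sup>+T. ennreal (1 / Gamma \<gamma>) * ennreal (indicator {0<..} T * T powr (\<gamma> - 1)) * ennreal (exp (- (s * (T0 + T)))) \<partial>lborel)"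
      using AE_mix_pos
    proof eventually_elim
      case (elim s)
      have "ennreal (s powr (- \<gamma>) * exp (- (s * T0))) = ennreal (s powr (- \<gamma>)) * ennreal (exp (- (s * T0)))"
        by (simp add: ennreal_mult)
      also have "\<dots> = (\<integral>\<^sup>+T. ennreal (1 / Gamma \<gamma>) * ennreal (indicator {0<..} T * (T powr (\<gamma> - 1) * exp (- (s * T)))) * ennreal (exp (- (s * T0))) \<partial>lborel)"
        unfolding powr_conv_nn_integral[OF \<gamma> elim] by (simp add: nn_integral_cmult nn_integral_multc)
      also have "\<dots> = (\<integral>\<^sup>+T. ennreal (1 / Gamma \<gamma>) * ennreal (indicator {0<..} T * T powr (\<gamma> - 1)) * ennreal (exp (- (s * (T0 + T)))) \<partial>lborel)"
      proof (rule nn_integral_cong)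
        fix T
        have x: "exp (- (s * (T0 + T))) = exp (- (s * T)) * exp (- (s * T0))" by (simp add: exp_add[symmetric] algebra_simps)
        show "ennreal (1 / Gamma \<gamma>) * ennreal (indicator {0<..} T * (T powr (\<gamma> - 1) * exp (- (s * T)))) * ennreal (exp (- (s * T0))) =
          ennreal (1 / Gamma \<gamma>) * ennreal (indicator {0<..} T * T powr (\<gamma> - 1)) * ennreal (exp (- (s * (T0 + T))))"
          unfolding x using Gamma_real_pos[OF \<gamma>] by (simp add: ennreal_mult[symmetric] mult_ac)
      qed
      finally show ?case .
    qed
  qed
  also have "\<dots> = (\<integral>\<^sup>+T. (\<integral>\<^sup>+s. ennreal (1 / Gamma \<gamma>) * ennreal (indicator {0<..} T * T powr (\<gamma> - 1)) * ennreal (exp (- (s * (T0 + T)))) \<partial>mix N) \<partial>lborel)"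
    by (rule PL.Fubini'[symmetric]) measurable
  also have "\<dots> = (\<integral>\<^sup>+T. ennreal (1 / Gamma \<gamma>) * ennreal (indicator {0<..} T * (T powr (\<gamma> - 1) * profile N (T0 + T))) \<partial>lborel)"
  proof (rule nn_integral_cong)
    fix T :: real
    show "(\<integral>\<^sup>+s. ennreal (1 / Gamma \<gamma>) * ennreal (indicator {0<..} T * T powr (\<gamma> - 1)) * ennreal (exp (- (s * (T0 + T)))) \<partial>mix N) =
        ennreal (1 / Gamma \<gamma>) * ennreal (indicator {0<..} T * (T powr (\<gamma> - 1) * profile N (T0 + T)))"
    proof (cases "T > 0")
      case True
      then have "(\<integral>\<^sup>+s. ennreal (exp (- (s * (T0 + T)))) \<partial>mix N) = ennreal (profile N (T0 + T))"
        using T0 by (intro laplace_mix N) simp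
      then have "(\<integral>\<^sup>+s. ennreal (1 / Gamma \<gamma>) * ennreal (indicator {0<..} T * T powr (\<gamma> - 1)) * ennreal (exp (- (s * (T0 + T)))) \<partial>mix N) =
          ennreal (1 / Gamma \<gamma>) * ennreal (indicator {0<..} T * T powr (\<gamma> - 1)) * ennreal (profile N (T0 + T))"
        by (subst nn_integral_cmult) auto
      then show ?thesis using True by (simp add: ennreal_mult profile_nonneg mult.assoc)
    qed simp
  qed
  also have "\<dots> = ennreal (1 / Gamma \<gamma>) * (\<integral>\<^sup>+T. ennreal (indicator {0<..} T * (T powr (\<gamma> - 1) * profile N (T0 + T))) \<partial>lborel)"
    by (rule nn_integral_cmult) (simp add: profile_def)
  finally show ?thesis .
qed

text \<open>Only T \<le> 1/N^2 is kept. There N^2 T \<le> 1 bounds the profile from below by N^2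
  2^(-b), while T^(-1/2) integrates to 2/N. The resulting order N is the growth on which the whole
  comparison rests.\<close>

lemma mix_moment_half_ge:
  assumes N: "1 \<le> N"
  shows "ennreal (2 * 2 powr (- b) / sqrt pi * N) \<le> (\<integral>\<^sup>+s. ennreal (s powr (- (1/2))) \<partial>mix N)"
proof -
  have N2: "1 \<le> N\<^sup>2" "0 < N\<^sup>2" using N by (auto simp: one_le_power zero_less_power)
  have "(\<integral>\<^sup>+T. ennreal (indicator {0..1 / N\<^sup>2} T * T powr (- 1/2)) \<partial>lborel) = ennreal ((1 / N\<^sup>2) powr (1/2) / (1/2))"
    using nn_integral_has_integral_lebesgue[OF _ has_integral_powr_from_0[of "-1/2" "1 / N\<^sup>2"]] N2 by simp
  also have "(1 / N\<^sup>2) powr (1/2) / (1/2) = 2 / N"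
    using N by (simp add: powr_half_sqrt real_sqrt_divide)
  finally have I: "(\<integral>\<^sup>+T. ennreal (indicator {0..1 / N\<^sup>2} T * T powr (- 1/2)) \<partial>lborel) = ennreal (2 / N)" .
  have "ennreal (N\<^sup>2 * 2 powr (- b)) * ennreal (2 / N) = (\<integral>\<^sup>+T. ennreal (N\<^sup>2 * 2 powr (- b)) * ennreal (indicator {0..1 / N\<^sup>2} T * T powr (- 1/2)) \<partial>lborel)"
    unfolding I[symmetric] by (rule nn_integral_cmult[symmetric]) measurable
  also have "\<dots> \<le> (\<integral>\<^sup>+T. ennreal (indicator {0<..} T * (T powr (1/2 - 1) * profile N (0 + T))) \<partial>lborel)"
  proof (rule nn_integral_mono)
    fix T :: real
    show "ennreal (N\<^sup>2 * 2 powr (- b)) * ennreal (indicator {0..1 / N\<^sup>2} T * T powr (- 1/2)) \<le> ennreal (indicator {0<..} T * (T powr (1/2 - 1) * profile N (0 + T)))"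
    proof (cases "0 < T \<and> T \<le> 1 / N\<^sup>2")
      case True
      have "2 powr (- b) \<le> (1 + N\<^sup>2 * T) powr (- b)"
        using True N2 b_pos by (intro powr_mono2') (auto simp: field_simps add_pos_nonneg)
      moreover have "1 \<le> (1 + T) powr (\<alpha> / 2)" using True \<alpha>_ge_1 by (intro ge_one_powr_ge_zero) auto
      ultimately have "1 * 2 powr (- b) \<le> (1 + T) powr (\<alpha> / 2) * (1 + N\<^sup>2 * T) powr (- b)" by (intro mult_mono) auto
      then have "N\<^sup>2 * 2 powr (- b) \<le> profile N T" using N2 by (simp add: profile_def mult.assoc)
      then have "N\<^sup>2 * 2 powr (- b) * T powr (- 1/2) \<le> profile N T * T powr (- 1/2)"
        by (rule mult_right_mono) simp
      then show ?thesis using True N2 by (simp add: ennreal_mult[symmetric] ennreal_leI mult.commute)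
    qed (auto simp: indicator_def)
  qed
  finally have "ennreal (N\<^sup>2 * 2 powr (- b) * (2 / N)) \<le> (\<integral>\<^sup>+T. ennreal (indicator {0<..} T * (T powr (1/2 - 1) * profile N (0 + T))) \<partial>lborel)"
    using N by (simp add: ennreal_mult[symmetric])
  then have "ennreal (1 / Gamma (1/2)) * ennreal (N\<^sup>2 * 2 powr (- b) * (2 / N)) \<le> (\<integral>\<^sup>+s. ennreal (s powr (- (1/2)) * exp (- (s * 0))) \<partial>mix N)"
    using N2 by (subst nn_integral_mix_powr[OF N]) (auto intro!: mult_left_mono)
  moreover have "ennreal (1 / Gamma (1/2)) * ennreal (N\<^sup>2 * 2 powr (- b) * (2 / N)) = ennreal (2 * 2 powr (- b) / sqrt pi * N)"
    using N by (simp add: Gamma_one_half_real ennreal_mult[symmetric] power2_eq_square)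
  ultimately show ?thesis by simp
qed

text \<open>The substitution T = w / N^2 extracts the power of N, and the profile is then at most
  N^2 (1 + w)^(-a) uniformly in N \<ge> 1. The condition \<gamma> < a makes the integral over w
  converge. For \<gamma> > 1/2 the moment grows more slowly than N.\<close>

lemma mix_moment_le:
  assumes \<gamma>: "0 < \<gamma>" "\<gamma> < a"
  shows "\<exists>C\<ge>0. \<forall>N\<ge>1. (\<integral>\<^sup>+s. ennreal (s powr (- \<gamma>)) \<partial>mix N) \<le> ennreal (C * N powr (2 - 2 * \<gamma>))"
proof -
  define I where "I = (\<integral>\<^sup>+w. ennreal (indicator {0<..} w * (w powr (\<gamma> - 1) * (1 + w) powr (- a))) \<partial>lborel)"
  have I: "I < \<infinity>" unfolding I_def by (rule nn_integral_beta_prime[OF \<gamma>])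
  define C where "C = 1 / Gamma \<gamma> * enn2real I"
  have "(\<integral>\<^sup>+s. ennreal (s powr (- \<gamma>)) \<partial>mix N) \<le> ennreal (C * N powr (2 - 2 * \<gamma>))" if N: "1 \<le> N" for N
  proof -
    have N2: "1 \<le> N\<^sup>2" "0 < N\<^sup>2" using N by (auto simp: one_le_power zero_less_power)
    have "(\<integral>\<^sup>+T. ennreal (indicator {0<..} T * (T powr (\<gamma> - 1) * profile N (0 + T))) \<partial>lborel) =
        ennreal \<bar>1 / N\<^sup>2\<bar> * (\<integral>\<^sup>+w. ennreal (indicator {0<..} (0 + 1 / N\<^sup>2 * w) * ((0 + 1 / N\<^sup>2 * w) powr (\<gamma> - 1) * profile N (0 + (0 + 1 / N\<^sup>2 * w)))) \<partial>lborel)"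
      by (rule nn_integral_real_affine) (use N in \<open>auto simp: profile_def\<close>)
    also have "\<dots> \<le> ennreal (1 / N\<^sup>2) * (\<integral>\<^sup>+w. ennreal (N\<^sup>2 * (1 / N\<^sup>2) powr (\<gamma> - 1)) * ennreal (indicator {0<..} w * (w powr (\<gamma> - 1) * (1 + w) powr (- a))) \<partial>lborel)"
    proof (intro mult_mono nn_integral_mono)
      fix w :: real
      show "ennreal (indicator {0<..} (0 + 1 / N\<^sup>2 * w) * ((0 + 1 / N\<^sup>2 * w) powr (\<gamma> - 1) * profile N (0 + (0 + 1 / N\<^sup>2 * w)))) \<le>
          ennreal (N\<^sup>2 * (1 / N\<^sup>2) powr (\<gamma> - 1)) * ennreal (indicator {0<..} w * (w powr (\<gamma> - 1) * (1 + w) powr (- a)))"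
      proof (cases "w > 0")
        case True
        have "(1 + w / N\<^sup>2) powr (\<alpha> / 2) \<le> (1 + w) powr (\<alpha> / 2)"
          using True N2 \<alpha>_ge_1 by (intro powr_mono2) (auto simp: field_simps mult_le_cancel_left1)
        then have "(1 + w / N\<^sup>2) powr (\<alpha> / 2) * (1 + w) powr (- b) \<le> (1 + w) powr (\<alpha> / 2) * (1 + w) powr (- b)"
          by (rule mult_right_mono) simp
        also have "\<dots> = (1 + w) powr (- a)" unfolding powr_add[symmetric] b_minus_a[symmetric] by simp
        finally have "profile N (w / N\<^sup>2) \<le> N\<^sup>2 * (1 + w) powr (- a)"
          using N2 by (simp add: profile_def mult.assoc)
        then have "(1 / N\<^sup>2 * w) powr (\<gamma> - 1) * profile N (w / N\<^sup>2) \<le> (1 / N\<^sup>2 * w) powr (\<gamma> - 1) * (N\<^sup>2 * (1 + w) powr (- a))"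
          by (rule mult_left_mono) simp
        also have "\<dots> = ((1 / N\<^sup>2) powr (\<gamma> - 1) * w powr (\<gamma> - 1)) * (N\<^sup>2 * (1 + w) powr (- a))"
          using True N2 by (subst powr_mult) auto
        finally have "(1 / N\<^sup>2 * w) powr (\<gamma> - 1) * profile N (w / N\<^sup>2) \<le> N\<^sup>2 * (1 / N\<^sup>2) powr (\<gamma> - 1) * (w powr (\<gamma> - 1) * (1 + w) powr (- a))"
          by (simp only: mult_ac)
        moreover have "indicator {0<..} (0 + 1 / N\<^sup>2 * w) * ((0 + 1 / N\<^sup>2 * w) powr (\<gamma> - 1) * profile N (0 + (0 + 1 / N\<^sup>2 * w))) = (1 / N\<^sup>2 * w) powr (\<gamma> - 1) * profile N (w / N\<^sup>2)"
          using True N2 by (simp add: zero_less_divide_iff)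
        ultimately show ?thesis using True N2 by (simp add: ennreal_mult[symmetric] ennreal_leI del: times_divide_eq_left)
      next
        case False
        then have "\<not> 0 < 1 / N\<^sup>2 * w" using N2 by (simp add: zero_less_divide_iff)
        then show ?thesis by simp
      qed
    qed (use N2 in auto)
    also have "\<dots> = ennreal (1 / N\<^sup>2) * (ennreal (N\<^sup>2 * (1 / N\<^sup>2) powr (\<gamma> - 1)) * I)"
      unfolding I_def by (subst nn_integral_cmult) auto
    also have "\<dots> = ennreal ((1 / N\<^sup>2) powr (\<gamma> - 1)) * I"
      using N2 by (simp add: mult.assoc[symmetric] ennreal_mult[symmetric])
    also have "(1 / N\<^sup>2) powr (\<gamma> - 1) = N powr (2 - 2 * \<gamma>)"
    proof -
      have "1 / N\<^sup>2 = N powr (-2)" using N by (simp add: powr_minus_divide powr_numeral)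
      then show ?thesis by (simp add: powr_powr algebra_simps)
    qed
    finally have "(\<integral>\<^sup>+s. ennreal (s powr (- \<gamma>) * exp (- (s * 0))) \<partial>mix N) \<le> ennreal (1 / Gamma \<gamma>) * (ennreal (N powr (2 - 2 * \<gamma>)) * I)"
      using N2 \<gamma> by (subst nn_integral_mix_powr[OF N]) (auto intro!: mult_left_mono)
    also have "\<dots> = ennreal (C * N powr (2 - 2 * \<gamma>))"
    proof -
      have "I = ennreal (enn2real I)" using I by simp
      then have "ennreal (1 / Gamma \<gamma>) * (ennreal (N powr (2 - 2 * \<gamma>)) * I) = ennreal (1 / Gamma \<gamma>) * (ennreal (N powr (2 - 2 * \<gamma>)) * ennreal (enn2real I))"
        by (rule arg_cong)
      also have "\<dots> = ennreal (1 / Gamma \<gamma> * (N powr (2 - 2 * \<gamma>) * enn2real I))"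
        using Gamma_real_pos[OF \<gamma>(1)] by (simp only: ennreal_mult[symmetric] powr_ge_zero enn2real_nonneg
            mult_nonneg_nonneg divide_nonneg_nonneg zero_le_one less_imp_le)
      finally show ?thesis by (simp only: C_def mult_ac)
    qed
    finally show ?thesis by simp
  qed
  moreover have "C \<ge> 0" using Gamma_real_pos[OF \<gamma>(1)] by (simp add: C_def)
  ultimately show ?thesis by auto
qed

text \<open>The polynomial is absorbed by exp (d s) with a small d > 0, which amounts to evaluating
  the Laplace transform formula at the negative point -d.\<close>

lemma mix_moment_weighted_finite:
  assumes N: "1 \<le> N"
  shows "(\<integral>\<^sup>+s. ennreal (s powr (- (1/2)) * (1 + s) ^ k) \<partial>mix N) < \<infinity>"
proof -
  have N2: "1 \<le> N\<^sup>2" "0 < N\<^sup>2" using N by (auto simp: one_le_power zero_less_power)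
  \<comment> \<open>Half of the distance 1/N^2 to the singularity of the profile: this keeps 1 + N^2
    (T - d) at least (1 + T) / 2.\<close>
  define d where "d = 1 / (2 * N\<^sup>2)"
  have d: "d > 0" "- (1 / N\<^sup>2) < - d" "d \<le> 1/2" "N\<^sup>2 * d = 1/2" using N2 by (auto simp: d_def field_simps)
  define C where "C = fact k / d ^ k * exp d"
  have C: "(1 + s) ^ k \<le> C * exp (d * s)" if "s > 0" for s
    unfolding C_def using that d by (intro power_le_exp) auto
  have C0: "C \<ge> 0" using d by (simp add: C_def)
  have "(\<integral>\<^sup>+s. ennreal (s powr (- (1/2)) * (1 + s) ^ k) \<partial>mix N) \<le> (\<integral>\<^sup>+s. ennreal C * ennreal (s powr (- (1/2)) * exp (- (s * (- d)))) \<partial>mix N)"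
  proof (rule nn_integral_mono_AE)
    show "AE s in mix N. ennreal (s powr (- (1/2)) * (1 + s) ^ k) \<le> ennreal C * ennreal (s powr (- (1/2)) * exp (- (s * (- d))))"
      using AE_mix_pos
    proof eventually_elim
      case (elim s)
      have "s powr (- (1/2)) * (1 + s) ^ k \<le> s powr (- (1/2)) * (C * exp (d * s))" by (intro mult_left_mono C elim) simp
      then show ?case using C0 by (simp add: ennreal_mult[symmetric] ennreal_leI mult_ac)
    qed
  qed
  also have "\<dots> = ennreal C * (\<integral>\<^sup>+s. ennreal (s powr (- (1/2)) * exp (- (s * (- d)))) \<partial>mix N)"
    by (rule nn_integral_cmult) measurable
  also have "(\<integral>\<^sup>+s. ennreal (s powr (- (1/2)) * exp (- (s * (- d)))) \<partial>mix N) =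
      ennreal (1 / Gamma (1/2)) * (\<integral>\<^sup>+T. ennreal (indicator {0<..} T * (T powr (1/2 - 1) * profile N (- d + T))) \<partial>lborel)"
    by (rule nn_integral_mix_powr[OF N _ d(2)]) simp
  also have "(\<integral>\<^sup>+T. ennreal (indicator {0<..} T * (T powr (1/2 - 1) * profile N (- d + T))) \<partial>lborel) \<le>
      (\<integral>\<^sup>+T. ennreal (N\<^sup>2 * 2 powr b) * ennreal (indicator {0<..} T * (T powr (1/2 - 1) * (1 + T) powr (- a))) \<partial>lborel)"
  proof (rule nn_integral_mono)
    fix T :: real
    show "ennreal (indicator {0<..} T * (T powr (1/2 - 1) * profile N (- d + T))) \<le>
        ennreal (N\<^sup>2 * 2 powr b) * ennreal (indicator {0<..} T * (T powr (1/2 - 1) * (1 + T) powr (- a)))"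
    proof (cases "T > 0")
      case True
      have 1: "(1 + (- d + T)) powr (\<alpha> / 2) \<le> (1 + T) powr (\<alpha> / 2)"
        using True d \<alpha>_ge_1 by (intro powr_mono2) auto
      have "(1 + T) / 2 \<le> 1 + N\<^sup>2 * (- d + T)"
      proof -
        have "T \<le> N\<^sup>2 * T" using N2 True by simp
        moreover have "N\<^sup>2 * (- d + T) = N\<^sup>2 * T - 1/2" using d(4) by (simp add: algebra_simps)
        ultimately show ?thesis using True by simp
      qed
      then have "(1 + N\<^sup>2 * (- d + T)) powr (- b) \<le> ((1 + T) / 2) powr (- b)"
        using True b_pos by (intro powr_mono2') auto
      also have "\<dots> = 2 powr b * (1 + T) powr (- b)"
        using True by (simp add: powr_divide powr_minus_divide)
      finally have "(1 + (- d + T)) powr (\<alpha> / 2) * (1 + N\<^sup>2 * (- d + T)) powr (- b) \<le> (1 + T) powr (\<alpha> / 2) * (2 powr b * (1 + T) powr (- b))"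
        using 1 by (intro mult_mono) auto
      also have "\<dots> = 2 powr b * ((1 + T) powr (\<alpha> / 2) * (1 + T) powr (- b))" by simp
      also have "(1 + T) powr (\<alpha> / 2) * (1 + T) powr (- b) = (1 + T) powr (- a)"
        unfolding powr_add[symmetric] b_minus_a[symmetric] by simp
      finally have "profile N (- d + T) \<le> N\<^sup>2 * (2 powr b * (1 + T) powr (- a))"
        using N2 by (simp add: profile_def mult.assoc)
      then have "T powr (1/2 - 1) * profile N (- d + T) \<le> T powr (1/2 - 1) * (N\<^sup>2 * (2 powr b * (1 + T) powr (- a)))"
        by (rule mult_left_mono) simp
      then have "T powr (1/2 - 1) * profile N (- d + T) \<le> N\<^sup>2 * 2 powr b * (T powr (1/2 - 1) * (1 + T) powr (- a))"
        by (simp only: mult_ac)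
      then show ?thesis using True N2 by (simp add: ennreal_mult[symmetric] ennreal_leI)
    qed simp
  qed
  also have "\<dots> = ennreal (N\<^sup>2 * 2 powr b) * (\<integral>\<^sup>+T. ennreal (indicator {0<..} T * (T powr (1/2 - 1) * (1 + T) powr (- a))) \<partial>lborel)"
    by (rule nn_integral_cmult) measurable
  finally have "(\<integral>\<^sup>+s. ennreal (s powr (- (1/2)) * (1 + s) ^ k) \<partial>mix N) \<le>
     ennreal C * (ennreal (1 / Gamma (1/2)) * (ennreal (N\<^sup>2 * 2 powr b) * (\<integral>\<^sup>+T. ennreal (indicator {0<..} T * (T powr (1/2 - 1) * (1 + T) powr (- a))) \<partial>lborel)))"
    by (simp add: mult_left_mono)
  also have "\<dots> < \<infinity>"
    using nn_integral_beta_prime[of "1/2" a] a_gt_half by (auto simp: ennreal_mult_less_top)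
  finally show ?thesis .
qed

end

section \<open>The second mixing parameter and the weight as a mixture\<close>

context axial_power
begin

text \<open>The measure whose Laplace transform at Q is Q^(-p/2). It is infinite, which is why the
  mixture is handled as a sigma-finite rather than as a finite measure.\<close>

definition tau :: "real measure" where
  "tau = density lborel (\<lambda>t. ennreal (indicator {0<..} t * (t powr (p / 2 - 1) / Gamma (p / 2))))"

lemma sets_tau [simp, measurable_cong]: "sets tau = sets borel"
  by (simp add: tau_def)

lemma nn_integral_tau:
  assumes [measurable]: "f \<in> borel_measurable borel"
  shows "(\<integral>\<^sup>+t. f t \<partial>tau) = ennreal (1 / Gamma (p / 2)) * (\<integral>\<^sup>+t. ennreal (indicator {0<..} t * t powr (p / 2 - 1)) * f t \<partial>lborel)"
proof -
  have "0 \<le> 1 / Gamma (p / 2)" using Gamma_real_pos[of "p / 2"] p_pos by simp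
  then have "ennreal (indicator {0<..} t * (t powr (p / 2 - 1) / Gamma (p / 2))) * f t =
      ennreal (1 / Gamma (p / 2)) * (ennreal (indicator {0<..} t * t powr (p / 2 - 1)) * f t)" for t
    by (simp add: mult.assoc[symmetric] ennreal_mult[symmetric])
  then show ?thesis
    unfolding tau_def by (subst nn_integral_density) (auto simp: nn_integral_cmult)
qed

lemma AE_tau_pos: "AE t in tau. t > 0"
  unfolding tau_def by (subst AE_density) (auto simp: indicator_def split: if_splits)

lemma sigma_finite_tau: "sigma_finite_measure tau"
  unfolding tau_def by (subst sigma_finite_measure.sigma_finite_iff_density_finite[OF lborel.sigma_finite_measure_axioms]) auto

lemma nn_integral_tau_exp:
  assumes "Q > 0"
  shows "(\<integral>\<^sup>+t. ennreal (exp (- (t * Q))) \<partial>tau) = ennreal (Q powr (- (p / 2)))"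
proof -
  have p2: "p / 2 > 0" using p_pos by simp
  have "(\<integral>\<^sup>+t. ennreal (exp (- (t * Q))) \<partial>tau) =
      ennreal (1 / Gamma (p / 2)) * (\<integral>\<^sup>+t. ennreal (indicator {0<..} t * (t powr (p / 2 - 1) * exp (- (Q * t)))) \<partial>lborel)"
    by (subst nn_integral_tau) (auto simp: ennreal_mult[symmetric] mult_ac)
  then show ?thesis using powr_conv_nn_integral[OF p2 assms] by simp
qed

lemma nn_integral_tau_finite:
  assumes "p / 2 < c"
  shows "(\<integral>\<^sup>+t. ennreal ((1 + t) powr (- c)) \<partial>tau) < \<infinity>"
proof -
  have "(\<integral>\<^sup>+t. ennreal ((1 + t) powr (- c)) \<partial>tau) =
      ennreal (1 / Gamma (p / 2)) * (\<integral>\<^sup>+t. ennreal (indicator {0<..} t * (t powr (p / 2 - 1) * (1 + t) powr (- c))) \<partial>lborel)"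
    by (subst nn_integral_tau) (auto simp: ennreal_mult[symmetric] mult_ac)
  then show ?thesis
    using nn_integral_beta_prime[of "p / 2" c] assms p_pos by (auto simp: ennreal_mult_less_top)
qed

abbreviation mixture :: "real \<Rightarrow> (real \<times> real) measure" where
  "mixture N \<equiv> mix N \<Otimes>\<^sub>M tau"

lemma pair_sigma_finite_mixture: "1 \<le> N \<Longrightarrow> pair_sigma_finite (mix N) tau"
  by (intro pair_sigma_finite.intro finite_measure.axioms(1) finite_measure_mix sigma_finite_tau)

lemma sigma_finite_mixture: "1 \<le> N \<Longrightarrow> sigma_finite_measure (mixture N)"
  by (intro sigma_finite_pair_measure finite_measure.axioms(1) finite_measure_mix sigma_finite_tau)

lemma AE_mixture_pos:
  assumes N: "1 \<le> N"
  shows "AE \<omega> in mixture N. fst \<omega> > 0 \<and> snd \<omega> > 0"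
proof -
  interpret pair_sigma_finite "mix N" tau by (rule pair_sigma_finite_mixture[OF N])
  have "AE s in mix N. AE t in tau. s > 0 \<and> t > 0"
    using AE_mix_pos[of N]
  proof eventually_elim
    case (elim s)
    show ?case using AE_tau_pos by eventually_elim (simp add: elim)
  qed
  then have "AE \<omega> in mixture N. case \<omega> of (s, t) \<Rightarrow> s > 0 \<and> t > 0"
    by (intro AE_pair_measure, measurable)
  then show ?thesis by (auto elim!: eventually_mono)
qed

definition weight :: "real \<Rightarrow> 'a \<Rightarrow> real" where
  "weight N x = N\<^sup>2 * norm x powr \<alpha> * (N\<^sup>2 * (x \<bullet> e)\<^sup>2 + perp2 e x) powr (- b)"

lemma measurable_weight [measurable]: "weight N \<in> borel_measurable borel"
  unfolding weight_def[abs_def] by measurable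

lemma weight_nonneg: "0 \<le> weight N x"
  by (simp add: weight_def)

lemma weight_eq_profile:
  assumes Q: "perp2 e x > 0"
  shows "weight N x = profile N ((x \<bullet> e)\<^sup>2 / perp2 e x) * perp2 e x powr (- (p / 2)) / sqrt (perp2 e x)"
proof -
  define Q where "Q = perp2 e x"
  define T where "T = (x \<bullet> e)\<^sup>2 / Q"
  have Q0: "Q > 0" using assms by (simp add: Q_def)
  have T0: "T \<ge> 0" using Q0 by (simp add: T_def)
  have x2: "(norm x)\<^sup>2 = Q * (1 + T)" using Q0 by (simp add: norm2_eq_perp2[of x e] Q_def[symmetric] T_def field_simps)
  have B: "N\<^sup>2 * (x \<bullet> e)\<^sup>2 + Q = Q * (1 + N\<^sup>2 * T)" using Q0 by (simp add: T_def field_simps)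
  have "norm x powr \<alpha> = ((norm x)\<^sup>2) powr (\<alpha> / 2)"
  proof (cases "x = 0")
    case False
    then have sq: "(norm x)\<^sup>2 = norm x powr 2" by (simp add: powr_numeral)
    show ?thesis unfolding sq powr_powr by simp
  qed simp
  also have "\<dots> = Q powr (\<alpha> / 2) * (1 + T) powr (\<alpha> / 2)" unfolding x2 by (rule powr_mult)
  finally have 1: "norm x powr \<alpha> = Q powr (\<alpha> / 2) * (1 + T) powr (\<alpha> / 2)" .
  have 2: "(N\<^sup>2 * (x \<bullet> e)\<^sup>2 + Q) powr (- b) = Q powr (- b) * (1 + N\<^sup>2 * T) powr (- b)"
    unfolding B by (rule powr_mult)
  have "Q powr (\<alpha> / 2) * Q powr (- b) = Q powr (- (p / 2)) * Q powr (- (1 / 2))"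
    unfolding powr_add[symmetric] b_minus_a[symmetric] by (simp add: a_def field_simps)
  also have "Q powr (- (1 / 2)) = 1 / sqrt Q" using Q0 by (simp add: powr_minus_divide powr_half_sqrt)
  finally have 3: "Q powr (\<alpha> / 2) * Q powr (- b) = Q powr (- (p / 2)) / sqrt Q" by simp
  have "weight N x = (N\<^sup>2 * (1 + T) powr (\<alpha> / 2) * (1 + N\<^sup>2 * T) powr (- b)) * (Q powr (\<alpha> / 2) * Q powr (- b))"
    unfolding weight_def Q_def[symmetric] 1 2 by (simp only: mult_ac)
  then show ?thesis unfolding 3 by (simp add: profile_def Q_def T_def)
qed

lemma weight_le:
  assumes N: "1 \<le> N"
  shows "weight N x \<le> N\<^sup>2 * norm x powr (- (p + 1))"
proof (cases "x = 0")
  case False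
  have N2: "1 \<le> N\<^sup>2" using N by (simp add: one_le_power)
  have "(norm x)\<^sup>2 \<le> N\<^sup>2 * (x \<bullet> e)\<^sup>2 + perp2 e x"
    using N2 mult_right_mono[of 1 "N\<^sup>2" "(x \<bullet> e)\<^sup>2"] by (simp add: norm2_eq_perp2[of x e])
  then have "(N\<^sup>2 * (x \<bullet> e)\<^sup>2 + perp2 e x) powr (- b) \<le> ((norm x)\<^sup>2) powr (- b)"
    using False b_pos by (intro powr_mono2') auto
  also have "\<dots> = norm x powr (- (2 * b))"
  proof -
    have sq: "(norm x)\<^sup>2 = norm x powr 2" using False by (simp add: powr_numeral)
    show ?thesis unfolding sq powr_powr by simp
  qed
  finally have "weight N x \<le> N\<^sup>2 * norm x powr \<alpha> * norm x powr (- (2 * b))"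
    unfolding weight_def using N2 by (intro mult_left_mono) auto
  also have "\<dots> = N\<^sup>2 * (norm x powr \<alpha> * norm x powr (- (2 * b)))" by simp
  also have "norm x powr \<alpha> * norm x powr (- (2 * b)) = norm x powr (- (p + 1))"
    unfolding powr_add[symmetric] by (rule arg_cong[of _ _ "\<lambda>r. norm x powr r"]) (simp add: p_def b_def field_simps)
  finally show ?thesis .
qed (simp add: weight_def)

text \<open>The exponential factorises: integration over t produces |y|^(-p), integration over s
  produces the profile at T = x_1^2 / |y|^2, and the kernel itself carries the remaining
  1/|y|.\<close>

lemma nn_integral_mixture_kernel:
  assumes N: "1 \<le> N" and Q: "perp2 e x > 0"
  shows "(\<integral>\<^sup>+\<omega>. ennreal (axial_kernel e (fst \<omega>) (snd \<omega>) x) \<partial>mixture N) = ennreal (weight N x)"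
proof -
  interpret pair_sigma_finite "mix N" tau by (rule pair_sigma_finite_mixture[OF N])
  define T where "T = (x \<bullet> e)\<^sup>2 / perp2 e x"
  have T0: "T \<ge> 0" using Q by (simp add: T_def)
  have split: "ennreal (axial_kernel e s t x) = ennreal (exp (- (s * T)) / sqrt (perp2 e x)) * ennreal (exp (- (t * perp2 e x)))" for s t
    using Q by (simp add: axial_kernel_def T_def ennreal_mult[symmetric] exp_diff exp_minus divide_inverse mult_ac)
  have "(\<integral>\<^sup>+\<omega>. ennreal (axial_kernel e (fst \<omega>) (snd \<omega>) x) \<partial>mixture N) =
      (\<integral>\<^sup>+s. (\<integral>\<^sup>+t. ennreal (exp (- (s * T)) / sqrt (perp2 e x)) * ennreal (exp (- (t * perp2 e x))) \<partial>tau) \<partial>mix N)"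
    unfolding split by (subst M2.nn_integral_fst[symmetric]) auto
  also have "\<dots> = (\<integral>\<^sup>+s. ennreal (exp (- (s * T))) * ennreal (perp2 e x powr (- (p / 2)) / sqrt (perp2 e x)) \<partial>mix N)"
  proof (rule nn_integral_cong)
    fix s
    have "(\<integral>\<^sup>+t. ennreal (exp (- (s * T)) / sqrt (perp2 e x)) * ennreal (exp (- (t * perp2 e x))) \<partial>tau) =
        ennreal (exp (- (s * T)) / sqrt (perp2 e x)) * ennreal (perp2 e x powr (- (p / 2)))"
      by (subst nn_integral_cmult) (auto simp: nn_integral_tau_exp[OF Q])
    then show "(\<integral>\<^sup>+t. ennreal (exp (- (s * T)) / sqrt (perp2 e x)) * ennreal (exp (- (t * perp2 e x))) \<partial>tau) =
        ennreal (exp (- (s * T))) * ennreal (perp2 e x powr (- (p / 2)) / sqrt (perp2 e x))"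
      using Q by (simp add: ennreal_mult[symmetric])
  qed
  also have "\<dots> = ennreal (profile N T) * ennreal (perp2 e x powr (- (p / 2)) / sqrt (perp2 e x))"
  proof -
    have "- (1 / N\<^sup>2) < 0" using N by simp
    then have "- (1 / N\<^sup>2) < T" using T0 by linarith
    then show ?thesis by (subst nn_integral_multc) (auto simp: laplace_mix[OF N])
  qed
  also have "\<dots> = ennreal (weight N x)"
    using Q by (simp add: ennreal_mult[symmetric] profile_nonneg weight_eq_profile T_def)
  finally show ?thesis .
qed

text \<open>Treats both distributions at once: the pairing is the integral of the weight against the
  transform of \<phi> minus \<open>cut\<close> times its value at 0. For \<alpha> > 1 nothing is
  subtracted; for \<alpha> = 1 the indicator of the unit ball gives the regularization.\<close>

definition cut :: "'a \<Rightarrow> real" where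
  "cut x = (if 1 < \<alpha> then 0 else indicator (ball 0 1) x)"

lemma measurable_cut [measurable]: "cut \<in> borel_measurable borel"
  unfolding cut_def[abs_def] by (cases "1 < \<alpha>") (simp_all add: borel_measurable_indicator)

lemma cut_bounds: "0 \<le> cut x" "cut x \<le> 1"
  by (auto simp: cut_def indicator_def)

definition kernel_cut :: "real \<Rightarrow> real \<Rightarrow> real" where
  "kernel_cut s t = (\<integral>x. axial_kernel e s t x * cut x \<partial>lborel)"

text \<open>The difference is integrated as one function. For \<alpha> = 1 the two terms behave like
  1/t for large t and have no finite integral separately.\<close>

definition transform :: "real \<Rightarrow> 'a \<Rightarrow> real" where
  "transform N \<xi> = (\<integral>\<omega>. axial_kernel_fourier e (fst \<omega>) (snd \<omega>) \<xi> - kernel_cut (fst \<omega>) (snd \<omega>) \<partial>mixture N)"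

lemma measurable_kernel_pair [measurable]:
  "(\<lambda>(\<omega>, x). axial_kernel e (fst \<omega>) (snd \<omega>) x) \<in> borel_measurable ((borel \<Otimes>\<^sub>M borel) \<Otimes>\<^sub>M borel)"
  unfolding axial_kernel_def by measurable

lemma measurable_kernel_fourier_pair [measurable]:
  "(\<lambda>(\<omega>, x). axial_kernel_fourier e (fst \<omega>) (snd \<omega>) x) \<in> borel_measurable ((borel \<Otimes>\<^sub>M borel) \<Otimes>\<^sub>M borel)"
  unfolding axial_kernel_fourier_def by measurable

lemma measurable_kernel_cut [measurable]:
  "(\<lambda>\<omega>. kernel_cut (fst \<omega>) (snd \<omega>)) \<in> borel_measurable (borel \<Otimes>\<^sub>M borel)"
  unfolding kernel_cut_def by (rule lborel.borel_measurable_lebesgue_integral) measurable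

lemma kernel_fourier_nonneg: "s > 0 \<Longrightarrow> t > 0 \<Longrightarrow> 0 \<le> axial_kernel_fourier e s t \<xi>"
  by (simp add: axial_kernel_fourier_def add_nonneg_nonneg)

text \<open>The danger is a small rate \<kappa> = t + (\<xi> \<bullet> e)^2 / (4 s). If the axial
  component carries half of |\<xi>|^2, then \<kappa> is at least a multiple of t + 1/s; otherwise
  the factor exp (- d / \<kappa>) absorbs every power of 1/\<kappa>. The growth in s is harmless in
  view of \<open>mix_moment_weighted_finite\<close>.\<close>

lemma kernel_fourier_bound:
  assumes r: "r > 0"
  shows "\<exists>C\<ge>0. \<forall>s>0. \<forall>t>0. \<forall>\<xi>. r \<le> norm \<xi> \<longrightarrow>
    axial_kernel_fourier e s t \<xi> \<le> C * (s powr (- (1/2)) * (1 + s) ^ n * (1 + t) powr (- ((real n - 1) / 2)))"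
proof -
  define m where "m = (real n - 1) / 2"
  have m0: "m > 0" "m \<le> real n" using dim by (auto simp: m_def)
  define d where "d = r\<^sup>2 / 8"
  have d0: "d > 0" using r by (simp add: d_def)
  define c where "c = min 1 d"
  have c0: "c > 0" "c \<le> 1" "c \<le> d" using d0 by (auto simp: c_def)
  define D where "D = fact n / d ^ n * exp d"
  have D0: "D \<ge> 0" using d0 by (simp add: D_def)
  define C1 where "C1 = max (c powr (- m)) D"
  have C1: "C1 \<ge> 0" unfolding C1_def using D0 by (rule max.coboundedI2)
  have main: "\<kappa> powr (- m) * exp (- (perp2 e \<xi> / (4 * \<kappa>))) \<le> C1 * ((1 + s) ^ n * (1 + t) powr (- m))"
    if s: "s > 0" and t: "t > 0" and \<xi>: "r \<le> norm \<xi>" and \<kappa>: "\<kappa> = t + (\<xi> \<bullet> e)\<^sup>2 / (4 * s)" for s t \<xi> \<kappa>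
  proof -
    have \<kappa>0: "\<kappa> > 0" "t \<le> \<kappa>" using s t by (auto simp: \<kappa> add_pos_nonneg)
    have s1: "1 \<le> (1 + s) ^ n" using s by (simp add: one_le_power)
    have "r\<^sup>2 \<le> (norm \<xi>)\<^sup>2" using r \<xi> by (intro power_mono) auto
    \<comment> \<open>The two quantities add up to |\<xi>|^2, so one of them is at least half of
      r^2. This half and the factor 4 in the exponents give d = r^2 / 8.\<close>
    then consider "r\<^sup>2 / 2 \<le> (\<xi> \<bullet> e)\<^sup>2" | "r\<^sup>2 / 2 \<le> perp2 e \<xi>"
      unfolding norm2_eq_perp2[of \<xi> e] by linarith
    then show ?thesis
    proof cases
      case 1
      have "d / s \<le> (\<xi> \<bullet> e)\<^sup>2 / (4 * s)" using 1 s by (simp add: d_def field_simps)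
      then have "c * (t + 1 / s) \<le> \<kappa>"
      proof -
        have "c * t \<le> t" using c0 t by simp
        moreover have "c * (1 / s) \<le> d / s" using c0 s by (simp add: divide_right_mono)
        ultimately show ?thesis using \<open>d / s \<le> (\<xi> \<bullet> e)\<^sup>2 / (4 * s)\<close> unfolding \<kappa> by (simp add: distrib_left)
      qed
      moreover have "(1 + t) / (1 + s) \<le> t + 1 / s"
      proof -
        have "(t + 1 / s) * (1 + s) = t + t * s + 1 / s + 1" using s by (simp add: field_simps)
        moreover have "0 \<le> t * s" "0 \<le> 1 / s" using s t by auto
        ultimately have "1 + t \<le> (t + 1 / s) * (1 + s)" by linarith
        then show ?thesis using s by (simp add: pos_divide_le_eq)
      qed
      then have "c * ((1 + t) / (1 + s)) \<le> c * (t + 1 / s)" using c0 by (intro mult_left_mono) auto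
      ultimately have k: "c * ((1 + t) / (1 + s)) \<le> \<kappa>" by linarith
      have "\<kappa> powr (- m) \<le> (c * ((1 + t) / (1 + s))) powr (- m)"
        using k c0 s t m0 by (intro powr_mono2') auto
      also have "\<dots> = c powr (- m) * ((1 + t) powr (- m) * (1 + s) powr m)"
        using c0 s t by (simp add: powr_mult powr_divide powr_minus_divide)
      also have "\<dots> \<le> C1 * ((1 + t) powr (- m) * (1 + s) ^ n)"
      proof (intro mult_mono)
        have "(1 + s) powr m \<le> (1 + s) powr real n" using s m0 by (intro powr_mono) auto
        then show "(1 + s) powr m \<le> (1 + s) ^ n" using s by (simp add: powr_realpow)
      qed (use C1 in \<open>auto simp: C1_def\<close>)
      finally have "\<kappa> powr (- m) \<le> C1 * ((1 + s) ^ n * (1 + t) powr (- m))" by (simp add: mult.commute)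
      moreover have "exp (- (perp2 e \<xi> / (4 * \<kappa>))) \<le> 1" using \<kappa>0 perp2_nonneg[OF e, of \<xi>] by simp
      ultimately show ?thesis
        using mult_left_le[of "exp (- (perp2 e \<xi> / (4 * \<kappa>)))" "\<kappa> powr (- m)"] by simp
    next
      case 2
      have "d / \<kappa> \<le> perp2 e \<xi> / (4 * \<kappa>)" using 2 \<kappa>0 by (simp add: d_def field_simps)
      then have "\<kappa> powr (- m) * exp (- (perp2 e \<xi> / (4 * \<kappa>))) \<le> \<kappa> powr (- m) * exp (- (d / \<kappa>))"
        by (intro mult_left_mono) auto
      also have "\<kappa> powr (- m) * exp (- (d / \<kappa>)) = (1 + \<kappa>) powr (- m) * (1 + 1 / \<kappa>) powr m * exp (- (d / \<kappa>))"
      proof -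
        have "1 + 1 / \<kappa> = (1 + \<kappa>) / \<kappa>" using \<kappa>0 by (simp add: field_simps)
        then show ?thesis using \<kappa>0 by (simp add: powr_divide powr_minus_divide)
      qed
      also have "(1 + \<kappa>) powr (- m) * (1 + 1 / \<kappa>) powr m * exp (- (d / \<kappa>)) = (1 + \<kappa>) powr (- m) * ((1 + 1 / \<kappa>) powr m * exp (- (d / \<kappa>)))"
        by simp
      also have "\<dots> \<le> (1 + t) powr (- m) * D"
      proof (intro mult_mono)
        show "(1 + \<kappa>) powr (- m) \<le> (1 + t) powr (- m)" using \<kappa>0 t m0 by (intro powr_mono2') auto
        have "(1 + 1 / \<kappa>) powr m \<le> (1 + 1 / \<kappa>) powr real n" using \<kappa>0 m0 by (intro powr_mono) auto
        also have "\<dots> = (1 + 1 / \<kappa>) ^ n" using \<kappa>0 by (simp add: powr_realpow add_pos_pos)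
        also have "\<dots> \<le> D * exp (d * (1 / \<kappa>))" unfolding D_def using d0 \<kappa>0 by (intro power_le_exp) auto
        finally have "(1 + 1 / \<kappa>) powr m * exp (- (d / \<kappa>)) \<le> D * exp (d * (1 / \<kappa>)) * exp (- (d / \<kappa>))"
          by (rule mult_right_mono) simp
        also have "\<dots> = D" by (simp add: mult.assoc exp_add[symmetric])
        finally show "(1 + 1 / \<kappa>) powr m * exp (- (d / \<kappa>)) \<le> D" .
      qed auto
      also have "\<dots> \<le> C1 * ((1 + s) ^ n * (1 + t) powr (- m))"
      proof -
        have "D * 1 \<le> C1 * (1 + s) ^ n" using s1 D0 by (intro mult_mono) (auto simp: C1_def)
        then have "(1 + t) powr (- m) * (D * 1) \<le> (1 + t) powr (- m) * (C1 * (1 + s) ^ n)" by (rule mult_left_mono) simp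
        then show ?thesis by (simp add: mult_ac)
      qed
      finally show ?thesis .
    qed
  qed
  define C where "C = sqrt pi * sqrt pi ^ (n - 1) * C1"
  have "axial_kernel_fourier e s t \<xi> \<le> C * (s powr (- (1/2)) * (1 + s) ^ n * (1 + t) powr (- m))"
    if s: "s > 0" and t: "t > 0" and \<xi>: "r \<le> norm \<xi>" for s t \<xi>
  proof -
    define \<kappa> where "\<kappa> = t + (\<xi> \<bullet> e)\<^sup>2 / (4 * s)"
    have \<kappa>0: "\<kappa> > 0" using s t by (auto simp: \<kappa>_def add_pos_nonneg)
    have 1: "sqrt (pi / \<kappa>) ^ (n - 1) = sqrt pi ^ (n - 1) * \<kappa> powr (- m)"
      using sqrt_pi_div_power[OF \<kappa>0, of "n - 1"] dim by (simp add: m_def of_nat_diff)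
    have 2: "sqrt (pi / s) = sqrt pi * s powr (- (1/2))"
      using s by (simp add: real_sqrt_divide powr_minus_divide powr_half_sqrt)
    have "axial_kernel_fourier e s t \<xi> = sqrt pi * s powr (- (1/2)) * (sqrt pi ^ (n - 1) * \<kappa> powr (- m)) * exp (- (perp2 e \<xi> / (4 * \<kappa>)))"
      unfolding axial_kernel_fourier_def \<kappa>_def[symmetric] n_eq[symmetric] 1 2 ..
    also have "\<dots> = (sqrt pi * sqrt pi ^ (n - 1) * s powr (- (1/2))) * (\<kappa> powr (- m) * exp (- (perp2 e \<xi> / (4 * \<kappa>))))"
      by (simp only: mult_ac)
    also have "\<dots> \<le> (sqrt pi * sqrt pi ^ (n - 1) * s powr (- (1/2))) * (C1 * ((1 + s) ^ n * (1 + t) powr (- m)))"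
      by (intro mult_left_mono main[OF s t \<xi> \<kappa>_def]) auto
    also have "\<dots> = C * (s powr (- (1/2)) * (1 + s) ^ n * (1 + t) powr (- m))"
      unfolding C_def by (simp only: mult_ac)
    finally show ?thesis .
  qed
  moreover have "C \<ge> 0" using C1 by (simp add: C_def)
  ultimately show ?thesis unfolding m_def by blast
qed

lemma integrable_mixture_product:
  assumes N: "1 \<le> N" and [measurable]: "f \<in> borel_measurable borel" "g \<in> borel_measurable borel"
    and f0: "\<And>s. s > 0 \<Longrightarrow> 0 \<le> f s" and g0: "\<And>t. t > 0 \<Longrightarrow> 0 \<le> g t"
    and f: "(\<integral>\<^sup>+s. ennreal (f s) \<partial>mix N) < \<infinity>" and g: "(\<integral>\<^sup>+t. ennreal (g t) \<partial>tau) < \<infinity>"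
  shows "integrable (mixture N) (\<lambda>\<omega>. f (fst \<omega>) * g (snd \<omega>))"
proof -
  interpret pair_sigma_finite "mix N" tau by (rule pair_sigma_finite_mixture[OF N])
  have "(\<integral>\<^sup>+\<omega>. ennreal (norm (f (fst \<omega>) * g (snd \<omega>))) \<partial>mixture N) = (\<integral>\<^sup>+\<omega>. ennreal (f (fst \<omega>)) * ennreal (g (snd \<omega>)) \<partial>mixture N)"
  proof (rule nn_integral_cong_AE)
    show "AE \<omega> in mixture N. ennreal (norm (f (fst \<omega>) * g (snd \<omega>))) = ennreal (f (fst \<omega>)) * ennreal (g (snd \<omega>))"
      using AE_mixture_pos[OF N] by eventually_elim (simp add: abs_mult f0 g0 ennreal_mult)
  qed
  also have "\<dots> = (\<integral>\<^sup>+s. (\<integral>\<^sup>+t. ennreal (f s) * ennreal (g t) \<partial>tau) \<partial>mix N)"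
    by (subst M2.nn_integral_fst[symmetric]) auto
  also have "\<dots> = (\<integral>\<^sup>+s. ennreal (f s) \<partial>mix N) * (\<integral>\<^sup>+t. ennreal (g t) \<partial>tau)"
    by (simp add: nn_integral_cmult nn_integral_multc)
  also have "\<dots> < \<infinity>" using f g by (simp add: ennreal_mult_less_top)
  finally show ?thesis by (auto simp: integrable_iff_bounded)
qed

end

section \<open>The Fourier transform of the weight\<close>

context axial_power
begin

lemma integrable_kernel:
  assumes "s > 0" "t > 0"
  shows "integrable lborel (axial_kernel e s t)"
proof -
  have "integrable lborel (\<lambda>x. complex_of_real (axial_kernel e s t x))"
    using has_bochner_integral_axial_kernel[OF e _ assms, of 0] dim n_eq by (simp add: has_bochner_integral_iff)
  from integrable_Re[OF this] show ?thesis by simp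
qed

lemma integral_kernel:
  assumes "s > 0" "t > 0"
  shows "(\<integral>x. axial_kernel e s t x \<partial>lborel) = axial_kernel_fourier e s t 0"
proof -
  have "(\<integral>x. complex_of_real (axial_kernel e s t x) \<partial>lborel) = of_real (axial_kernel_fourier e s t 0)"
    using has_bochner_integral_axial_kernel[OF e _ assms, of 0] dim n_eq by (simp add: has_bochner_integral_iff)
  then show ?thesis by (simp only: integral_complex_of_real of_real_eq_iff)
qed

lemma integrable_kernel_cut:
  assumes "s > 0" "t > 0"
  shows "integrable lborel (\<lambda>x. axial_kernel e s t x * cut x)"
  by (rule Bochner_Integration.integrable_bound[OF integrable_kernel[OF assms]])
     (auto simp: abs_mult cut_bounds intro!: AE_I2 mult_left_le)

lemma kernel_cut_eq_0: "1 < \<alpha> \<Longrightarrow> kernel_cut s t = 0"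
  by (simp add: kernel_cut_def cut_def)

text \<open>For large t the cut-off integral is rewritten as the full integral minus this tail. The
  full integral is the transform at 0, which cancels the leading part of the transform at
  \<xi>.\<close>

definition kernel_tail :: "real \<Rightarrow> real \<Rightarrow> real" where
  "kernel_tail s t = (\<integral>x. axial_kernel e s t x * (1 - cut x) \<partial>lborel)"

lemma kernel_tail_eq:
  assumes "s > 0" "t > 0"
  shows "kernel_tail s t = axial_kernel_fourier e s t 0 - kernel_cut s t"
  unfolding kernel_tail_def kernel_cut_def integral_kernel[OF assms, symmetric]
  by (subst Bochner_Integration.integral_diff[symmetric])
     (auto intro: integrable_kernel integrable_kernel_cut assms simp: right_diff_distrib)

lemma kernel_tail_nonneg: "0 \<le> kernel_tail s t"
  unfolding kernel_tail_def
  by (intro integral_nonneg_AE AE_I2 mult_nonneg_nonneg axial_kernel_nonneg e) (simp add: cut_bounds)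

lemma measurable_kernel_tail [measurable]:
  "(\<lambda>\<omega>. kernel_tail (fst \<omega>) (snd \<omega>)) \<in> borel_measurable (borel \<Otimes>\<^sub>M borel)"
  unfolding kernel_tail_def by (rule lborel.borel_measurable_lebesgue_integral) measurable

text \<open>The unit ball is enlarged to the infinite cylinder |y| \<le> 1, over which the axial
  integral is explicit. For n = 3 what remains is the planar integral of exp (- t |y|^2) over the
  unit disc, namely \<pi> (1 - exp (- t)) / t.\<close>

lemma kernel_cut_le:
  assumes \<alpha>1: "\<not> 1 < \<alpha>" and s: "s > 0" and t: "t > 0"
  shows "kernel_cut s t \<le> sqrt (pi / s) * (pi * ((1 - exp (- t)) / t))"
proof -
  let ?g = "\<lambda>x. ennreal (exp (- (x \<bullet> e)\<^sup>2) / sqrt pi)"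
  have n3: "DIM('a) = 3" using \<alpha>_eq_1[OF \<alpha>1] n_eq by simp
  have \<nu>: "(\<integral>\<^sup>+x. ?g x * indicator {..v} (perp2 e x) \<partial>lborel) = ennreal (pi * v)" if "v > 0" for v
  proof -
    have "Gamma (2::real) = 1" using Gamma_fact[of 1, where 'a=real] by simp
    then have "emeasure lborel (unit_cylinder e) = ennreal pi"
      using measure_unit_cylinder[OF e] by (simp add: n3)
    then show ?thesis
      using nn_integral_axial_cylinder[OF e that] that by (simp add: n3 ennreal_mult[symmetric] mult.commute)
  qed
  \<comment> \<open>Layer representation of the Gaussian truncated at P = 1; the last term is the
    height exp (- t) of the jump there. It reduces the planar integral to the areas \<pi> v of
    discs.\<close>
  have layer: "ennreal (exp (- (t * P))) * indicator {..1} P =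
      (\<integral>\<^sup>+v. ennreal (t * exp (- (t * v))) * indicator {0..1} v * indicator {0..} (v - P) \<partial>lborel) + ennreal (exp (- t)) * indicator {..1} P"
    if P: "P \<ge> 0" for P
  proof (cases "P \<le> 1")
    case True
    have "(\<integral>\<^sup>+v. ennreal (t * exp (- (t * v))) * indicator {0..1} v * indicator {0..} (v - P) \<partial>lborel) =
        (\<integral>\<^sup>+v. ennreal (t * exp (- (t * v))) * indicator {P..1} v \<partial>lborel)"
      using P by (intro nn_integral_cong) (auto simp: indicator_def)
    also have "\<dots> = ennreal (- exp (- (t * 1)) - (- exp (- (t * P))))"
      using t True by (intro nn_integral_FTC_Icc) (auto intro!: derivative_eq_intros)
    finally have "(\<integral>\<^sup>+v. ennreal (t * exp (- (t * v))) * indicator {0..1} v * indicator {0..} (v - P) \<partial>lborel) = ennreal (exp (- (t * P)) - exp (- t))"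
      by simp
    moreover have "exp (- t) \<le> exp (- (t * P))" using True t by simp
    ultimately show ?thesis using True by (simp add: ennreal_plus[symmetric] del: ennreal_plus)
  next
    case False
    have "(\<integral>\<^sup>+v. ennreal (t * exp (- (t * v))) * indicator {0..1} v * indicator {0..} (v - P) \<partial>lborel) = (\<integral>\<^sup>+(v::real). 0 \<partial>lborel)"
      using False by (intro nn_integral_cong) (auto simp: indicator_def)
    then show ?thesis using False by simp
  qed
  have Ig: "(\<integral>\<^sup>+x. ?g x * (ennreal (exp (- (t * perp2 e x))) * indicator {..1} (perp2 e x)) \<partial>lborel) = ennreal (pi * ((1 - exp (- t)) / t))"
  proof -
    have "(\<integral>\<^sup>+x. ?g x * (ennreal (exp (- (t * perp2 e x))) * indicator {..1} (perp2 e x)) \<partial>lborel) =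
        (\<integral>\<^sup>+x. (\<integral>\<^sup>+v. ?g x * (ennreal (t * exp (- (t * v))) * indicator {0..1} v * indicator {0..} (v - perp2 e x)) \<partial>lborel)
          + ennreal (exp (- t)) * (?g x * indicator {..1} (perp2 e x)) \<partial>lborel)"
    proof (rule nn_integral_cong)
      fix x :: 'a
      have "?g x * (\<integral>\<^sup>+v. ennreal (t * exp (- (t * v))) * indicator {0..1} v * indicator {0..} (v - perp2 e x) \<partial>lborel) =
          (\<integral>\<^sup>+v. ?g x * (ennreal (t * exp (- (t * v))) * indicator {0..1} v * indicator {0..} (v - perp2 e x)) \<partial>lborel)"
        by (rule nn_integral_cmult[symmetric]) measurable
      then show "?g x * (ennreal (exp (- (t * perp2 e x))) * indicator {..1} (perp2 e x)) =
          (\<integral>\<^sup>+v. ?g x * (ennreal (t * exp (- (t * v))) * indicator {0..1} v * indicator {0..} (v - perp2 e x)) \<partial>lborel)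
          + ennreal (exp (- t)) * (?g x * indicator {..1} (perp2 e x))"
        unfolding layer[OF perp2_nonneg[OF e]] distrib_left by (simp only: mult.left_commute)
    qed
    also have "\<dots> = (\<integral>\<^sup>+x. (\<integral>\<^sup>+v. ?g x * (ennreal (t * exp (- (t * v))) * indicator {0..1} v * indicator {0..} (v - perp2 e x)) \<partial>lborel) \<partial>lborel)
          + (\<integral>\<^sup>+x. ennreal (exp (- t)) * (?g x * indicator {..1} (perp2 e x)) \<partial>lborel)"
      by (rule nn_integral_add) measurable
    also have "(\<integral>\<^sup>+x. ennreal (exp (- t)) * (?g x * indicator {..1} (perp2 e x)) \<partial>lborel) = ennreal (exp (- t) * pi)"
      using \<nu>[of 1] by (subst nn_integral_cmult) (auto simp: ennreal_mult[symmetric])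
    also have "(\<integral>\<^sup>+x. (\<integral>\<^sup>+v. ?g x * (ennreal (t * exp (- (t * v))) * indicator {0..1} v * indicator {0..} (v - perp2 e x)) \<partial>lborel) \<partial>lborel) =
        (\<integral>\<^sup>+v. (\<integral>\<^sup>+x. ?g x * (ennreal (t * exp (- (t * v))) * indicator {0..1} v * indicator {0..} (v - perp2 e x)) \<partial>lborel) \<partial>lborel)"
      by (rule lborel_pair.Fubini'[symmetric]) measurable
    also have "\<dots> = (\<integral>\<^sup>+v. ennreal (pi * (t * v * exp (- (t * v)))) * indicator {0..1} v \<partial>lborel)"
    proof (rule nn_integral_cong_AE)
      show "AE v in lborel. (\<integral>\<^sup>+x. ?g x * (ennreal (t * exp (- (t * v))) * indicator {0..1} v * indicator {0..} (v - perp2 e x)) \<partial>lborel) =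
          ennreal (pi * (t * v * exp (- (t * v)))) * indicator {0..1} v"
        using AE_lborel_singleton[of "0::real"]
      proof eventually_elim
        case (elim v)
        show ?case
        proof (cases "v \<in> {0..1}")
          case True
          then have v: "v > 0" using elim by auto
          have "(\<integral>\<^sup>+x. ?g x * (ennreal (t * exp (- (t * v))) * indicator {0..1} v * indicator {0..} (v - perp2 e x)) \<partial>lborel) =
              (\<integral>\<^sup>+x. ennreal (t * exp (- (t * v))) * (?g x * indicator {..v} (perp2 e x)) \<partial>lborel)"
            using True by (intro nn_integral_cong) (auto simp: indicator_def mult_ac)
          also have "\<dots> = ennreal (t * exp (- (t * v))) * ennreal (pi * v)"
            by (subst nn_integral_cmult) (auto simp: \<nu>[OF v])
          finally show ?thesis using True t v by (simp add: ennreal_mult[symmetric] mult_ac)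
        qed simp
      qed
    qed
    also have "\<dots> = ennreal (- (pi * ((1 + 1 / t) * exp (- (t * 1)))) - (- (pi * ((0 + 1 / t) * exp (- (t * 0))))))"
    proof (rule nn_integral_FTC_Icc)
      fix v :: real
      show "((\<lambda>v. - (pi * ((v + 1 / t) * exp (- (t * v))))) has_real_derivative pi * (t * v * exp (- (t * v)))) (at v)"
        using t by (auto intro!: derivative_eq_intros simp: field_simps)
    qed (use t in auto)
    also have "\<dots> + ennreal (exp (- t) * pi) = ennreal (pi * ((1 - exp (- t)) / t))"
    proof -
      have "(1 + 1 / t) * exp (- t) \<le> 1 / t"
      proof -
        have "(t + 1) * exp (- t) \<le> exp t * exp (- t)" using exp_ge_add_one_self[of t] by (intro mult_right_mono) (simp_all add: add.commute)
        then have "(t + 1) * exp (- t) \<le> 1" by (simp add: exp_add[symmetric])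
        then have "((t + 1) * exp (- t)) / t \<le> 1 / t" using t by (intro divide_right_mono) auto
        moreover have "((t + 1) * exp (- t)) / t = (1 + 1 / t) * exp (- t)" using t by (simp add: field_simps)
        ultimately show ?thesis by simp
      qed
      then have "pi * ((1 + 1 / t) * exp (- t)) \<le> pi * (1 / t)" by (rule mult_left_mono) simp
      then have "0 \<le> - (pi * ((1 + 1 / t) * exp (- (t * 1)))) - (- (pi * ((0 + 1 / t) * exp (- (t * 0)))))" by simp
      then have "ennreal (- (pi * ((1 + 1 / t) * exp (- (t * 1)))) - (- (pi * ((0 + 1 / t) * exp (- (t * 0)))))) + ennreal (exp (- t) * pi) =
         ennreal ((- (pi * ((1 + 1 / t) * exp (- (t * 1)))) - (- (pi * ((0 + 1 / t) * exp (- (t * 0)))))) + exp (- t) * pi)"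
        by (intro ennreal_plus[symmetric]) auto
      also have "(- (pi * ((1 + 1 / t) * exp (- (t * 1)))) - (- (pi * ((0 + 1 / t) * exp (- (t * 0)))))) + exp (- t) * pi = pi * ((1 - exp (- t)) / t)"
        using t by (simp add: field_simps)
      finally show ?thesis .
    qed
    finally show ?thesis .
  qed
  have AEpos: "AE x in lborel. perp2 e x > 0" using AE_perp2_pos[OF e] n3 by simp
  have "ennreal (kernel_cut s t) = (\<integral>\<^sup>+x. ennreal (axial_kernel e s t x * cut x) \<partial>lborel)"
    unfolding kernel_cut_def using integrable_kernel_cut[OF s t]
    by (intro nn_integral_eq_integral[symmetric]) (auto simp: axial_kernel_nonneg e cut_bounds)
  also have "\<dots> \<le> (\<integral>\<^sup>+x. ennreal (axial_kernel e s t x) * indicator {..1} (perp2 e x) \<partial>lborel)"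
  proof (rule nn_integral_mono)
    fix x :: 'a
    have "perp2 e x \<le> 1" if "norm x < 1"
      using that norm2_eq_perp2[of x e] by (simp add: perp2_def) (smt (verit) abs_square_le_1 norm_ge_zero abs_of_nonneg zero_le_power2)
    then show "ennreal (axial_kernel e s t x * cut x) \<le> ennreal (axial_kernel e s t x) * indicator {..1} (perp2 e x)"
      using \<alpha>1 by (auto simp: cut_def indicator_def)
  qed
  also have "\<dots> = (\<integral>\<^sup>+x. ?g x * (\<integral>\<^sup>+r. ennreal (axial_kernel e s t (x + (r - x \<bullet> e) *\<^sub>R e)) * indicator {..1} (perp2 e (x + (r - x \<bullet> e) *\<^sub>R e)) \<partial>lborel) \<partial>lborel)"
    by (rule nn_integral_axis[OF _ e]) measurable
  also have "\<dots> = (\<integral>\<^sup>+x. ennreal (sqrt (pi / s)) * (?g x * (ennreal (exp (- (t * perp2 e x))) * indicator {..1} (perp2 e x))) \<partial>lborel)"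
  proof (rule nn_integral_cong_AE)
    show "AE x in lborel. ?g x * (\<integral>\<^sup>+r. ennreal (axial_kernel e s t (x + (r - x \<bullet> e) *\<^sub>R e)) * indicator {..1} (perp2 e (x + (r - x \<bullet> e) *\<^sub>R e)) \<partial>lborel) =
        ennreal (sqrt (pi / s)) * (?g x * (ennreal (exp (- (t * perp2 e x))) * indicator {..1} (perp2 e x)))"
      using AEpos
    proof eventually_elim
      case (elim x)
      have "(\<integral>\<^sup>+r. ennreal (axial_kernel e s t (x + (r - x \<bullet> e) *\<^sub>R e)) * indicator {..1} (perp2 e x) \<partial>lborel) =
          (\<integral>\<^sup>+r. ennreal (axial_kernel e s t (x + (r - x \<bullet> e) *\<^sub>R e)) \<partial>lborel) * indicator {..1} (perp2 e x)"
        by (rule nn_integral_multc) measurable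
      then show ?case
        unfolding perp2_add_axis[OF e] nn_integral_axial_kernel_line[OF e s elim] using s
        by (simp add: ennreal_mult mult_ac)
    qed
  qed
  also have "\<dots> = ennreal (sqrt (pi / s)) * ennreal (pi * ((1 - exp (- t)) / t))"
    by (subst nn_integral_cmult) (auto simp: Ig)
  also have "\<dots> = ennreal (sqrt (pi / s) * (pi * ((1 - exp (- t)) / t)))"
    using s t by (simp add: ennreal_mult[symmetric])
  finally show ?thesis
    using s t by (simp add: ennreal_le_iff)
qed

text \<open>Integration over t and s gives back the weight, now with an extra factor exp (- |y|^2 /
  2) saved from t \<ge> 1. Outside the unit ball the weight is at most 2 N^2 / (1 + x_1^2), so the
  bound is integrable along the axis and Gaussian across it.\<close>

lemma kernel_tail_integrable:
  assumes \<alpha>1: "\<not> 1 < \<alpha>" and N: "1 \<le> N"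
  shows "integrable (mixture N) (\<lambda>\<omega>. indicator {1..} (snd \<omega>) * kernel_tail (fst \<omega>) (snd \<omega>))"
proof -
  interpret M: pair_sigma_finite "mix N" tau by (rule pair_sigma_finite_mixture[OF N])
  interpret P: sigma_finite_measure "mixture N" by (rule sigma_finite_mixture[OF N])
  interpret PL: pair_sigma_finite "mixture N" "lborel :: 'a measure" ..
  have p2: "p = 2" and n3: "DIM('a) = 3" using \<alpha>_eq_1[OF \<alpha>1] n_eq by simp_all
  have AEpos: "AE x in lborel. perp2 e x > 0" using AE_perp2_pos[OF e] n3 by simp
  let ?f = "\<lambda>\<omega> x. ennreal (indicator {1..} (snd \<omega>) * (axial_kernel e (fst \<omega>) (snd \<omega>) x * (1 - cut x)))"
  have [measurable]: "(\<lambda>(\<omega>, x). ?f \<omega> x) \<in> borel_measurable (mixture N \<Otimes>\<^sub>M lborel)"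
  proof -
    have "(\<lambda>(\<omega>, x). axial_kernel e (fst \<omega>) (snd \<omega>) x) \<in> borel_measurable (mixture N \<Otimes>\<^sub>M lborel)"
      by measurable
    then show ?thesis by measurable
  qed
  have "(\<integral>\<^sup>+\<omega>. ennreal (norm (indicator {1..} (snd \<omega>) * kernel_tail (fst \<omega>) (snd \<omega>))) \<partial>mixture N) = (\<integral>\<^sup>+\<omega>. (\<integral>\<^sup>+x. ?f \<omega> x \<partial>lborel) \<partial>mixture N)"
  proof (rule nn_integral_cong_AE)
    show "AE \<omega> in mixture N. ennreal (norm (indicator {1..} (snd \<omega>) * kernel_tail (fst \<omega>) (snd \<omega>))) = (\<integral>\<^sup>+x. ?f \<omega> x \<partial>lborel)"
      using AE_mixture_pos[OF N]
    proof eventually_elim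
      case (elim \<omega>)
      have "integrable lborel (\<lambda>x. axial_kernel e (fst \<omega>) (snd \<omega>) x - axial_kernel e (fst \<omega>) (snd \<omega>) x * cut x)"
        using elim by (intro Bochner_Integration.integrable_diff integrable_kernel integrable_kernel_cut) auto
      then have i: "integrable lborel (\<lambda>x. indicator {1..} (snd \<omega>) * (axial_kernel e (fst \<omega>) (snd \<omega>) x * (1 - cut x)))"
        by (intro integrable_mult_right) (simp add: right_diff_distrib)
      have "(\<integral>\<^sup>+x. ?f \<omega> x \<partial>lborel) = ennreal (\<integral>x. indicator {1..} (snd \<omega>) * (axial_kernel e (fst \<omega>) (snd \<omega>) x * (1 - cut x)) \<partial>lborel)"
        by (intro nn_integral_eq_integral[OF i] AE_I2) (simp add: axial_kernel_nonneg e cut_bounds)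
      then show ?case by (simp add: kernel_tail_def[symmetric] kernel_tail_nonneg)
    qed
  qed
  also have "\<dots> = (\<integral>\<^sup>+x. (\<integral>\<^sup>+\<omega>. ?f \<omega> x \<partial>mixture N) \<partial>lborel)"
    by (rule PL.Fubini'[symmetric]) measurable
  also have "\<dots> \<le> (\<integral>\<^sup>+x. ennreal (4 * N\<^sup>2 * ((1 / (1 + (norm (x \<bullet> e))\<^sup>2) ^ 1) * exp (- (1/2 * perp2 e x)))) \<partial>lborel)"
  proof (rule nn_integral_mono_AE)
    show "AE x in lborel. (\<integral>\<^sup>+\<omega>. ?f \<omega> x \<partial>mixture N) \<le> ennreal (4 * N\<^sup>2 * ((1 / (1 + (norm (x \<bullet> e))\<^sup>2) ^ 1) * exp (- (1/2 * perp2 e x))))"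
      using AEpos
    proof eventually_elim
      case (elim x)
      define Q where "Q = perp2 e x"
      have Q: "Q > 0" using elim by (simp add: Q_def)
      define T where "T = (x \<bullet> e)\<^sup>2 / Q"
      have T0: "T \<ge> 0" using Q by (simp add: T_def)
      show ?case
      proof (cases "norm x < 1")
        case True
        then show ?thesis using \<alpha>1 by (simp add: cut_def)
      next
        case False
        then have x1: "1 \<le> norm x" by simp
        have "(\<integral>\<^sup>+\<omega>. ?f \<omega> x \<partial>mixture N) \<le> (\<integral>\<^sup>+\<omega>. ennreal (exp (- (1/2 * Q)) / sqrt Q * exp (- (fst \<omega> * T))) * ennreal (exp (- (snd \<omega> * (Q / 2)))) \<partial>mixture N)"
        proof (rule nn_integral_mono)
          fix \<omega> :: "real \<times> real"
          have "axial_kernel e (fst \<omega>) (snd \<omega>) x \<le> exp (- (1/2 * Q)) / sqrt Q * exp (- (fst \<omega> * T)) * exp (- (snd \<omega> * (Q / 2)))" if "snd \<omega> \<ge> 1"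
          proof -
            \<comment> \<open>Half of t Q is given up for Q / 2, as t \<ge> 1; the other half keeps
              the integral over t finite and only replaces Q by Q / 2 in the result.\<close>
            have "Q * 1 \<le> Q * snd \<omega>" using that Q by (intro mult_left_mono) auto
            then have "exp (- (fst \<omega> * T + snd \<omega> * Q)) \<le> exp (- (1/2 * Q) + (- (fst \<omega> * T)) + (- (snd \<omega> * (Q / 2))))"
              by (simp add: mult.commute)
            also have "\<dots> = exp (- (1/2 * Q)) * exp (- (fst \<omega> * T)) * exp (- (snd \<omega> * (Q / 2)))" by (simp only: exp_add)
            finally have "exp (- (fst \<omega> * T + snd \<omega> * Q)) / sqrt Q \<le> exp (- (1/2 * Q)) * exp (- (fst \<omega> * T)) * exp (- (snd \<omega> * (Q / 2))) / sqrt Q"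
              using Q by (intro divide_right_mono) auto
            then show ?thesis by (simp add: axial_kernel_def Q_def T_def)
          qed
          then show "?f \<omega> x \<le> ennreal (exp (- (1/2 * Q)) / sqrt Q * exp (- (fst \<omega> * T))) * ennreal (exp (- (snd \<omega> * (Q / 2))))"
            using False Q by (auto simp: cut_def indicator_def ennreal_mult[symmetric] intro!: ennreal_leI)
        qed
        also have "\<dots> = (\<integral>\<^sup>+s. (\<integral>\<^sup>+t. ennreal (exp (- (1/2 * Q)) / sqrt Q * exp (- (s * T))) * ennreal (exp (- (t * (Q / 2)))) \<partial>tau) \<partial>mix N)"
          by (subst M.M2.nn_integral_fst[symmetric]) auto
        also have "\<dots> = (\<integral>\<^sup>+s. ennreal (exp (- (s * T))) * ennreal (exp (- (1/2 * Q)) / sqrt Q * (2 / Q)) \<partial>mix N)"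
        proof (rule nn_integral_cong)
          fix s
          have "(\<integral>\<^sup>+t. ennreal (exp (- (t * (Q / 2)))) \<partial>tau) = ennreal (2 / Q)"
            using nn_integral_tau_exp[of "Q / 2"] Q by (simp add: p2 powr_minus_divide)
          then show "(\<integral>\<^sup>+t. ennreal (exp (- (1/2 * Q)) / sqrt Q * exp (- (s * T))) * ennreal (exp (- (t * (Q / 2)))) \<partial>tau) =
              ennreal (exp (- (s * T))) * ennreal (exp (- (1/2 * Q)) / sqrt Q * (2 / Q))"
            using Q by (subst nn_integral_cmult) (auto simp: ennreal_mult[symmetric] mult_ac)
        qed
        also have "\<dots> = ennreal (profile N T) * ennreal (exp (- (1/2 * Q)) / sqrt Q * (2 / Q))"
        proof -
          have "- (1 / N\<^sup>2) < 0" using N by simp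
          then have "- (1 / N\<^sup>2) < T" using T0 by linarith
          then show ?thesis by (subst nn_integral_multc) (auto simp: laplace_mix[OF N])
        qed
        also have "\<dots> = ennreal (2 * weight N x * exp (- (1/2 * Q)))"
          using Q by (simp add: ennreal_mult[symmetric] profile_nonneg weight_eq_profile[OF elim] Q_def[symmetric] T_def[symmetric] p2 powr_minus_divide mult_ac)
        also have "\<dots> \<le> ennreal (4 * N\<^sup>2 * ((1 / (1 + (norm (x \<bullet> e))\<^sup>2) ^ 1) * exp (- (1/2 * perp2 e x))))"
        proof (rule ennreal_leI)
          have "weight N x \<le> N\<^sup>2 * norm x powr (- (p + 1))" by (rule weight_le[OF N])
          also have "norm x powr (- (p + 1)) \<le> norm x powr (- 2)" unfolding p2 using x1 by (intro powr_mono) auto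
          also have "norm x powr (- 2) = 1 / (norm x)\<^sup>2" using x1 by (simp add: powr_minus_divide powr_numeral)
          also have "\<dots> \<le> 2 / (1 + (x \<bullet> e)\<^sup>2)"
          proof -
            have "1 \<le> (norm x)\<^sup>2" using x1 by (simp add: one_le_power)
            moreover have "(x \<bullet> e)\<^sup>2 \<le> (norm x)\<^sup>2" using Q norm2_eq_perp2[of x e] by (simp add: Q_def)
            ultimately have "1 + (x \<bullet> e)\<^sup>2 \<le> 2 * (norm x)\<^sup>2" "0 < (norm x)\<^sup>2" by linarith+
            moreover have "0 < 1 + (x \<bullet> e)\<^sup>2" by (simp add: add_pos_nonneg)
            ultimately show ?thesis by (simp add: divide_le_eq pos_le_divide_eq field_simps)
          qed
          finally have "weight N x \<le> N\<^sup>2 * (2 / (1 + (x \<bullet> e)\<^sup>2))" using N by (simp add: mult_left_mono)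
          then have "2 * weight N x * exp (- (1/2 * Q)) \<le> 2 * (N\<^sup>2 * (2 / (1 + (x \<bullet> e)\<^sup>2))) * exp (- (1/2 * Q))"
            by (intro mult_right_mono mult_left_mono) auto
          then show "2 * weight N x * exp (- (1/2 * Q)) \<le> 4 * N\<^sup>2 * ((1 / (1 + (norm (x \<bullet> e))\<^sup>2) ^ 1) * exp (- (1/2 * perp2 e x)))"
            by (simp add: Q_def)
        qed
        finally show ?thesis .
      qed
    qed
  qed
  also have "\<dots> = ennreal (4 * N\<^sup>2) * (\<integral>\<^sup>+x. ennreal ((1 / (1 + (norm (x \<bullet> e))\<^sup>2) ^ 1) * exp (- (1/2 * perp2 e x))) \<partial>lborel)"
    by (subst nn_integral_cmult[symmetric], measurable) (intro nn_integral_cong ennreal_mult', simp)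
  finally have le: "(\<integral>\<^sup>+\<omega>. ennreal (norm (indicator {1..} (snd \<omega>) * kernel_tail (fst \<omega>) (snd \<omega>))) \<partial>mixture N) \<le>
      ennreal (4 * N\<^sup>2) * (\<integral>\<^sup>+x. ennreal ((1 / (1 + (norm (x \<bullet> e))\<^sup>2) ^ 1) * exp (- (1/2 * perp2 e x))) \<partial>lborel)" .
  have fin: "(\<integral>\<^sup>+x. ennreal ((1 / (1 + (norm (x \<bullet> e))\<^sup>2) ^ 1) * exp (- (1/2 * perp2 e x))) \<partial>lborel) < \<infinity>"
  proof -
    define I where "I = (\<integral>\<^sup>+(r::real). ennreal (1 / (1 + (norm r)\<^sup>2) ^ 1) \<partial>lborel)"
    have I: "I < \<infinity>"
      using integrable_inverse_one_plus_norm[where 'a=real, of 1] unfolding I_def by (auto simp: integrable_iff_bounded add_nonneg_nonneg)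
    have ee: "e \<bullet> e = 1" using e by simp
    have line: "(\<integral>\<^sup>+r. ennreal ((1 / (1 + (norm ((x + (r - x \<bullet> e) *\<^sub>R e) \<bullet> e))\<^sup>2) ^ 1) * exp (- (1/2 * perp2 e (x + (r - x \<bullet> e) *\<^sub>R e)))) \<partial>lborel) = I * ennreal (exp (- (1/2 * perp2 e x)))" for x
    proof -
      have "(x + (r - x \<bullet> e) *\<^sub>R e) \<bullet> e = r" for r unfolding inner_add_left inner_scaleR_left ee by simp
      then have "(\<integral>\<^sup>+r. ennreal ((1 / (1 + (norm ((x + (r - x \<bullet> e) *\<^sub>R e) \<bullet> e))\<^sup>2) ^ 1) * exp (- (1/2 * perp2 e (x + (r - x \<bullet> e) *\<^sub>R e)))) \<partial>lborel) =
          (\<integral>\<^sup>+(r::real). ennreal (1 / (1 + (norm r)\<^sup>2) ^ 1) * ennreal (exp (- (1/2 * perp2 e x))) \<partial>lborel)"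
        unfolding perp2_add_axis[OF e] by (intro nn_integral_cong) (simp only: ennreal_mult'' exp_ge_zero)
      also have "\<dots> = I * ennreal (exp (- (1/2 * perp2 e x)))"
        unfolding I_def by (rule nn_integral_multc) measurable
      finally show ?thesis .
    qed
    have "(\<integral>\<^sup>+x. ennreal ((1 / (1 + (norm (x \<bullet> e))\<^sup>2) ^ 1) * exp (- (1/2 * perp2 e x))) \<partial>lborel) =
        (\<integral>\<^sup>+x. ennreal (exp (- (x \<bullet> e)\<^sup>2) / sqrt pi) * (I * ennreal (exp (- (1/2 * perp2 e x)))) \<partial>lborel)"
      by (subst nn_integral_axis[OF _ e], measurable) (simp only: line)
    also have "\<dots> = (\<integral>\<^sup>+x. I * ennreal (1 / sqrt pi * exp (- (1 * (x \<bullet> e)\<^sup>2 + 1/2 * perp2 e x))) \<partial>lborel)"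
    proof (rule nn_integral_cong)
      fix x :: 'a
      have eq: "1 / sqrt pi * exp (- (1 * (x \<bullet> e)\<^sup>2 + 1/2 * perp2 e x)) = (exp (- (x \<bullet> e)\<^sup>2) / sqrt pi) * exp (- (1/2 * perp2 e x))"
        by (simp add: exp_add[symmetric])
      show "ennreal (exp (- (x \<bullet> e)\<^sup>2) / sqrt pi) * (I * ennreal (exp (- (1/2 * perp2 e x)))) = I * ennreal (1 / sqrt pi * exp (- (1 * (x \<bullet> e)\<^sup>2 + 1/2 * perp2 e x)))"
        unfolding eq ennreal_mult''[OF exp_ge_zero] by (rule mult.left_commute)
    qed
    also have "\<dots> = I * (\<integral>\<^sup>+x. ennreal (1 / sqrt pi * exp (- (1 * (x \<bullet> e)\<^sup>2 + 1/2 * perp2 e x))) \<partial>lborel)"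
      by (rule nn_integral_cmult) measurable
    finally have eq: "(\<integral>\<^sup>+x. ennreal ((1 / (1 + (norm (x \<bullet> e))\<^sup>2) ^ 1) * exp (- (1/2 * perp2 e x))) \<partial>lborel) =
        I * (\<integral>\<^sup>+x. ennreal (1 / sqrt pi * exp (- (1 * (x \<bullet> e)\<^sup>2 + 1/2 * perp2 e x))) \<partial>lborel)" .
    have "(\<integral>\<^sup>+x. ennreal (1 / sqrt pi * exp (- (1 * (x \<bullet> e)\<^sup>2 + 1/2 * perp2 e x))) \<partial>lborel) < \<infinity>"
    proof -
      have "integrable lborel (\<lambda>x. exp (- (1 * (x \<bullet> e)\<^sup>2 + 1/2 * perp2 e x)))"
        using gauss_fourier[OF e, of 1 "1/2" 0] by (auto simp: has_bochner_integral_iff dest!: integrable_Re)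
      from integrable_mult_right[OF this, of "1 / sqrt pi"] show ?thesis
        by (subst nn_integral_eq_integral) auto
    qed
    then show ?thesis unfolding eq using I unfolding infinity_ennreal_def ennreal_mult_less_top by simp
  qed
  have "ennreal (4 * N\<^sup>2) * (\<integral>\<^sup>+x. ennreal ((1 / (1 + (norm (x \<bullet> e))\<^sup>2) ^ 1) * exp (- (1/2 * perp2 e x))) \<partial>lborel) < \<infinity>"
    using fin unfolding infinity_ennreal_def ennreal_mult_less_top by simp
  with le have "(\<integral>\<^sup>+\<omega>. ennreal (norm (indicator {1..} (snd \<omega>) * kernel_tail (fst \<omega>) (snd \<omega>))) \<partial>mixture N) < \<infinity>"
    by (rule order_le_less_trans)
  then show ?thesis by (auto simp: integrable_iff_bounded)
qed

end

section \<open>Domination, continuity and the Fourier identity\<close>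

context axial_power
begin

lemma kernel_fourier_0:
  assumes "\<not> 1 < \<alpha>" "t > 0"
  shows "axial_kernel_fourier e s t 0 = sqrt (pi / s) * (pi * (1 / t))"
proof -
  have "DIM('a) = 3" using \<alpha>_eq_1[OF assms(1)] n_eq by simp
  then show ?thesis using assms by (simp add: axial_kernel_fourier_def perp2_def)
qed

lemma kernel_fourier_eq_3:
  assumes "\<not> 1 < \<alpha>" "s > 0" "t > 0"
  shows "axial_kernel_fourier e s t \<xi> = sqrt (pi / s) * (pi * (exp (- (perp2 e \<xi> / (4 * (t + (\<xi> \<bullet> e)\<^sup>2 / (4 * s))))) / (t + (\<xi> \<bullet> e)\<^sup>2 / (4 * s))))"
proof -
  have "DIM('a) = 3" using \<alpha>_eq_1[OF assms(1)] n_eq by simp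
  moreover have "0 < t + (\<xi> \<bullet> e)\<^sup>2 / (4 * s)" using assms by (simp add: add_pos_nonneg)
  ultimately show ?thesis by (simp add: axial_kernel_fourier_def)
qed

text \<open>Relative to its value at 0 the transform changes by moving the rate from t to \<kappa> =
  t + c and by the factor exp (- q / (4 \<kappa>)). Both changes gain t^(-1/2) over the leading term
  1/t, which is what integrability at large t demands.\<close>

lemma kernel_fourier_diff_bound:
  assumes \<alpha>1: "\<not> 1 < \<alpha>" and s: "s > 0" and t: "t \<ge> 1" and R: "norm \<xi> \<le> R"
  shows "\<bar>axial_kernel_fourier e s t \<xi> - axial_kernel_fourier e s t 0\<bar> \<le>
    sqrt (pi / s) * (pi * ((R\<^sup>2 + R * s powr (- (1/2))) * t powr (- 3/2)))"
proof -
  have t0: "t > 0" using t by simp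
  have R0: "R \<ge> 0" using R norm_ge_zero[of \<xi>] by linarith
  define c where "c = (\<xi> \<bullet> e)\<^sup>2 / (4 * s)"
  define q where "q = perp2 e \<xi>"
  define \<kappa> where "\<kappa> = t + c"
  have c0: "c \<ge> 0" using s by (simp add: c_def)
  have \<kappa>: "t \<le> \<kappa>" "\<kappa> > 0" using c0 t0 by (auto simp: \<kappa>_def)
  have nR: "(norm \<xi>)\<^sup>2 \<le> R\<^sup>2" using R by (intro power_mono) auto
  have q: "0 \<le> q" "q \<le> R\<^sup>2" using nR norm2_eq_perp2[of \<xi> e] perp2_nonneg[OF e, of \<xi>]
    by (auto simp: q_def) (smt (verit) zero_le_power2)
  have z: "\<bar>\<xi> \<bullet> e\<bar> \<le> R" using Basis_le_norm[OF e, of \<xi>] R by simp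
  have "sqrt c = \<bar>\<xi> \<bullet> e\<bar> / (2 * sqrt s)" using s by (simp add: c_def real_sqrt_divide real_sqrt_mult)
  also have "\<dots> \<le> R / (2 * sqrt s)" using z s by (intro divide_right_mono) auto
  also have "\<dots> \<le> R / sqrt s" using s R0 by (intro divide_left_mono) auto
  also have "\<dots> = R * s powr (- (1/2))" using s by (simp add: powr_minus_divide powr_half_sqrt)
  finally have sc: "sqrt c \<le> R * s powr (- (1/2))" .
  have e1: "exp (- (q / (4 * \<kappa>))) \<le> 1" using q \<kappa> by simp
  have e2: "1 - q / (4 * \<kappa>) \<le> exp (- (q / (4 * \<kappa>)))" using exp_ge_add_one_self[of "- (q / (4 * \<kappa>))"] by simp
  have pos: "exp (- (q / (4 * \<kappa>))) / \<kappa> \<le> 1 / t"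
    using e1 \<kappa> t0 by (intro frac_le) auto
  have "1 / t - exp (- (q / (4 * \<kappa>))) / \<kappa> \<le> 1 / t - (1 - q / (4 * \<kappa>)) / \<kappa>"
    using e2 \<kappa> by (intro diff_left_mono divide_right_mono) auto
  also have "\<dots> = c / (t * \<kappa>) + q / (4 * \<kappa> * \<kappa>)"
    using t0 \<kappa> by (simp add: field_simps) (simp add: \<kappa>_def algebra_simps)
  also have "\<dots> \<le> sqrt c * t powr (- 3/2) + R\<^sup>2 * t powr (- 3/2)"
  proof (rule add_mono)
    have t32: "t powr (- 3/2) = 1 / (t * sqrt t)"
    proof -
      have "t powr (- 3/2) = t powr (- 1) * t powr (- (1/2))" unfolding powr_add[symmetric] by simp
      then show ?thesis using t0 by (simp add: powr_minus_divide powr_half_sqrt)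
    qed
    \<comment> \<open>The shift c is of order 1/s. Using it linearly would call for the moment of
      s^(-3/2), the excluded borderline exponent a = 3/2; with sqrt c in its place the moment of
      s^(-1) suffices.\<close>
    have "sqrt t * sqrt c \<le> \<kappa>"
    proof -
      have "sqrt (t * c) \<le> sqrt (\<kappa> * \<kappa>)"
        using t0 c0 \<kappa> by (intro real_sqrt_le_mono mult_mono) (auto simp: \<kappa>_def)
      then show ?thesis using \<kappa> by (simp add: real_sqrt_mult)
    qed
    then have "sqrt c * (sqrt t * sqrt c) \<le> sqrt c * \<kappa>" using c0 by (intro mult_left_mono) auto
    moreover have "sqrt c * (sqrt t * sqrt c) = c * sqrt t" using c0 by (simp add: mult_ac)
    ultimately have "c * sqrt t \<le> sqrt c * \<kappa>" by simp
    then have "t * (c * sqrt t) \<le> t * (sqrt c * \<kappa>)" using t0 by (intro mult_left_mono) auto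
    then show "c / (t * \<kappa>) \<le> sqrt c * t powr (- 3/2)"
      unfolding t32 using t0 \<kappa> by (simp add: divide_le_eq pos_le_divide_eq field_simps)
    have "t * sqrt t \<le> t * t"
    proof (rule mult_left_mono)
      have "sqrt t \<le> sqrt (t * t)" using t by (intro real_sqrt_le_mono) simp
      then show "sqrt t \<le> t" using t0 by (simp add: real_sqrt_mult)
    qed (use t0 in simp)
    also have "\<dots> \<le> 4 * \<kappa> * \<kappa>" using \<kappa> t0 mult_mono[of t \<kappa> t \<kappa>] mult_nonneg_nonneg[of \<kappa> \<kappa>] by linarith
    finally have "t * sqrt t \<le> 4 * \<kappa> * \<kappa>" .
    then have "1 / (4 * \<kappa> * \<kappa>) \<le> 1 / (t * sqrt t)" using t0 \<kappa> by (intro divide_left_mono) auto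
    then have "q * (1 / (4 * \<kappa> * \<kappa>)) \<le> R\<^sup>2 * (1 / (t * sqrt t))" using q \<kappa> t0 by (intro mult_mono) auto
    then show "q / (4 * \<kappa> * \<kappa>) \<le> R\<^sup>2 * t powr (- 3/2)" unfolding t32 by simp
  qed
  also have "\<dots> \<le> (R\<^sup>2 + R * s powr (- (1/2))) * t powr (- 3/2)"
    using mult_right_mono[OF sc, of "t powr (- 3/2)"] by (simp add: distrib_right)
  finally have main: "1 / t - exp (- (q / (4 * \<kappa>))) / \<kappa> \<le> (R\<^sup>2 + R * s powr (- (1/2))) * t powr (- 3/2)" .
  have "\<bar>axial_kernel_fourier e s t \<xi> - axial_kernel_fourier e s t 0\<bar> = sqrt (pi / s) * (pi * (1 / t - exp (- (q / (4 * \<kappa>))) / \<kappa>))"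
  proof -
    have "axial_kernel_fourier e s t \<xi> - axial_kernel_fourier e s t 0 = - (sqrt (pi / s) * (pi * (1 / t - exp (- (q / (4 * \<kappa>))) / \<kappa>)))"
      unfolding kernel_fourier_eq_3[OF \<alpha>1 s t0] kernel_fourier_0[OF \<alpha>1 t0] q_def[symmetric] c_def[symmetric] \<kappa>_def[symmetric]
      by (simp add: algebra_simps)
    moreover have "0 \<le> sqrt (pi / s) * (pi * (1 / t - exp (- (q / (4 * \<kappa>))) / \<kappa>))"
      using pos s by (intro mult_nonneg_nonneg) auto
    ultimately show ?thesis by simp
  qed
  also have "\<dots> \<le> sqrt (pi / s) * (pi * ((R\<^sup>2 + R * s powr (- (1/2))) * t powr (- 3/2)))"
    using main s by (intro mult_left_mono) auto
  finally show ?thesis .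
qed

text \<open>For \<alpha> > 1 the uniform bound of the transform is already integrable. For \<alpha>
  = 1 the range of t is divided at 1: below 1 both terms are bounded separately, and above 1 the
  difference is the deviation from the value at 0 plus the tail, each of which is integrable
  there.\<close>

lemma kernel_diff_dominated:
  assumes N: "1 \<le> N" and r: "r > 0" and R: "R > 0"
  shows "\<exists>G. integrable (mixture N) G \<and>
    (AE \<omega> in mixture N. \<forall>\<xi>. r \<le> norm \<xi> \<and> norm \<xi> \<le> R \<longrightarrow>
       \<bar>axial_kernel_fourier e (fst \<omega>) (snd \<omega>) \<xi> - kernel_cut (fst \<omega>) (snd \<omega>)\<bar> \<le> G \<omega>)"
proof -
  obtain C where C: "C \<ge> 0" "\<And>s t \<xi>. s > 0 \<Longrightarrow> t > 0 \<Longrightarrow> r \<le> norm \<xi> \<Longrightarrow>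
      axial_kernel_fourier e s t \<xi> \<le> C * (s powr (- (1/2)) * (1 + s) ^ n * (1 + t) powr (- ((real n - 1) / 2)))"
    using kernel_fourier_bound[OF r] by blast
  show ?thesis
  proof (cases "1 < \<alpha>")
    case True
    let ?G = "\<lambda>\<omega>. C * ((fst \<omega> powr (- (1/2)) * (1 + fst \<omega>) ^ n) * (1 + snd \<omega>) powr (- ((real n - 1) / 2)))"
    have "integrable (mixture N) ?G"
    proof (intro integrable_mult_right integrable_mixture_product N)
      show "(\<integral>\<^sup>+t. ennreal ((1 + t) powr (- ((real n - 1) / 2))) \<partial>tau) < \<infinity>"
        using p_less[OF True] by (intro nn_integral_tau_finite) simp
      show "(\<integral>\<^sup>+s. ennreal (s powr (- (1/2)) * (1 + s) ^ n) \<partial>mix N) < \<infinity>"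
        by (rule mix_moment_weighted_finite[OF N])
    qed auto
    moreover have "AE \<omega> in mixture N. \<forall>\<xi>. r \<le> norm \<xi> \<and> norm \<xi> \<le> R \<longrightarrow>
       \<bar>axial_kernel_fourier e (fst \<omega>) (snd \<omega>) \<xi> - kernel_cut (fst \<omega>) (snd \<omega>)\<bar> \<le> ?G \<omega>"
      using AE_mixture_pos[OF N]
    proof eventually_elim
      case (elim \<omega>)
      then show ?case using C(2)[of "fst \<omega>" "snd \<omega>"] kernel_fourier_nonneg[of "fst \<omega>" "snd \<omega>"]
        by (simp add: kernel_cut_eq_0[OF True])
    qed
    ultimately show ?thesis by blast
  next
    case False
    note n3 = \<alpha>_eq_1(2)[OF False] and p2 = \<alpha>_eq_1(3)[OF False]
    define A where "A = sqrt pi * pi"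
    have A0: "A > 0" by (simp add: A_def)
    \<comment> \<open>The factor 2^(3/2) makes the single function (1 + t)^(-3/2) dominate both the
      constant 1 for t < 1 and t^(-3/2) for t \<ge> 1.\<close>
    define K where "K = 2 powr (3/2) * (C + A * (1 + R\<^sup>2 + R))"
    define f where "f = (\<lambda>s::real. s powr (- (1/2)) * (1 + s) ^ n + s powr (- 1))"
    define g where "g = (\<lambda>t::real. (1 + t) powr (- (3/2)))"
    let ?G = "\<lambda>\<omega>. K * (f (fst \<omega>) * g (snd \<omega>)) + indicator {1..} (snd \<omega>) * kernel_tail (fst \<omega>) (snd \<omega>)"
    have "integrable (mixture N) ?G"
    proof (intro Bochner_Integration.integrable_add integrable_mult_right integrable_mixture_product N kernel_tail_integrable False)
      show "f \<in> borel_measurable borel" "g \<in> borel_measurable borel" unfolding f_def g_def by measurable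
      show "0 \<le> f s" if "s > 0" for s using that by (simp add: f_def)
      show "0 \<le> g t" for t by (simp add: g_def)
      show "(\<integral>\<^sup>+t. ennreal (g t) \<partial>tau) < \<infinity>" unfolding g_def by (intro nn_integral_tau_finite) (simp add: p2)
      have "a = 3 / 2" by (simp add: a_def p2)
      then obtain C' where "(\<integral>\<^sup>+s. ennreal (s powr (- 1)) \<partial>mix N) \<le> ennreal (C' * N powr (2 - 2 * 1))"
        using mix_moment_le[of 1] N by auto
      then have "(\<integral>\<^sup>+s. ennreal (s powr (- 1)) \<partial>mix N) < \<infinity>" by (rule order_le_less_trans) simp
      moreover have "(\<integral>\<^sup>+s. ennreal (f s) \<partial>mix N) = (\<integral>\<^sup>+s. ennreal (s powr (- (1/2)) * (1 + s) ^ n) + ennreal (s powr (- 1)) \<partial>mix N)"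
      proof (rule nn_integral_cong_AE)
        show "AE s in mix N. ennreal (f s) = ennreal (s powr (- (1/2)) * (1 + s) ^ n) + ennreal (s powr (- 1))"
          using AE_mix_pos by eventually_elim (simp add: f_def)
      qed
      moreover have "\<dots> = (\<integral>\<^sup>+s. ennreal (s powr (- (1/2)) * (1 + s) ^ n) \<partial>mix N) + (\<integral>\<^sup>+s. ennreal (s powr (- 1)) \<partial>mix N)"
        by (rule nn_integral_add) measurable
      ultimately show "(\<integral>\<^sup>+s. ennreal (f s) \<partial>mix N) < \<infinity>"
        using mix_moment_weighted_finite[OF N, of n] by simp
    qed
    moreover have "AE \<omega> in mixture N. \<forall>\<xi>. r \<le> norm \<xi> \<and> norm \<xi> \<le> R \<longrightarrow>
       \<bar>axial_kernel_fourier e (fst \<omega>) (snd \<omega>) \<xi> - kernel_cut (fst \<omega>) (snd \<omega>)\<bar> \<le> ?G \<omega>"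
      using AE_mixture_pos[OF N]
    proof eventually_elim
      case (elim \<omega>)
      obtain s t where \<omega>: "\<omega> = (s, t)" by (cases \<omega>)
      have s: "s > 0" and t: "t > 0" using elim by (auto simp: \<omega>)
      have sq: "sqrt (pi / s) * pi = A * s powr (- (1/2))"
        using s by (simp add: A_def real_sqrt_divide powr_minus_divide powr_half_sqrt)
      have s1: "s powr (- (1/2)) \<le> s powr (- (1/2)) * (1 + s) ^ n"
        using s by (simp add: one_le_power mult_le_cancel_left1)
      have f1: "s powr (- (1/2)) * (1 + s) ^ n \<le> f s" "s powr (- (1/2)) \<le> f s" "s powr (- 1) \<le> f s" "0 \<le> f s"
        using s s1 by (auto simp: f_def intro: order_trans[OF s1])
      have tail0: "0 \<le> indicator {1..} t * kernel_tail s t" by (simp add: kernel_tail_nonneg)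
      have "\<bar>axial_kernel_fourier e s t \<xi> - kernel_cut s t\<bar> \<le> K * (f s * g t) + indicator {1..} t * kernel_tail s t"
        if \<xi>: "r \<le> norm \<xi>" "norm \<xi> \<le> R" for \<xi>
      proof (cases "t \<ge> 1")
        case False
        have g1: "1 \<le> 2 powr (3/2) * g t"
        proof -
          have "2 powr (- (3/2)) \<le> (1 + t) powr (- (3/2))" using False t by (intro powr_mono2') auto
          then have "2 powr (3/2) * 2 powr (- (3/2)) \<le> 2 powr (3/2) * (1 + t) powr (- (3/2))" by (intro mult_left_mono) auto
          then show ?thesis by (simp add: g_def powr_add[symmetric])
        qed
        have "axial_kernel_fourier e s t \<xi> \<le> C * (s powr (- (1/2)) * (1 + s) ^ n * (1 + t) powr (- ((real n - 1) / 2)))"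
          by (rule C(2)[OF s t \<xi>(1)])
        also have "\<dots> \<le> C * (f s * 1)"
        proof (intro mult_left_mono mult_mono C)
          show "(1 + t) powr (- ((real n - 1) / 2)) \<le> 1" using t by (simp add: n3 powr_minus_divide)
        qed (use f1 s in auto)
        finally have V: "axial_kernel_fourier e s t \<xi> \<le> C * f s" by simp
        have "kernel_cut s t \<le> sqrt (pi / s) * (pi * ((1 - exp (- t)) / t))" by (rule kernel_cut_le[OF \<open>\<not> 1 < \<alpha>\<close> s t])
        also have "\<dots> \<le> sqrt (pi / s) * (pi * 1)"
        proof (intro mult_left_mono)
          show "(1 - exp (- t)) / t \<le> 1" using t exp_ge_add_one_self[of "- t"] by (simp add: divide_le_eq)
        qed (use s in auto)
        also have "\<dots> = A * s powr (- (1/2))" using sq by simp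
        also have "\<dots> \<le> A * f s" using A0 f1 by (intro mult_left_mono) auto
        finally have u: "kernel_cut s t \<le> A * f s" .
        have u0: "0 \<le> kernel_cut s t"
          unfolding kernel_cut_def by (intro integral_nonneg_AE AE_I2 mult_nonneg_nonneg axial_kernel_nonneg e cut_bounds)
        have V0: "0 \<le> axial_kernel_fourier e s t \<xi>" by (rule kernel_fourier_nonneg[OF s t])
        have "C * f s + A * f s \<le> (C + A * (1 + R\<^sup>2 + R)) * f s"
          using A0 R f1(4) by (simp add: algebra_simps add_nonneg_nonneg)
        also have "\<dots> * 1 \<le> (C + A * (1 + R\<^sup>2 + R)) * f s * (2 powr (3/2) * g t)"
          using g1 A0 R f1(4) C(1) by (intro mult_left_mono) auto
        finally have "C * f s + A * f s \<le> K * (f s * g t)" by (simp add: K_def mult_ac)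
        moreover have "\<bar>axial_kernel_fourier e s t \<xi> - kernel_cut s t\<bar> \<le> C * f s + A * f s"
          using V u u0 V0 by linarith
        ultimately show ?thesis using tail0 by linarith
      next
        case True
        have tg: "t powr (- 3/2) \<le> 2 powr (3/2) * g t"
        proof -
          have "t powr (- (3/2)) \<le> ((1 + t) / 2) powr (- (3/2))" using True by (intro powr_mono2') auto
          also have "\<dots> = 2 powr (3/2) * g t" using t by (simp add: g_def powr_divide powr_minus_divide)
          finally show ?thesis by simp
        qed
        have "\<bar>axial_kernel_fourier e s t \<xi> - axial_kernel_fourier e s t 0\<bar> \<le> sqrt (pi / s) * (pi * ((R\<^sup>2 + R * s powr (- (1/2))) * t powr (- 3/2)))"
          by (rule kernel_fourier_diff_bound[OF \<open>\<not> 1 < \<alpha>\<close> s True \<xi>(2)])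
        also have "\<dots> = (sqrt (pi / s) * pi) * (R\<^sup>2 + R * s powr (- (1/2))) * t powr (- 3/2)" by (simp only: mult_ac)
        also have "\<dots> = A * (R\<^sup>2 * s powr (- (1/2)) + R * (s powr (- (1/2)) * s powr (- (1/2)))) * t powr (- 3/2)"
          unfolding sq by (simp add: algebra_simps)
        also have "s powr (- (1/2)) * s powr (- (1/2)) = s powr (- 1)" unfolding powr_add[symmetric] by simp
        also have "A * (R\<^sup>2 * s powr (- (1/2)) + R * s powr (- 1)) * t powr (- 3/2) \<le> A * (R\<^sup>2 * f s + R * f s) * (2 powr (3/2) * g t)"
          using A0 R f1 tg s by (intro mult_mono add_mono mult_left_mono) (auto simp: add_nonneg_nonneg)
        also have "\<dots> = 2 powr (3/2) * (A * (R\<^sup>2 + R)) * (f s * g t)" by (simp add: algebra_simps)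
        also have "\<dots> \<le> K * (f s * g t)"
          unfolding K_def using A0 C(1) f1(4) R
          by (intro mult_right_mono mult_left_mono) (auto simp: g_def algebra_simps)
        finally have "\<bar>axial_kernel_fourier e s t \<xi> - axial_kernel_fourier e s t 0\<bar> \<le> K * (f s * g t)" .
        moreover have "kernel_cut s t = axial_kernel_fourier e s t 0 - kernel_tail s t"
          using kernel_tail_eq[OF s t] by simp
        ultimately show ?thesis using True kernel_tail_nonneg[of s t] by simp
      qed
      then show ?case by (simp add: \<omega>)
    qed
    ultimately show ?thesis by blast
  qed
qed

text \<open>Dominated convergence on an annulus r < |\<xi>| < R, since the dominating function
  depends on both radii. Every point off the origin lies in such an annulus.\<close>

lemma continuous_on_transform:
  assumes N: "1 \<le> N"
  shows "continuous_on (- {0}) (transform N)"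
proof -
  have "continuous_on {\<xi>. r < norm \<xi> \<and> norm \<xi> < R} (transform N)" if r: "r > 0" and R: "R > 0" for r R
    unfolding continuous_on_sequentially
  proof (intro allI ballI impI)
    fix x :: "nat \<Rightarrow> 'a" and a :: 'a
    assume asm: "(\<forall>k. x k \<in> {\<xi>. r < norm \<xi> \<and> norm \<xi> < R}) \<and> x \<longlonglongrightarrow> a" and a: "a \<in> {\<xi>. r < norm \<xi> \<and> norm \<xi> < R}"
    obtain G where G: "integrable (mixture N) G" "AE \<omega> in mixture N. \<forall>\<xi>. r \<le> norm \<xi> \<and> norm \<xi> \<le> R \<longrightarrow>
       \<bar>axial_kernel_fourier e (fst \<omega>) (snd \<omega>) \<xi> - kernel_cut (fst \<omega>) (snd \<omega>)\<bar> \<le> G \<omega>"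
      using kernel_diff_dominated[OF N r R] by blast
    have meas [measurable]: "(\<lambda>\<omega>. axial_kernel_fourier e (fst \<omega>) (snd \<omega>) \<xi>) \<in> borel_measurable (mixture N)" for \<xi>
      unfolding axial_kernel_fourier_def by measurable
    have cutm [measurable]: "(\<lambda>\<omega>. kernel_cut (fst \<omega>) (snd \<omega>)) \<in> borel_measurable (mixture N)"
      by measurable
    show "(transform N \<circ> x) \<longlonglongrightarrow> transform N a"
      unfolding transform_def o_def
    proof (rule integral_dominated_convergence[OF _ _ G(1)])
      show "AE \<omega> in mixture N. (\<lambda>k. axial_kernel_fourier e (fst \<omega>) (snd \<omega>) (x k) - kernel_cut (fst \<omega>) (snd \<omega>)) \<longlonglongrightarrow>
          axial_kernel_fourier e (fst \<omega>) (snd \<omega>) a - kernel_cut (fst \<omega>) (snd \<omega>)"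
        using AE_mixture_pos[OF N]
      proof eventually_elim
        case (elim \<omega>)
        have k: "snd \<omega> + (a \<bullet> e)\<^sup>2 / (4 * fst \<omega>) \<noteq> 0" using elim by (smt (verit) divide_nonneg_pos zero_le_power2)
        show ?case
          unfolding axial_kernel_fourier_def perp2_def using k elim asm
          by (intro tendsto_intros) auto
      qed
      show "AE \<omega> in mixture N. norm (axial_kernel_fourier e (fst \<omega>) (snd \<omega>) (x k) - kernel_cut (fst \<omega>) (snd \<omega>)) \<le> G \<omega>" for k
        using G(2)
      proof eventually_elim
        case (elim \<omega>)
        then show ?case using asm by (auto simp: less_imp_le)
      qed
    qed measurable
  qed
  then have open_part: "continuous_on {\<xi>. r < norm \<xi> \<and> norm \<xi> < R} (transform N)" if "r > 0" "R > 0" for r R using that by blast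
  show ?thesis
  proof (rule continuous_at_imp_continuous_on, rule ballI)
    fix \<xi> :: 'a assume "\<xi> \<in> - {0}"
    then have \<xi>: "norm \<xi> > 0" by simp
    have "open {\<eta>::'a. norm \<xi> / 2 < norm \<eta> \<and> norm \<eta> < 2 * norm \<xi>}"
      by (intro open_Collect_conj open_Collect_less continuous_intros)
    then show "isCont (transform N) \<xi>"
      using continuous_on_eq_continuous_at open_part[of "norm \<xi> / 2" "2 * norm \<xi>"] \<xi> by force
  qed
qed

text \<open>At the origin the weight is of order |x|^(-p-1). For \<alpha> > 1 this is locally
  integrable because p + 1 < n; for \<alpha> = 1 it is |x|^(-3) in dimension 3, and the subtracted
  value at 0 lowers the singularity to |x|^(-2). Decay of the transform takes care of
  infinity.\<close>

lemma weight_integrable_test: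
  assumes N: "1 \<le> N" and \<phi>: "test_function_off_origin \<phi>"
  shows "integrable lborel (\<lambda>x. weight N x * norm (fourier \<phi> x - of_real (cut x) * fourier \<phi> 0))"
proof -
  have sc: "smooth_compact \<phi>" by (rule test_function_off_originD[OF \<phi>])
  have i\<phi>: "integrable lborel \<phi>" by (rule smooth_compact_integrable[OF sc])
  have [measurable]: "\<phi> \<in> borel_measurable borel" using i\<phi> by (auto dest: borel_measurable_integrable)
  obtain C where C: "C \<ge> 0" "\<And>\<xi>. norm (fourier \<phi> \<xi>) \<le> C / (1 + (norm \<xi>)\<^sup>2) ^ n"
    using fourier_decay[OF sc, of n] by auto
  have n2: "DIM('a) < 2 * n" using n_eq dim by simp
  show ?thesis
  proof (cases "1 < \<alpha>")
    case True
    show ?thesis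
    proof (rule Bochner_Integration.integrable_bound)
      show "integrable lborel (\<lambda>x::'a. N\<^sup>2 * C * (norm x powr (- (p + 1)) / (1 + (norm x)\<^sup>2) ^ n))"
        using p_pos p_less[OF True] n_eq by (intro integrable_mult_right integrable_norm_powr_decay n2) auto
      show "AE x in lborel. norm (weight N x * norm (fourier \<phi> x - of_real (cut x) * fourier \<phi> 0)) \<le> norm (N\<^sup>2 * C * (norm x powr (- (p + 1)) / (1 + (norm x)\<^sup>2) ^ n))"
      proof (rule AE_I2)
        fix x :: 'a
        have "weight N x * norm (fourier \<phi> x) \<le> (N\<^sup>2 * norm x powr (- (p + 1))) * (C / (1 + (norm x)\<^sup>2) ^ n)"
          using weight_le[OF N, of x] weight_nonneg[of N x] C by (intro mult_mono) auto
        then show "norm (weight N x * norm (fourier \<phi> x - of_real (cut x) * fourier \<phi> 0)) \<le> norm (N\<^sup>2 * C * (norm x powr (- (p + 1)) / (1 + (norm x)\<^sup>2) ^ n))"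
          using True C(1) weight_nonneg[of N x] by (simp add: cut_def mult_ac)
      qed
    qed measurable
  next
    case False
    note n3 = \<alpha>_eq_1(2)[OF False] and p2 = \<alpha>_eq_1(3)[OF False]
    obtain R where R: "R > 0" "\<And>x. norm x > R \<Longrightarrow> \<phi> x = 0" using sc by (auto simp: smooth_compact_def)
    define L where "L = R * (\<integral>x. norm (\<phi> x) \<partial>lborel)"
    have L: "norm (fourier \<phi> \<xi> - fourier \<phi> 0) \<le> L * norm \<xi>" for \<xi>
      unfolding L_def by (rule fourier_lipschitz_at_0[OF i\<phi> R(2)])
    have L0: "L \<ge> 0" unfolding L_def using R by (intro mult_nonneg_nonneg integral_nonneg_AE) auto
    show ?thesis
    proof (rule Bochner_Integration.integrable_bound)
      show "integrable lborel (\<lambda>x::'a. N\<^sup>2 * (2 ^ n * L + C) * (norm x powr (- 2) / (1 + (norm x)\<^sup>2) ^ n))"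
        using n_eq n3 by (intro integrable_mult_right integrable_norm_powr_decay n2) auto
      show "AE x in lborel. norm (weight N x * norm (fourier \<phi> x - of_real (cut x) * fourier \<phi> 0)) \<le> norm (N\<^sup>2 * (2 ^ n * L + C) * (norm x powr (- 2) / (1 + (norm x)\<^sup>2) ^ n))"
      proof (rule AE_I2)
        fix x :: 'a
        have w: "weight N x \<le> N\<^sup>2 * norm x powr (- 3)" using weight_le[OF N, of x] by (simp add: p2)
        have D0: "(1 + (norm x)\<^sup>2) ^ n > 0" by (simp add: add_pos_nonneg)
        have "weight N x * norm (fourier \<phi> x - of_real (cut x) * fourier \<phi> 0) \<le> N\<^sup>2 * (2 ^ n * L + C) * (norm x powr (- 2) / (1 + (norm x)\<^sup>2) ^ n)"
        proof (cases "norm x < 1")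
          case True
          have "weight N x * norm (fourier \<phi> x - fourier \<phi> 0) \<le> (N\<^sup>2 * norm x powr (- 3)) * (L * norm x)"
            using w L weight_nonneg[of N x] by (intro mult_mono) auto
          also have "\<dots> = N\<^sup>2 * L * (norm x powr (- 3) * norm x)" by simp
          also have "norm x powr (- 3) * norm x = norm x powr (- 2)"
            using powr_add[of "norm x" "- 3" 1] by simp
          also have "N\<^sup>2 * L * norm x powr (- 2) \<le> N\<^sup>2 * L * (2 ^ n * (norm x powr (- 2) / (1 + (norm x)\<^sup>2) ^ n))"
          proof (intro mult_left_mono)
            have "(norm x)\<^sup>2 \<le> 1" using True by (simp add: power_le_one)
            then have "(1 + (norm x)\<^sup>2) ^ n \<le> 2 ^ n" by (intro power_mono) auto
            then have "norm x powr (- 2) * (1 + (norm x)\<^sup>2) ^ n \<le> norm x powr (- 2) * 2 ^ n" by (intro mult_left_mono) auto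
            then show "norm x powr (- 2) \<le> 2 ^ n * (norm x powr (- 2) / (1 + (norm x)\<^sup>2) ^ n)"
              using D0 by (simp add: pos_le_divide_eq mult.commute)
          qed (use L0 in auto)
          also have "\<dots> = N\<^sup>2 * (2 ^ n * L) * (norm x powr (- 2) / (1 + (norm x)\<^sup>2) ^ n)" by (simp only: mult_ac)
          also have "\<dots> \<le> N\<^sup>2 * (2 ^ n * L + C) * (norm x powr (- 2) / (1 + (norm x)\<^sup>2) ^ n)"
            using C(1) D0 by (intro mult_right_mono mult_left_mono) auto
          finally show ?thesis using True False by (simp add: cut_def)
        next
          case F: False
          have "weight N x * norm (fourier \<phi> x) \<le> (N\<^sup>2 * norm x powr (- 2)) * (C / (1 + (norm x)\<^sup>2) ^ n)"
          proof (intro mult_mono C)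
            have "norm x powr (- 3) \<le> norm x powr (- 2)" using F by (intro powr_mono) auto
            then have "N\<^sup>2 * norm x powr (- 3) \<le> N\<^sup>2 * norm x powr (- 2)" by (intro mult_left_mono) auto
            then show "weight N x \<le> N\<^sup>2 * norm x powr (- 2)" using w by linarith
          qed (auto simp: weight_nonneg)
          also have "\<dots> = N\<^sup>2 * C * (norm x powr (- 2) / (1 + (norm x)\<^sup>2) ^ n)" by simp
          also have "\<dots> \<le> N\<^sup>2 * (2 ^ n * L + C) * (norm x powr (- 2) / (1 + (norm x)\<^sup>2) ^ n)"
            using L0 D0 by (intro mult_right_mono mult_left_mono) auto
          finally show ?thesis using F by (simp add: cut_def)
        qed
        then show "norm (weight N x * norm (fourier \<phi> x - of_real (cut x) * fourier \<phi> 0)) \<le> norm (N\<^sup>2 * (2 ^ n * L + C) * (norm x powr (- 2) / (1 + (norm x)\<^sup>2) ^ n))"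
          using weight_nonneg[of N x] by (smt (verit) mult_nonneg_nonneg norm_ge_zero real_norm_def)
      qed
    qed measurable
  qed
qed

lemma fourier_weight:
  assumes N: "1 \<le> N" and \<phi>: "test_function_off_origin \<phi>"
  shows "(\<integral>x. of_real (weight N x) * (fourier \<phi> x - of_real (cut x) * fourier \<phi> 0) \<partial>lborel) =
    (\<integral>\<xi>. of_real (transform N \<xi>) * \<phi> \<xi> \<partial>lborel)"
proof -
  have sc: "smooth_compact \<phi>" by (rule test_function_off_originD[OF \<phi>])
  have i\<phi>: "integrable lborel \<phi>" by (rule smooth_compact_integrable[OF sc])
  obtain r where r: "r > 0" "\<And>x. \<phi> x \<noteq> 0 \<Longrightarrow> r \<le> norm x" using test_function_off_originD(2)[OF \<phi>] by auto
  obtain R where R: "R > 0" "\<And>x. norm x > R \<Longrightarrow> \<phi> x = 0" using sc by (auto simp: smooth_compact_def)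
  obtain G where G: "integrable (mixture N) G" "AE \<omega> in mixture N. \<forall>\<xi>. r \<le> norm \<xi> \<and> norm \<xi> \<le> R \<longrightarrow>
     \<bar>axial_kernel_fourier e (fst \<omega>) (snd \<omega>) \<xi> - kernel_cut (fst \<omega>) (snd \<omega>)\<bar> \<le> G \<omega>"
    using kernel_diff_dominated[OF N r(1) R(1)] by blast
  have dim2: "2 \<le> DIM('a)" using dim n_eq by simp
  show ?thesis
    unfolding transform_def kernel_cut_def
  proof (rule fourier_mixture[where G = G])
    show "sigma_finite_measure (mixture N)" by (rule sigma_finite_mixture[OF N])
    show "(\<lambda>(\<omega>, x). axial_kernel e (fst \<omega>) (snd \<omega>) x) \<in> borel_measurable (mixture N \<Otimes>\<^sub>M lborel)" by measurable
    show "(\<lambda>(\<omega>, x). axial_kernel_fourier e (fst \<omega>) (snd \<omega>) x) \<in> borel_measurable (mixture N \<Otimes>\<^sub>M lborel)" by measurable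
    show "0 \<le> axial_kernel e (fst \<omega>) (snd \<omega>) x" for \<omega> x by (rule axial_kernel_nonneg[OF e])
    show "AE \<omega> in mixture N. \<forall>\<xi>. has_bochner_integral lborel (\<lambda>x. of_real (axial_kernel e (fst \<omega>) (snd \<omega>) x) * exp (- (\<i> * of_real (x \<bullet> \<xi>)))) (complex_of_real (axial_kernel_fourier e (fst \<omega>) (snd \<omega>) \<xi>))"
      using AE_mixture_pos[OF N]
      by eventually_elim (auto intro: has_bochner_integral_axial_kernel[OF e dim2])
    show "AE x in lborel. (\<integral>\<^sup>+\<omega>. ennreal (axial_kernel e (fst \<omega>) (snd \<omega>) x) \<partial>mixture N) = ennreal (weight N x)"
      using AE_perp2_pos[OF e dim2] by eventually_elim (rule nn_integral_mixture_kernel[OF N])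
    show "AE \<omega> in mixture N. \<forall>\<xi>. \<phi> \<xi> \<noteq> 0 \<longrightarrow> \<bar>axial_kernel_fourier e (fst \<omega>) (snd \<omega>) \<xi> - (\<integral>x. axial_kernel e (fst \<omega>) (snd \<omega>) x * cut x \<partial>lborel)\<bar> \<le> G \<omega>"
      using G(2)
    proof eventually_elim
      case (elim \<omega>)
      then show ?case unfolding kernel_cut_def using r(2) R(2) by (meson not_less)
    qed
  qed (auto simp: weight_nonneg cut_bounds i\<phi> G(1) intro: weight_integrable_test[OF N \<phi>])
qed

end

section \<open>The transform of an elongated ellipsoid from below\<close>

text \<open>For \<alpha> = 1, up to the factor sqrt (\<pi> / s) \<pi>, this is the transform without
  axial shift of the rate and with orthogonal part of \<xi> of length 1, minus the bound of
  \<open>kernel_cut_le\<close>. On the unit sphere it is the least favourable case as s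
  grows.\<close>

definition log_kernel :: "real \<Rightarrow> real" where
  "log_kernel t = (exp (- (1 / (4 * t))) - 1 + exp (- t)) / t"

lemma measurable_log_kernel [measurable]: "log_kernel \<in> borel_measurable borel"
  unfolding log_kernel_def[abs_def] by measurable

text \<open>Near 0 the first exponential outweighs 1/t, and 1 - exp (- t) \<le> t; at infinity the
  numerator is itself O(1/t). The constant is 5 times 4, with 5 = 4 + 1 bounding the function on t
  \<le> 1, where (1 + t)^2 \<le> 4.\<close>

lemma log_kernel_bound:
  assumes t: "t > 0"
  shows "\<bar>log_kernel t\<bar> \<le> 20 * (1 + t) powr (- 2)"
proof -
  have sq: "(1 + t) powr (- 2) = 1 / (1 + t)\<^sup>2" using t by (simp add: powr_minus_divide powr_numeral)
  have ex: "exp (- y) \<le> 1 / y" if "y > 0" for y :: real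
  proof -
    have "y \<le> exp y" using exp_ge_add_one_self[of y] by linarith
    then show ?thesis using that by (simp add: exp_minus field_simps)
  qed
  show ?thesis
  proof (cases "t \<le> 1")
    case True
    have "exp (- (1 / (4 * t))) / t \<le> (4 * t) / t" using ex[of "1 / (4 * t)"] t by (intro divide_right_mono) auto
    then have 1: "exp (- (1 / (4 * t))) / t \<le> 4" "0 \<le> exp (- (1 / (4 * t))) / t" using t by auto
    have 2: "(1 - exp (- t)) / t \<le> 1" "0 \<le> (1 - exp (- t)) / t"
      using t exp_ge_add_one_self[of "- t"] by (auto simp: divide_le_eq)
    have "log_kernel t = exp (- (1 / (4 * t))) / t - (1 - exp (- t)) / t"
      by (simp add: log_kernel_def diff_divide_distrib add_divide_distrib)
    then have "\<bar>log_kernel t\<bar> \<le> 5" using 1 2 by linarith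
    also have "5 \<le> 20 * (1 + t) powr (- 2)"
    proof -
      have "(1 + t)\<^sup>2 \<le> 2\<^sup>2" using True t by (intro power_mono) auto
      moreover have "0 < (1 + t)\<^sup>2" using t by simp
      ultimately show ?thesis unfolding sq by (simp add: field_simps)
    qed
    finally show ?thesis .
  next
    case False
    have 1: "1 - 1 / (4 * t) \<le> exp (- (1 / (4 * t)))" using exp_ge_add_one_self[of "- (1 / (4 * t))"] by simp
    have 2: "exp (- (1 / (4 * t))) \<le> 1" using t by simp
    have 3: "exp (- t) \<le> 1 / t" by (rule ex[OF t])
    have "\<bar>exp (- (1 / (4 * t))) - 1 + exp (- t)\<bar> \<le> 1 / (4 * t) + 1 / t"
      using 1 2 3 exp_ge_zero[of "- t"] by linarith
    then have "\<bar>exp (- (1 / (4 * t))) - 1 + exp (- t)\<bar> / t \<le> (1 / (4 * t) + 1 / t) / t"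
      by (rule divide_right_mono) (use t in simp)
    then have "\<bar>log_kernel t\<bar> \<le> (1 / (4 * t) + 1 / t) / t"
      unfolding log_kernel_def abs_divide using t by simp
    also have "\<dots> = 5 / (4 * t\<^sup>2)" using t by (simp add: field_simps power2_eq_square)
    also have "\<dots> \<le> 20 * (1 + t) powr (- 2)"
    proof -
      have "(1 + t)\<^sup>2 \<le> (2 * t)\<^sup>2" using False t by (intro power_mono) auto
      moreover have "0 < (1 + t)\<^sup>2" "0 < t\<^sup>2" using t by simp_all
      moreover have "0 \<le> t\<^sup>2" by simp
      moreover have "(2 * t)\<^sup>2 = 4 * t\<^sup>2" by (simp add: power_mult_distrib)
      ultimately have "5 * (1 + t)\<^sup>2 \<le> 80 * t\<^sup>2" by linarith
      then have "5 / (4 * t\<^sup>2) \<le> 20 / (1 + t)\<^sup>2"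
        using \<open>0 < (1 + t)\<^sup>2\<close> \<open>0 < t\<^sup>2\<close> by (simp add: divide_le_eq pos_le_divide_eq field_simps)
      then show ?thesis unfolding sq by simp
    qed
    finally show ?thesis .
  qed
qed

lemma integrable_log_kernel: "set_integrable lborel {0<..} log_kernel"
proof -
  have "(\<integral>\<^sup>+t. ennreal (indicator {0<..} t * (t powr (1 - 1) * (1 + t) powr (- 2))) \<partial>lborel) < \<infinity>"
    by (rule nn_integral_beta_prime) auto
  then have "integrable lborel (\<lambda>t::real. indicator {0<..} t * (t powr (1 - 1) * (1 + t) powr (- 2)))"
    by (auto simp: integrable_iff_bounded)
  then have i: "integrable lborel (\<lambda>t::real. 20 * (indicator {0<..} t * (t powr (1 - 1) * (1 + t) powr (- 2))))"
    by (rule integrable_mult_right)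
  show ?thesis
    unfolding set_integrable_def
  proof (rule Bochner_Integration.integrable_bound[OF i])
    show "AE t in lborel. norm (indicator {0<..} t *\<^sub>R log_kernel t) \<le> norm (20 * (indicator {0<..} t * (t powr (1 - 1) * (1 + t) powr (- 2))))"
      using log_kernel_bound by (intro AE_I2) (auto simp: indicator_def)
  qed measurable
qed

lemma log_kernel_ge:
  assumes t: "t > 0"
  shows "- (1 / (4 * t\<^sup>2)) + exp (- t) / t \<le> log_kernel t"
proof -
  have "1 - 1 / (4 * t) \<le> exp (- (1 / (4 * t)))" using exp_ge_add_one_self[of "- (1 / (4 * t))"] by simp
  then have "(- (1 / (4 * t)) + exp (- t)) / t \<le> log_kernel t"
    unfolding log_kernel_def using t by (intro divide_right_mono) auto
  moreover have "(- (1 / (4 * t)) + exp (- t)) / t = - (1 / (4 * t\<^sup>2)) + exp (- t) / t"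
    using t by (simp add: field_simps power2_eq_square)
  ultimately show ?thesis by simp
qed

text \<open>The integral over the half line is \<open>2 (ln 2 - \<gamma>)\<close> with Euler's constant \<open>\<gamma>\<close>; the substitution
  \<open>t \<mapsto> 1 / (4 t)\<close> exchanges the two sides of \<open>t = 1/2\<close>, and for \<open>t \<ge> 1/2\<close> the function \<open>1 / t\<close> is
  estimated from below by its tangents at \<open>3/4\<close> and \<open>3/2\<close>.\<close>

lemma integral_log_kernel_pos: "0 < (LINT t:{0<..}|lborel. log_kernel t)"
proof -
  let ?S = "{1/2<..} :: real set"
  have im: "(\<lambda>t. 1 / (4 * t)) ` ?S = {0<..<1/2}"
  proof
    show "(\<lambda>t. 1 / (4 * t)) ` ?S \<subseteq> {0<..<1/2}" by (auto simp: field_simps)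
    show "{0<..<1/2} \<subseteq> (\<lambda>t. 1 / (4 * t)) ` ?S"
    proof
      fix x :: real assume "x \<in> {0<..<1/2}"
      then have "x = 1 / (4 * (1 / (4 * x)))" "1 / (4 * x) \<in> ?S" by (auto simp: field_simps)
      then show "x \<in> (\<lambda>t. 1 / (4 * t)) ` ?S" by blast
    qed
  qed
  have i1: "set_integrable lborel ?S log_kernel" and i2: "set_integrable lborel {0<..<1/2} log_kernel"
    by (auto intro: set_integrable_subset[OF integrable_log_kernel])
  have "log_kernel absolutely_integrable_on {0<..<1/2}"
    using i2 by (simp add: set_integrable_def integrable_completion)
  moreover have "((\<lambda>t. 1 / (4 * t)) has_field_derivative - (1 / (4 * t\<^sup>2))) (at t within ?S)" if "t \<in> ?S" for t
    using that by (auto intro!: derivative_eq_intros simp: power2_eq_square)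
  moreover have "inj_on (\<lambda>t. 1 / (4 * t)) ?S" by (auto simp: inj_on_def)
  ultimately have "integral ?S (\<lambda>t. \<bar>- (1 / (4 * t\<^sup>2))\<bar> * log_kernel (1 / (4 * t))) = integral {0<..<1/2} log_kernel"
    using has_absolute_integral_change_of_variables_1'[of ?S "\<lambda>t. 1 / (4 * t)" "\<lambda>t. - (1 / (4 * t\<^sup>2))" log_kernel "integral {0<..<1/2} log_kernel"]
    unfolding im by auto
  \<comment> \<open>The substitution exchanges the two exponentials, and the Jacobian 1 / (4 t^2)
    turns the factor 4 t into 1/t, so the integrand reproduces itself.\<close>
  moreover have "integral ?S (\<lambda>t. \<bar>- (1 / (4 * t\<^sup>2))\<bar> * log_kernel (1 / (4 * t))) = integral ?S log_kernel"
  proof (rule Henstock_Kurzweil_Integration.integral_cong)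
    fix t :: real assume "t \<in> ?S"
    then have t: "t > 0" by simp
    have "\<bar>- (1 / (4 * t\<^sup>2))\<bar> = 1 / (4 * t\<^sup>2)" by simp
    moreover have "log_kernel (1 / (4 * t)) = (exp (- t) - 1 + exp (- (1 / (4 * t)))) * (4 * t)"
      using t by (simp add: log_kernel_def)
    ultimately show "\<bar>- (1 / (4 * t\<^sup>2))\<bar> * log_kernel (1 / (4 * t)) = log_kernel t"
      using t by (simp add: log_kernel_def power2_eq_square field_simps)
  qed
  ultimately have sym: "(LINT t:{0<..<1/2}|lborel. log_kernel t) = (LINT t:?S|lborel. log_kernel t)"
    by (simp add: set_borel_integral_eq_integral(2)[OF i1] set_borel_integral_eq_integral(2)[OF i2])
  have "(LINT t:{0<..}|lborel. log_kernel t) = (LINT t:{0<..<1/2} \<union> ?S|lborel. log_kernel t)"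
    unfolding set_lebesgue_integral_def using AE_lborel_singleton[of "1/2::real"]
    by (intro integral_cong_AE) (auto simp: indicator_def elim!: eventually_mono)
  also have "\<dots> = (LINT t:{0<..<1/2}|lborel. log_kernel t) + (LINT t:?S|lborel. log_kernel t)"
    by (intro set_integral_Un i1 i2) auto
  finally have total: "(LINT t:{0<..}|lborel. log_kernel t) = 2 * (LINT t:?S|lborel. log_kernel t)"
    using sym by simp
  have h1: "has_bochner_integral lborel (\<lambda>t::real. indicator {1/2..} t * (1 / (4 * t\<^sup>2))) (1/2)"
  proof -
    have "(\<integral>\<^sup>+t. ennreal (1 / (4 * t\<^sup>2)) * indicator {1/2..} t \<partial>lborel) = ennreal (0 - (- (1 / (4 * (1/2)))))"
    proof (rule nn_integral_FTC_atLeast)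
      show "((\<lambda>t::real. - (1 / (4 * t))) has_real_derivative 1 / (4 * t\<^sup>2)) (at t)" if "1/2 \<le> t" for t
        using that by (auto intro!: derivative_eq_intros simp: power2_eq_square)
      have "filterlim (\<lambda>t::real. 4 * t) at_top at_top"
        by (rule filterlim_tendsto_pos_mult_at_top[OF tendsto_const _ filterlim_ident]) simp
      then have "((\<lambda>t::real. 1 / (4 * t)) \<longlongrightarrow> 0) at_top"
        by (intro tendsto_divide_0[OF tendsto_const] filterlim_at_top_imp_at_infinity)
      then show "((\<lambda>t::real. - (1 / (4 * t))) \<longlongrightarrow> 0) at_top" using tendsto_minus by fastforce
    qed auto
    moreover have "(\<integral>\<^sup>+t. ennreal (indicator {1/2..} t * (1 / (4 * t\<^sup>2))) \<partial>lborel) = (\<integral>\<^sup>+t. ennreal (1 / (4 * t\<^sup>2)) * indicator {1/2..} t \<partial>lborel)"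
      by (intro nn_integral_cong) (auto simp: indicator_def)
    ultimately show ?thesis
      by (intro has_bochner_integral_nn_integral) auto
  qed
  have tang: "has_bochner_integral lborel (\<lambda>t::real. indicator {l..u} t * (exp (- t) * (c - d * t))) (exp (- u) * (d * u + d - c) - exp (- l) * (d * l + d - c))"
    if "l \<le> u" for l u c d :: real
  proof -
    have "has_bochner_integral lborel (\<lambda>t::real. indicator {l..u} t *\<^sub>R (exp (- t) * (c - d * t))) (exp (- u) * (d * u + d - c) - exp (- l) * (d * l + d - c))"
      unfolding has_bochner_integral_iff
    proof
      have cont: "continuous_on {l..u} (\<lambda>t. exp (- t) * (c - d * t))" by (intro continuous_intros)
      show "integrable lborel (\<lambda>t::real. indicator {l..u} t *\<^sub>R (exp (- t) * (c - d * t)))"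
        by (rule borel_integrable_compact[OF _ cont]) simp
      show "(\<integral>t. indicator {l..u} t *\<^sub>R (exp (- t) * (c - d * t)) \<partial>lborel) = exp (- u) * (d * u + d - c) - exp (- l) * (d * l + d - c)"
      proof (rule integral_FTC_atLeastAtMost[OF that _ cont])
        show "((\<lambda>t. exp (- t) * (d * t + d - c)) has_vector_derivative exp (- t) * (c - d * t)) (at t within {l..u})" for t
          unfolding has_real_derivative_iff_has_vector_derivative[symmetric]
          by (auto intro!: derivative_eq_intros simp: algebra_simps)
      qed
    qed
    then show ?thesis by simp
  qed
  \<comment> \<open>The tangent of 1/t at t_0 is 2/t_0 - t/t_0^2. The tangents at 3/4 and 3/2 cross
    at t = 1, and the second one is used up to its zero t = 3. The last term bounds (exp (- 1 / (4
    t)) - 1) / t from below.\<close>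
  define L where "L = (\<lambda>t::real. indicator {1/2..1} t * (exp (- t) * (8/3 - 16/9 * t)) + indicator {1..3} t * (exp (- t) * (4/3 - 4/9 * t))
     - indicator {1/2..} t * (1 / (4 * t\<^sup>2)))"
  define B :: real where "B = (exp (- 1) * (16/9 * 1 + 16/9 - 8/3) - exp (- (1/2)) * (16/9 * (1/2) + 16/9 - 8/3)) +
      (exp (- 3) * (4/9 * 3 + 4/9 - 4/3) - exp (- 1) * (4/9 * 1 + 4/9 - 4/3)) - 1/2"
  have hL: "has_bochner_integral lborel L B"
    unfolding L_def B_def by (intro has_bochner_integral_add has_bochner_integral_diff tang h1) auto
  \<comment> \<open>The tangent point 3/4 makes the antiderivative vanish at t = 1/2, so no exp (-
    1/2) occurs. The value is about 0.013, a margin that the bound e < 2.72 is sharp enough to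
    confirm.\<close>
  have Beq: "B = 4/3 * exp (- 1) + 4/9 * exp (- 3) - 1/2" by (simp add: B_def)
  have "B \<le> (LINT t:?S|lborel. log_kernel t)"
  proof -
    have "integral\<^sup>L lborel L \<le> (\<integral>t. indicator ?S t *\<^sub>R log_kernel t \<partial>lborel)"
    proof (rule integral_mono_AE)
      show "integrable lborel L" using hL by (simp add: has_bochner_integral_iff)
      show "integrable lborel (\<lambda>t. indicator ?S t *\<^sub>R log_kernel t)" using i1 by (simp add: set_integrable_def)
      have "AE t::real in lborel. t \<noteq> 1/2 \<and> t \<noteq> 1"
        using AE_lborel_singleton[of "1/2::real"] AE_lborel_singleton[of "1::real"] by eventually_elim simp
      then show "AE t in lborel. L t \<le> indicator ?S t *\<^sub>R log_kernel t"
      proof eventually_elim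
        case (elim t)
        show ?case
        proof (cases "t > 1/2")
          case True
          then have t0: "t > 0" by simp
          have e1: "exp (- t) * (8/3 - 16/9 * t) \<le> exp (- t) / t"
          proof -
            have "0 \<le> (4/3 * t - 1)\<^sup>2" by simp
            then have "(8/3 - 16/9 * t) * t \<le> 1" by (simp add: power2_eq_square algebra_simps)
            then have "8/3 - 16/9 * t \<le> 1 / t" using t0 by (simp add: pos_le_divide_eq)
            then have "exp (- t) * (8/3 - 16/9 * t) \<le> exp (- t) * (1 / t)" by (intro mult_left_mono) auto
            then show ?thesis by simp
          qed
          have e2: "exp (- t) * (4/3 - 4/9 * t) \<le> exp (- t) / t"
          proof -
            have "0 \<le> (2/3 * t - 1)\<^sup>2" by simp
            then have "(4/3 - 4/9 * t) * t \<le> 1" by (simp add: power2_eq_square algebra_simps)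
            then have "4/3 - 4/9 * t \<le> 1 / t" using t0 by (simp add: pos_le_divide_eq)
            then have "exp (- t) * (4/3 - 4/9 * t) \<le> exp (- t) * (1 / t)" by (intro mult_left_mono) auto
            then show ?thesis by simp
          qed
          have e3: "0 \<le> exp (- t) / t" using t0 by simp
          have "L t \<le> exp (- t) / t - 1 / (4 * t\<^sup>2)"
            unfolding L_def using True elim e1 e2 e3 by (auto simp: indicator_def)
          also have "\<dots> \<le> log_kernel t" using log_kernel_ge[OF t0] by simp
          finally show ?thesis using True by simp
        next
          case False
          then show ?thesis using elim by (simp add: L_def indicator_def)
        qed
      qed
    qed
    then show ?thesis using hL by (simp add: has_bochner_integral_iff set_lebesgue_integral_def)
  qed
  moreover have "B > 0"
  proof -
    have "exp (1::real) < 272/100" using e_less_272 by simp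
    then have x: "100/272 < exp (- 1 :: real)" by (simp add: exp_minus field_simps)
    have "exp (- 3 :: real) = exp (- 1) ^ 3" by (simp add: exp_of_nat_mult[symmetric])
    moreover have "(100/272) ^ 3 \<le> exp (- 1 :: real) ^ 3" using x by (intro power_mono) auto
    ultimately have y: "(100/272) ^ 3 \<le> exp (- 3 :: real)" by simp
    have "(1/2::real) < 4/3 * (100/272) + 4/9 * (100/272) ^ 3" by (simp add: power3_eq_cube)
    then show ?thesis unfolding Beq using x y by linarith
  qed
  ultimately show ?thesis unfolding total by simp
qed

lemma (in pair_sigma_finite) pair_product_integral:
  fixes f :: "'a \<Rightarrow> real" and g :: "'b \<Rightarrow> real"
  assumes f: "integrable M1 f" and g: "integrable M2 g"
  shows "integrable (M1 \<Otimes>\<^sub>M M2) (\<lambda>\<omega>. f (fst \<omega>) * g (snd \<omega>))"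
    and "(\<integral>\<omega>. f (fst \<omega>) * g (snd \<omega>) \<partial>(M1 \<Otimes>\<^sub>M M2)) = integral\<^sup>L M1 f * integral\<^sup>L M2 g"
proof -
  have [measurable]: "f \<in> borel_measurable M1" "g \<in> borel_measurable M2" using f g by auto
  show i: "integrable (M1 \<Otimes>\<^sub>M M2) (\<lambda>\<omega>. f (fst \<omega>) * g (snd \<omega>))"
    by (rule Fubini_integrable) (use f g in \<open>auto simp: abs_mult\<close>)
  show "(\<integral>\<omega>. f (fst \<omega>) * g (snd \<omega>) \<partial>(M1 \<Otimes>\<^sub>M M2)) = integral\<^sup>L M1 f * integral\<^sup>L M2 g"
    using integral_fst'[OF i] by simp
qed

section \<open>Lower bounds that separate the two mixing parameters\<close>

context axial_power
begin

text \<open>The midpoint of 1/2 and a. Being above 1/2 it gives a moment of lower order than N,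
  namely N^(1-p/2); being below a it keeps that moment finite.\<close>

definition \<gamma> :: real where "\<gamma> = 1/2 + p / 4"

lemma \<gamma>_pos: "0 < \<gamma>" and \<gamma>_less: "\<gamma> < a"
  using p_pos by (auto simp: \<gamma>_def a_def field_simps)

lemma integrable_mix_half:
  assumes N: "1 \<le> N"
  shows "integrable (mix N) (\<lambda>s. s powr (- (1/2)))"
  using mix_moment_weighted_finite[OF N, of 0] by (auto simp: integrable_iff_bounded)

lemma integral_mix_half_ge:
  assumes N: "1 \<le> N"
  shows "2 * 2 powr (- b) / sqrt pi * N \<le> (\<integral>s. s powr (- (1/2)) \<partial>mix N)"
proof -
  have "(\<integral>\<^sup>+s. ennreal (s powr (- (1/2))) \<partial>mix N) = ennreal (\<integral>s. s powr (- (1/2)) \<partial>mix N)"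
    by (intro nn_integral_eq_integral integrable_mix_half N) auto
  then show ?thesis
    using mix_moment_half_ge[OF N] by (simp add: integral_nonneg_AE)
qed

lemma integrable_mix_\<gamma>:
  assumes N: "1 \<le> N"
  shows "integrable (mix N) (\<lambda>s. s powr (- \<gamma>))"
proof -
  obtain C where "(\<integral>\<^sup>+s. ennreal (s powr (- \<gamma>)) \<partial>mix N) \<le> ennreal (C * N powr (2 - 2 * \<gamma>))"
    using mix_moment_le[OF \<gamma>_pos \<gamma>_less] N by blast
  then have "(\<integral>\<^sup>+s. ennreal (s powr (- \<gamma>)) \<partial>mix N) < \<infinity>" by (rule order_le_less_trans) simp
  then show ?thesis by (auto simp: integrable_iff_bounded)
qed

lemma integral_mix_\<gamma>_le:
  "\<exists>C\<ge>0. \<forall>N\<ge>1. (\<integral>s. s powr (- \<gamma>) \<partial>mix N) \<le> C * N powr (1 - p / 2)"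
proof -
  obtain C where C: "C \<ge> 0" "\<And>N. N \<ge> 1 \<Longrightarrow> (\<integral>\<^sup>+s. ennreal (s powr (- \<gamma>)) \<partial>mix N) \<le> ennreal (C * N powr (2 - 2 * \<gamma>))"
    using mix_moment_le[OF \<gamma>_pos \<gamma>_less] by blast
  have e: "2 - 2 * \<gamma> = 1 - p / 2" by (simp add: \<gamma>_def)
  have "(\<integral>s. s powr (- \<gamma>) \<partial>mix N) \<le> C * N powr (1 - p / 2)" if N: "N \<ge> 1" for N
  proof -
    have "(\<integral>\<^sup>+s. ennreal (s powr (- \<gamma>)) \<partial>mix N) = ennreal (\<integral>s. s powr (- \<gamma>) \<partial>mix N)"
      by (intro nn_integral_eq_integral integrable_mix_\<gamma> N) auto
    then show ?thesis using C(2)[OF N] C(1) unfolding e by (simp add: ennreal_le_iff)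
  qed
  then show ?thesis using C(1) by blast
qed

text \<open>With s and t separated in the pointwise bound, the double integral factorises into
  moments of the two mixing measures. The leading term carries the moment of order N, the error term
  the moment of s^(-\<gamma>).\<close>

lemma transform_ge_product:
  assumes N: "1 \<le> N" and \<xi>: "norm \<xi> = 1" and g1: "integrable tau g1" and g2: "integrable tau g2"
    and le: "\<And>s t. s > 0 \<Longrightarrow> t > 0 \<Longrightarrow>
      s powr (- (1/2)) * g1 t - s powr (- \<gamma>) * g2 t \<le> axial_kernel_fourier e s t \<xi> - kernel_cut s t"
  shows "(\<integral>s. s powr (- (1/2)) \<partial>mix N) * integral\<^sup>L tau g1 - (\<integral>s. s powr (- \<gamma>) \<partial>mix N) * integral\<^sup>L tau g2 \<le> transform N \<xi>"
proof -
  interpret M: pair_sigma_finite "mix N" tau by (rule pair_sigma_finite_mixture[OF N])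
  obtain G where G: "integrable (mixture N) G" "AE \<omega> in mixture N. \<forall>\<xi>. 1 \<le> norm \<xi> \<and> norm \<xi> \<le> 1 \<longrightarrow>
     \<bar>axial_kernel_fourier e (fst \<omega>) (snd \<omega>) \<xi> - kernel_cut (fst \<omega>) (snd \<omega>)\<bar> \<le> G \<omega>"
    using kernel_diff_dominated[OF N, of 1 1] by auto
  have int: "integrable (mixture N) (\<lambda>\<omega>. axial_kernel_fourier e (fst \<omega>) (snd \<omega>) \<xi> - kernel_cut (fst \<omega>) (snd \<omega>))"
  proof (rule Bochner_Integration.integrable_bound[OF G(1)])
    have "(\<lambda>\<omega>. axial_kernel_fourier e (fst \<omega>) (snd \<omega>) \<xi>) \<in> borel_measurable (mixture N)"
      unfolding axial_kernel_fourier_def by measurable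
    moreover have "(\<lambda>\<omega>. kernel_cut (fst \<omega>) (snd \<omega>)) \<in> borel_measurable (mixture N)" by measurable
    ultimately show "(\<lambda>\<omega>. axial_kernel_fourier e (fst \<omega>) (snd \<omega>) \<xi> - kernel_cut (fst \<omega>) (snd \<omega>)) \<in> borel_measurable (mixture N)"
      by (rule borel_measurable_diff)
    show "AE \<omega> in mixture N. norm (axial_kernel_fourier e (fst \<omega>) (snd \<omega>) \<xi> - kernel_cut (fst \<omega>) (snd \<omega>)) \<le> norm (G \<omega>)"
      using G(2)
    proof eventually_elim
      case (elim \<omega>)
      then have "\<bar>axial_kernel_fourier e (fst \<omega>) (snd \<omega>) \<xi> - kernel_cut (fst \<omega>) (snd \<omega>)\<bar> \<le> G \<omega>" using \<xi> by simp
      then show ?case by simp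
    qed
  qed
  note p1 = M.pair_product_integral[OF integrable_mix_half[OF N] g1]
  note p2 = M.pair_product_integral[OF integrable_mix_\<gamma>[OF N] g2]
  have "(\<integral>\<omega>. fst \<omega> powr (- (1/2)) * g1 (snd \<omega>) - fst \<omega> powr (- \<gamma>) * g2 (snd \<omega>) \<partial>mixture N) \<le> transform N \<xi>"
    unfolding transform_def
  proof (rule integral_mono_AE[OF Bochner_Integration.integrable_diff[OF p1(1) p2(1)] int])
    show "AE \<omega> in mixture N. fst \<omega> powr (- (1/2)) * g1 (snd \<omega>) - fst \<omega> powr (- \<gamma>) * g2 (snd \<omega>) \<le>
        axial_kernel_fourier e (fst \<omega>) (snd \<omega>) \<xi> - kernel_cut (fst \<omega>) (snd \<omega>)"
      using AE_mixture_pos[OF N] by eventually_elim (simp add: le)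
  qed
  then show ?thesis
    by (simp only: Bochner_Integration.integral_diff[OF p1(1) p2(1)] p1(2) p2(2))
qed

text \<open>Without a subtraction the kernel is positive, so it is enough to keep t between 1 and 2.
  There the rate is at most 3 unless the shift c exceeds 1, which happens only for small s; the
  error term s^(-\<gamma>) pays for that range.\<close>

lemma kernel_lower_bound_gt_1:
  assumes \<alpha>1: "1 < \<alpha>"
  shows "\<exists>g1 g2. integrable tau g1 \<and> integrable tau g2 \<and> integral\<^sup>L tau g1 > 0 \<and>
    (\<forall>s>0. \<forall>t>0. \<forall>\<xi>. norm \<xi> = 1 \<longrightarrow>
      s powr (- (1/2)) * g1 t - s powr (- \<gamma>) * g2 t \<le> axial_kernel_fourier e s t \<xi> - kernel_cut s t)"
proof -
  define m where "m = (real n - 1) / 2"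
  have m0: "m > 0" using dim by (simp add: m_def)
  define A where "A = sqrt pi * sqrt pi ^ (n - 1) * 3 powr (- m) * exp (- (1/4))"
  have A0: "A > 0" by (simp add: A_def)
  define g where "g = (\<lambda>t::real. A * indicator {1..2} t)"
  have [measurable]: "g \<in> borel_measurable borel" unfolding g_def by measurable
  have g0: "g t \<ge> 0" for t using A0 by (simp add: g_def)
  have fin: "(\<integral>\<^sup>+t. ennreal (g t) \<partial>tau) < \<infinity>"
  proof -
    have "(\<integral>\<^sup>+t. ennreal (g t) \<partial>tau) \<le> (\<integral>\<^sup>+t. ennreal (A * 3 powr p) * ennreal ((1 + t) powr (- p)) \<partial>tau)"
    proof (rule nn_integral_mono)
      fix t :: real
      show "ennreal (g t) \<le> ennreal (A * 3 powr p) * ennreal ((1 + t) powr (- p))"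
      proof (cases "t \<in> {1..2}")
        case True
        have "3 powr (- p) \<le> (1 + t) powr (- p)" using True p_pos by (intro powr_mono2') auto
        then have "3 powr p * 3 powr (- p) \<le> 3 powr p * (1 + t) powr (- p)" by (intro mult_left_mono) auto
        then have "1 \<le> 3 powr p * (1 + t) powr (- p)" by (simp add: powr_add[symmetric])
        then have "A * 1 \<le> A * (3 powr p * (1 + t) powr (- p))" using A0 by (intro mult_left_mono) auto
        then show ?thesis using True A0 by (simp add: g_def ennreal_mult[symmetric] ennreal_leI mult.assoc)
      qed (simp add: g_def)
    qed
    also have "\<dots> = ennreal (A * 3 powr p) * (\<integral>\<^sup>+t. ennreal ((1 + t) powr (- p)) \<partial>tau)"
      by (rule nn_integral_cmult) measurable
    also have "\<dots> < \<infinity>"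
      using nn_integral_tau_finite[of p] p_pos by (simp add: ennreal_mult_less_top)
    finally show ?thesis .
  qed
  then have int: "integrable tau g" using g0 by (auto simp: integrable_iff_bounded)
  have "ennreal (1 / Gamma (p / 2) * (A / 2)) \<le> (\<integral>\<^sup>+t. ennreal (g t) \<partial>tau)"
  proof -
    have "ennreal (A / 2) = (\<integral>\<^sup>+t. ennreal (A / 2) * indicator {1..2::real} t \<partial>lborel)"
      by (simp add: nn_integral_cmult)
    also have "\<dots> \<le> (\<integral>\<^sup>+t. ennreal (indicator {0<..} t * t powr (p / 2 - 1)) * ennreal (g t) \<partial>lborel)"
    proof (rule nn_integral_mono)
      fix t :: real
      show "ennreal (A / 2) * indicator {1..2} t \<le> ennreal (indicator {0<..} t * t powr (p / 2 - 1)) * ennreal (g t)"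
      proof (cases "t \<in> {1..2}")
        case True
        have "1 / 2 \<le> 1 / t" using True by (intro divide_left_mono) auto
        also have "\<dots> = t powr (- 1)" using True by (simp add: powr_minus_divide)
        also have "\<dots> \<le> t powr (p / 2 - 1)" using True p_pos by (intro powr_mono) auto
        finally have "A * (1 / 2) \<le> A * t powr (p / 2 - 1)" using A0 by (intro mult_left_mono) auto
        then show ?thesis using True A0 by (simp add: g_def ennreal_mult[symmetric] ennreal_leI mult.commute)
      qed simp
    qed
    finally have "ennreal (1 / Gamma (p / 2)) * ennreal (A / 2) \<le> (\<integral>\<^sup>+t. ennreal (g t) \<partial>tau)"
      by (subst nn_integral_tau) (auto intro: mult_left_mono)
    then show ?thesis using A0 Gamma_real_pos[of "p / 2"] p_pos by (simp add: ennreal_mult[symmetric])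
  qed
  then have "1 / Gamma (p / 2) * (A / 2) \<le> integral\<^sup>L tau g"
    using int g0 by (subst (asm) nn_integral_eq_integral) (auto simp: integral_nonneg_AE)
  moreover have "0 < 1 / Gamma (p / 2) * (A / 2)" using A0 Gamma_real_pos[of "p / 2"] p_pos by simp
  ultimately have pos: "integral\<^sup>L tau g > 0" by linarith
  have "s powr (- (1/2)) * g t - s powr (- \<gamma>) * g t \<le> axial_kernel_fourier e s t \<xi> - kernel_cut s t"
    if s: "s > 0" and t: "t > 0" and \<xi>: "norm \<xi> = 1" for s t \<xi>
  proof (cases "t \<in> {1..2}")
    case True
    define c where "c = (\<xi> \<bullet> e)\<^sup>2 / (4 * s)"
    define \<kappa> where "\<kappa> = t + c"
    have c0: "c \<ge> 0" using s by (simp add: c_def)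
    have \<kappa>: "1 \<le> \<kappa>" "\<kappa> \<le> 2 + c" "0 < \<kappa>" using True c0 by (auto simp: \<kappa>_def)
    have q: "0 \<le> perp2 e \<xi>" "perp2 e \<xi> \<le> 1" "(\<xi> \<bullet> e)\<^sup>2 \<le> 1"
      using norm2_eq_perp2[of \<xi> e] perp2_nonneg[OF e, of \<xi>] \<xi> by (auto simp: perp2_def)
    have "perp2 e \<xi> / (4 * \<kappa>) \<le> 1 / 4"
    proof -
      have "perp2 e \<xi> / (4 * \<kappa>) \<le> 1 / (4 * 1)" using q \<kappa> by (intro frac_le) auto
      then show ?thesis by simp
    qed
    then have ex: "exp (- (1/4)) \<le> exp (- (perp2 e \<xi> / (4 * \<kappa>)))" by simp
    have cs: "c powr (p / 4) \<le> s powr (- (p / 4))"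
    proof -
      have "c \<le> 1 / s" unfolding c_def using q s by (intro frac_le) auto
      then have "c powr (p / 4) \<le> (1 / s) powr (p / 4)" using c0 p_pos by (intro powr_mono2) auto
      also have "\<dots> = s powr (- (p / 4))" using s by (simp add: powr_divide powr_minus_divide)
      finally show ?thesis .
    qed
    \<comment> \<open>If c > 1, then s^(-p/4) \<ge> c^(p/4) \<ge> 1, and the left side is not
      positive.\<close>
    have "3 powr (- m) * (1 - s powr (- (p / 4))) \<le> \<kappa> powr (- m)"
    proof (cases "c \<le> 1")
      case True
      have "3 powr (- m) * (1 - s powr (- (p / 4))) \<le> 3 powr (- m) * 1" by (intro mult_left_mono) auto
      also have "\<dots> \<le> \<kappa> powr (- m)" using \<kappa> True m0 by (simp, intro powr_mono2') auto
      finally show ?thesis .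
    next
      case False
      then have "1 \<le> c powr (p / 4)" using p_pos by (intro ge_one_powr_ge_zero) auto
      then have "1 - s powr (- (p / 4)) \<le> 0" using cs by linarith
      then have "3 powr (- m) * (1 - s powr (- (p / 4))) \<le> 0" by (simp add: mult_nonneg_nonpos)
      then show ?thesis by (rule order_trans) simp
    qed
    then have "exp (- (1/4)) * (3 powr (- m) * (1 - s powr (- (p / 4)))) \<le> exp (- (1/4)) * \<kappa> powr (- m)" by (intro mult_left_mono) auto
    also have "\<dots> \<le> exp (- (perp2 e \<xi> / (4 * \<kappa>))) * \<kappa> powr (- m)" using ex by (intro mult_right_mono) auto
    finally have main: "exp (- (1/4)) * (3 powr (- m) * (1 - s powr (- (p / 4)))) \<le> exp (- (perp2 e \<xi> / (4 * \<kappa>))) * \<kappa> powr (- m)" .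
    have 1: "sqrt (pi / \<kappa>) ^ (n - 1) = sqrt pi ^ (n - 1) * \<kappa> powr (- m)"
      using sqrt_pi_div_power[OF \<kappa>(3), of "n - 1"] dim by (simp add: m_def of_nat_diff)
    have 2: "sqrt (pi / s) = sqrt pi * s powr (- (1/2))"
      using s by (simp add: real_sqrt_divide powr_minus_divide powr_half_sqrt)
    have "s powr (- \<gamma>) = s powr (- (1/2)) * s powr (- (p / 4))" unfolding powr_add[symmetric] by (simp add: \<gamma>_def)
    then have "s powr (- (1/2)) * g t - s powr (- \<gamma>) * g t = (sqrt pi * sqrt pi ^ (n - 1) * s powr (- (1/2))) * (exp (- (1/4)) * (3 powr (- m) * (1 - s powr (- (p / 4)))))"
      using True by (simp add: g_def A_def algebra_simps)
    also have "\<dots> \<le> (sqrt pi * sqrt pi ^ (n - 1) * s powr (- (1/2))) * (exp (- (perp2 e \<xi> / (4 * \<kappa>))) * \<kappa> powr (- m))"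
      using main by (intro mult_left_mono) auto
    also have "\<dots> = axial_kernel_fourier e s t \<xi>"
      unfolding axial_kernel_fourier_def c_def[symmetric] \<kappa>_def[symmetric] n_eq[symmetric] 1 2 by (simp only: mult_ac)
    finally show ?thesis by (simp add: kernel_cut_eq_0[OF \<alpha>1])
  next
    case False
    then show ?thesis using kernel_fourier_nonneg[OF s t, of \<xi>] by (simp add: g_def kernel_cut_eq_0[OF \<alpha>1])
  qed
  then show ?thesis using int pos by blast
qed

text \<open>Here p = 2, so \<open>tau\<close> is Lebesgue measure on the half line. On the unit
  sphere the squared orthogonal part of \<xi> is at most 1 and may be replaced by 1 in the exponent;
  replacing the rate \<kappa> by t costs at most (sqrt c / 2) t^(-3/2), where sqrt c is of order
  s^(-1/2). The main term is then \<open>log_kernel\<close>, whose integral is positive.\<close>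

lemma kernel_lower_bound_1:
  assumes \<alpha>1: "\<not> 1 < \<alpha>"
  shows "\<exists>g1 g2. integrable tau g1 \<and> integrable tau g2 \<and> integral\<^sup>L tau g1 > 0 \<and>
    (\<forall>s>0. \<forall>t>0. \<forall>\<xi>. norm \<xi> = 1 \<longrightarrow>
      s powr (- (1/2)) * g1 t - s powr (- \<gamma>) * g2 t \<le> axial_kernel_fourier e s t \<xi> - kernel_cut s t)"
proof -
  note p2 = \<alpha>_eq_1(3)[OF \<alpha>1]
  have \<gamma>1: "\<gamma> = 1" by (simp add: \<gamma>_def p2)
  define A where "A = sqrt pi * pi"
  have A0: "A > 0" by (simp add: A_def)
  have tau: "tau = density lborel (\<lambda>t. ennreal (indicator {0<..} t))"
    unfolding tau_def by (intro density_cong AE_I2) (auto simp: p2 indicator_def)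
  \<comment> \<open>The factor exp (- 1 / (4 t)) is kept in the error term because t^(-3/2) alone is
    not integrable at 0.\<close>
  define h where "h = (\<lambda>t::real. t powr (- (1/2) - 1) * exp (- ((1/4) / t)))"
  have [measurable]: "h \<in> borel_measurable borel" unfolding h_def by measurable
  have ij: "integrable tau log_kernel" and vj: "integral\<^sup>L tau log_kernel = (LINT t:{0<..}|lborel. log_kernel t)"
    using integrable_log_kernel unfolding tau
    by (subst integrable_density integral_density; simp add: set_integrable_def set_lebesgue_integral_def)+
  have ih: "integrable tau h"
    using has_bochner_integral_inverse_gamma[of "1/2" "1/4"] unfolding tau
    by (subst integrable_density) (auto simp: h_def has_bochner_integral_iff)
  define g1 where "g1 = (\<lambda>t. A * log_kernel t)"
  define g2 where "g2 = (\<lambda>t. A / 4 * h t)"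
  have 1: "integrable tau g1" "integrable tau g2" unfolding g1_def g2_def by (intro integrable_mult_right ij ih)+
  have 2: "integral\<^sup>L tau g1 > 0" unfolding g1_def using A0 integral_log_kernel_pos by (simp add: vj)
  have "s powr (- (1/2)) * g1 t - s powr (- \<gamma>) * g2 t \<le> axial_kernel_fourier e s t \<xi> - kernel_cut s t"
    if s: "s > 0" and t: "t > 0" and \<xi>: "norm \<xi> = 1" for s t \<xi>
  proof -
    define c where "c = (\<xi> \<bullet> e)\<^sup>2 / (4 * s)"
    define \<kappa> where "\<kappa> = t + c"
    have c0: "c \<ge> 0" using s by (simp add: c_def)
    have \<kappa>: "t \<le> \<kappa>" "0 < \<kappa>" using t c0 by (auto simp: \<kappa>_def)
    have q: "0 \<le> perp2 e \<xi>" "perp2 e \<xi> \<le> 1" "(\<xi> \<bullet> e)\<^sup>2 \<le> 1"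
      using norm2_eq_perp2[of \<xi> e] perp2_nonneg[OF e, of \<xi>] \<xi> by (auto simp: perp2_def)
    have sq: "sqrt (pi / s) * pi = A * s powr (- (1/2))"
      using s by (simp add: A_def real_sqrt_divide powr_minus_divide powr_half_sqrt)
    have "perp2 e \<xi> / (4 * \<kappa>) \<le> 1 / (4 * t)" using q \<kappa> t by (intro frac_le) auto
    then have ex: "exp (- (1 / (4 * t))) \<le> exp (- (perp2 e \<xi> / (4 * \<kappa>)))" by simp
    have sc: "sqrt c \<le> 1/2 * s powr (- (1/2))"
    proof -
      have "c \<le> 1 / (4 * s)" unfolding c_def using q s by (intro divide_right_mono) auto
      then have "sqrt c \<le> sqrt (1 / (4 * s))" by (rule real_sqrt_le_mono)
      then show ?thesis using s by (simp add: real_sqrt_divide real_sqrt_mult powr_minus_divide powr_half_sqrt)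
    qed
    have "1 / t - 1 / \<kappa> \<le> 1/2 * (sqrt c * t powr (- (1/2) - 1))"
    proof -
      have t32: "t powr (- (1/2) - 1) = 1 / (t * sqrt t)"
      proof -
        have "t powr (- (1/2) - 1) = t powr (- 1) * t powr (- (1/2))" unfolding powr_add[symmetric] by simp
        then show ?thesis using t by (simp add: powr_minus_divide powr_half_sqrt)
      qed
      \<comment> \<open>The inequality of arithmetic and geometric means for \<kappa> = t + c trades
        c for sqrt c in the error, so that the moment with exponent \<gamma> = 1 applies.\<close>
      have "2 * (sqrt t * sqrt c) \<le> \<kappa>"
      proof -
        have "0 \<le> (sqrt t - sqrt c)\<^sup>2" by simp
        then show ?thesis using t c0 by (simp add: power2_diff \<kappa>_def)
      qed
      then have "sqrt c * (2 * (sqrt t * sqrt c)) \<le> sqrt c * \<kappa>" using c0 by (intro mult_left_mono) auto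
      moreover have "sqrt c * (2 * (sqrt t * sqrt c)) = 2 * (c * sqrt t)" using c0 by (simp add: mult_ac)
      ultimately have k: "2 * (c * sqrt t) \<le> sqrt c * \<kappa>" by simp
      have "1 / t - 1 / \<kappa> = c / (t * \<kappa>)" using t \<kappa> by (simp add: field_simps) (simp add: \<kappa>_def)
      also have "\<dots> = (2 * (c * sqrt t)) / (2 * (t * sqrt t) * \<kappa>)" using t \<kappa> by simp
      also have "\<dots> \<le> (sqrt c * \<kappa>) / (2 * (t * sqrt t) * \<kappa>)" using k t \<kappa> by (intro divide_right_mono) auto
      also have "\<dots> = 1/2 * (sqrt c * (1 / (t * sqrt t)))" using \<kappa> by simp
      finally show ?thesis unfolding t32 .
    qed
    also have "\<dots> \<le> 1/2 * ((1/2 * s powr (- (1/2))) * t powr (- (1/2) - 1))"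
      using sc by (intro mult_left_mono mult_right_mono) auto
    finally have d: "1 / t - 1 / \<kappa> \<le> 1/4 * s powr (- (1/2)) * t powr (- (1/2) - 1)" by simp
    have hh: "h t = t powr (- (1/2) - 1) * exp (- (1 / (4 * t)))" by (simp add: h_def)
    have "exp (- (1 / (4 * t))) * (1 / t - 1 / \<kappa>) \<le> exp (- (1 / (4 * t))) * (1/4 * s powr (- (1/2)) * t powr (- (1/2) - 1))"
      using d by (intro mult_left_mono) auto
    then have "exp (- (1 / (4 * t))) / t - 1/4 * s powr (- (1/2)) * h t \<le> exp (- (1 / (4 * t))) / \<kappa>"
      unfolding hh by (simp add: algebra_simps)
    also have "\<dots> \<le> exp (- (perp2 e \<xi> / (4 * \<kappa>))) / \<kappa>" using ex \<kappa> by (intro divide_right_mono) auto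
    finally have k: "exp (- (1 / (4 * t))) / t - 1/4 * s powr (- (1/2)) * h t \<le> exp (- (perp2 e \<xi> / (4 * \<kappa>))) / \<kappa>" .
    have j: "log_kernel t = exp (- (1 / (4 * t))) / t - (1 - exp (- t)) / t"
      by (simp add: log_kernel_def diff_divide_distrib add_divide_distrib)
    have "s powr (- \<gamma>) = s powr (- (1/2)) * s powr (- (1/2))" unfolding powr_add[symmetric] by (simp add: \<gamma>1)
    then have "s powr (- (1/2)) * g1 t - s powr (- \<gamma>) * g2 t = (A * s powr (- (1/2))) * (log_kernel t - 1/4 * s powr (- (1/2)) * h t)"
      by (simp add: g1_def g2_def algebra_simps)
    also have "\<dots> \<le> (A * s powr (- (1/2))) * (exp (- (perp2 e \<xi> / (4 * \<kappa>))) / \<kappa> - (1 - exp (- t)) / t)"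
      using k A0 unfolding j by (intro mult_left_mono) auto
    also have "\<dots> = sqrt (pi / s) * (pi * (exp (- (perp2 e \<xi> / (4 * \<kappa>))) / \<kappa>)) - sqrt (pi / s) * (pi * ((1 - exp (- t)) / t))"
      unfolding sq[symmetric] by (simp add: algebra_simps)
    also have "\<dots> \<le> axial_kernel_fourier e s t \<xi> - kernel_cut s t"
      using kernel_cut_le[OF \<alpha>1 s t] unfolding kernel_fourier_eq_3[OF \<alpha>1 s t] c_def[symmetric] \<kappa>_def[symmetric] by simp
    finally show ?thesis .
  qed
  then show ?thesis using 1 2 by blast
qed

lemma transform_lower_bound:
  "\<exists>c>0. \<exists>C\<ge>0. \<forall>N\<ge>1. \<forall>\<xi>. norm \<xi> = 1 \<longrightarrow> c * N - C * N powr (1 - p / 2) \<le> transform N \<xi>"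
proof -
  obtain g1 g2 where g: "integrable tau g1" "integrable tau g2" "integral\<^sup>L tau g1 > 0"
    "\<And>s t \<xi>. s > 0 \<Longrightarrow> t > 0 \<Longrightarrow> norm \<xi> = 1 \<Longrightarrow>
      s powr (- (1/2)) * g1 t - s powr (- \<gamma>) * g2 t \<le> axial_kernel_fourier e s t \<xi> - kernel_cut s t"
    using kernel_lower_bound_gt_1 kernel_lower_bound_1 by (cases "1 < \<alpha>") metis+
  obtain C where C: "C \<ge> 0" "\<And>N. N \<ge> 1 \<Longrightarrow> (\<integral>s. s powr (- \<gamma>) \<partial>mix N) \<le> C * N powr (1 - p / 2)"
    using integral_mix_\<gamma>_le by blast
  define c where "c = 2 * 2 powr (- b) / sqrt pi"
  have c0: "c > 0" by (simp add: c_def)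
  have "(c * integral\<^sup>L tau g1) * N - (C * \<bar>integral\<^sup>L tau g2\<bar>) * N powr (1 - p / 2) \<le> transform N \<xi>"
    if N: "N \<ge> 1" and \<xi>: "norm \<xi> = 1" for N \<xi>
  proof -
    have "c * N * integral\<^sup>L tau g1 \<le> (\<integral>s. s powr (- (1/2)) \<partial>mix N) * integral\<^sup>L tau g1"
      using integral_mix_half_ge[OF N] g(3) by (intro mult_right_mono) (auto simp: c_def)
    moreover have "(\<integral>s. s powr (- \<gamma>) \<partial>mix N) * integral\<^sup>L tau g2 \<le> (C * N powr (1 - p / 2)) * \<bar>integral\<^sup>L tau g2\<bar>"
    proof -
      have "(\<integral>s. s powr (- \<gamma>) \<partial>mix N) * integral\<^sup>L tau g2 \<le> (\<integral>s. s powr (- \<gamma>) \<partial>mix N) * \<bar>integral\<^sup>L tau g2\<bar>"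
        by (intro mult_left_mono integral_nonneg_AE) auto
      also have "\<dots> \<le> (C * N powr (1 - p / 2)) * \<bar>integral\<^sup>L tau g2\<bar>"
        using C(2)[OF N] by (intro mult_right_mono) auto
      finally show ?thesis .
    qed
    moreover have "(\<integral>s. s powr (- (1/2)) \<partial>mix N) * integral\<^sup>L tau g1 - (\<integral>s. s powr (- \<gamma>) \<partial>mix N) * integral\<^sup>L tau g2 \<le> transform N \<xi>"
      by (rule transform_ge_product[OF N \<xi> g(1,2)]) (use g(4) \<xi> in blast)
    ultimately show ?thesis by (simp add: mult_ac)
  qed
  then show ?thesis
    using c0 g(3) C(1) by (intro exI[of _ "c * integral\<^sup>L tau g1"] conjI exI[of _ "C * \<bar>integral\<^sup>L tau g2\<bar>"]) auto
qed

end

section \<open>Balls and elongated ellipsoids\<close>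

text \<open>For a unit vector \<open>e\<close> the image of the unit ball is the ellipsoid with
  semi-axis r N along \<open>e\<close> and r across. A single family thus contains both the balls,
  with N = 1, and the elongated bodies, with r = 1.\<close>

definition stretch :: "real \<Rightarrow> real \<Rightarrow> 'a::euclidean_space \<Rightarrow> 'a \<Rightarrow> 'a" where
  "stretch r N e x = r *\<^sub>R (x + ((N - 1) * (x \<bullet> e)) *\<^sub>R e)"

lemma linear_stretch: "linear (stretch r N e)"
  by (rule linearI) (simp_all add: stretch_def inner_add_left algebra_simps)

lemma inner_stretch: "stretch r N e x \<bullet> y = x \<bullet> stretch r N e y"
  by (simp add: stretch_def inner_add_left inner_add_right inner_commute algebra_simps)

lemma stretch_stretch:
  assumes "norm e = 1"
  shows "stretch r N e (stretch s M e x) = stretch (r * s) (N * M) e x"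
proof -
  have "e \<bullet> e = 1" using assms by (simp add: norm_eq_1)
  then show ?thesis
    by (simp add: stretch_def inner_add_left algebra_simps)
qed

lemma stretch_1: "stretch 1 1 e x = x"
  by (simp add: stretch_def)

lemma stretch_inverse:
  assumes "norm e = 1" "0 < r" "0 < N"
  shows "stretch r N e (stretch (1 / r) (1 / N) e x) = x" "stretch (1 / r) (1 / N) e (stretch r N e x) = x"
  using assms by (simp_all add: stretch_stretch stretch_1)

lemma inj_stretch:
  assumes "norm e = 1" "0 < r" "0 < N"
  shows "inj (stretch r N e)"
  by (rule inj_on_inverseI) (rule stretch_inverse(2)[OF assms])

lemma norm_stretch:
  assumes e: "norm e = 1" and r: "0 \<le> r"
  shows "norm (stretch r N e x) = r * sqrt (N\<^sup>2 * (x \<bullet> e)\<^sup>2 + perp2 e x)"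
proof -
  have ee: "e \<bullet> e = 1" using e by (simp add: norm_eq_1)
  have "(norm (x + ((N - 1) * (x \<bullet> e)) *\<^sub>R e))\<^sup>2 = N\<^sup>2 * (x \<bullet> e)\<^sup>2 + perp2 e x"
  proof -
    have "(x + s *\<^sub>R e) \<bullet> (x + s *\<^sub>R e) = x \<bullet> x + 2 * s * (x \<bullet> e) + s\<^sup>2" for s
      by (simp add: inner_add_left inner_add_right ee inner_commute[of e x] power2_eq_square algebra_simps)
    note this[of "(N - 1) * (x \<bullet> e)"]
    then show ?thesis unfolding perp2_def power2_norm_eq_inner by algebra
  qed
  then have "norm (x + ((N - 1) * (x \<bullet> e)) *\<^sub>R e) = sqrt (N\<^sup>2 * (x \<bullet> e)\<^sup>2 + perp2 e x)"
    by (metis norm_ge_zero real_sqrt_unique)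
  then show ?thesis using r by (simp add: stretch_def)
qed

lemma ldet_stretch:
  fixes e :: "real^'n"
  assumes e: "norm e = 1"
  shows "ldet (stretch r N e) = r ^ CARD('n) * N"
proof -
  let ?u = "\<lambda>x. x + (((N - 1) *\<^sub>R e) \<bullet> x) *\<^sub>R e"
  have s: "stretch r N e = (\<lambda>x. r *\<^sub>R ?u x)"
    by (auto simp: stretch_def fun_eq_iff inner_commute[of e])
  have l: "linear (\<lambda>x :: real^'n. r *\<^sub>R x)" "linear ?u"
    by (auto intro!: linearI simp: algebra_simps inner_add_right)
  have "ldet (stretch r N e) = r ^ CARD('n) * (1 + e \<bullet> ((N - 1) *\<^sub>R e))"
    unfolding s ldet_compose[OF l] ldet_scaleR ldet_rank_one_update ..
  then show ?thesis using e by (simp add: norm_eq_1)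
qed

lemma sqrt_power_powr: "0 < x \<Longrightarrow> sqrt x ^ k = x powr (real k / 2)"
  by (simp add: powr_half_sqrt[symmetric] powr_power)

text \<open>The curvature function of an ellipsoid is already homogeneous of degree -k-1 off the
  origin, and at the origin both sides are 0 since the denominator on the right vanishes.\<close>

lemma homogeneous_extension_linear:
  fixes A :: "'a::euclidean_space \<Rightarrow> 'a"
  assumes A: "linear A"
  shows "homogeneous_extension (- real k - 1) (\<lambda>x. c / norm (A x) ^ (k + 1)) x = c / norm (A x) ^ (k + 1)"
proof (cases "x = 0")
  case True
  then show ?thesis using linear_0[OF A] by (simp add: homogeneous_extension_def)
next
  case False
  have "norm (A (sgn x)) = norm (A x) / norm x"
    by (simp add: sgn_div_norm linear_scale[OF A] divide_inverse)
  moreover have "norm x powr (- real k - 1) = inverse (norm x ^ (k + 1))"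
  proof -
    have "- real k - 1 = - real (k + 1)" by simp
    moreover have "norm x powr real (k + 1) = norm x ^ (k + 1)" using False by (intro powr_realpow) simp
    ultimately show ?thesis by (simp only: powr_minus)
  qed
  ultimately show ?thesis using False
    unfolding homogeneous_extension_def by (simp only: power_divide) (simp add: field_simps)
qed

lemma homogeneous_extension_projection_volume_stretch:
  fixes e :: "real^'n"
  assumes e: "e \<in> Basis" and r: "0 < r" and N: "0 < N"
  shows "homogeneous_extension 1 (projection_volume (stretch r N e ` cball 0 1)) x =
    r ^ CARD('n) * N * measure lborel (unit_cylinder e) * norm (stretch (1 / r) (1 / N) e x)"
proof (cases "x = 0")
  case True
  then show ?thesis by (simp add: homogeneous_extension_def stretch_def)
next
  case False
  have e1: "norm e = 1" using e by simp
  let ?B = "stretch (1 / r) (1 / N) e"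
  have "projection_volume (stretch r N e ` cball 0 1) (sgn x) =
      \<bar>ldet (stretch r N e)\<bar> * norm (?B (sgn x)) * measure lborel (unit_cylinder e)"
    using False by (intro projection_volume_ellipsoid linear_stretch inner_stretch inj_stretch stretch_inverse e1 r N)
      (simp add: norm_sgn)
  moreover have "norm x * norm (?B (sgn x)) = norm (?B x)"
    using False by (simp add: sgn_div_norm linear_scale[OF linear_stretch])
  ultimately show ?thesis
    using False r N by (simp add: homogeneous_extension_def ldet_stretch[OF e1] mult_ac)
qed

section \<open>The fractional Laplacian of stretched balls and the final comparison\<close>

context axial_power
begin

text \<open>\<open>cut\<close> makes the two cases one integral. For \<alpha> = 1 the regularization
  is taken over |x| < 1 and |x| > 1 separately, and these pieces miss only the unit sphere, a null
  set.\<close>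

lemma norm_powr_dist_weight:
  assumes N: "1 \<le> N" and \<phi>: "test_function_off_origin \<phi>"
    and G: "\<And>x. norm x powr \<alpha> * G x = q * weight N x"
  shows "norm_powr_dist \<alpha> G (fourier \<phi>) = of_real q * (\<integral>\<xi>. of_real (transform N \<xi>) * \<phi> \<xi> \<partial>lborel)"
proof -
  have sc: "smooth_compact \<phi>" by (rule test_function_off_originD[OF \<phi>])
  have [measurable]: "fourier \<phi> \<in> borel_measurable borel" 
    using borel_measurable_integrable[OF smooth_compact_integrable[OF sc]] by (intro measurable_fourier) simp
  note [measurable] = measurable_weight measurable_cut
  let ?F = "\<lambda>x. of_real (q * weight N x) * (fourier \<phi> x - of_real (cut x) * fourier \<phi> 0)"
  have int: "integrable lborel ?F"
  proof (rule Bochner_Integration.integrable_bound[OF integrable_mult_right[OF weight_integrable_test[OF N \<phi>], of q]])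
    show "?F \<in> borel_measurable lborel" by measurable
  qed (auto simp: norm_mult abs_mult weight_nonneg)
  have F: "integral\<^sup>L lborel ?F = of_real q * (\<integral>\<xi>. of_real (transform N \<xi>) * \<phi> \<xi> \<partial>lborel)"
    unfolding fourier_weight[OF N \<phi>, symmetric] by (simp add: mult.assoc)
  show ?thesis
  proof (cases "1 < \<alpha>")
    case True
    then have "norm_powr_dist \<alpha> G (fourier \<phi>) = integral\<^sup>L lborel ?F"
      by (simp only: norm_powr_dist_def fun_dist_def G if_True cut_def) simp
    then show ?thesis by (simp only: F)
  next
    case False
    have "norm_powr_dist \<alpha> G (fourier \<phi>) =
       (LINT x:{x. norm x < 1}|lborel. of_real (q * weight N x) * (fourier \<phi> x - fourier \<phi> 0)) +
       (LINT x:{x. norm x > 1}|lborel. of_real (q * weight N x) * fourier \<phi> x)"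
      using False by (simp only: norm_powr_dist_def regularized_dist_def G if_False)
    also have "(LINT x:{x. norm x < 1}|lborel. of_real (q * weight N x) * (fourier \<phi> x - fourier \<phi> 0)) =
        (LINT x:{x. norm x < 1}|lborel. ?F x)"
      unfolding set_lebesgue_integral_def using False
      by (intro Bochner_Integration.integral_cong) (auto simp: cut_def indicator_def)
    also have "(LINT x:{x. norm x > 1}|lborel. of_real (q * weight N x) * fourier \<phi> x) =
        (LINT x:{x. norm x > 1}|lborel. ?F x)"
      unfolding set_lebesgue_integral_def using False
      by (intro Bochner_Integration.integral_cong) (auto simp: cut_def indicator_def)
    also have "(LINT x:{x. norm x < 1}|lborel. ?F x) + (LINT x:{x. norm x > 1}|lborel. ?F x) =
        (\<integral>x. indicator {x. norm x < 1} x *\<^sub>R ?F x + indicator {x. norm x > 1} x *\<^sub>R ?F x \<partial>lborel)"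
      unfolding set_lebesgue_integral_def
      by (intro Bochner_Integration.integral_add[symmetric] integrable_mult_indicator int) auto
    also have "\<dots> = integral\<^sup>L lborel ?F"
    proof (rule integral_cong_AE)
      show "AE x in lborel. indicator {x. norm x < 1} x *\<^sub>R ?F x + indicator {x. norm x > 1} x *\<^sub>R ?F x = ?F x"
        using AE_lborel_norm_neq[of 1] by eventually_elim (auto simp: indicator_def)
    qed measurable
    finally show ?thesis by (simp only: F)
  qed
qed

end

text \<open>The transform of the projection function is -(2 \<pi>)^n / \<pi> times the extended
  curvature function h, by \<open>fourier_ellipsoidal_norm\<close> and the volume of the unit ball
  in n - 1 variables. Hence the definition by distributions and the formula with -1/\<pi> both come
  down to the transform of |x|^\<alpha> h, that is, of a multiple of \<open>weight\<close>.\<close>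

lemma projection_frac_laplacian_stretch:
  fixes e :: "real^'n"
  assumes ax: "axial_power e \<alpha> CARD('n)" and r: "0 < r" and N: "1 \<le> N"
  shows "projection_frac_laplacian \<alpha> (stretch r N e ` cball 0 1)
    (\<lambda>\<xi>. - (r ^ (CARD('n) - 1) * axial_power.transform e \<alpha> CARD('n) N \<xi> / pi))"
proof -
  interpret ap: axial_power e \<alpha> "CARD('n)" by (rule ax)
  let ?n = "CARD('n)"
  let ?A = "stretch r N e"
  have e: "e \<in> Basis" by (rule ap.e)
  have e1: "norm e = 1" using e by simp
  have N0: "0 < N" using N by simp
  have n0: "?n > 0" by simp
  define f where "f = (\<lambda>x. (ldet ?A)\<^sup>2 / norm (?A x) ^ (?n + 1))"
  define h where "h = homogeneous_extension (- real ?n - 1) f"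
  have h: "h x = r ^ (2 * ?n) * N\<^sup>2 / norm (?A x) ^ (?n + 1)" for x
    unfolding h_def f_def homogeneous_extension_linear[OF linear_stretch] ldet_stretch[OF e1]
    by (simp add: power_mult_distrib power_mult[symmetric] mult.commute)
  define Q where "Q = (\<lambda>x. N\<^sup>2 * (x \<bullet> e)\<^sup>2 + perp2 e x)"
  have nA: "norm (?A x) = r * sqrt (Q x)" for x
    unfolding Q_def by (rule norm_stretch) (use e1 r in auto)
  have A0: "?A x = 0 \<longleftrightarrow> x = 0" for x
    using stretch_inverse(2)[OF e1 r N0, of x] linear_0[OF linear_stretch] by metis
  have Q0: "0 < Q x" if "x \<noteq> 0" for x
  proof -
    have "0 < r * sqrt (Q x)" using A0[of x] that unfolding nA[symmetric] by simp
    then show ?thesis using r by (simp add: zero_less_mult_iff)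
  qed
  have sqrtQ: "sqrt (Q x) ^ (?n + 1) = Q x powr ap.b" if "x \<noteq> 0" for x
    unfolding sqrt_power_powr[OF Q0[OF that]] ap.b_def by (simp add: add.commute)
  have hw: "norm x powr \<alpha> * h x = r ^ (?n - 1) * ap.weight N x" for x
  proof (cases "x = 0")
    case True
    then show ?thesis by (simp add: ap.weight_def)
  next
    case False
    \<comment> \<open>The denominator |A x|^(n+1) contributes r^(n+1). What is left of r^(2n) is
      r^(n-1), the scaling of the curvature function under dilation.\<close>
    have r2: "r ^ (2 * ?n) = r ^ (?n - 1) * r ^ (?n + 1)" 
    proof -
      have "2 * ?n = (?n - 1) + (?n + 1)" using n0 by arith
      then show ?thesis by (simp only: power_add)
    qed
    have "h x = r ^ (?n - 1) * N\<^sup>2 * Q x powr (- ap.b)"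
      unfolding h nA power_mult_distrib sqrtQ[OF False] r2 powr_minus using r by (simp add: divide_simps)
    then show ?thesis by (simp add: ap.weight_def Q_def)
  qed
  have F: "norm_powr_dist \<alpha> G (fourier \<phi>) =
      of_real k * (of_real (r ^ (?n - 1)) * (\<integral>\<xi>. of_real (ap.transform N \<xi>) * \<phi> \<xi> \<partial>lborel))"
    if \<phi>: "test_function_off_origin \<phi>" and G: "\<And>x. G x = k * h x" for \<phi> G k
  proof -
    have "norm x powr \<alpha> * G x = (k * r ^ (?n - 1)) * ap.weight N x" for x
      using hw[of x] by (simp add: G mult.left_commute mult.assoc)
    from ap.norm_powr_dist_weight[OF N \<phi> this] show ?thesis by (simp add: mult.assoc)
  qed
  let ?g = "\<lambda>\<xi>. - (r ^ (?n - 1) * ap.transform N \<xi> / pi)"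
  have g: "fun_dist ?g \<phi> = - (of_real (r ^ (?n - 1)) * (\<integral>\<xi>. of_real (ap.transform N \<xi>) * \<phi> \<xi> \<partial>lborel)) / of_real pi" for \<phi>
  proof -
    have "fun_dist ?g \<phi> = (\<integral>\<xi>. (- (of_real (r ^ (?n - 1)) / of_real pi)) * (of_real (ap.transform N \<xi>) * \<phi> \<xi>) \<partial>lborel)"
      unfolding fun_dist_def by (intro Bochner_Integration.integral_cong) auto
    also have "\<dots> = (- (of_real (r ^ (?n - 1)) / of_real pi)) * (\<integral>\<xi>. of_real (ap.transform N \<xi>) * \<phi> \<xi> \<partial>lborel)"
      by (rule integral_mult_right_zero)
    finally show ?thesis by simp
  qed
  \<comment> \<open>The power (2 \<pi>)^n is removed again by the normalisation of the fractional
    Laplacian, leaving the factor -1/\<pi>.\<close>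
  define G where "G = (\<lambda>x. - ((2 * pi) ^ ?n / pi) * h x)"
  have hcont: "continuous_on (- {0}) h"
    unfolding h[abs_def]
    by (intro continuous_intros linear_continuous_on linear_conv_bounded_linear[THEN iffD1] linear_stretch)
      (auto simp: A0)
  have Gint: "set_integrable lborel C G" if "compact C" "0 \<notin> C" for C
    by (rule borel_integrable_compact[OF that(1), unfolded set_integrable_def[symmetric], of G, unfolded if_distrib])
      (use that in \<open>auto simp: G_def intro!: continuous_intros continuous_on_subset[OF hcont]\<close>)
  have Gfour: "fourier_dist (fun_dist (homogeneous_extension 1 (projection_volume (?A ` cball 0 1)))) \<phi> = fun_dist G \<phi>"
    if \<phi>: "test_function_off_origin \<phi>" for \<phi>
  proof -
    let ?\<kappa> = "measure lborel (unit_cylinder e)"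
    have \<kappa>: "?\<kappa> = sqrt pi ^ (?n - 1) / Gamma ap.b"
      using measure_unit_cylinder[OF e] ap.b_pos by (simp add: measure_def ap.b_def)
    \<comment> \<open>The coefficients c and d are those of |B x|^2, where B is the inverse of ?A,
      as the projection function is a multiple of |B x|. The inverse quadratic form is |?A x|^2, the
      quantity in the denominator of the curvature function.\<close>
    define c where "c = 1 / (r\<^sup>2 * N\<^sup>2)"
    define d where "d = 1 / r\<^sup>2"
    have c0: "0 < c" and d0: "0 < d" using r N0 by (auto simp: c_def d_def)
    have u: "homogeneous_extension 1 (projection_volume (?A ` cball 0 1)) x =
        (r ^ ?n * N * ?\<kappa>) * sqrt (c * (x \<bullet> e)\<^sup>2 + d * perp2 e x)" for x
    proof -
      have "norm (stretch (1 / r) (1 / N) e x) = 1 / r * sqrt ((1 / N)\<^sup>2 * (x \<bullet> e)\<^sup>2 + perp2 e x)"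
        by (rule norm_stretch) (use e1 r in auto)
      also have "\<dots> = sqrt d * sqrt ((1 / N)\<^sup>2 * (x \<bullet> e)\<^sup>2 + perp2 e x)" using r by (simp add: d_def real_sqrt_divide)
      also have "\<dots> = sqrt (c * (x \<bullet> e)\<^sup>2 + d * perp2 e x)"
        unfolding real_sqrt_mult[symmetric] by (simp add: c_def d_def power_divide algebra_simps)
      finally show ?thesis
        unfolding homogeneous_extension_projection_volume_stretch[OF e r N0] by simp
    qed
    have "fourier_dist (fun_dist (homogeneous_extension 1 (projection_volume (?A ` cball 0 1)))) \<phi> =
        (\<integral>x. of_real (r ^ ?n * N * ?\<kappa>) * (of_real (sqrt (c * (x \<bullet> e)\<^sup>2 + d * perp2 e x)) * fourier \<phi> x) \<partial>lborel)"
      unfolding fourier_dist_def fun_dist_def u by (simp only: of_real_mult mult.assoc)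
    also have "\<dots> = of_real (r ^ ?n * N * ?\<kappa>) * (\<integral>x. of_real (sqrt (c * (x \<bullet> e)\<^sup>2 + d * perp2 e x)) * fourier \<phi> x \<partial>lborel)"
      by (rule integral_mult_right_zero)
    also note fourier_ellipsoidal_norm[OF e c0 d0 \<phi>]
    also have "of_real (r ^ ?n * N * ?\<kappa>) * (\<integral>\<xi>. of_real (- (1 / (2 * sqrt pi) * (sqrt (pi / c) * sqrt (pi / d) ^ (DIM(real^'n) - 1)) *
           (Gamma ((real DIM(real^'n) + 1) / 2) / (((\<xi> \<bullet> e)\<^sup>2 / c + perp2 e \<xi> / d) / 4) powr ((real DIM(real^'n) + 1) / 2)))) * \<phi> \<xi> \<partial>lborel) =
       (\<integral>\<xi>. of_real (r ^ ?n * N * ?\<kappa>) * (of_real (- (1 / (2 * sqrt pi) * (sqrt (pi / c) * sqrt (pi / d) ^ (DIM(real^'n) - 1)) *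
           (Gamma ((real DIM(real^'n) + 1) / 2) / (((\<xi> \<bullet> e)\<^sup>2 / c + perp2 e \<xi> / d) / 4) powr ((real DIM(real^'n) + 1) / 2)))) * \<phi> \<xi>) \<partial>lborel)"
      by (rule integral_mult_right_zero[symmetric])
    also have "\<dots> = fun_dist G \<phi>"
      unfolding fun_dist_def
    proof (rule Bochner_Integration.integral_cong[OF refl])
      fix \<xi> :: "real^'n"
      show "of_real (r ^ ?n * N * ?\<kappa>) * (of_real (- (1 / (2 * sqrt pi) * (sqrt (pi / c) * sqrt (pi / d) ^ (DIM(real^'n) - 1)) *
           (Gamma ((real DIM(real^'n) + 1) / 2) / (((\<xi> \<bullet> e)\<^sup>2 / c + perp2 e \<xi> / d) / 4) powr ((real DIM(real^'n) + 1) / 2)))) * \<phi> \<xi>)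
         = of_real (G \<xi>) * \<phi> \<xi>"
      proof (cases "\<xi> = 0")
        case True
        then have "\<phi> \<xi> = 0" using test_function_off_originD(2)[OF \<phi>] by force
        then show ?thesis by simp
      next
        case False
        have d: "DIM(real^'n) = ?n" by simp
        have b: "(real ?n + 1) / 2 = ap.b" by (simp add: ap.b_def)
        have sc: "sqrt (pi / c) = sqrt pi * (r * N)" using r N0 by (simp add: c_def real_sqrt_mult)
        have sd: "sqrt (pi / d) = sqrt pi * r" using r by (simp add: d_def real_sqrt_mult)
        have E: "((\<xi> \<bullet> e)\<^sup>2 / c + perp2 e \<xi> / d) / 4 = r\<^sup>2 / 4 * Q \<xi>"
          using r N0 by (simp add: c_def d_def Q_def algebra_simps)
        have "(r\<^sup>2 / 4 * Q \<xi>) powr ap.b = sqrt (r\<^sup>2 / 4 * Q \<xi>) ^ (?n + 1)"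
          using Q0[OF False] r by (subst sqrt_power_powr) (auto simp: ap.b_def add.commute)
        also have "sqrt (r\<^sup>2 / 4 * Q \<xi>) = norm (?A \<xi>) / 2"
          using r by (simp add: nA real_sqrt_mult real_sqrt_divide)
        finally have E': "(r\<^sup>2 / 4 * Q \<xi>) powr ap.b = norm (?A \<xi>) ^ (?n + 1) / 2 ^ (?n + 1)"
          by (simp add: power_divide)
        obtain m where m: "?n = Suc m" using n0 by (cases ?n) auto
        have pp: "sqrt pi ^ m * sqrt pi ^ m = pi ^ m" by (simp flip: power_mult_distrib)
        have Gb: "Gamma ap.b \<noteq> 0" using ap.b_pos by (simp add: Gamma_real_pos less_imp_neq[symmetric])
        let ?P = "norm (?A \<xi>) ^ (?n + 1)"
        have "(r ^ ?n * N * ?\<kappa>) * - (1 / (2 * sqrt pi) * (sqrt (pi / c) * sqrt (pi / d) ^ (?n - 1)) *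
           (Gamma ap.b / (((\<xi> \<bullet> e)\<^sup>2 / c + perp2 e \<xi> / d) / 4) powr ap.b)) =
           - (r ^ ?n * r ^ ?n * N\<^sup>2 * (sqrt pi ^ m * sqrt pi ^ m) * 2 ^ ?n / ?P)"
          unfolding \<kappa> sc sd E E' using Gb by (simp add: m power_mult_distrib power2_eq_square)
        also have "\<dots> = G \<xi>"
        proof -
          have "(2 * pi) ^ ?n / pi = 2 ^ ?n * pi ^ m" by (simp add: m power_mult_distrib)
          moreover have "r ^ (2 * ?n) = r ^ ?n * r ^ ?n" unfolding mult_2 power_add ..
          ultimately show ?thesis unfolding G_def h pp by (simp only:) (simp add: mult_ac)
        qed
        finally show ?thesis unfolding d b mult.assoc[symmetric, of _ _ "\<phi> \<xi>"] of_real_mult[symmetric] by (rule arg_cong[where f = "\<lambda>z. complex_of_real z * \<phi> \<xi>"])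
      qed
    qed
    finally show ?thesis .
  qed
  have curv: "is_curvature_function (?A ` cball 0 1) f"
    unfolding f_def by (intro curvature_function_ellipsoid linear_stretch inner_stretch inj_stretch e1 r N0)
  have d: "DIM(real^'n) = ?n" by simp
  have gcont: "continuous_on (- {0}) ?g"
    by (intro continuous_intros ap.continuous_on_transform[OF N]) simp
  have "has_frac_laplacian \<alpha> (homogeneous_extension 1 (projection_volume (?A ` cball 0 1))) ?g"
    unfolding has_frac_laplacian_def d
  proof (intro conjI gcont exI[of _ G] allI impI)
    show "coincides_off_origin (\<lambda>\<phi>. fourier_dist (norm_powr_dist \<alpha> G) \<phi> / of_real ((2 * pi) ^ ?n)) ?g"
      unfolding coincides_off_origin_def fourier_dist_def
    proof (intro allI impI)
      fix \<phi> :: "real^'n \<Rightarrow> complex" assume \<phi>: "test_function_off_origin \<phi>"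
      show "norm_powr_dist \<alpha> G (fourier \<phi>) / of_real ((2 * pi) ^ ?n) = fun_dist ?g \<phi>"
        unfolding F[OF \<phi>, of G "- ((2 * pi) ^ ?n / pi)", OF G_def[THEN fun_cong]] g by simp
    qed
  qed (use Gint Gfour in \<open>auto simp: coincides_off_origin_def\<close>)
  moreover have "coincides_off_origin (\<lambda>\<phi>. - fourier_dist (norm_powr_dist \<alpha> h) \<phi> / of_real pi) ?g"
    unfolding coincides_off_origin_def fourier_dist_def g by (auto simp: F[of _ h 1])
  ultimately show ?thesis
    unfolding projection_frac_laplacian_def d h_def using curv by blast
qed

lemma convex_body_stretch:
  fixes e :: "real^'n"
  assumes "norm e = 1" "0 < r" "0 < N"
  shows "convex_body (stretch r N e ` cball 0 1)" "origin_symmetric (stretch r N e ` cball 0 1)"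
proof -
  have "surj (stretch r N e)" using stretch_inverse(1)[OF assms] by (rule surjI)
  then have "open (stretch r N e ` ball 0 1)"
    by (intro open_surjective_linear_image linear_stretch) auto
  moreover have "stretch r N e ` ball 0 1 \<subseteq> stretch r N e ` cball 0 1" by auto
  moreover have "stretch r N e 0 \<in> stretch r N e ` ball 0 1" by auto
  ultimately have "interior (stretch r N e ` cball 0 1) \<noteq> {}" using interior_maximal by blast
  then show "convex_body (stretch r N e ` cball 0 1)"
    unfolding convex_body_def
    by (simp add: compact_linear_imageI linear_stretch convex_linear_image)
  have "uminus ` stretch r N e ` cball 0 1 = stretch r N e ` uminus ` cball 0 1"
    unfolding image_image linear_neg[OF linear_stretch] ..
  also have "uminus ` cball 0 1 = (cball 0 1 :: (real^'n) set)"
  proof -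
    have "x \<in> uminus ` cball 0 1" if "x \<in> cball 0 1" for x :: "real^'n"
      using that by (intro image_eqI[of _ _ "- x"]) auto
    then show ?thesis by auto
  qed
  finally show "origin_symmetric (stretch r N e ` cball 0 1)" unfolding origin_symmetric_def .
qed

lemma measure_stretch_cball:
  fixes e :: "real^'n"
  assumes "norm e = 1" "0 < r" "0 < N"
  shows "measure lebesgue (stretch r N e ` cball 0 1) = r ^ CARD('n) * N * measure lborel (cball 0 1 :: (real^'n) set)"
proof -
  have "stretch r N e ` cball 0 1 \<in> sets borel"
    by (simp add: borel_compact compact_linear_imageI linear_stretch)
  then have "measure lebesgue (stretch r N e ` cball 0 1) = measure lborel (stretch r N e ` cball 0 1)"
    by (simp add: measure_completion)
  then show ?thesis
    using assms by (simp add: measure_linear_image_ldet[OF linear_stretch inj_stretch] ldet_stretch)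
qed

theorem theorem3p4:
  fixes \<alpha> :: real
  assumes "CARD('n::finite) \<ge> 3"
    and "real CARD('n) - 2 \<le> \<alpha>" and "\<alpha> < real CARD('n)"
  shows "\<exists>(K :: (real ^ 'n) set) (L :: (real ^ 'n) set) gK gL.
     convex_body K \<and> origin_symmetric K \<and>
     convex_body L \<and> origin_symmetric L \<and>
     projection_frac_laplacian \<alpha> K gK \<and>
     projection_frac_laplacian \<alpha> L gL \<and>
     (\<forall>\<theta> \<in> sphere 0 1. gL \<theta> \<le> gK \<theta>) \<and>
     measure lebesgue L < measure lebesgue K"
proof -
  let ?n = "CARD('n)"
  obtain e :: "real^'n" where e: "e \<in> Basis" using nonempty_Basis by blast
  then have e1: "norm e = 1" by simp
  have ax: "axial_power e \<alpha> ?n" using assms e by unfold_locales auto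
  interpret ap: axial_power e \<alpha> ?n by (rule ax)
  obtain c C where c: "0 < c" and
    lower: "\<And>N \<xi>. 1 \<le> N \<Longrightarrow> norm \<xi> = 1 \<Longrightarrow> c * N - C * N powr (1 - ap.p / 2) \<le> ap.transform N \<xi>"
    using ap.transform_lower_bound by blast
  \<comment> \<open>N = 1 is the unit ball. Any bound M on its transform will do, because a ball of
    radius r only multiplies it by r^(n-1).\<close>
  have "compact (ap.transform 1 ` sphere 0 1)"
    by (intro compact_continuous_image continuous_on_subset[OF ap.continuous_on_transform]) auto
  then obtain M where M: "\<And>\<xi>. norm \<xi> = 1 \<Longrightarrow> ap.transform 1 \<xi> \<le> M"
    unfolding compact_eq_bounded_closed bounded_iff using abs_le_D1 by (metis imageI mem_sphere_0 real_norm_def)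
  define q where "q = 1 / real ?n"
  have q: "0 < q" by (simp add: q_def)
  \<comment> \<open>The inequality between the two transforms, divided by N: the error for the
    ellipsoid and the contribution of the ball both carry negative powers of N, while c
    stays.\<close>
  have "((\<lambda>N. C * N powr (- (ap.p / 2)) + 2 powr (1 - q) * M * N powr (- q)) \<longlongrightarrow> C * 0 + 2 powr (1 - q) * M * 0) at_top"
    using ap.p_pos q by (intro tendsto_intros tendsto_neg_powr filterlim_ident) auto
  then have "\<forall>\<^sub>F N in at_top. C * N powr (- (ap.p / 2)) + 2 powr (1 - q) * M * N powr (- q) < c"
    using c by (intro order_tendstoD(2)) auto
  then have "\<forall>\<^sub>F N in at_top. 1 \<le> N \<and> C * N powr (- (ap.p / 2)) + 2 powr (1 - q) * M * N powr (- q) < c"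
    using eventually_ge_at_top[of 1] by eventually_elim simp
  then obtain N where N: "1 \<le> N" and Nc: "C * N powr (- (ap.p / 2)) + 2 powr (1 - q) * M * N powr (- q) < c"
    by (auto simp: eventually_at_top_linorder)
  \<comment> \<open>The radius is chosen to make r^n = 2 N, so the ball has exactly twice the volume
    of the ellipsoid with r = 1 and elongation N.\<close>
  define r where "r = (2 * N) powr q"
  have r: "0 < r" using N by (simp add: r_def)
  have rn: "r ^ ?n = 2 * N"
    using N by (simp add: r_def q_def powr_realpow[symmetric] powr_powr)
  have "r ^ (?n - 1) = r powr (real ?n - 1)"
    using r by (simp add: powr_realpow[symmetric] of_nat_diff Suc_leI)
  also have "\<dots> = (2 * N) powr (1 - q)"
    unfolding r_def powr_powr by (simp add: q_def field_simps)
  finally have rn1: "r ^ (?n - 1) = 2 powr (1 - q) * N powr (1 - q)"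
    using N by (simp add: powr_mult)
  \<comment> \<open>The choice of N is multiplied back by N; the left side is r^(n-1) M and the
    right side is the lower bound of the transform for the ellipsoid.\<close>
  have "2 powr (1 - q) * N powr (1 - q) * M \<le> c * N - C * N powr (1 - ap.p / 2)"
  proof -
    have "N powr (1 - x) = N * N powr (- x)" for x
      using N powr_add[of N 1 "- x"] by simp
    then show ?thesis
      using mult_left_mono[OF less_imp_le[OF Nc], of N] N by (simp add: algebra_simps)
  qed
  then have le: "r ^ (?n - 1) * ap.transform 1 \<xi> \<le> ap.transform N \<xi>" if "norm \<xi> = 1" for \<xi>
    using mult_left_mono[OF M[OF that], of "r ^ (?n - 1)"] lower[OF N that] zero_le_power[OF less_imp_le[OF r], of "?n - 1"]
    unfolding rn1 by linarith
  let ?K = "stretch r 1 e ` cball 0 1" and ?L = "stretch 1 N e ` cball 0 1"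
  have "0 < measure lborel (cball 0 1 :: (real^'n) set)"
    using content_cball_pos[of 1 0] by simp
  then have "measure lebesgue ?L < measure lebesgue ?K"
    using N r by (simp add: measure_stretch_cball[OF e1] rn)
  moreover have "convex_body ?K" "origin_symmetric ?K" "convex_body ?L" "origin_symmetric ?L"
    using N r by (auto intro!: convex_body_stretch e1)
  moreover have "projection_frac_laplacian \<alpha> ?K (\<lambda>\<xi>. - (r ^ (?n - 1) * ap.transform 1 \<xi> / pi))"
    "projection_frac_laplacian \<alpha> ?L (\<lambda>\<xi>. - (1 ^ (?n - 1) * ap.transform N \<xi> / pi))"
    by (rule projection_frac_laplacian_stretch[OF ax]; use N r in simp)+
  moreover have "- (1 ^ (?n - 1) * ap.transform N \<xi> / pi) \<le> - (r ^ (?n - 1) * ap.transform 1 \<xi> / pi)"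
    if "\<xi> \<in> sphere 0 1" for \<xi>
    using le[of \<xi>] that by (simp add: divide_right_mono)
  ultimately show ?thesis by blast
qed

end
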